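(* Consider the $M$-player linear-quadratic game and the radically uncoupled multi-agent $\epsilon$-greedy iterated least-squares algorithm described in the context. Suppose that (i) best responses are well-posed, (ii) the feedback Nash equilibrium is stable, with constants $\mu>0$, $\zeta\in(0,1)$ and fixed point $(F^*,f^* )$ of the collective best-response map $\Psi$, (iii) the state dynamics are uniformly stable, (iv) the optimal strategy map is uniformly locally Lipschitz, and (v) the schedule condition holds, with growth rate $\lambda>1$ and decay rates $\nu_m\in(0,\tfrac12)$ (all five are defined in the context). Then for any $\delta\in(0,1)$ there exist constants $c_0,c_1>0$ (independent of $\delta$) and $T(\delta)=O((\log(1/\delta))^{c_1})$ such that, with probability at least $1-\delta$, for all $t\ge T(\delta)$, $$\|(F^{(k(t))},f^{(k(t))})-(F^*,f^* )\|_{\mu,1,2}=O\bigl(\max\{R_1(t,\delta),R_2(t,\delta),R_3(t)\}\bigr),$$ where the implied constant is independent of $t$ and $\delta$, and $$R_1(t,\delta)=\bigl((\log t)^{3/2}+(\log\tfrac1\delta)^{c_0}\bigr)t^{\frac{\ln\zeta}{\ln\lambda}},\quad R_2(t,\delta)=\sqrt{\log t+\log\tfrac1\delta}\;t^{-(\frac12-\max_m\nu_m)},\quad R_3(t)=t^{-\min_m\nu_m}.$$ Consequently, almost surely, as $t\to\infty$, $$\|(F^{(k(t))},f^{(k(t))})-(F^*,f^* )\|_{\mu,1,2}=\tilde O(t^{-q}),\qquad q:=\min\Bigl\{-\frac{\ln\zeta}{\ln\lambda},\ \frac12-\max_m\nu_m,\ \min_m\nu_m\Bigr\},$$ where $\tilde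 O$ suppresses logarithmic factors.
   Context: **Norms.** $\|\cdot\|$ is the spectral norm of matrices, $\|\cdot\|_2$ the Euclidean norm, $\succ,\succcurlyeq$ the Loewner order. **Game.** There are $M$ players, a state $x_t\in\mathbb R^n$ and controls $u_t^m\in\mathbb R^{d_m}$, with $$x_{t+1}=A_0+Ax_t+\sum_{m=1}^M B_mu_t^m+\omega_t,\qquad x_0=x,$$ where $\{\omega_t\}$ is i.i.d. sub-Gaussian with mean zero and covariance $\Sigma_\omega\succ0$. The discount factor is $\rho\in(0,1)$. Player $m$'s running cost is $$Y_m(x_t,x_{t+1},u)=x_t^\top Q_mx_t+x_{t+1}^\top H_mu+u^\top R_mu+x_t^\top q_m+u^\top r_m,$$ with $Q_m\succcurlyeq0$, $R_m\succ0$. Admissible sets: $\mathcal A_m=\{F_m\in\mathbb R^{d_m\times n}:\|F_m\|\le\kappa_m\}$, $\mathcal B_m=\{f_m\in\mathbb R^{d_m}:\|f_m\|_2\le\kappa_m'\}$ with $\kappa_m,\kappa_m'>0$; $\mathcal A=\prod_m\mathcal A_m$, $\mathcal B=\prod_m\mathcal B_m$, and $\mathcal A_{-m},\mathcal B_{-m}$ are the products over $j\ne m$. Write $F=\{F_m\}_m$, $f=\{f_m\}_m$, $F_{-m}=\{F_j\}_{j\ne m}$, $f_{-m}=\{f_j\}_{j\neq m}$. **Complete-information problem.** $J_m((F_m,f_m);(F_{-m},f_{-m}),x)=\mathbb E[\sum_{t\ge0}\rho^tY_m(x_t,x_{t+1},-F_mx_t+f_m)]$, where $x_t$ follows the true dynamics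 with $u_t^j=-F_jx_t+f_j$ for every $j$. A profile $(F^*,f^* )\in\mathcal A\times\mathcal B$ is a feedback Nash equilibrium if for all $m$ and all $x\in\mathbb R^n$, $J_m((F_m^*,f_m^* );(F_{-m}^*,f_{-m}^* ),x)$ is finite and $(F_m^*,f_m^* )$ is the minimizer of $J_m(\cdot;(F^*_{-m},f^*_{-m}),x)$ over $\mathcal A_m\times\mathcal B_m$. **(i) Well-posedness of best responses.** For all $m$, $x\in\mathbb R^n$ and $(F_{-m},f_{-m})\in\mathcal A_{-m}\times\mathcal B_{-m}$, the infimum of $J_m(\cdot;(F_{-m},f_{-m}),x)$ over $\mathcal A_m\times\mathcal B_m$ is attained at a unique minimizer $(\psi_m(F_{-m},f_{-m}),\varphi_m(F_{-m},f_{-m}))$, which is independent of $x$ and continuous in $(F_{-m},f_{-m})$. The collective best-response map $\Psi:\mathcal A\times\mathcal B\to\mathcal A\times\mathcal B$ is $\Psi((F,f))=(\{\psi_m(F_{-m},f_{-m})\}_m,\{\varphi_m(F_{-m},f_{-m})\}_m)$. **(ii) Stability of the equilibrium.** There are $\mu>0$ and $0<\zeta<1$ such that for all $(F,f)\in\mathcal A\times\mathcal B$, $\|\Psi((F,f))-\Psi((F^*,f^* ))\|_{\mu,1,2}\le\zeta\|(F,f)-(F^*,f^* )\|_{\mu,1,2}$, where $(F^*,f^* )$ is a fixed point of $\Psi$ (equivalently, a feedback Nash equilibrium) and $\|(F,f)\|_{\mu,1,2}:=\mu\sum_m\|F_m\|+\sum_m\|f_m\|_2$. **(iii) Uniform state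 stability.** $\sup_{F\in\mathcal A}\|A-\sum_{m}B_mF_m\|<1$. **Perceived problem.** For $\Theta_m\in\mathbb R^{(1+n+d_m)\times n}$, a covariance matrix $\Sigma_m$, $x\in\mathbb R^n$, $\alpha_m\ge0$, let $J_m^{(\Theta_m,\Sigma_m)}((F_m,f_m);x,\alpha_m)=\mathbb E[\sum_t\rho^tY_m(x_t,x_{t+1},u_t)]$ where $u_t=-F_mx_t+f_m+\alpha_mv_t$, $x_{t+1}=\Theta_m^\top[1,x_t^\top,u_t^\top]^\top+\omega_t'$, $x_0=x$, with $\{\omega'_t\}$, $\{v_t\}$ independent i.i.d. sub-Gaussian mean-zero sequences with covariances $\Sigma_m$ and $I_{d_m}$. The feasible set $\mathcal S_m$ is the set of $(\Theta_m,\Sigma_m)$ such that $\inf_{\mathcal A_m\times\mathcal B_m}J_m^{(\Theta_m,\Sigma_m)}(\cdot;x,\alpha_m)$ is finite (neither $-\infty$ nor $+\infty$) for all $x\in\mathbb R^n$, $\alpha_m\ge0$. For such pairs, $(\Phi_m,\phi_m)(\Theta_m,\Sigma_m,x,\alpha_m)\in\mathcal A_m\times\mathcal B_m$ denotes a minimizer. Put $$\Theta_m^{(F_{-m},f_{-m})}=\Bigl[A_0+\sum_{j\ne m}B_jf_j,\ A-\sum_{j\ne m}B_jF_j,\ B_m\Bigr]^\top.$$ **(iv) Uniform local Lipschitz regularity.** For each $m$ there are $\delta_m,L_m\in(0,\infty)$ such that for all $(F_{-m},f_{-m})\in\mathcal A_{-m}\times\mathcal B_{-m}$ and all $(\tilde\Theta_m,\tilde\Sigma_m)$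 with $\max\{\|\tilde\Theta_m-\Theta_m^{(F_{-m},f_{-m})}\|,\|\tilde\Sigma_m-\Sigma_\omega\|\}\le\delta_m$: (a) $(\tilde\Theta_m,\tilde\Sigma_m)\in\mathcal S_m$; (b) for all $x$ and $\alpha_m\in[0,\delta_m]$ the perceived problem has a unique minimizer over $\mathcal A_m\times\mathcal B_m$, and $\|\Phi_m(\tilde\Theta_m,\tilde\Sigma_m,x,\alpha_m)-\Phi_m(\Theta_m^{(F_{-m},f_{-m})},\Sigma_\omega,x,0)\|\le L_m\Delta_m$ and $\|\phi_m(\tilde\Theta_m,\tilde\Sigma_m,x,\alpha_m)-\phi_m(\Theta_m^{(F_{-m},f_{-m})},\Sigma_\omega,x,0)\|_2\le L_m\Delta_m$, with $\Delta_m=\max\{\|\tilde\Theta_m-\Theta_m^{(F_{-m},f_{-m})}\|,\|\tilde\Sigma_m-\Sigma_\omega\|,\alpha_m\}$. **(v) Schedule condition.** For all $m$ and $k\ge0$: epoch length $\tau_m^{(k+1)}=\lfloor\tau^{(k+1)}+\tilde\tau_m^{(k+1)}\rfloor$ and exploration scale $\alpha_m^{(k)}=\bar\alpha(\tau_m^{(k+1)})^{-\nu_m}$, where $\tau^{(k+1)}=\underline\tau+\tau\lambda^{k+1}$ with $\lambda>1$, $\tau>0$, $\underline\tau\ge0$; $\tilde\tau_m^{(k+1)}\in[0,\bar\tau]$ is an asynchronous shift ($\bar\tau>0$), possibly random; $\bar\alpha>0$; $\nu_m\in(0,\frac12)$. **Algorithm.** Let $\bar\tau_m^{(k)}=\sum_{i=1}^k\tau_m^{(i)}$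 ($\bar\tau_m^{(0)}=0$) and $k_m(t)=\sup\{k:\bar\tau_m^{(k)}\le t\}$. Each player $m$ picks some $(\tilde\Theta_m^{(0)},\tilde\Sigma_m^{(0)})\in\mathcal S_m$. At time $\bar\tau_m^{(k)}$, $k\ge1$, with $z_t^m=[1,x_t^\top,(u_t^m)^\top]^\top$ and regularization $\beta_m>0$, she computes, with sums over $\bar\tau_m^{(k-1)}\le t\le\bar\tau_m^{(k)}-1$, $$V_m^{(k)}=\beta_mI+\sum_tz_t^m(z_t^m)^\top,\quad\hat\Theta_m^{(k)}=(V_m^{(k)})^{-1}\sum_tz_t^mx_{t+1}^\top,\quad\hat\Sigma_m^{(k)}=\frac1{\tau_m^{(k)}}\sum_t(x_{t+1}-(\hat\Theta_m^{(k)})^\top z_t^m)(x_{t+1}-(\hat\Theta_m^{(k)})^\top z_t^m)^\top,$$ and sets $(\tilde\Theta_m^{(k)},\tilde\Sigma_m^{(k)})=(\hat\Theta_m^{(k)},\hat\Sigma_m^{(k)})$ if this pair lies in $\mathcal S_m$, and $(\tilde\Theta_m^{(k-1)},\tilde\Sigma_m^{(k-1)})$ otherwise. For $k\ge0$ let $(F_m^{(k)},f_m^{(k)})=(\Phi_m,\phi_m)(\tilde\Theta_m^{(k)},\tilde\Sigma_m^{(k)},x_{\bar\tau_m^{(k)}},\alpha_m^{(k)})$. For $\bar\tau_m^{(k)}\le t<\bar\tau_m^{(k+1)}$ she applies $u_t^m=-F_m^{(k)}x_t+f_m^{(k)}+\alpha_m^{(k)}v_t^m$, where $\{v_t^m\}_t$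 is i.i.d. sub-Gaussian, mean zero, covariance $I_{d_m}$. The state noise, the exploration noises of the different players and the shifts are independent of one another. $(F^{(k(t))},f^{(k(t))})$ denotes the profile in which player $m$ uses $(F_m^{(k_m(t))},f_m^{(k_m(t))})$. *)

theory Defs
  imports "HOL-Probability.Probability" "HOL-Library.Landau_Symbols"
begin

text \<open>
  The control dimensions differ from player to player, while the dimensions of HOL-Analysis vectors
  are types. All players therefore share one index type \<open>'d\<close>, and player \<open>m\<close> owns the coordinates
  in a nonempty set \<open>ctrl G m\<close>; the dimension of her control space is the cardinality of that set.
  A vector or matrix of player \<open>m\<close> is stored with zeros in the coordinates she does not own.
  Zero padding changes neither Euclidean nor spectral norms, and every family of positive
  dimensions arises this way.
\<close>

text \<open>For a matrix this says that the rows outside \<open>I\<close> vanish; columns are treated by transposing.\<close>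
definition supp_in :: "'i set \<Rightarrow> ('b::zero)^'i \<Rightarrow> bool" where
  "supp_in I v \<longleftrightarrow> (\<forall>i. i \<notin> I \<longrightarrow> v $ i = 0)"

definition ident_on :: "'i set \<Rightarrow> real^'i^'i" where
  "ident_on I = (\<chi> i j. if i = j \<and> i \<in> I then 1 else 0)"

definition spec_norm :: "real^'b^'a \<Rightarrow> real" where
  "spec_norm A = onorm ((*v) A)"

definition psd :: "real^'n^'n \<Rightarrow> bool" where
  "psd S \<longleftrightarrow> transpose S = S \<and> (\<forall>x. 0 \<le> x \<bullet> (S *v x))"

definition pos_def_on :: "'n set \<Rightarrow> real^'n^'n \<Rightarrow> bool" where
  "pos_def_on I S \<longleftrightarrow> transpose S = S \<and> (\<forall>x. supp_in I x \<and> x \<noteq> 0 \<longrightarrow> 0 < x \<bullet> (S *v x))"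

definition outer :: "real^'a \<Rightarrow> real^'b \<Rightarrow> real^'b^'a" where
  "outer z y = (\<chi> i j. z $ i * y $ j)"

definition is_argmin :: "'b set \<Rightarrow> ('b \<Rightarrow> ereal) \<Rightarrow> 'b \<Rightarrow> bool" where
  "is_argmin S J p \<longleftrightarrow> p \<in> S \<and> (\<forall>q\<in>S. J p \<le> J q)"

text \<open>Sub-Gaussian law with mean zero and covariance \<open>S\<close>.\<close>
definition noise_law :: "(real^'k) measure \<Rightarrow> real^'k^'k \<Rightarrow> bool" where
  "noise_law N S \<longleftrightarrow> prob_space N \<and> sets N = sets borel \<and>
     (\<exists>\<sigma>::real. \<forall>w. integrable N (\<lambda>z. exp (w \<bullet> z)) \<and>
        (\<integral>z. exp (w \<bullet> z) \<partial>N) \<le> exp (\<sigma>\<^sup>2 * (norm w)\<^sup>2 / 2)) \<and>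
     (\<integral>z. z \<partial>N) = 0 \<and> (\<integral>z. outer z z \<partial>N) = S"

definition iid_noise :: "'a measure \<Rightarrow> (nat \<Rightarrow> 'a \<Rightarrow> real^'k) \<Rightarrow> real^'k^'k \<Rightarrow> bool" where
  "iid_noise M X S \<longleftrightarrow> prob_space.indep_vars M (\<lambda>_. borel) X UNIV \<and>
     (\<exists>N. noise_law N S \<and> (\<forall>t. distr M borel (X t) = N))"

text \<open>Expectation with values in the extended reals. By the convention
  \<open>\<infinity> - \<infinity> = \<infinity>\<close> of type \<open>ereal\<close>, an undefined expectation counts as an infinite cost.\<close>
definition ext_expectation :: "'a measure \<Rightarrow> ('a \<Rightarrow> ereal) \<Rightarrow> ereal" where
  "ext_expectation M g =
     enn2ereal (\<integral>\<^sup>+\<omega>. e2ennreal (g \<omega>) \<partial>M) - enn2ereal (\<integral>\<^sup>+\<omega>. e2ennreal (- g \<omega>) \<partial>M)"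

text \<open>The upper limit of the partial sums is the value of the pathwise series whenever that
  series converges or diverges to plus or minus infinity.\<close>
definition discounted_cost :: "'a measure \<Rightarrow> real \<Rightarrow> ('a \<Rightarrow> nat \<Rightarrow> real) \<Rightarrow> ereal" where
  "discounted_cost M \<rho> Y =
     ext_expectation M (\<lambda>\<omega>. limsup (\<lambda>T. ereal (\<Sum>t<T. \<rho> ^ t * Y \<omega> t)))"

record ('m, 'n, 'd) lq_game =
  ctrl :: "'m \<Rightarrow> 'd set"
  drift :: "real^'n"
  Amat :: "real^'n^'n"
  Bmat :: "'m \<Rightarrow> real^'d^'n"
  Qmat :: "'m \<Rightarrow> real^'n^'n"
  Hmat :: "'m \<Rightarrow> real^'d^'n"
  Rmat :: "'m \<Rightarrow> real^'d^'d"
  qvec :: "'m \<Rightarrow> real^'n"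
  rvec :: "'m \<Rightarrow> real^'d"
  disc :: real
  noise_cov :: "real^'n^'n"
  radF :: "'m \<Rightarrow> real"
  radf :: "'m \<Rightarrow> real"

type_synonym ('n, 'd) strategy = "(real^'n^'d) \<times> (real^'d)"
type_synonym ('m, 'n, 'd) profile = "('m \<Rightarrow> real^'n^'d) \<times> ('m \<Rightarrow> real^'d)"

definition valid_game :: "('m::finite, 'n::finite, 'd::finite) lq_game \<Rightarrow> bool" where
  "valid_game G \<longleftrightarrow> 0 < disc G \<and> disc G < 1 \<and> pos_def_on UNIV (noise_cov G) \<and>
     (\<forall>m. ctrl G m \<noteq> {} \<and>
        supp_in (ctrl G m) (transpose (Bmat G m)) \<and> supp_in (ctrl G m) (transpose (Hmat G m)) \<and>
        supp_in (ctrl G m) (Rmat G m) \<and> supp_in (ctrl G m) (transpose (Rmat G m)) \<and>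
        supp_in (ctrl G m) (rvec G m) \<and>
        psd (Qmat G m) \<and> pos_def_on (ctrl G m) (Rmat G m) \<and> 0 < radF G m \<and> 0 < radf G m)"

definition stage_cost ::
  "('m, 'n::finite, 'd::finite) lq_game \<Rightarrow> 'm \<Rightarrow> real^'n \<Rightarrow> real^'n \<Rightarrow> real^'d \<Rightarrow> real" where
  "stage_cost G m x x' u = x \<bullet> (Qmat G m *v x) + x' \<bullet> (Hmat G m *v u) + u \<bullet> (Rmat G m *v u)
     + x \<bullet> qvec G m + u \<bullet> rvec G m"

definition feedback :: "('n, 'd) strategy \<Rightarrow> real^'n \<Rightarrow> real^'d" where
  "feedback s x = - (fst s *v x) + snd s"

definition game_step ::
  "('m::finite, 'n::finite, 'd::finite) lq_game \<Rightarrow> real^'n \<Rightarrow> ('m \<Rightarrow> real^'d) \<Rightarrow> real^'n \<Rightarrow> real^'n" where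
  "game_step G x u w = drift G + Amat G *v x + (\<Sum>m\<in>UNIV. Bmat G m *v u m) + w"

definition strategy_of :: "('m, 'n, 'd) profile \<Rightarrow> 'm \<Rightarrow> ('n, 'd) strategy" where
  "strategy_of p m = (fst p m, snd p m)"

definition deviate ::
  "('m, 'n, 'd) profile \<Rightarrow> 'm \<Rightarrow> ('n, 'd) strategy \<Rightarrow> ('m, 'n, 'd) profile" where
  "deviate p m s = ((fst p)(m := fst s), (snd p)(m := snd s))"

definition gains :: "('m, 'n::finite, 'd::finite) lq_game \<Rightarrow> 'm \<Rightarrow> (real^'n^'d) set" where
  "gains G m = {F. supp_in (ctrl G m) F \<and> spec_norm F \<le> radF G m}"

definition offsets :: "('m, 'n::finite, 'd::finite) lq_game \<Rightarrow> 'm \<Rightarrow> (real^'d) set" where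
  "offsets G m = {f. supp_in (ctrl G m) f \<and> norm f \<le> radf G m}"

definition strategies ::
  "('m, 'n::finite, 'd::finite) lq_game \<Rightarrow> 'm \<Rightarrow> (('n, 'd) strategy) set" where
  "strategies G m = gains G m \<times> offsets G m"

definition gain_profiles :: "('m, 'n::finite, 'd::finite) lq_game \<Rightarrow> ('m \<Rightarrow> real^'n^'d) set" where
  "gain_profiles G = {F. \<forall>m. F m \<in> gains G m}"

definition offset_profiles :: "('m, 'n::finite, 'd::finite) lq_game \<Rightarrow> ('m \<Rightarrow> real^'d) set" where
  "offset_profiles G = {f. \<forall>m. f m \<in> offsets G m}"

definition profiles :: "('m, 'n::finite, 'd::finite) lq_game \<Rightarrow> ('m, 'n, 'd) profile set" where
  "profiles G = gain_profiles G \<times> offset_profiles G"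

definition profile_norm :: "real \<Rightarrow> ('m::finite, 'n::finite, 'd::finite) profile \<Rightarrow> real" where
  "profile_norm \<mu> p = \<mu> * (\<Sum>m\<in>UNIV. spec_norm (fst p m)) + (\<Sum>m\<in>UNIV. norm (snd p m))"

primrec closed_loop ::
  "('m::finite, 'n::finite, 'd::finite) lq_game \<Rightarrow> ('m, 'n, 'd) profile \<Rightarrow> real^'n \<Rightarrow>
     (nat \<Rightarrow> real^'n) \<Rightarrow> nat \<Rightarrow> real^'n" where
  "closed_loop G p x w 0 = x"
| "closed_loop G p x w (Suc t) = game_step G (closed_loop G p x w t)
     (\<lambda>m. feedback (strategy_of p m) (closed_loop G p x w t)) (w t)"

definition game_cost ::
  "'a measure \<Rightarrow> (nat \<Rightarrow> 'a \<Rightarrow> real^'n) \<Rightarrow> ('m::finite, 'n::finite, 'd::finite) lq_game \<Rightarrow> 'm \<Rightarrow>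
     ('m, 'n, 'd) profile \<Rightarrow> real^'n \<Rightarrow> ereal" where
  "game_cost M w G m p x = discounted_cost M (disc G)
     (\<lambda>\<omega> t. let X = closed_loop G p x (\<lambda>s. w s \<omega>)
             in stage_cost G m (X t) (X (Suc t)) (feedback (strategy_of p m) (X t)))"

text \<open>
  \<open>BR m p\<close> is the best response of player \<open>m\<close> to the strategies of the others in \<open>p\<close>. Uniqueness
  of the minimizer makes it independent of the component \<open>m\<close> of \<open>p\<close>, so that continuity in \<open>p\<close> is
  continuity in the strategies of the others.
\<close>
definition well_posed_best_responses ::
  "'a measure \<Rightarrow> (nat \<Rightarrow> 'a \<Rightarrow> real^'n) \<Rightarrow> ('m::finite, 'n::finite, 'd::finite) lq_game \<Rightarrow>
     ('m \<Rightarrow> ('m, 'n, 'd) profile \<Rightarrow> ('n, 'd) strategy) \<Rightarrow> bool" where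
  "well_posed_best_responses M w G BR \<longleftrightarrow>
     (\<forall>m. \<forall>p\<in>profiles G. \<forall>x. \<forall>s.
        is_argmin (strategies G m) (\<lambda>s. game_cost M w G m (deviate p m s) x) s \<longleftrightarrow> s = BR m p) \<and>
     (\<forall>m. continuous_on (profiles G) (BR m))"

definition collective_response ::
  "('m \<Rightarrow> ('m, 'n, 'd) profile \<Rightarrow> ('n, 'd) strategy) \<Rightarrow>
     ('m, 'n, 'd) profile \<Rightarrow> ('m, 'n, 'd) profile" where
  "collective_response BR p = (\<lambda>m. fst (BR m p), \<lambda>m. snd (BR m p))"

definition stable_equilibrium ::
  "('m::finite, 'n::finite, 'd::finite) lq_game \<Rightarrow>
     ('m \<Rightarrow> ('m, 'n, 'd) profile \<Rightarrow> ('n, 'd) strategy) \<Rightarrow>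
     ('m, 'n, 'd) profile \<Rightarrow> real \<Rightarrow> real \<Rightarrow> bool" where
  "stable_equilibrium G BR pstar \<mu> \<zeta> \<longleftrightarrow>
     0 < \<mu> \<and> 0 < \<zeta> \<and> \<zeta> < 1 \<and> pstar \<in> profiles G \<and> collective_response BR pstar = pstar \<and>
     (\<forall>p\<in>profiles G. profile_norm \<mu> (collective_response BR p - collective_response BR pstar)
        \<le> \<zeta> * profile_norm \<mu> (p - pstar))"

definition uniformly_stable :: "('m::finite, 'n::finite, 'd::finite) lq_game \<Rightarrow> bool" where
  "uniformly_stable G \<longleftrightarrow>
     (SUP F\<in>gain_profiles G. spec_norm (Amat G - (\<Sum>m\<in>UNIV. Bmat G m ** F m))) < 1"

text \<open>The index type \<open>unit + ('n + 'd)\<close> lists the constant, the state and the control block.\<close>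
type_synonym ('n, 'd) model = "(real^'n^(unit + ('n + 'd))) \<times> (real^'n^'n)"

definition regressor :: "real^'n \<Rightarrow> real^'d \<Rightarrow> real^(unit + ('n + 'd))" where
  "regressor x u = (\<chi> i. case i of Inl _ \<Rightarrow> 1 | Inr (Inl j) \<Rightarrow> x $ j | Inr (Inr j) \<Rightarrow> u $ j)"

definition true_param ::
  "('m::finite, 'n::finite, 'd::finite) lq_game \<Rightarrow> 'm \<Rightarrow> ('m, 'n, 'd) profile \<Rightarrow>
     real^'n^(unit + ('n + 'd))" where
  "true_param G m p = (\<chi> i. case i of
       Inl _ \<Rightarrow> drift G + (\<Sum>j\<in>UNIV - {m}. Bmat G j *v snd p j)
     | Inr (Inl k) \<Rightarrow> column k (Amat G - (\<Sum>j\<in>UNIV - {m}. Bmat G j ** fst p j))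
     | Inr (Inr k) \<Rightarrow> column k (Bmat G m))"

definition models :: "('m, 'n::finite, 'd::finite) lq_game \<Rightarrow> 'm \<Rightarrow> ('n, 'd) model set" where
  "models G m = {(\<Theta>, S). supp_in (UNIV <+> (UNIV <+> ctrl G m)) \<Theta> \<and> psd S}"

text \<open>A noise path \<open>\<xi>\<close> consists of the pairs (state noise, exploration noise).\<close>
primrec perceived_state ::
  "real^'n^(unit + ('n + 'd)) \<Rightarrow> ('n, 'd) strategy \<Rightarrow> real^'n \<Rightarrow> real \<Rightarrow>
     (nat \<Rightarrow> (real^'n) \<times> (real^'d)) \<Rightarrow> nat \<Rightarrow> real^'n" where
  "perceived_state \<Theta> s x \<alpha> \<xi> 0 = x"
| "perceived_state \<Theta> s x \<alpha> \<xi> (Suc t) = transpose \<Theta> *v regressor (perceived_state \<Theta> s x \<alpha> \<xi> t)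
     (feedback s (perceived_state \<Theta> s x \<alpha> \<xi> t) + \<alpha> *\<^sub>R snd (\<xi> t)) + fst (\<xi> t)"

text \<open>
  \<open>W m S\<close> is the law of one state noise with covariance \<open>S\<close> and \<open>V m\<close> that of one exploration
  noise in the model of player \<open>m\<close>. Only mean, covariance and sub-Gaussianity of these laws are
  prescribed; they are arbitrary otherwise.
\<close>
definition perceived_noise_laws ::
  "('m, 'n::finite, 'd::finite) lq_game \<Rightarrow> ('m \<Rightarrow> real^'n^'n \<Rightarrow> (real^'n) measure) \<Rightarrow>
     ('m \<Rightarrow> (real^'d) measure) \<Rightarrow> bool" where
  "perceived_noise_laws G W V \<longleftrightarrow>
     (\<forall>m. (\<forall>S. psd S \<longrightarrow> noise_law (W m S) S) \<and> noise_law (V m) (ident_on (ctrl G m)))"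

definition perceived_cost ::
  "('m, 'n::finite, 'd::finite) lq_game \<Rightarrow> ('m \<Rightarrow> real^'n^'n \<Rightarrow> (real^'n) measure) \<Rightarrow>
     ('m \<Rightarrow> (real^'d) measure) \<Rightarrow> 'm \<Rightarrow> ('n, 'd) model \<Rightarrow> real^'n \<Rightarrow> real \<Rightarrow>
     ('n, 'd) strategy \<Rightarrow> ereal" where
  "perceived_cost G W V m \<theta> x \<alpha> s =
     discounted_cost (\<Pi>\<^sub>M t\<in>(UNIV::nat set). W m (snd \<theta>) \<Otimes>\<^sub>M V m) (disc G)
       (\<lambda>\<xi> t. let X = perceived_state (fst \<theta>) s x \<alpha> \<xi>
               in stage_cost G m (X t) (X (Suc t)) (feedback s (X t) + \<alpha> *\<^sub>R snd (\<xi> t)))"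

definition feasible ::
  "('m, 'n::finite, 'd::finite) lq_game \<Rightarrow> ('m \<Rightarrow> real^'n^'n \<Rightarrow> (real^'n) measure) \<Rightarrow>
     ('m \<Rightarrow> (real^'d) measure) \<Rightarrow> 'm \<Rightarrow> ('n, 'd) model set" where
  "feasible G W V m = {\<theta> \<in> models G m. \<forall>x. \<forall>\<alpha>\<ge>0.
     \<bar>INF s\<in>strategies G m. perceived_cost G W V m \<theta> x \<alpha> s\<bar> \<noteq> \<infinity>}"

text \<open>A finite infimum over the feasible set need not be attained for degenerate models; the
  selection is then only required to be admissible.\<close>
definition optimal_selection ::
  "('m, 'n::finite, 'd::finite) lq_game \<Rightarrow> ('m \<Rightarrow> real^'n^'n \<Rightarrow> (real^'n) measure) \<Rightarrow>
     ('m \<Rightarrow> (real^'d) measure) \<Rightarrow>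
     ('m \<Rightarrow> ('n, 'd) model \<Rightarrow> real^'n \<Rightarrow> real \<Rightarrow> ('n, 'd) strategy) \<Rightarrow> bool" where
  "optimal_selection G W V \<Phi> \<longleftrightarrow> (\<forall>m. \<forall>\<theta>\<in>feasible G W V m. \<forall>x. \<forall>\<alpha>\<ge>0.
     \<Phi> m \<theta> x \<alpha> \<in> strategies G m \<and>
     ((\<exists>s. is_argmin (strategies G m) (perceived_cost G W V m \<theta> x \<alpha>) s) \<longrightarrow>
        is_argmin (strategies G m) (perceived_cost G W V m \<theta> x \<alpha>) (\<Phi> m \<theta> x \<alpha>)))"

definition model_dist :: "('n::finite, 'd::finite) model \<Rightarrow> ('n, 'd) model \<Rightarrow> real" where
  "model_dist \<theta> \<theta>' = max (spec_norm (fst \<theta> - fst \<theta>')) (spec_norm (snd \<theta> - snd \<theta>'))"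

definition uniformly_lipschitz ::
  "('m::finite, 'n::finite, 'd::finite) lq_game \<Rightarrow> ('m \<Rightarrow> real^'n^'n \<Rightarrow> (real^'n) measure) \<Rightarrow>
     ('m \<Rightarrow> (real^'d) measure) \<Rightarrow>
     ('m \<Rightarrow> ('n, 'd) model \<Rightarrow> real^'n \<Rightarrow> real \<Rightarrow> ('n, 'd) strategy) \<Rightarrow> bool" where
  "uniformly_lipschitz G W V \<Phi> \<longleftrightarrow> (\<forall>m. \<exists>\<delta>>0. \<exists>L>0. \<forall>p\<in>profiles G. \<forall>\<theta>\<in>models G m.
     let \<theta>0 = (true_param G m p, noise_cov G) in
     model_dist \<theta> \<theta>0 \<le> \<delta> \<longrightarrow>
       \<theta> \<in> feasible G W V m \<and>
       (\<forall>x. \<forall>\<alpha>\<in>{0..\<delta>}.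
          (\<exists>!s. is_argmin (strategies G m) (perceived_cost G W V m \<theta> x \<alpha>) s) \<and>
          spec_norm (fst (\<Phi> m \<theta> x \<alpha>) - fst (\<Phi> m \<theta>0 x 0)) \<le> L * max (model_dist \<theta> \<theta>0) \<alpha> \<and>
          norm (snd (\<Phi> m \<theta> x \<alpha>) - snd (\<Phi> m \<theta>0 x 0)) \<le> L * max (model_dist \<theta> \<theta>0) \<alpha>))"

record 'm schedule =
  base_len :: real
  scale_len :: real
  growth :: real
  max_shift :: real
  expl_scale :: real
  decay :: "'m \<Rightarrow> real"

definition valid_schedule :: "'m schedule \<Rightarrow> bool" where
  "valid_schedule c \<longleftrightarrow> 0 \<le> base_len c \<and> 0 < scale_len c \<and> 1 < growth c \<and> 0 < max_shift c \<and>
     0 < expl_scale c \<and> (\<forall>m. 0 < decay c m \<and> decay c m < 1/2)"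

text \<open>Epoch \<open>k\<close> starts at \<open>epoch_start c sh m k\<close> and has length \<open>epoch_len c sh m (k + 1)\<close>; hence the
  shift \<open>sh m k\<close> and the length with index \<open>k = 0\<close> are never used.\<close>

definition epoch_len :: "'m schedule \<Rightarrow> ('m \<Rightarrow> nat \<Rightarrow> real) \<Rightarrow> 'm \<Rightarrow> nat \<Rightarrow> nat" where
  "epoch_len c sh m k = nat \<lfloor>base_len c + scale_len c * growth c ^ k + sh m k\<rfloor>"

definition epoch_start :: "'m schedule \<Rightarrow> ('m \<Rightarrow> nat \<Rightarrow> real) \<Rightarrow> 'm \<Rightarrow> nat \<Rightarrow> nat" where
  "epoch_start c sh m k = (\<Sum>i=1..k. epoch_len c sh m i)"

definition epoch_at :: "'m schedule \<Rightarrow> ('m \<Rightarrow> nat \<Rightarrow> real) \<Rightarrow> 'm \<Rightarrow> nat \<Rightarrow> nat" where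
  "epoch_at c sh m t = Sup {k. epoch_start c sh m k \<le> t}"

definition exploration :: "'m schedule \<Rightarrow> ('m \<Rightarrow> nat \<Rightarrow> real) \<Rightarrow> 'm \<Rightarrow> nat \<Rightarrow> real" where
  "exploration c sh m k = expl_scale c * real (epoch_len c sh m (k + 1)) powr (- decay c m)"

definition generated ::
  "'a measure \<Rightarrow> 'i set \<Rightarrow> ('i \<Rightarrow> 'a \<Rightarrow> 'b::topological_space) \<Rightarrow> 'a set set" where
  "generated M I X = sigma_sets (space M) {X i -` E \<inter> space M | i E. i \<in> I \<and> E \<in> sets borel}"

datatype 'm source = State_Noise | Exploration 'm | Shifts

primrec source_events ::
  "'a measure \<Rightarrow> (nat \<Rightarrow> 'a \<Rightarrow> real^'n) \<Rightarrow> ('m \<Rightarrow> nat \<Rightarrow> 'a \<Rightarrow> real^'d) \<Rightarrow>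
     ('m \<Rightarrow> nat \<Rightarrow> 'a \<Rightarrow> real) \<Rightarrow> 'm source \<Rightarrow> 'a set set" where
  "source_events M w v sh State_Noise = generated M UNIV w"
| "source_events M w v sh (Exploration m) = generated M UNIV (v m)"
| "source_events M w v sh Shifts = generated M (UNIV \<times> {1..}) (\<lambda>(m, k). sh m k)"

text \<open>The shifts may depend on each other in an arbitrary way.\<close>
definition learning_noise ::
  "'a measure \<Rightarrow> ('m::finite, 'n::finite, 'd::finite) lq_game \<Rightarrow> 'm schedule \<Rightarrow>
     (nat \<Rightarrow> 'a \<Rightarrow> real^'n) \<Rightarrow> ('m \<Rightarrow> nat \<Rightarrow> 'a \<Rightarrow> real^'d) \<Rightarrow>
     ('m \<Rightarrow> nat \<Rightarrow> 'a \<Rightarrow> real) \<Rightarrow> bool" where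
  "learning_noise M G c w v sh \<longleftrightarrow>
     iid_noise M w (noise_cov G) \<and>
     (\<forall>m. iid_noise M (v m) (ident_on (ctrl G m)) \<and>
        (\<forall>t. \<forall>\<omega>\<in>space M. supp_in (ctrl G m) (v m t \<omega>))) \<and>
     (\<forall>m. \<forall>k\<ge>1. sh m k \<in> borel_measurable M \<and> (\<forall>\<omega>\<in>space M. sh m k \<omega> \<in> {0..max_shift c})) \<and>
     prob_space.indep_sets M (source_events M w v sh) UNIV"

definition history ::
  "'a measure \<Rightarrow> (nat \<Rightarrow> 'a \<Rightarrow> real^'n) \<Rightarrow> ('m \<Rightarrow> nat \<Rightarrow> 'a \<Rightarrow> real^'d) \<Rightarrow>
     ('m \<Rightarrow> nat \<Rightarrow> 'a \<Rightarrow> real) \<Rightarrow> nat \<Rightarrow> 'a measure" where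
  "history M w v sh t = sigma (space M)
     (generated M {..<t} w \<union> (\<Union>m. generated M {..<t} (v m)) \<union>
      generated M (UNIV \<times> {1..}) (\<lambda>(m, k). sh m k))"

definition ls_gram :: "real \<Rightarrow> (nat \<Rightarrow> real^'k) \<Rightarrow> nat set \<Rightarrow> real^'k^'k" where
  "ls_gram \<beta> z I = \<beta> *\<^sub>R mat 1 + (\<Sum>t\<in>I. outer (z t) (z t))"

definition ls_param ::
  "real \<Rightarrow> (nat \<Rightarrow> real^'k) \<Rightarrow> (nat \<Rightarrow> real^'n) \<Rightarrow> nat set \<Rightarrow> real^'n^'k" where
  "ls_param \<beta> z x I = matrix_inv (ls_gram \<beta> z I) ** (\<Sum>t\<in>I. outer (z t) (x (Suc t)))"

definition ls_cov ::
  "real \<Rightarrow> (nat \<Rightarrow> real^'k) \<Rightarrow> (nat \<Rightarrow> real^'n) \<Rightarrow> nat set \<Rightarrow> real^'n^'n" where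
  "ls_cov \<beta> z x I = (1 / real (card I)) *\<^sub>R
     (\<Sum>t\<in>I. let e = x (Suc t) - transpose (ls_param \<beta> z x I) *v z t in outer e e)"

record ('a, 'm, 'n, 'd) run =
  state :: "nat \<Rightarrow> 'a \<Rightarrow> real^'n"
  control :: "'m \<Rightarrow> nat \<Rightarrow> 'a \<Rightarrow> real^'d"
  estimate :: "'m \<Rightarrow> nat \<Rightarrow> 'a \<Rightarrow> ('n, 'd) model"
  policy :: "'m \<Rightarrow> nat \<Rightarrow> 'a \<Rightarrow> ('n, 'd) strategy"

text \<open>
  The four processes are pinned down by recursion in time, for every sample point \<open>\<omega>\<close>:
  \<open>estimate r m k\<close> is the model adopted at the start of epoch \<open>k\<close>, which is the fresh least-squares
  estimate if that is feasible and the previous model otherwise.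
\<close>
definition runs_algorithm ::
  "'a measure \<Rightarrow> ('m::finite, 'n::finite, 'd::finite) lq_game \<Rightarrow> 'm schedule \<Rightarrow>
     ('m \<Rightarrow> real^'n^'n \<Rightarrow> (real^'n) measure) \<Rightarrow> ('m \<Rightarrow> (real^'d) measure) \<Rightarrow>
     ('m \<Rightarrow> ('n, 'd) model \<Rightarrow> real^'n \<Rightarrow> real \<Rightarrow> ('n, 'd) strategy) \<Rightarrow>
     ('m \<Rightarrow> real) \<Rightarrow> ('m \<Rightarrow> ('n, 'd) model) \<Rightarrow> real^'n \<Rightarrow>
     (nat \<Rightarrow> 'a \<Rightarrow> real^'n) \<Rightarrow> ('m \<Rightarrow> nat \<Rightarrow> 'a \<Rightarrow> real^'d) \<Rightarrow>
     ('m \<Rightarrow> nat \<Rightarrow> 'a \<Rightarrow> real) \<Rightarrow> ('a, 'm, 'n, 'd) run \<Rightarrow> bool" where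
  "runs_algorithm M G c W V \<Phi> \<beta> init x0 w v sh r \<longleftrightarrow>
     (\<forall>m. 0 < \<beta> m \<and> init m \<in> feasible G W V m) \<and>
     (\<forall>\<omega>\<in>space M.
        let start = epoch_start c (\<lambda>m k. sh m k \<omega>);
            \<alpha> = exploration c (\<lambda>m k. sh m k \<omega>);
            x = (\<lambda>t. state r t \<omega>);
            z = (\<lambda>m t. regressor (state r t \<omega>) (control r m t \<omega>));
            \<theta>hat = (\<lambda>m k. let I = {start m (k - 1)..<start m k}
                          in (ls_param (\<beta> m) (z m) x I, ls_cov (\<beta> m) (z m) x I))
        in x 0 = x0 \<and>
           (\<forall>t. x (Suc t) = game_step G (x t) (\<lambda>m. control r m t \<omega>) (w t \<omega>)) \<and>
           (\<forall>m k t. start m k \<le> t \<and> t < start m (k + 1) \<longrightarrow>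
              control r m t \<omega> = feedback (policy r m k \<omega>) (x t) + \<alpha> m k *\<^sub>R v m t \<omega>) \<and>
           (\<forall>m. estimate r m 0 \<omega> = init m) \<and>
           (\<forall>m. \<forall>k\<ge>1. estimate r m k \<omega> =
              (if \<theta>hat m k \<in> feasible G W V m then \<theta>hat m k else estimate r m (k - 1) \<omega>)) \<and>
           (\<forall>m k. policy r m k \<omega> = \<Phi> m (estimate r m k \<omega>) (x (start m k)) (\<alpha> m k)))"

definition played ::
  "'m schedule \<Rightarrow> ('m \<Rightarrow> nat \<Rightarrow> 'a \<Rightarrow> real) \<Rightarrow> ('a, 'm, 'n::finite, 'd::finite) run \<Rightarrow> nat \<Rightarrow> 'a \<Rightarrow>
     ('m, 'n, 'd) profile" where
  "played c sh r t \<omega> =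
     (\<lambda>m. fst (policy r m (epoch_at c (\<lambda>m k. sh m k \<omega>) m t) \<omega>),
      \<lambda>m. snd (policy r m (epoch_at c (\<lambda>m k. sh m k \<omega>) m t) \<omega>))"

text \<open>Rules out selections \<open>\<Phi>\<close> whose choice among several minimizers is not measurable.\<close>
definition adapted_play ::
  "'a measure \<Rightarrow> 'm schedule \<Rightarrow> (nat \<Rightarrow> 'a \<Rightarrow> real^'n) \<Rightarrow> ('m \<Rightarrow> nat \<Rightarrow> 'a \<Rightarrow> real^'d) \<Rightarrow>
     ('m \<Rightarrow> nat \<Rightarrow> 'a \<Rightarrow> real) \<Rightarrow> ('a, 'm, 'n::finite, 'd::finite) run \<Rightarrow> bool" where
  "adapted_play M c w v sh r \<longleftrightarrow> (\<forall>m t.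
     (\<lambda>\<omega>. strategy_of (played c sh r t \<omega>) m) \<in> borel_measurable (history M w v sh t))"

definition rate1 :: "real \<Rightarrow> real \<Rightarrow> real \<Rightarrow> real \<Rightarrow> real \<Rightarrow> real" where
  "rate1 \<zeta> g c0 t \<delta> = (ln t powr (3/2) + ln (1 / \<delta>) powr c0) * t powr (ln \<zeta> / ln g)"

definition rate2 :: "('m::finite \<Rightarrow> real) \<Rightarrow> real \<Rightarrow> real \<Rightarrow> real" where
  "rate2 \<nu> t \<delta> = sqrt (ln t + ln (1 / \<delta>)) * t powr (- (1/2 - (MAX m. \<nu> m)))"

definition rate3 :: "('m::finite \<Rightarrow> real) \<Rightarrow> real \<Rightarrow> real" where
  "rate3 \<nu> t = t powr (- (MIN m. \<nu> m))"

definition limit_exponent :: "real \<Rightarrow> real \<Rightarrow> ('m::finite \<Rightarrow> real) \<Rightarrow> real" where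
  "limit_exponent \<zeta> g \<nu> = min (- (ln \<zeta> / ln g)) (min (1/2 - (MAX m. \<nu> m)) (MIN m. \<nu> m))"

end

theory Submission
 imports Defs
begin

text \<open>
 The cost of a strategy depends on the noise only through its mean and covariance, so the optimal
 strategy in the true model of a player is her best response. With probability at least \<open>1 - \<delta>\<close>
 all sums over time intervals of products of states and noises that occur in the least-squares
 errors are within their typical size, up to logarithms of the time and \<open>ln (1 / \<delta>)\<close>. On such a path the
 epochs of different players, which drift apart only linearly in the epoch number, overlap up to a
 logarithmic number of steps, and the estimate of a player for epoch \<open>k\<close> is close to her true
 model under the profile of epoch \<open>k - 1\<close>: the error consists of a statistical part, with rate one half
 minus the largest decay exponent because exploration excites the control direction, and of the exploration
 noise of the others, with rate the smallest decay exponent. By the Lipschitz property the distance of the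
 epoch-\<open>k\<close> profile to the equilibrium satisfies a contraction with factor \<open>\<zeta>\<close>, perturbed by these two rates,
 as soon as a power of \<open>k + ln (1 / \<delta>)\<close> is dominated by the geometric epoch length. Unrolling the
 recursion gives the three rates.
\<close>

section \<open>Deviation inequalities for innovation sequences\<close>

text \<open>The data are generated under feedback: the state depends on all past noises and, through
  the policies, on past estimates, and the epoch boundaries are random. Hence the sums in the
  least-squares problem have in general neither independent terms nor fixed limits. Every source of
  randomness therefore gets its own filtration, which contains the other sources for all times; in
  each cross product one factor is then known before the other is drawn. The deviation bounds keep
  the random energy of the known factor, which is estimated afterwards from stability, path by path,
  and they hold for all time intervals at once, so that random epochs may be inserted. On the
  resulting event the argument is deterministic, with constants chosen before the path and \<delta>.
  The exponent 3/2 of the logarithm arises when a perturbation decays at least as fast as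
  \<open>\<zeta> ^ k\<close>: the convolution then gains a factor \<open>k\<close>, and the
  statistical error brings a further \<open>sqrt (k + L)\<close> with
  \<open>L = ln (1 / \<delta>)\<close>. The power \<open>c0\<close> of \<open>L\<close> also pays
  for the epochs before the contraction sets in.\<close>

lemma (in prob_space) indep_set_mono:
 "indep_set A B \<Longrightarrow> A' \<subseteq> A \<Longrightarrow> B' \<subseteq> B \<Longrightarrow> indep_set A' B'"
 unfolding indep_sets2_eq by (meson subset_iff)

text \<open>\<open>\<G> t\<close> is the information available just before
  \<open>\<epsilon> t\<close> is drawn, so a multiplier at time \<open>t\<close> has to be
  measurable in \<open>\<G> t\<close>. Moments and identical laws are left out; they enter each
  bound through its own hypothesis on moment generating functions.\<close>

definition innovation ::
 "'a measure \<Rightarrow> (nat \<Rightarrow> 'a measure) \<Rightarrow> (nat \<Rightarrow> 'a \<Rightarrow> 'b::topological_space) \<Rightarrow> bool" where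
 "innovation M \<G> \<epsilon> \<longleftrightarrow> (\<forall>t. subalgebra M (\<G> t)) \<and> (\<forall>s t. s \<le> t \<longrightarrow> sets (\<G> s) \<subseteq> sets (\<G> t)) \<and>
   (\<forall>s t. s < t \<longrightarrow> \<epsilon> s \<in> borel_measurable (\<G> t)) \<and> (\<forall>t. \<epsilon> t \<in> borel_measurable M) \<and>
   (\<forall>t. prob_space.indep_set M (sets (\<G> t)) {\<epsilon> t -` B \<inter> space M | B. B \<in> sets borel})"

lemma innovation_compose:
 assumes "prob_space M" "innovation M \<G> \<epsilon>" "h \<in> borel_measurable borel"
 shows "innovation M \<G> (\<lambda>t \<omega>. h (\<epsilon> t \<omega>))"
proof -
 interpret prob_space M by fact
 have "indep_set (sets (\<G> t)) {(\<lambda>\<omega>. h (\<epsilon> t \<omega>)) -` B \<inter> space M | B. B \<in> sets borel}" for t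
 proof -
  have *: "indep_set (sets (\<G> t)) {\<epsilon> t -` B \<inter> space M | B. B \<in> sets borel}"
   using assms(2) by (auto simp: innovation_def)
  have "{(\<lambda>\<omega>. h (\<epsilon> t \<omega>)) -` B \<inter> space M | B. B \<in> sets borel} \<subseteq> {\<epsilon> t -` B \<inter> space M | B. B \<in> sets borel}"
  proof safe
   fix B :: "'c set" assume "B \<in> sets borel"
   then have "h -` B \<in> sets borel" using assms(3) by (metis measurable_sets_borel)
   then show "\<exists>B'. (\<lambda>\<omega>. h (\<epsilon> t \<omega>)) -` B \<inter> space M = \<epsilon> t -` B' \<inter> space M \<and> B' \<in> sets borel"
    by (intro exI[of _ "h -` B"]) auto
  qed
  then show ?thesis by (rule indep_set_mono[OF * order_refl])
 qed
 moreover have "\<And>t. (\<lambda>\<omega>. h (\<epsilon> t \<omega>)) \<in> borel_measurable M"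
  "\<And>s t. s < t \<Longrightarrow> (\<lambda>\<omega>. h (\<epsilon> s \<omega>)) \<in> borel_measurable (\<G> t)"
  using assms(2) by (auto simp: innovation_def intro!: measurable_compose[OF _ assms(3)])
 ultimately show ?thesis using assms(2) unfolding innovation_def by auto
qed

text \<open>One step of the exponential supermartingale. No conditional expectation is taken: the
  pair of accumulated sum \<open>Z\<close> and multiplier \<open>\<xi>\<close> is independent of
  \<open>\<epsilon>\<close>, so the joint law is a product and Fubini freezes the pair. The moment
  bound is then applied with \<open>s * \<xi> \<omega>\<close> as a constant.\<close>

lemma nn_integral_exp_step:
 fixes Z \<xi> \<epsilon> :: "'a \<Rightarrow> real"
 assumes M: "prob_space M" and sub: "subalgebra M N"
  and Z[measurable]: "Z \<in> borel_measurable N" and \<xi>[measurable]: "\<xi> \<in> borel_measurable N"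
  and \<epsilon>: "\<epsilon> \<in> borel_measurable M"
  and ind: "prob_space.indep_set M (sets N) {\<epsilon> -` B \<inter> space M | B. B \<in> sets borel}"
  and mgf: "\<And>\<omega>. \<omega> \<in> space M \<Longrightarrow> (\<integral>\<^sup>+\<omega>'. ennreal (exp (s * \<xi> \<omega> * \<epsilon> \<omega>')) \<partial>M) \<le> ennreal (exp (c * (s * \<xi> \<omega>)^2))"
 shows "(\<integral>\<^sup>+\<omega>. ennreal (exp (Z \<omega> + (s * \<xi> \<omega> * \<epsilon> \<omega> - c * (s * \<xi> \<omega>)^2))) \<partial>M) \<le> (\<integral>\<^sup>+\<omega>. ennreal (exp (Z \<omega>)) \<partial>M)"
proof -
 interpret prob_space M by fact
 have ZM[measurable]: "Z \<in> borel_measurable M" and \<xi>M[measurable]: "\<xi> \<in> borel_measurable M"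
  using measurable_from_subalg[OF sub Z] measurable_from_subalg[OF sub \<xi>] by auto
 have \<epsilon>M[measurable]: "\<epsilon> \<in> borel_measurable M" by fact
 define X where "X \<omega> = (Z \<omega>, \<xi> \<omega>)" for \<omega>
 have XN: "X \<in> borel_measurable N" unfolding X_def by measurable
 have XM[measurable]: "X \<in> borel_measurable M" using measurable_from_subalg[OF sub XN] .
 have spN: "space N = space M" using sub by (simp add: subalgebra_def)
 \<comment> \<open>Independence of two variables is formulated for a common value type, hence the
   scalar is padded to a pair.\<close>
 define Y where "Y \<omega> = (\<epsilon> \<omega>, 0::real)" for \<omega>
 have YM[measurable]: "Y \<in> borel_measurable M" unfolding Y_def by measurable
 have "indep_var borel X borel Y" unfolding indep_var_eq
 proof (intro conjI)
  have 1: "{X -` A \<inter> space M |A. A \<in> sets borel} \<subseteq> sets N" using measurable_sets[OF XN] spN by auto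
  have 2: "{Y -` A \<inter> space M |A. A \<in> sets borel} \<subseteq> {\<epsilon> -` A \<inter> space M |A. A \<in> sets borel}"
  proof safe
   fix A :: "(real \<times> real) set" assume A: "A \<in> sets borel"
   have "(\<lambda>e::real. (e, 0::real)) \<in> borel_measurable borel" by measurable
   then have "(\<lambda>e. (e, 0)) -` A \<in> sets borel" using A by (metis measurable_sets_borel)
   then show "\<exists>B. Y -` A \<inter> space M = \<epsilon> -` B \<inter> space M \<and> B \<in> sets borel"
    by (intro exI[of _ "(\<lambda>e. (e, 0)) -` A"]) (auto simp: Y_def)
  qed
  have "indep_set {X -` A \<inter> space M |A. A \<in> sets borel} {Y -` A \<inter> space M |A. A \<in> sets borel}"
   using ind 1 2 by (rule indep_set_mono)
  then show "indep_set (sigma_sets (space M) {X -` A \<inter> space M |A. A \<in> sets borel})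
    (sigma_sets (space M) {Y -` A \<inter> space M |A. A \<in> sets borel})"
  proof (rule indep_set_sigma_sets)
   show "Int_stable {X -` A \<inter> space M |A. A \<in> sets borel}"
   proof (safe intro!: Int_stableI, goal_cases)
    case (1 _ _ A B) then show ?case by (intro exI[of _ "A \<inter> B"]) auto
   qed
   show "Int_stable {Y -` A \<inter> space M |A. A \<in> sets borel}"
   proof (safe intro!: Int_stableI, goal_cases)
    case (1 _ _ A B) then show ?case by (intro exI[of _ "A \<inter> B"]) auto
   qed
  qed
 qed auto
 then have D: "distr M borel X \<Otimes>\<^sub>M distr M borel Y = distr M (borel \<Otimes>\<^sub>M borel) (\<lambda>\<omega>. (X \<omega>, Y \<omega>))"
  by (simp add: indep_var_distribution_eq)
 interpret D1: prob_space "distr M borel X" by (rule prob_space_distr) simp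
 interpret D2: prob_space "distr M borel Y" by (rule prob_space_distr) simp
 define g where "g = (\<lambda>p::(real\<times>real)\<times>(real\<times>real). ennreal (exp (fst (fst p) + (s * snd (fst p) * fst (snd p) - c * (s * snd (fst p))^2))))"
 have g[measurable]: "g \<in> borel_measurable (borel \<Otimes>\<^sub>M borel)" unfolding g_def borel_prod[symmetric] by measurable
 have "(\<integral>\<^sup>+\<omega>. ennreal (exp (Z \<omega> + (s * \<xi> \<omega> * \<epsilon> \<omega> - c * (s * \<xi> \<omega>)^2))) \<partial>M) = (\<integral>\<^sup>+\<omega>. g (X \<omega>, Y \<omega>) \<partial>M)"
  by (simp add: g_def X_def Y_def)
 also have "\<dots> = (\<integral>\<^sup>+p. g p \<partial>distr M (borel \<Otimes>\<^sub>M borel) (\<lambda>\<omega>. (X \<omega>, Y \<omega>)))"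
  by (subst nn_integral_distr) auto
 also have "\<dots> = (\<integral>\<^sup>+x. \<integral>\<^sup>+e. g (x, e) \<partial>distr M borel Y \<partial>distr M borel X)"
  unfolding D[symmetric] by (subst D2.nn_integral_fst[symmetric]) auto
 also have "\<dots> = (\<integral>\<^sup>+\<omega>. \<integral>\<^sup>+\<omega>'. g (X \<omega>, Y \<omega>') \<partial>M \<partial>M)"
 proof -
  have "(\<lambda>x. \<integral>\<^sup>+e. g (x, e) \<partial>distr M borel Y) \<in> borel_measurable borel"
   by (rule D2.borel_measurable_nn_integral) (auto simp: split_beta)
  then show ?thesis by (subst nn_integral_distr) (auto simp: nn_integral_distr)
 qed
 also have "\<dots> \<le> (\<integral>\<^sup>+\<omega>. ennreal (exp (Z \<omega>)) \<partial>M)"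
 proof (rule nn_integral_mono)
  fix \<omega> assume \<omega>: "\<omega> \<in> space M"
  have "(\<integral>\<^sup>+\<omega>'. g (X \<omega>, Y \<omega>') \<partial>M) = (\<integral>\<^sup>+\<omega>'. ennreal (exp (Z \<omega> - c * (s * \<xi> \<omega>)^2)) * ennreal (exp (s * \<xi> \<omega> * \<epsilon> \<omega>')) \<partial>M)"
   by (rule nn_integral_cong) (simp add: g_def X_def Y_def ennreal_mult[symmetric] exp_add[symmetric] algebra_simps)
  also have "\<dots> = ennreal (exp (Z \<omega> - c * (s * \<xi> \<omega>)^2)) * (\<integral>\<^sup>+\<omega>'. ennreal (exp (s * \<xi> \<omega> * \<epsilon> \<omega>')) \<partial>M)"
   by (rule nn_integral_cmult) measurable
  also have "\<dots> \<le> ennreal (exp (Z \<omega> - c * (s * \<xi> \<omega>)^2)) * ennreal (exp (c * (s * \<xi> \<omega>)^2))"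
   by (rule mult_left_mono[OF mgf[OF \<omega>]]) simp
  also have "\<dots> = ennreal (exp (Z \<omega>))" by (simp add: ennreal_mult[symmetric] exp_add[symmetric])
  finally show "(\<integral>\<^sup>+\<omega>'. g (X \<omega>, Y \<omega>') \<partial>M) \<le> ennreal (exp (Z \<omega>))" .
 qed
 finally show ?thesis .
qed

lemma nn_integral_exp_sum:
 fixes \<xi> \<epsilon> :: "nat \<Rightarrow> 'a \<Rightarrow> real"
 assumes M: "prob_space M" and inn: "innovation M \<G> \<epsilon>"
  and \<xi>: "\<And>t. \<xi> t \<in> borel_measurable (\<G> t)"
  and mgf: "\<And>t \<omega>. \<omega> \<in> space M \<Longrightarrow> (\<integral>\<^sup>+\<omega>'. ennreal (exp (s * \<xi> t \<omega> * \<epsilon> t \<omega>')) \<partial>M) \<le> ennreal (exp (c * (s * \<xi> t \<omega>)^2))"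
 shows "(\<integral>\<^sup>+\<omega>. ennreal (exp (\<Sum>t\<in>{a..<a+n}. s * \<xi> t \<omega> * \<epsilon> t \<omega> - c * (s * \<xi> t \<omega>)^2)) \<partial>M) \<le> 1"
proof (induction n)
 case 0
 interpret prob_space M by fact
 show ?case by (simp add: emeasure_space_1)
next
 case (Suc n)
 let ?Z = "\<lambda>\<omega>. \<Sum>t\<in>{a..<a+n}. s * \<xi> t \<omega> * \<epsilon> t \<omega> - c * (s * \<xi> t \<omega>)^2"
 have spG: "space (\<G> t) = space M" for t using inn by (auto simp: innovation_def subalgebra_def)
 have \<xi>': "\<xi> t \<in> borel_measurable (\<G> (a+n))" if "t \<le> a + n" for t
 proof -
  have "sets (\<G> t) \<subseteq> sets (\<G> (a+n))" using inn that by (auto simp: innovation_def)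
  then have "subalgebra (\<G> (a+n)) (\<G> t)" by (simp add: subalgebra_def spG)
  from measurable_from_subalg[OF this \<xi>] show ?thesis .
 qed
 have \<epsilon>': "\<epsilon> t \<in> borel_measurable (\<G> (a+n))" if "t < a + n" for t using inn that by (auto simp: innovation_def)
 have Z: "?Z \<in> borel_measurable (\<G> (a+n))"
  by (intro borel_measurable_sum borel_measurable_diff borel_measurable_times borel_measurable_power
   borel_measurable_const \<xi>' \<epsilon>') auto
 have "(\<integral>\<^sup>+\<omega>. ennreal (exp (?Z \<omega> + (s * \<xi> (a+n) \<omega> * \<epsilon> (a+n) \<omega> - c * (s * \<xi> (a+n) \<omega>)^2))) \<partial>M)
   \<le> (\<integral>\<^sup>+\<omega>. ennreal (exp (?Z \<omega>)) \<partial>M)" by (rule nn_integral_exp_step[OF M _ Z \<xi>'])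
   (use inn mgf in \<open>auto simp: innovation_def\<close>)
 also have "\<dots> \<le> 1" by (rule Suc.IH)
 finally show ?case by simp
qed

lemma chernoff_sum:
 fixes \<xi> \<epsilon> :: "nat \<Rightarrow> 'a \<Rightarrow> real"
 assumes M: "prob_space M" and inn: "innovation M \<G> \<epsilon>"
  and \<xi>: "\<And>t. \<xi> t \<in> borel_measurable (\<G> t)"
  and mgf: "\<And>t \<omega>. \<omega> \<in> space M \<Longrightarrow> (\<integral>\<^sup>+\<omega>'. ennreal (exp (s * \<xi> t \<omega> * \<epsilon> t \<omega>')) \<partial>M) \<le> ennreal (exp (c * (s * \<xi> t \<omega>)^2))"
 shows "measure M {\<omega>\<in>space M. u \<le> (\<Sum>t\<in>{a..<b}. s * \<xi> t \<omega> * \<epsilon> t \<omega> - c * (s * \<xi> t \<omega>)^2)} \<le> exp (- u)"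
proof -
 interpret prob_space M by fact
 let ?Z = "\<lambda>\<omega>. \<Sum>t\<in>{a..<b}. s * \<xi> t \<omega> * \<epsilon> t \<omega> - c * (s * \<xi> t \<omega>)^2"
 have [measurable]: "\<xi> t \<in> borel_measurable M" for t using inn measurable_from_subalg[OF _ \<xi>] by (auto simp: innovation_def)
 have [measurable]: "\<epsilon> t \<in> borel_measurable M" for t using inn by (auto simp: innovation_def)
 have I: "(\<integral>\<^sup>+\<omega>. ennreal (exp (?Z \<omega>)) \<partial>M) \<le> 1"
 proof (cases "a \<le> b")
  case True
  then show ?thesis using nn_integral_exp_sum[OF M inn \<xi> mgf, where a=a and n="b-a"] by simp
 next
  case False then show ?thesis by (simp add: emeasure_space_1)
 qed
 have "emeasure M {\<omega>\<in>space M. 1 \<le> ennreal (exp (-u)) * ennreal (exp (?Z \<omega>))}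
   \<le> ennreal (exp (-u)) * (\<integral>\<^sup>+\<omega>. ennreal (exp (?Z \<omega>)) * indicator (space M) \<omega> \<partial>M)"
  using nn_integral_Markov_inequality[of "\<lambda>\<omega>. ennreal (exp (?Z \<omega>))" "space M" M "ennreal (exp (-u))"]
  by (auto simp: conj_commute)
 also have "(\<integral>\<^sup>+\<omega>. ennreal (exp (?Z \<omega>)) * indicator (space M) \<omega> \<partial>M) = (\<integral>\<^sup>+\<omega>. ennreal (exp (?Z \<omega>)) \<partial>M)"
  by (rule nn_integral_cong) simp
 also have "ennreal (exp (-u)) * \<dots> \<le> ennreal (exp (-u)) * 1" by (rule mult_left_mono[OF I]) simp
 also have "{\<omega>\<in>space M. 1 \<le> ennreal (exp (-u)) * ennreal (exp (?Z \<omega>))} = {\<omega>\<in>space M. u \<le> ?Z \<omega>}"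
  by (auto simp: ennreal_mult[symmetric] exp_add[symmetric] simp flip: ennreal_1)
 finally show ?thesis by (simp add: emeasure_eq_measure)
qed

text \<open>A self-normalized bound: the energy of \<open>\<xi>\<close> stays in it as a random
  quantity, because multipliers such as the state have no a priori bound. The choice
  \<open>s = sqrt (u / (b - a))\<close> has the optimal order when that energy is comparable to the
  length of the interval, and both signs of \<open>s\<close> give the absolute value.\<close>

lemma sub_gaussian_sum_deviation:
 fixes \<xi> \<epsilon> :: "nat \<Rightarrow> 'a \<Rightarrow> real"
 assumes M: "prob_space M" and inn: "innovation M \<G> \<epsilon>"
  and \<xi>: "\<And>t. \<xi> t \<in> borel_measurable (\<G> t)"
  and mgf: "\<And>t y. (\<integral>\<^sup>+\<omega>'. ennreal (exp (y * \<epsilon> t \<omega>')) \<partial>M) \<le> ennreal (exp (c * y^2))"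
  and ab: "a < b" and u: "0 < u"
 shows "measure M {\<omega>\<in>space M. sqrt (u / real (b - a)) * c * (\<Sum>t\<in>{a..<b}. (\<xi> t \<omega>)^2) + sqrt (u * real (b - a)) \<le> \<bar>\<Sum>t\<in>{a..<b}. \<xi> t \<omega> * \<epsilon> t \<omega>\<bar>} \<le> 2 * exp (- u)"
proof -
 interpret prob_space M by fact
 have [measurable]: "\<xi> t \<in> borel_measurable M" for t using inn measurable_from_subalg[OF _ \<xi>] by (auto simp: innovation_def)
 have [measurable]: "\<epsilon> t \<in> borel_measurable M" for t using inn by (auto simp: innovation_def)
 let ?s = "sqrt (u / real (b - a))"
 have s: "?s > 0" using ab u by simp
 have su: "?s * sqrt (u * real (b - a)) = u" using ab u by (simp add: real_sqrt_mult[symmetric])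
 let ?B = "\<lambda>s. {\<omega>\<in>space M. u \<le> (\<Sum>t\<in>{a..<b}. s * \<xi> t \<omega> * \<epsilon> t \<omega> - c * (s * \<xi> t \<omega>)^2)}"
 have P: "measure M (?B s) \<le> exp (- u)" for s by (rule chernoff_sum[OF M inn \<xi>]) (rule mgf)
 have "measure M {\<omega>\<in>space M. ?s * c * (\<Sum>t\<in>{a..<b}. (\<xi> t \<omega>)^2) + sqrt (u * real (b - a)) \<le> \<bar>\<Sum>t\<in>{a..<b}. \<xi> t \<omega> * \<epsilon> t \<omega>\<bar>}
   \<le> measure M (?B ?s \<union> ?B (- ?s))"
 proof (rule finite_measure_mono)
  show "{\<omega>\<in>space M. ?s * c * (\<Sum>t\<in>{a..<b}. (\<xi> t \<omega>)^2) + sqrt (u * real (b - a)) \<le> \<bar>\<Sum>t\<in>{a..<b}. \<xi> t \<omega> * \<epsilon> t \<omega>\<bar>}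
   \<subseteq> ?B ?s \<union> ?B (- ?s)"
  proof
   fix \<omega> assume "\<omega> \<in> {\<omega>\<in>space M. ?s * c * (\<Sum>t\<in>{a..<b}. (\<xi> t \<omega>)^2) + sqrt (u * real (b - a)) \<le> \<bar>\<Sum>t\<in>{a..<b}. \<xi> t \<omega> * \<epsilon> t \<omega>\<bar>}"
   then have \<omega>: "\<omega> \<in> space M" and le: "?s * c * (\<Sum>t\<in>{a..<b}. (\<xi> t \<omega>)^2) + sqrt (u * real (b - a)) \<le> \<bar>\<Sum>t\<in>{a..<b}. \<xi> t \<omega> * \<epsilon> t \<omega>\<bar>" by auto
   let ?S = "\<Sum>t\<in>{a..<b}. \<xi> t \<omega> * \<epsilon> t \<omega>" and ?Q = "\<Sum>t\<in>{a..<b}. (\<xi> t \<omega>)^2"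
   have "?s * (?s * c * ?Q + sqrt (u * real (b - a))) \<le> ?s * \<bar>?S\<bar>" using le s by (intro mult_left_mono) auto
   moreover have "?s * (?s * c * ?Q + sqrt (u * real (b - a))) = ?s^2 * c * ?Q + ?s * sqrt (u * real (b - a))"
    by (simp only: power2_eq_square distrib_left mult.assoc)
   ultimately have A: "?s^2 * c * ?Q + u \<le> ?s * \<bar>?S\<bar>" using su by linarith
   have E: "(\<Sum>t\<in>{a..<b}. s * \<xi> t \<omega> * \<epsilon> t \<omega> - c * (s * \<xi> t \<omega>)^2) = s * ?S - s^2 * c * ?Q" for s
    by (simp add: sum_subtractf sum_distrib_left power_mult_distrib mult_ac)
   show "\<omega> \<in> ?B ?s \<union> ?B (- ?s)"
   proof (cases "?S \<ge> 0")
    case True then have "u \<le> ?s * ?S - ?s^2 * c * ?Q" using A by simp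
    then show ?thesis using \<omega> by (intro UnI1 CollectI conjI) (simp_all only: E)
   next
    case False then have "u \<le> (- ?s) * ?S - (- ?s)^2 * c * ?Q" using A by simp
    then show ?thesis using \<omega> by (intro UnI2 CollectI conjI) (simp_all only: E)
   qed
  qed
 qed measurable
 also have "\<dots> \<le> measure M (?B ?s) + measure M (?B (- ?s))" by (rule measure_Un_le) measurable
 also have "\<dots> \<le> 2 * exp (- u)" using P[of ?s] P[of "- ?s"] by simp
 finally show ?thesis .
qed

text \<open>The moment bound is available only near zero. The choice \<open>s = y0 / sqrt n\<close>
  stays in that range for every \<open>n \<ge> 1\<close>, at the cost of a deviation linear in
  \<open>u\<close> instead of its square root.\<close>

lemma sub_exponential_sum_deviation:
 fixes \<epsilon> :: "nat \<Rightarrow> 'a \<Rightarrow> real"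
 assumes M: "prob_space M" and inn: "innovation M \<G> \<epsilon>" and y0: "0 < y0" and c: "0 \<le> c"
  and mgf: "\<And>t y. \<bar>y\<bar> \<le> y0 \<Longrightarrow> (\<integral>\<^sup>+\<omega>'. ennreal (exp (y * \<epsilon> t \<omega>')) \<partial>M) \<le> ennreal (exp (c * y^2))"
  and ab: "a < b"
 shows "measure M {\<omega>\<in>space M. sqrt (real (b - a)) * (u / y0 + c * y0) \<le> \<bar>\<Sum>t\<in>{a..<b}. \<epsilon> t \<omega>\<bar>} \<le> 2 * exp (- u)"
proof -
 interpret prob_space M by fact
 have [measurable]: "\<epsilon> t \<in> borel_measurable M" for t using inn by (auto simp: innovation_def)
 define n where "n = real (b - a)"
 have n: "n \<ge> 1" using ab by (simp add: n_def)
 let ?s = "y0 / sqrt n"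
 have s: "?s > 0" "?s \<le> y0" using y0 n by (auto simp: field_simps)
 let ?B = "\<lambda>s. {\<omega>\<in>space M. u \<le> (\<Sum>t\<in>{a..<b}. s * 1 * \<epsilon> t \<omega> - c * (s * 1)^2)}"
 have P: "measure M (?B s) \<le> exp (- u)" if "\<bar>s\<bar> = ?s" for s
  by (rule chernoff_sum[OF M inn, where \<xi>="\<lambda>_ _. 1"]) (use that s mgf[of s] in auto)
 have "measure M {\<omega>\<in>space M. sqrt n * (u / y0 + c * y0) \<le> \<bar>\<Sum>t\<in>{a..<b}. \<epsilon> t \<omega>\<bar>}
   \<le> measure M (?B ?s \<union> ?B (- ?s))"
 proof (rule finite_measure_mono)
  show "{\<omega>\<in>space M. sqrt n * (u / y0 + c * y0) \<le> \<bar>\<Sum>t\<in>{a..<b}. \<epsilon> t \<omega>\<bar>} \<subseteq> ?B ?s \<union> ?B (- ?s)"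
  proof
   fix \<omega> assume "\<omega> \<in> {\<omega>\<in>space M. sqrt n * (u / y0 + c * y0) \<le> \<bar>\<Sum>t\<in>{a..<b}. \<epsilon> t \<omega>\<bar>}"
   then have \<omega>: "\<omega> \<in> space M" and le: "sqrt n * (u / y0 + c * y0) \<le> \<bar>\<Sum>t\<in>{a..<b}. \<epsilon> t \<omega>\<bar>" by auto
   let ?S = "\<Sum>t\<in>{a..<b}. \<epsilon> t \<omega>"
   have "?s * (sqrt n * (u / y0 + c * y0)) \<le> ?s * \<bar>?S\<bar>" using le s by (intro mult_left_mono) auto
   moreover have "?s * (sqrt n * (u / y0 + c * y0)) = u + c * y0^2" using n y0 by (simp add: field_simps power2_eq_square)
   ultimately have A: "c * y0^2 + u \<le> ?s * \<bar>?S\<bar>" by simp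
   have E: "(\<Sum>t\<in>{a..<b}. s * 1 * \<epsilon> t \<omega> - c * (s * 1)^2) = s * ?S - c * (n * s^2)" for s
    using n_def by (simp add: sum_subtractf sum_distrib_left algebra_simps)
   have E2: "n * (?s)^2 = y0^2" "n * (- ?s)^2 = y0^2" using n by (auto simp: power_divide)
   show "\<omega> \<in> ?B ?s \<union> ?B (- ?s)"
   proof (cases "?S \<ge> 0")
    case True then have "u \<le> ?s * ?S - c * (n * (?s)^2)" using A unfolding E2 by simp
    then show ?thesis using \<omega> by (intro UnI1 CollectI conjI) (simp_all only: E)
   next
    case False then have "u \<le> (- ?s) * ?S - c * (n * (- ?s)^2)" using A unfolding E2 by simp
    then show ?thesis using \<omega> by (intro UnI2 CollectI conjI) (simp_all only: E)
   qed
  qed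
 qed measurable
 also have "\<dots> \<le> measure M (?B ?s) + measure M (?B (- ?s))" by (rule measure_Un_le) measurable
 also have "\<dots> \<le> 2 * exp (- u)" proof -
  have "\<bar>?s\<bar> = ?s" "\<bar>- ?s\<bar> = ?s" using s(1) unfolding abs_minus_cancel by (simp_all only: abs_of_pos)
  from P[OF this(1)] P[OF this(2)] show ?thesis by linarith
 qed
 finally show ?thesis by (simp add: n_def)
qed

text \<open>Endpoints of epochs are random, so all intervals are needed simultaneously. Of the three
  units of \<open>ln (b + 1)\<close> one pays for the \<open>b\<close> possible left endpoints, and
  the other two leave a series summable in \<open>b\<close>; \<open>c\<close> pays for the number of
  families and for the value of that series.\<close>

lemma (in prob_space) uniform_union_bound:
 fixes D :: "'i \<Rightarrow> nat \<Rightarrow> nat \<Rightarrow> real \<Rightarrow> 'a \<Rightarrow> bool"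
 assumes I: "finite I"
  and D: "\<And>i a b u. i \<in> I \<Longrightarrow> a < b \<Longrightarrow> 0 < u \<Longrightarrow> prob {\<xi>\<in>space M. D i a b u \<xi>} \<le> 2 * exp (- u)"
  and meas: "\<And>i a b u. i \<in> I \<Longrightarrow> {\<xi>\<in>space M. D i a b u \<xi>} \<in> events"
 obtains c where "0 < c" "\<And>\<delta>. 0 < \<delta> \<Longrightarrow> \<delta> < 1 \<Longrightarrow>
   prob {\<xi>\<in>space M. \<forall>i\<in>I. \<forall>b. \<forall>a<b. \<not> D i a b (3 * ln (real b + 1) + ln (1 / \<delta>) + c) \<xi>} \<ge> 1 - \<delta>"
  "\<And>\<delta>. {\<xi>\<in>space M. \<forall>i\<in>I. \<forall>b. \<forall>a<b. \<not> D i a b (3 * ln (real b + 1) + ln (1 / \<delta>) + c) \<xi>} \<in> events"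
proof -
 define Z where "Z = (\<Sum>b. inverse ((real (Suc b))^2))"
 have sZ: "summable (\<lambda>b. inverse ((real (Suc b))^2))"
  using inverse_power_summable[of 2, where 'a=real] by (subst summable_Suc_iff) simp
 have Z: "Z \<ge> 0" unfolding Z_def by (rule suminf_nonneg[OF sZ]) simp
 \<comment> \<open>The first summand makes the total probability at most \<open>\<delta>\<close>,
   the added 2 makes \<open>c = ln A\<close> positive.\<close>
 define A where "A = 2 * (real (card I) + 1) * Z + 2"
 have A: "A \<ge> 2" using Z by (simp add: A_def)
 define c where "c = ln A"
 have c: "c > 0" using A by (simp add: c_def)
 define u where "u \<delta> b = 3 * ln (real b + 1) + ln (1 / \<delta>) + c" for \<delta> b
 have m: "{\<xi>\<in>space M. \<forall>i\<in>I. \<forall>b. \<forall>a<b. \<not> D i a b (u \<delta> b) \<xi>} \<in> events" for \<delta>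
 proof -
  have "{\<xi>\<in>space M. \<forall>i\<in>I. \<forall>b. \<forall>a<b. \<not> D i a b (u \<delta> b) \<xi>} = space M - (\<Union>i\<in>I. \<Union>b. \<Union>a<b. {\<xi>\<in>space M. D i a b (u \<delta> b) \<xi>})"
   by auto
  also have "\<dots> \<in> events" using meas I by (intro sets.Diff sets.top sets.finite_UN sets.countable_UN'') auto
  finally show ?thesis .
 qed
 have p: "prob {\<xi>\<in>space M. \<forall>i\<in>I. \<forall>b. \<forall>a<b. \<not> D i a b (u \<delta> b) \<xi>} \<ge> 1 - \<delta>" if \<delta>: "0 < \<delta>" "\<delta> < 1" for \<delta>
 proof -
  define B where "B b = (\<Union>i\<in>I. \<Union>a<b. {\<xi>\<in>space M. D i a b (u \<delta> b) \<xi>})" for b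
  have Bm: "B b \<in> events" for b unfolding B_def using meas I by (intro sets.finite_UN) auto
  have ui: "u \<delta> b > 0" for b using \<delta> c by (simp add: u_def add_nonneg_pos)
  have e: "exp (- u \<delta> b) = \<delta> / A * inverse (real (Suc b) ^ 3)" for b
  proof -
   have "exp (- u \<delta> b) = inverse (exp (3 * ln (real b + 1))) * inverse (exp (ln (1/\<delta>))) * inverse (exp c)"
    by (simp only: u_def exp_minus[symmetric] exp_add[symmetric]) simp
   also have "exp (3 * ln (real b + 1)) = real (Suc b) ^ 3" using exp_of_nat_mult[of 3 "ln (real b + 1)"] by (simp add: add.commute)
   also have "exp c = A" using A by (simp add: c_def)
   finally show ?thesis using \<delta> by (simp add: field_simps)
  qed
  have Bp: "prob (B b) \<le> real (card I) * 2 * (\<delta> / A) * inverse ((real (Suc b))^2)" for b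
  proof -
   have "prob (B b) \<le> (\<Sum>i\<in>I. prob (\<Union>a<b. {\<xi>\<in>space M. D i a b (u \<delta> b) \<xi>}))"
    unfolding B_def using meas I by (intro finite_measure_subadditive_finite) auto
   also have "\<dots> \<le> (\<Sum>i\<in>I. \<Sum>a<b. prob {\<xi>\<in>space M. D i a b (u \<delta> b) \<xi>})"
    using meas by (intro sum_mono finite_measure_subadditive_finite) auto
   also have "\<dots> \<le> (\<Sum>i\<in>I. \<Sum>a<b. 2 * exp (- u \<delta> b))" using ui by (intro sum_mono D) auto
   also have "\<dots> = real (card I) * 2 * (\<delta> / A) * (real b * inverse (real (Suc b) ^ 3))" by (simp add: e)
   also have "\<dots> \<le> real (card I) * 2 * (\<delta> / A) * inverse ((real (Suc b))^2)"
   proof (intro mult_left_mono)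
    have "real b * inverse (real (Suc b) ^ 3) \<le> real (Suc b) * inverse (real (Suc b) ^ 3)" by (intro mult_right_mono) auto
    also have "\<dots> = inverse ((real (Suc b))^2)" by (simp add: power2_eq_square power3_eq_cube del: of_nat_Suc)
    finally show "real b * inverse (real (Suc b) ^ 3) \<le> inverse ((real (Suc b))^2)" .
   qed (use \<delta> A in auto)
   finally show ?thesis .
  qed
  have sB: "summable (\<lambda>b. prob (B b))" by (rule summable_comparison_test'[OF summable_mult[OF sZ], of 0])
    (simp only: real_norm_def abs_of_nonneg measure_nonneg, rule Bp)
  have "prob (\<Union>b. B b) \<le> (\<Sum>b. prob (B b))" using Bm sB by (intro finite_measure_subadditive_countably) auto
  also have "\<dots> \<le> (\<Sum>b. real (card I) * 2 * (\<delta> / A) * inverse ((real (Suc b))^2))"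
   by (rule suminf_le[OF Bp sB summable_mult[OF sZ]])
  also have "\<dots> = real (card I) * 2 * (\<delta> / A) * Z" unfolding Z_def by (rule suminf_mult[OF sZ])
  also have "\<dots> \<le> \<delta>"
  proof -
   have "real (card I) * 2 * Z \<le> A" using Z by (simp add: A_def algebra_simps)
   then have "real (card I) * 2 * Z / A \<le> 1" using A by simp
   then have "\<delta> * (real (card I) * 2 * Z / A) \<le> \<delta> * 1" using \<delta> by (intro mult_left_mono) auto
   then show ?thesis by (simp add: mult_ac)
  qed
  finally have 1: "prob (\<Union>b. B b) \<le> \<delta>" .
  have "{\<xi>\<in>space M. \<forall>i\<in>I. \<forall>b. \<forall>a<b. \<not> D i a b (u \<delta> b) \<xi>} = space M - (\<Union>b. B b)"
   by (auto simp: B_def)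
  then show ?thesis using 1 Bm by (simp add: prob_compl sets.countable_UN'')
 qed
 show thesis using that[OF c] p m unfolding u_def by blast
qed

section \<open>Moment generating functions of noise components and of their products\<close>

lemma exp_le_quadratic:
 fixes z :: real shows "exp z \<le> 1 + z + z^2 * exp \<bar>z\<bar> / 2"
proof -
 obtain t where t: "\<bar>t\<bar> \<le> \<bar>z\<bar>" "exp z = (\<Sum>m<2. z ^ m / fact m) + exp t / fact 2 * z ^ 2"
  using Maclaurin_exp_le[of z 2] by blast
 have "exp t * z^2 \<le> exp \<bar>z\<bar> * z^2" using t(1) by (intro mult_right_mono) auto
 then show ?thesis using t(2) by (simp add: numeral_2_eq_2 algebra_simps)
qed

lemma square_le_exp: "0 \<le> z \<Longrightarrow> z^2 \<le> 2 * exp (z::real)" using exp_lower_Taylor_quadratic[of z] by auto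

text \<open>The zero mean removes the linear term of the exponential. Half of the exponential moment
  controls the square in the remainder, and the other half controls
  \<open>exp \<bar>y * X \<xi>\<bar>\<close> for \<open>\<bar>y\<bar> \<le> s0\<close>; this is the
  origin of the factor 2 in the integrability hypothesis.\<close>

lemma (in prob_space) centered_mgf_bound:
 fixes X :: "'a \<Rightarrow> real"
 assumes [measurable]: "X \<in> borel_measurable M" and s0: "0 < s0"
  and fin: "(\<integral>\<^sup>+\<xi>. ennreal (exp (2 * s0 * \<bar>X \<xi>\<bar>)) \<partial>M) < \<infinity>" and mean: "(\<integral>\<xi>. X \<xi> \<partial>M) = 0"
 obtains c where "0 \<le> c" "\<And>y. \<bar>y\<bar> \<le> s0 \<Longrightarrow> (\<integral>\<^sup>+\<xi>. ennreal (exp (y * X \<xi>)) \<partial>M) \<le> ennreal (exp (c * y^2))"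
proof -
 have iK: "integrable M (\<lambda>\<xi>. exp (2 * s0 * \<bar>X \<xi>\<bar>))" using fin by (intro integrableI_nonneg) auto
 define K where "K = (\<integral>\<xi>. exp (2 * s0 * \<bar>X \<xi>\<bar>) \<partial>M)"
 have K: "0 \<le> K" unfolding K_def by (rule integral_nonneg_AE) simp
 have iX: "integrable M X"
 proof (rule Bochner_Integration.integrable_bound)
  show "integrable M (\<lambda>\<xi>. exp (2 * s0 * \<bar>X \<xi>\<bar>) / (2 * s0))" using iK by simp
  show "AE \<xi> in M. norm (X \<xi>) \<le> norm (exp (2 * s0 * \<bar>X \<xi>\<bar>) / (2 * s0))"
  proof (rule AE_I2)
   fix \<xi>
   have "2 * s0 * \<bar>X \<xi>\<bar> \<le> exp (2 * s0 * \<bar>X \<xi>\<bar>)" using exp_ge_add_one_self[of "2 * s0 * \<bar>X \<xi>\<bar>"] by linarith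
   then show "norm (X \<xi>) \<le> norm (exp (2 * s0 * \<bar>X \<xi>\<bar>) / (2 * s0))" using s0 by (simp add: field_simps)
  qed
 qed simp
 have main: "(\<integral>\<^sup>+\<xi>. ennreal (exp (y * X \<xi>)) \<partial>M) \<le> ennreal (exp (K / s0^2 * y^2))" if y: "\<bar>y\<bar> \<le> s0" for y
 proof -
  have pt: "exp (y * X \<xi>) \<le> 1 + y * X \<xi> + (y^2 / s0^2) * exp (2 * s0 * \<bar>X \<xi>\<bar>)" for \<xi>
  proof -
   have "(s0 * \<bar>X \<xi>\<bar>)^2 \<le> 2 * exp (s0 * \<bar>X \<xi>\<bar>)" using s0 by (intro square_le_exp) simp
   moreover have "exp \<bar>y * X \<xi>\<bar> \<le> exp (s0 * \<bar>X \<xi>\<bar>)" using y by (simp add: abs_mult mult_right_mono)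
   ultimately have "(s0 * \<bar>X \<xi>\<bar>)^2 * exp \<bar>y * X \<xi>\<bar> \<le> 2 * exp (s0 * \<bar>X \<xi>\<bar>) * exp (s0 * \<bar>X \<xi>\<bar>)"
    by (intro mult_mono) auto
   also have "\<dots> = 2 * exp (2 * s0 * \<bar>X \<xi>\<bar>)" by (simp add: exp_add[symmetric])
   finally have 1: "(s0 * \<bar>X \<xi>\<bar>)^2 * exp \<bar>y * X \<xi>\<bar> \<le> 2 * exp (2 * s0 * \<bar>X \<xi>\<bar>)" .
   have "(y * X \<xi>)^2 * exp \<bar>y * X \<xi>\<bar> / 2 = (y^2 / s0^2) * ((s0 * \<bar>X \<xi>\<bar>)^2 * exp \<bar>y * X \<xi>\<bar>) / 2"
    using s0 by (simp add: power_mult_distrib)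
   also have "\<dots> \<le> (y^2 / s0^2) * (2 * exp (2 * s0 * \<bar>X \<xi>\<bar>)) / 2" by (intro divide_right_mono mult_left_mono 1) auto
   also have "\<dots> = (y^2 / s0^2) * exp (2 * s0 * \<bar>X \<xi>\<bar>)" by simp
   finally show ?thesis using exp_le_quadratic[of "y * X \<xi>"] by linarith
  qed
  have "(\<integral>\<^sup>+\<xi>. ennreal (exp (y * X \<xi>)) \<partial>M) \<le> (\<integral>\<^sup>+\<xi>. ennreal (1 + y * X \<xi> + (y^2 / s0^2) * exp (2 * s0 * \<bar>X \<xi>\<bar>)) \<partial>M)"
   by (intro nn_integral_mono ennreal_leI pt)
  also have "\<dots> = ennreal (\<integral>\<xi>. 1 + y * X \<xi> + (y^2 / s0^2) * exp (2 * s0 * \<bar>X \<xi>\<bar>) \<partial>M)"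
  proof (rule nn_integral_eq_integral)
   show "integrable M (\<lambda>\<xi>. 1 + y * X \<xi> + (y^2 / s0^2) * exp (2 * s0 * \<bar>X \<xi>\<bar>))" using iX iK by simp
   show "AE \<xi> in M. 0 \<le> 1 + y * X \<xi> + (y^2 / s0^2) * exp (2 * s0 * \<bar>X \<xi>\<bar>)"
    by (rule AE_I2) (meson pt exp_ge_zero order.trans)
  qed
  also have "(\<integral>\<xi>. 1 + y * X \<xi> + (y^2 / s0^2) * exp (2 * s0 * \<bar>X \<xi>\<bar>) \<partial>M) = 1 + (y^2 / s0^2) * K"
   using iX iK mean by (simp add: K_def prob_space)
  also have "\<dots> \<le> exp (K / s0^2 * y^2)" using exp_ge_add_one_self[of "K / s0^2 * y^2"] by (simp add: mult_ac)
  finally show ?thesis by (simp add: ennreal_leI)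
 qed
 show thesis by (rule that[of "K / s0^2"]) (use K main in auto)
qed

text \<open>Where \<open>\<bar>x\<bar>\<close> lies between \<open>n\<close> and
  \<open>n + 1\<close>, the weight \<open>exp (\<theta> * x^2)\<close> is dominated by a multiple of
  the exponentials with slopes \<open>y n\<close> and \<open>- y n\<close>, so a countable sum of
  such terms dominates it everywhere. The slope \<open>n / (2 * c)\<close> minimizes
  \<open>c * y^2 - n * y\<close> and leaves \<open>exp (- n^2 / (4 * c))\<close>, which beats the
  growth of \<open>exp ((n + 1)^2 / (16 * c))\<close>.\<close>

lemma (in prob_space) sub_gaussian_square_exponential:
 fixes X :: "'a \<Rightarrow> real"
 assumes [measurable]: "X \<in> borel_measurable M" and c: "0 < c"
  and mgf: "\<And>y. (\<integral>\<^sup>+\<xi>. ennreal (exp (y * X \<xi>)) \<partial>M) \<le> ennreal (exp (c * y^2))"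
 shows "(\<integral>\<^sup>+\<xi>. ennreal (exp ((X \<xi>)^2 / (16 * c))) \<partial>M) < \<infinity>"
proof -
 define \<theta> where "\<theta> = 1 / (16 * c)"
 define y where "y n = real n / (2 * c)" for n :: nat
 define g where "g n = exp (\<theta> * (real n + 1)^2 - real n * y n)" for n
 have pt: "ennreal (exp (\<theta> * x^2)) \<le> (\<Sum>n. ennreal (g n * (exp (y n * x) + exp (- y n * x))))" for x :: real
 proof -
  define n where "n = nat \<lfloor>\<bar>x\<bar>\<rfloor>"
  have n: "real n \<le> \<bar>x\<bar>" "\<bar>x\<bar> \<le> real n + 1" unfolding n_def by linarith+
  have yn: "0 \<le> y n" using c by (simp add: y_def)
  have "x^2 \<le> (real n + 1)^2" using n by (metis abs_ge_zero power2_abs power_mono)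
  then have "exp (\<theta> * x^2) \<le> exp (\<theta> * (real n + 1)^2)" using c by (simp add: \<theta>_def divide_right_mono)
  also have "\<dots> = g n * exp (real n * y n)" by (simp add: g_def exp_add[symmetric])
  also have "\<dots> \<le> g n * exp (\<bar>x\<bar> * y n)" using n yn by (intro mult_left_mono) (auto simp: g_def intro: mult_right_mono)
  also have "\<dots> \<le> g n * (exp (y n * x) + exp (- y n * x))" by (intro mult_left_mono) (auto simp: g_def abs_if mult_ac)
  finally have 1: "ennreal (exp (\<theta> * x^2)) \<le> ennreal (g n * (exp (y n * x) + exp (- y n * x)))" by (rule ennreal_leI)
  also have "\<dots> \<le> (\<Sum>n. ennreal (g n * (exp (y n * x) + exp (- y n * x))))"
   using sum_le_suminf[of "\<lambda>n. ennreal (g n * (exp (y n * x) + exp (- y n * x)))" "{n}"] by simp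
  finally show ?thesis .
 qed
 have tn: "(\<integral>\<^sup>+\<xi>. ennreal (g n * (exp (y n * X \<xi>) + exp (- y n * X \<xi>))) \<partial>M) \<le> ennreal (2 * exp (2 * \<theta>) * exp (- 1 / (8 * c)) ^ n)" for n
 proof -
  have "(\<integral>\<^sup>+\<xi>. ennreal (g n * (exp (y n * X \<xi>) + exp (- y n * X \<xi>))) \<partial>M)
    = (\<integral>\<^sup>+\<xi>. ennreal (g n) * (ennreal (exp (y n * X \<xi>)) + ennreal (exp (- y n * X \<xi>))) \<partial>M)"
   by (intro nn_integral_cong) (simp add: g_def ennreal_mult ennreal_plus)
  also have "\<dots> = ennreal (g n) * ((\<integral>\<^sup>+\<xi>. ennreal (exp (y n * X \<xi>)) \<partial>M) + (\<integral>\<^sup>+\<xi>. ennreal (exp (- y n * X \<xi>)) \<partial>M))"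
   by (subst nn_integral_cmult, measurable, subst nn_integral_add) auto
  also have "\<dots> \<le> ennreal (g n) * (ennreal (exp (c * (y n)^2)) + ennreal (exp (c * (- y n)^2)))"
   by (intro mult_left_mono add_mono mgf) auto
  also have "\<dots> = ennreal (2 * (g n * exp (c * (y n)^2)))"
   by (simp add: ennreal_plus[symmetric] ennreal_mult[symmetric] g_def del: ennreal_plus)
  also have "g n * exp (c * (y n)^2) = exp (\<theta> * (real n + 1)^2 - (real n)^2 / (4 * c))"
   using c by (simp add: g_def exp_add[symmetric] y_def field_simps power2_eq_square)
  also have "\<dots> \<le> exp (2 * \<theta> + real n * (- 1 / (8 * c)))"
  proof -
   have "(real n + 1)^2 \<le> 2 * (real n)^2 + 2" using sum_squares_ge_zero[of "real n - 1" 0] by (simp add: power2_eq_square algebra_simps)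
   then have "\<theta> * (real n + 1)^2 \<le> \<theta> * (2 * (real n)^2 + 2)" using c by (intro mult_left_mono) (auto simp: \<theta>_def)
   also have "\<dots> = 2 * \<theta> + (real n)^2 / (8 * c)" using c by (simp add: \<theta>_def field_simps)
   finally have "\<theta> * (real n + 1)^2 - (real n)^2 / (4 * c) \<le> 2 * \<theta> + (real n)^2 / (8 * c) - (real n)^2 / (4 * c)" by simp
   also have "\<dots> = 2 * \<theta> - (real n)^2 / (8 * c)" using c by (simp add: field_simps)
   also have "\<dots> \<le> 2 * \<theta> - real n / (8 * c)" using c by (cases n) (auto simp: power2_eq_square intro!: divide_right_mono)
   finally show ?thesis by simp
  qed
  also have "\<dots> = exp (2 * \<theta>) * exp (- 1 / (8 * c)) ^ n" by (simp only: exp_add exp_of_nat_mult)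
  finally show ?thesis by (simp add: ennreal_leI mult.assoc)
 qed
 have "(\<integral>\<^sup>+\<xi>. ennreal (exp (\<theta> * (X \<xi>)^2)) \<partial>M) \<le> (\<integral>\<^sup>+\<xi>. (\<Sum>n. ennreal (g n * (exp (y n * X \<xi>) + exp (- y n * X \<xi>)))) \<partial>M)"
  by (intro nn_integral_mono pt)
 also have "\<dots> = (\<Sum>n. \<integral>\<^sup>+\<xi>. ennreal (g n * (exp (y n * X \<xi>) + exp (- y n * X \<xi>))) \<partial>M)"
  by (rule nn_integral_suminf) measurable
 also have "\<dots> \<le> (\<Sum>n. ennreal (2 * exp (2 * \<theta>) * exp (- 1 / (8 * c)) ^ n))" by (rule suminf_le[OF tn]) auto
 also have "\<dots> < \<infinity>"
 proof -
  have "exp (- 1 / (8 * c)) < 1" using c by simp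
  then have "summable (\<lambda>n. 2 * exp (2 * \<theta>) * exp (- 1 / (8 * c)) ^ n)" by (intro summable_mult summable_geometric) simp
  then show ?thesis by (subst suminf_ennreal2) auto
 qed
 finally show ?thesis by (simp add: \<theta>_def)
qed

lemma noise_law_mgf:
 assumes "noise_law N S"
 obtains c where "0 < c" "\<And>w. (\<integral>\<^sup>+z. ennreal (exp (w \<bullet> z)) \<partial>N) \<le> ennreal (exp (c * (norm w)^2))"
proof -
 obtain \<sigma> :: real where \<sigma>: "\<And>w. integrable N (\<lambda>z. exp (w \<bullet> z))" "\<And>w. (\<integral>z. exp (w \<bullet> z) \<partial>N) \<le> exp (\<sigma>^2 * (norm w)^2 / 2)"
  using assms unfolding noise_law_def by blast
 show thesis
 \<comment> \<open>The summand 1 keeps the constant positive also for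
   \<open>\<sigma> = 0\<close>.\<close>
 proof (rule that[of "\<sigma>^2/2 + 1"])
  fix w
  have "(\<integral>\<^sup>+z. ennreal (exp (w \<bullet> z)) \<partial>N) = ennreal (\<integral>z. exp (w \<bullet> z) \<partial>N)"
   by (rule nn_integral_eq_integral[OF \<sigma>(1)]) simp
  also have "\<dots> \<le> ennreal (exp (\<sigma>^2 * (norm w)^2 / 2))" by (intro ennreal_leI \<sigma>(2))
  also have "\<dots> \<le> ennreal (exp ((\<sigma>^2/2 + 1) * (norm w)^2))" by (intro ennreal_leI) (simp add: algebra_simps)
  finally show "(\<integral>\<^sup>+z. ennreal (exp (w \<bullet> z)) \<partial>N) \<le> ennreal (exp ((\<sigma>^2/2 + 1) * (norm w)^2))" .
 qed (simp add: add_nonneg_pos)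
qed

lemma noise_law_component_mgf:
 fixes N :: "(real^'k) measure"
 assumes "noise_law N S"
 obtains c where "0 < c" "\<And>i y. (\<integral>\<^sup>+z. ennreal (exp (y * z $ i)) \<partial>N) \<le> ennreal (exp (c * y^2))"
proof -
 obtain c where c: "0 < c" "\<And>w::real^'k. (\<integral>\<^sup>+z. ennreal (exp (w \<bullet> z)) \<partial>N) \<le> ennreal (exp (c * (norm w)^2))"
  using noise_law_mgf[OF assms] by blast
 have "(\<integral>\<^sup>+z. ennreal (exp (y * z $ i)) \<partial>N) \<le> ennreal (exp (c * y^2))" for i y
  using c(2)[of "axis i y"] unfolding power2_norm_eq_inner by (simp add: inner_axis' inner_axis_axis power2_eq_square)
 then show thesis using that[OF c(1)] by blast
qed

lemma noise_law_component_square: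
 fixes N :: "(real^'k) measure"
 assumes N: "noise_law N S"
 obtains \<theta> where "0 < \<theta>" "\<And>i. (\<integral>\<^sup>+z. ennreal (exp (\<theta> * (z $ i)^2)) \<partial>N) < \<infinity>"
proof -
 interpret prob_space N using N by (simp add: noise_law_def)
 have sN: "sets N = sets borel" using N by (simp add: noise_law_def)
 obtain c where c: "0 < c" "\<And>i y. (\<integral>\<^sup>+z. ennreal (exp (y * z $ i)) \<partial>N) \<le> ennreal (exp (c * y^2))"
  using noise_law_component_mgf[OF N] by blast
 have m: "(\<lambda>z. z $ i) \<in> borel_measurable N" for i by (subst measurable_cong_sets[OF sN refl]) simp
 show thesis by (rule that[of "1 / (16 * c)"]) (use sub_gaussian_square_exponential[OF m c(1) c(2)] c(1) in auto)
qed

lemma sum_if_const: "(\<Sum>a\<in>A. if P then g a else 0) = (if P then sum g A else 0)" by simp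

lemma outer_eq_sum: "outer z y = (\<Sum>i\<in>UNIV. \<Sum>j\<in>UNIV. (z $ i * y $ j) *\<^sub>R axis i (axis j (1::real)))"
 unfolding outer_def vec_eq_iff
 by (simp add: axis_def if_distrib[of "\<lambda>x. x $ _"] if_distrib[of "\<lambda>x. _ * x"] sum_if_const cong: if_cong)

text \<open>A Bochner integral of a non-integrable function has a default value. The equations for
  mean and covariance in \<open>noise_law\<close> therefore say something about components only
  after integrability is known; it is derived here from the exponential moment of the
  squares.\<close>

lemma noise_law_moments:
 fixes N :: "(real^'k) measure"
 assumes N: "noise_law N S"
 shows "integrable N (\<lambda>z. z $ i)" "integrable N (\<lambda>z. z $ i * z $ j)"
  "(\<integral>z. z $ i \<partial>N) = 0" "(\<integral>z. z $ i * z $ j \<partial>N) = S $ i $ j"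
proof -
 interpret prob_space N using N by (simp add: noise_law_def)
 have sN: "sets N = sets borel" using N by (simp add: noise_law_def)
 have m[measurable]: "(\<lambda>z. z $ i) \<in> borel_measurable N" for i by (subst measurable_cong_sets[OF sN refl]) simp
 obtain \<theta> where \<theta>: "0 < \<theta>" "\<And>i. (\<integral>\<^sup>+z. ennreal (exp (\<theta> * (z $ i)^2)) \<partial>N) < \<infinity>"
  using noise_law_component_square[OF N] by blast
 have iE: "integrable N (\<lambda>z. exp (\<theta> * (z $ i)^2))" for i using \<theta>(2) by (intro integrableI_nonneg) auto
 have sq: "integrable N (\<lambda>z. (z $ i)^2)" for i
 proof (rule Bochner_Integration.integrable_bound)
  show "integrable N (\<lambda>z. exp (\<theta> * (z $ i)^2) / \<theta>)" using iE by simp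
  show "AE z in N. norm ((z $ i)^2) \<le> norm (exp (\<theta> * (z $ i)^2) / \<theta>)"
  proof (rule AE_I2)
   fix z :: "real^'k"
   have "\<theta> * (z $ i)^2 \<le> exp (\<theta> * (z $ i)^2)" using exp_ge_add_one_self[of "\<theta> * (z $ i)^2"] by linarith
   then show "norm ((z $ i)^2) \<le> norm (exp (\<theta> * (z $ i)^2) / \<theta>)" using \<theta>(1) by (simp add: field_simps)
  qed
 qed simp
 have i1: "integrable N (\<lambda>z. z $ i)" for i by (rule square_integrable_imp_integrable[OF m sq])
 have i2: "integrable N (\<lambda>z. z $ i * z $ j)" for i j
 proof (rule Bochner_Integration.integrable_bound)
  show "integrable N (\<lambda>z. (z $ i)^2 + (z $ j)^2)" using sq by simp
  show "AE z in N. norm (z $ i * z $ j) \<le> norm ((z $ i)^2 + (z $ j)^2)"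
  proof (rule AE_I2)
   fix z :: "real^'k"
   have "2 * \<bar>z $ i\<bar> * \<bar>z $ j\<bar> \<le> (z $ i)^2 + (z $ j)^2" using sum_squares_bound[of "\<bar>z $ i\<bar>" "\<bar>z $ j\<bar>"] by simp
   moreover have "0 \<le> \<bar>z $ i\<bar> * \<bar>z $ j\<bar>" by simp
   ultimately have "\<bar>z $ i * z $ j\<bar> \<le> (z $ i)^2 + (z $ j)^2" unfolding abs_mult by linarith
   then show "norm (z $ i * z $ j) \<le> norm ((z $ i)^2 + (z $ j)^2)" by simp
  qed
 qed simp
 show "integrable N (\<lambda>z. z $ i)" by (rule i1)
 show "integrable N (\<lambda>z. z $ i * z $ j)" by (rule i2)
 have iz: "integrable N (\<lambda>z. z)"
 proof -
  have "integrable N (\<lambda>z::real^'k. \<Sum>i\<in>UNIV. z $ i *\<^sub>R axis i (1::real))" using i1 by (intro Bochner_Integration.integrable_sum integrable_scaleR_left) auto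
  moreover have "(\<lambda>z::real^'k. \<Sum>i\<in>UNIV. z $ i *\<^sub>R axis i (1::real)) = (\<lambda>z. z)"
   by (rule ext) (simp add: vec_eq_iff axis_def if_distrib cong: if_cong)
  ultimately show ?thesis by simp
 qed
 have "(\<integral>z. z $ i \<partial>N) = (\<integral>z. z \<partial>N) $ i" using integral_bounded_linear[OF bounded_linear_vec_nth iz] .
 then show "(\<integral>z. z $ i \<partial>N) = 0" using N by (simp add: noise_law_def)
 have io: "integrable N (\<lambda>z. outer z z)"
  unfolding outer_eq_sum using i2 by (intro Bochner_Integration.integrable_sum integrable_scaleR_left) auto
 have bl: "bounded_linear (\<lambda>A::real^'k^'k. A $ i $ j)"
  using bounded_linear_compose[OF bounded_linear_vec_nth bounded_linear_vec_nth] .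
 have "(\<integral>z. outer z z $ i $ j \<partial>N) = (\<integral>z. outer z z \<partial>N) $ i $ j" using integral_bounded_linear[OF bl io] .
 then show "(\<integral>z. z $ i * z $ j \<partial>N) = S $ i $ j" using N by (simp add: noise_law_def outer_def)
qed

text \<open>Products of sub-Gaussian variables are sub-exponential:
  \<open>\<bar>z $ i * z $ j\<bar>\<close> is at most the larger of the two squares, whose
  exponential moments are finite. Hence the bound holds near zero only; one range and one constant
  serve all pairs of coordinates.\<close>

lemma noise_law_covariance_mgf:
 fixes N :: "(real^'k) measure"
 assumes N: "noise_law N S"
 obtains y0 c where "0 < y0" "0 \<le> c"
  "\<And>i j y. \<bar>y\<bar> \<le> y0 \<Longrightarrow> (\<integral>\<^sup>+z. ennreal (exp (y * (z $ i * z $ j - S $ i $ j))) \<partial>N) \<le> ennreal (exp (c * y^2))"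
proof -
 interpret prob_space N using N by (simp add: noise_law_def)
 have sN: "sets N = sets borel" using N by (simp add: noise_law_def)
 have m[measurable]: "(\<lambda>z. z $ i) \<in> borel_measurable N" for i by (subst measurable_cong_sets[OF sN refl]) simp
 obtain \<theta> where \<theta>: "0 < \<theta>" "\<And>i. (\<integral>\<^sup>+z. ennreal (exp (\<theta> * (z $ i)^2)) \<partial>N) < \<infinity>"
  using noise_law_component_square[OF N] by blast
 define s0 where "s0 = \<theta> / 2"
 have s0: "s0 > 0" using \<theta> by (simp add: s0_def)
 have fin: "(\<integral>\<^sup>+z. ennreal (exp (2 * s0 * \<bar>z $ i * z $ j - S $ i $ j\<bar>)) \<partial>N) < \<infinity>" for i j
 proof -
  have "(\<integral>\<^sup>+z. ennreal (exp (2 * s0 * \<bar>z $ i * z $ j - S $ i $ j\<bar>)) \<partial>N)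
   \<le> (\<integral>\<^sup>+z. ennreal (exp (\<theta> * \<bar>S $ i $ j\<bar>)) * (ennreal (exp (\<theta> * (z $ i)^2)) + ennreal (exp (\<theta> * (z $ j)^2))) \<partial>N)"
  proof (rule nn_integral_mono)
   fix z :: "real^'k"
   let ?m = "max ((z $ i)^2) ((z $ j)^2)"
   have "2 * \<bar>z $ i\<bar> * \<bar>z $ j\<bar> \<le> (z $ i)^2 + (z $ j)^2" using sum_squares_bound[of "\<bar>z $ i\<bar>" "\<bar>z $ j\<bar>"] by simp
   then have "\<bar>z $ i * z $ j\<bar> \<le> ?m" by (simp add: abs_mult max_def split: if_splits)
   then have "\<bar>z $ i * z $ j - S $ i $ j\<bar> \<le> \<bar>S $ i $ j\<bar> + ?m" by linarith
   then have "2 * s0 * \<bar>z $ i * z $ j - S $ i $ j\<bar> \<le> \<theta> * \<bar>S $ i $ j\<bar> + \<theta> * ?m"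
    using \<theta>(1) by (simp add: s0_def mult_left_mono flip: distrib_left)
   then have "exp (2 * s0 * \<bar>z $ i * z $ j - S $ i $ j\<bar>) \<le> exp (\<theta> * \<bar>S $ i $ j\<bar>) * exp (\<theta> * ?m)"
    by (simp flip: exp_add)
   also have "\<dots> \<le> exp (\<theta> * \<bar>S $ i $ j\<bar>) * (exp (\<theta> * (z $ i)^2) + exp (\<theta> * (z $ j)^2))"
    by (intro mult_left_mono) (auto simp: max_def)
   finally show "ennreal (exp (2 * s0 * \<bar>z $ i * z $ j - S $ i $ j\<bar>))
    \<le> ennreal (exp (\<theta> * \<bar>S $ i $ j\<bar>)) * (ennreal (exp (\<theta> * (z $ i)^2)) + ennreal (exp (\<theta> * (z $ j)^2)))"
    by (simp add: ennreal_leI flip: ennreal_plus ennreal_mult)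
  qed
  also have "\<dots> = ennreal (exp (\<theta> * \<bar>S $ i $ j\<bar>)) * ((\<integral>\<^sup>+z. ennreal (exp (\<theta> * (z $ i)^2)) \<partial>N) + (\<integral>\<^sup>+z. ennreal (exp (\<theta> * (z $ j)^2)) \<partial>N))"
   by (subst nn_integral_cmult, measurable, subst nn_integral_add) auto
  also have "\<dots> < \<infinity>" using \<theta>(2)[of i] \<theta>(2)[of j] by (simp add: ennreal_mult_less_top)
  finally show ?thesis .
 qed
 define R where "R i j c \<longleftrightarrow> 0 \<le> c \<and> (\<forall>y. \<bar>y\<bar> \<le> s0 \<longrightarrow> (\<integral>\<^sup>+z. ennreal (exp (y * (z $ i * z $ j - S $ i $ j))) \<partial>N) \<le> ennreal (exp (c * y^2)))" for i j c
 have "\<exists>c. R i j c" for i j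
 proof -
  have mean: "(\<integral>z. z $ i * z $ j - S $ i $ j \<partial>N) = 0" using noise_law_moments(2,4)[OF N] by (simp add: prob_space)
  have meas: "(\<lambda>z. z $ i * z $ j - S $ i $ j) \<in> borel_measurable N" by measurable
  show ?thesis
  proof (rule centered_mgf_bound[OF meas s0 fin mean])
   fix c assume "0 \<le> c" "\<And>y. \<bar>y\<bar> \<le> s0 \<Longrightarrow> (\<integral>\<^sup>+z. ennreal (exp (y * (z $ i * z $ j - S $ i $ j))) \<partial>N) \<le> ennreal (exp (c * y^2))"
   then show "\<exists>c. R i j c" unfolding R_def by (intro exI[of _ c] conjI allI impI)
  qed
 qed
 then obtain c where cR: "\<And>i j. R i j (c i j)" by metis
 have c: "\<And>i j. c i j \<ge> 0" using cR by (simp add: R_def)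
 have c2: "\<And>i j y. \<bar>y\<bar> \<le> s0 \<Longrightarrow> (\<integral>\<^sup>+z. ennreal (exp (y * (z $ i * z $ j - S $ i $ j))) \<partial>N) \<le> ennreal (exp (c i j * y^2))"
  using cR unfolding R_def by blast
 define C where "C = (\<Sum>i\<in>UNIV. \<Sum>j\<in>UNIV. c i j)"
 have cC: "c i j \<le> C" for i j
 proof -
  have "c i j \<le> (\<Sum>j\<in>UNIV. c i j)" using c by (intro member_le_sum) auto
  also have "\<dots> \<le> C" unfolding C_def using c by (intro member_le_sum) (auto intro: sum_nonneg)
  finally show ?thesis .
 qed
 show thesis
 proof (rule that[OF s0, of C])
  show "0 \<le> C" unfolding C_def using c by (intro sum_nonneg) auto
  fix i j y assume y: "\<bar>y\<bar> \<le> s0"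
  have "exp (c i j * y^2) \<le> exp (C * y^2)" using cC by (simp add: mult_right_mono)
  then show "(\<integral>\<^sup>+z. ennreal (exp (y * (z $ i * z $ j - S $ i $ j))) \<partial>N) \<le> ennreal (exp (C * y^2))"
   using c2[OF y] by (meson ennreal_leI order.trans)
 qed
qed

section \<open>Independent noise sources\<close>

lemma generated_subset:
 assumes "\<And>i. i \<in> I \<Longrightarrow> X i \<in> borel_measurable M"
 shows "generated M I X \<subseteq> sets M"
 unfolding generated_def using assms by (intro sets.sigma_sets_subset) (auto intro: measurable_sets)

lemma generated_Pow: "generated M I X \<subseteq> Pow (space M)"
 unfolding generated_def by (rule subsetI) (auto dest: sigma_sets_into_sp[rotated])

lemma Int_stable_sigma_sets:
 assumes "A \<subseteq> Pow \<Omega>" shows "Int_stable (sigma_sets \<Omega> A)"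
proof -
 interpret sigma_algebra \<Omega> "sigma_sets \<Omega> A" by (rule sigma_algebra_sigma_sets[OF assms])
 show ?thesis by (auto simp: Int_stable_def)
qed

lemma Int_stable_generated: "Int_stable (generated M I X)" unfolding generated_def by (intro Int_stable_sigma_sets) auto

lemma generated_mono: "I \<subseteq> J \<Longrightarrow> generated M I X \<subseteq> generated M J X"
 unfolding generated_def by (intro sigma_sets_mono') blast

lemma vimage_in_generated: "i \<in> I \<Longrightarrow> B \<in> sets borel \<Longrightarrow> X i -` B \<inter> space M \<in> generated M I X"
 unfolding generated_def by (intro sigma_sets.Basic) blast

lemma measurable_if_generated:
 assumes "generated M I X \<subseteq> sets N" "space N = space M" "i \<in> I"
 shows "X i \<in> borel_measurable N" using assms by (intro measurableI) (auto dest: vimage_in_generated[of i I _ X M])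

lemma Int_stable_vimages: "Int_stable {f -` A \<inter> S | A. A \<in> sets N}"
proof (safe intro!: Int_stableI, goal_cases)
 case (1 _ _ A B) then show ?case by (intro exI[of _ "A \<inter> B"]) auto
qed

text \<open>Contains the source \<open>s\<close> before time \<open>t\<close> but the other sources
  for all times, their future included; this is legitimate because the sources are independent. A
  multiplier of the state noise at time \<open>t\<close> may thus involve exploration noise of the
  same time, and all shifts count as known from the start.\<close>

definition past_and_others ::
 "'a measure \<Rightarrow> ('s \<Rightarrow> 'a set set) \<Rightarrow> 's \<Rightarrow> (nat \<Rightarrow> 'a \<Rightarrow> 'b::topological_space) \<Rightarrow> nat \<Rightarrow> 'a measure" where
 "past_and_others M E s X t = sigma (space M) (generated M {..<t} X \<union> (\<Union>r\<in>UNIV - {s}. E r))"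

text \<open>Independence is combined in two stages: events of source \<open>s\<close> are
  independent of the other sources, and within the source \<open>X t\<close> is independent of its
  own past. Intersections of a past event with an event of the others form an intersection-stable
  generator, on which the two product rules can be multiplied.\<close>

lemma innovation_past_and_others:
 fixes X :: "nat \<Rightarrow> 'a \<Rightarrow> 'b::topological_space"
 assumes M: "prob_space M" and E: "prob_space.indep_sets M E UNIV"
  and st: "\<And>r. Int_stable (E r)"
  and X: "prob_space.indep_vars M (\<lambda>_. borel) X UNIV" and Es: "E s = generated M UNIV X"
 shows "innovation M (past_and_others M E s X) X"
proof -
 interpret prob_space M by fact
 have Xm: "X t \<in> borel_measurable M" for t using X by (auto simp: indep_vars_def)
 have Eev: "E r \<subseteq> events" for r using E by (auto simp: indep_sets_def)
 define Oth where "Oth = sigma_sets (space M) (\<Union>r\<in>UNIV - {s}. E r)"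
 have OEP: "(\<Union>r\<in>UNIV - {s}. E r) \<subseteq> Pow (space M)" using Eev sets.sets_into_space by blast
 have Oev: "Oth \<subseteq> events" unfolding Oth_def using Eev by (intro sets.sigma_sets_subset) auto
 have genP: "generated M {..<t} X \<union> (\<Union>r\<in>UNIV - {s}. E r) \<subseteq> Pow (space M)" for t
  using OEP generated_Pow[of M "{..<t}" X] by blast
 have sp: "space (past_and_others M E s X t) = space M" for t unfolding past_and_others_def by (rule space_measure_of[OF genP])
 have se: "sets (past_and_others M E s X t) = sigma_sets (space M) (generated M {..<t} X \<union> (\<Union>r\<in>UNIV - {s}. E r))" for t
  unfolding past_and_others_def by (rule sets_measure_of[OF genP])
 have gev: "generated M {..<t} X \<subseteq> events" for t by (rule generated_subset) (rule Xm)
 have sub: "sets (past_and_others M E s X t) \<subseteq> events" for t unfolding se using gev Eev by (intro sets.sigma_sets_subset) auto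
 have mono: "sets (past_and_others M E s X t) \<subseteq> sets (past_and_others M E s X t')" if "t \<le> t'" for t t'
  unfolding se using generated_mono[of "{..<t}" "{..<t'}" M X] that by (intro sigma_sets_mono') auto
 have past: "X i \<in> borel_measurable (past_and_others M E s X t)" if "i < t" for i t
  by (rule measurable_if_generated[where I="{..<t}" and M=M]) (use that sp in \<open>auto simp: se intro: sigma_sets.Basic\<close>)
 have ind: "indep_set (sets (past_and_others M E s X t)) {X t -` B \<inter> space M | B. B \<in> sets borel}" for t
 proof -
  let ?A = "{X t -` B \<inter> space M | B. B \<in> sets borel}"
  let ?P = "{b \<inter> c | b c. b \<in> generated M {..<t} X \<and> c \<in> Oth}"
  have 1: "indep_sets (\<lambda>j. sigma_sets (space M) (\<Union>i\<in>case_bool {s} (UNIV - {s}) j. E i)) UNIV"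
   using E st by (intro indep_sets_collect_sigma) (auto simp: disjoint_family_on_def UNIV_bool split: bool.split)
  have 1: "prob (a \<inter> c) = prob a * prob c" if "a \<in> E s" "c \<in> Oth" for a c
   using indep_setsD[OF 1, of UNIV "case_bool a c"] that by (auto simp: UNIV_bool Oth_def ac_simps intro: sigma_sets.Basic)
  have 2: "indep_sets (\<lambda>j. sigma_sets (space M) (\<Union>i\<in>case_bool {t} {..<t} j. {X i -` A \<inter> space M | A. A \<in> sets borel})) UNIV"
  proof (rule indep_sets_collect_sigma)
   have "indep_sets (\<lambda>i. {X i -` A \<inter> space M | A. A \<in> sets borel}) UNIV" using X unfolding indep_vars_def2 by auto
   then show "indep_sets (\<lambda>i. {X i -` A \<inter> space M | A. A \<in> sets borel}) (\<Union>j. case_bool {t} {..<t} j)"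
    by (rule indep_sets_mono_index[rotated]) simp
   show "disjoint_family_on (case_bool {t} {..<t}) UNIV" by (auto simp: disjoint_family_on_def split: bool.split)
  qed (rule Int_stable_vimages)
  have gU: "generated M {..<t} X = sigma_sets (space M) (\<Union>i\<in>{..<t}. {X i -` A \<inter> space M | A. A \<in> sets borel})"
   unfolding generated_def by (rule arg_cong2[where f=sigma_sets]) auto
  have 2: "prob (a \<inter> b) = prob a * prob b" if "a \<in> ?A" "b \<in> generated M {..<t} X" for a b
   using indep_setsD[OF 2, of UNIV "case_bool a b"] that by (auto simp: UNIV_bool gU ac_simps intro!: sigma_sets.Basic)
  have AE: "?A \<subseteq> E s" unfolding Es by (auto intro: vimage_in_generated)
  have gE: "generated M {..<t} X \<subseteq> E s" unfolding Es by (rule generated_mono) simp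
  have stE: "a \<inter> b \<in> E s" if "a \<in> E s" "b \<in> E s" for a b using st[of s] that by (auto simp: Int_stable_def)
  have "indep_set ?P ?A" unfolding indep_sets2_eq
  proof (intro conjI ballI)
   show "?P \<subseteq> events" using gev Oev by auto
   show "?A \<subseteq> events" using Xm by (auto intro: measurable_sets)
   fix p a assume "p \<in> ?P" and a: "a \<in> ?A"
   then obtain b c where bc: "p = b \<inter> c" "b \<in> generated M {..<t} X" "c \<in> Oth" by blast
   have "prob (p \<inter> a) = prob ((a \<inter> b) \<inter> c)" by (simp add: bc ac_simps)
   also have "\<dots> = prob (a \<inter> b) * prob c" using a bc AE gE by (intro 1 stE) auto
   also have "\<dots> = prob a * (prob b * prob c)" using 2[OF a bc(2)] by simp
   also have "prob b * prob c = prob p" unfolding bc using bc gE by (intro 1[symmetric]) auto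
   finally show "prob (p \<inter> a) = prob p * prob a" by simp
  qed
  then have I: "indep_set (sigma_sets (space M) ?P) (sigma_sets (space M) ?A)"
  proof (rule indep_set_sigma_sets)
   show "Int_stable ?P"
   proof (safe intro!: Int_stableI, goal_cases)
    case (1 _ _ b1 b2 c1 c2)
    have "b1 \<inter> b2 \<in> generated M {..<t} X" using Int_stable_generated[of M "{..<t}" X] 1 by (auto simp: Int_stable_def)
    moreover have "c1 \<inter> c2 \<in> Oth" using Int_stable_sigma_sets[OF OEP] 1 by (auto simp: Int_stable_def Oth_def)
    ultimately show ?case by (intro exI[of _ "b1 \<inter> b2"] exI[of _ "c1 \<inter> c2"]) auto
   qed
  qed (rule Int_stable_vimages)
  have top: "space M \<in> Oth" "space M \<in> generated M {..<t} X" by (auto simp: Oth_def generated_def sigma_sets_top)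
  have "generated M {..<t} X \<union> (\<Union>r\<in>UNIV - {s}. E r) \<subseteq> ?P"
  proof (intro Un_least subsetI)
   fix b assume b: "b \<in> generated M {..<t} X"
   then have "b = b \<inter> space M" using generated_Pow[of M "{..<t}" X] by auto
   then show "b \<in> ?P" using b top by blast
  next
   fix c assume c: "c \<in> (\<Union>r\<in>UNIV - {s}. E r)"
   then have "c \<in> Oth" unfolding Oth_def by (rule sigma_sets.Basic)
   moreover have "c = space M \<inter> c" using c OEP by auto
   ultimately show "c \<in> ?P" using top by blast
  qed
  then have "sets (past_and_others M E s X t) \<subseteq> sigma_sets (space M) ?P" unfolding se by (rule sigma_sets_mono')
  then show ?thesis by (rule indep_set_mono[OF I]) (rule sigma_sets_superset_generator)
 qed
 show ?thesis unfolding innovation_def subalgebra_def using sp sub mono past Xm ind by blast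
qed

lemma past_and_others_space:
 assumes "\<And>r. E r \<subseteq> Pow (space M)"
 shows "space (past_and_others M E s X t) = space M"
  "sets (past_and_others M E s X t) = sigma_sets (space M) (generated M {..<t} X \<union> (\<Union>r\<in>UNIV - {s}. E r))"
proof -
 have "generated M {..<t} X \<union> (\<Union>r\<in>UNIV - {s}. E r) \<subseteq> Pow (space M)"
  using assms generated_Pow[of M "{..<t}" X] by blast
 then show "space (past_and_others M E s X t) = space M"
  "sets (past_and_others M E s X t) = sigma_sets (space M) (generated M {..<t} X \<union> (\<Union>r\<in>UNIV - {s}. E r))"
  unfolding past_and_others_def by auto
qed

lemma innovation_indep_var:
 fixes \<xi> \<epsilon> :: "_ \<Rightarrow> real"
 assumes M: "prob_space M" and sub: "subalgebra M N" and \<xi>: "\<xi> \<in> borel_measurable N" and \<epsilon>: "\<epsilon> \<in> borel_measurable M"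
  and ind: "prob_space.indep_set M (sets N) {\<epsilon> -` B \<inter> space M | B. B \<in> sets borel}"
 shows "prob_space.indep_var M borel \<xi> borel \<epsilon>"
proof -
 interpret prob_space M by fact
 have spN: "space N = space M" using sub by (simp add: subalgebra_def)
 have *: "{\<xi> -` A \<inter> space M |A. A \<in> sets borel} \<subseteq> sets N" using measurable_sets[OF \<xi>] spN by auto
 have "indep_set {\<xi> -` A \<inter> space M |A. A \<in> sets borel} {\<epsilon> -` A \<inter> space M |A. A \<in> sets borel}"
  using ind * by (rule indep_set_mono) simp
 then have "indep_set (sigma_sets (space M) {\<xi> -` A \<inter> space M |A. A \<in> sets borel}) (sigma_sets (space M) {\<epsilon> -` A \<inter> space M |A. A \<in> sets borel})"
  by (rule indep_set_sigma_sets) (rule Int_stable_vimages)+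
 then show ?thesis unfolding indep_var_eq using \<epsilon> measurable_from_subalg[OF sub \<xi>] by blast
qed

text \<open>With a single source, indexed by \<open>unit\<close>, there are no others, and
  \<open>past_and_others\<close> is the natural filtration.\<close>

lemma iid_noise_innovation:
 assumes M: "prob_space M" and w: "iid_noise M w S"
 obtains \<G> where "innovation M \<G> w"
proof -
 interpret prob_space M by fact
 have i: "indep_vars (\<lambda>_. borel) w UNIV" using w by (simp add: iid_noise_def)
 have wm: "w t \<in> borel_measurable M" for t using i by (auto simp: indep_vars_def)
 have "innovation M (past_and_others M (\<lambda>_::unit. generated M UNIV w) () w) w"
 proof (rule innovation_past_and_others[OF M _ _ i])
  have "generated M UNIV w \<subseteq> events" by (rule generated_subset) (rule wm)
  then show "indep_sets (\<lambda>_::unit. generated M UNIV w) UNIV" by (intro indep_setsI) (auto simp: UNIV_unit subset_singleton_iff)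
 qed (auto intro: Int_stable_generated)
 then show thesis by (rule that)
qed

section \<open>Costs of affine systems\<close>

definition square_integrable :: "'a measure \<Rightarrow> ('a \<Rightarrow> real) \<Rightarrow> bool" where
 "square_integrable M f \<longleftrightarrow> f \<in> borel_measurable M \<and> integrable M (\<lambda>\<xi>. (f \<xi>)^2)"

lemma square_integrable_mult:
 assumes "square_integrable M f" "square_integrable M g"
 shows "integrable M (\<lambda>\<xi>. f \<xi> * g \<xi>)"
proof (rule Bochner_Integration.integrable_bound)
 show "integrable M (\<lambda>\<xi>. (f \<xi>)^2 + (g \<xi>)^2)" "(\<lambda>\<xi>. f \<xi> * g \<xi>) \<in> borel_measurable M"
  using assms by (auto simp: square_integrable_def)
 show "AE \<xi> in M. norm (f \<xi> * g \<xi>) \<le> norm ((f \<xi>)^2 + (g \<xi>)^2)"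
 proof (rule AE_I2)
  fix \<xi>
  have "2 * \<bar>f \<xi>\<bar> * \<bar>g \<xi>\<bar> \<le> (f \<xi>)^2 + (g \<xi>)^2" using sum_squares_bound[of "\<bar>f \<xi>\<bar>" "\<bar>g \<xi>\<bar>"] by simp
  moreover have "0 \<le> \<bar>f \<xi>\<bar> * \<bar>g \<xi>\<bar>" by simp
  ultimately have "\<bar>f \<xi> * g \<xi>\<bar> \<le> (f \<xi>)^2 + (g \<xi>)^2" unfolding abs_mult by linarith
  then show "norm (f \<xi> * g \<xi>) \<le> norm ((f \<xi>)^2 + (g \<xi>)^2)" by simp
 qed
qed

lemma square_integrable_add:
 assumes "square_integrable M f" "square_integrable M g"
 shows "square_integrable M (\<lambda>\<xi>. f \<xi> + g \<xi>)" using assms square_integrable_mult[OF assms]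
 by (auto simp: square_integrable_def power2_sum mult.assoc)

lemma square_integrable_cmult:
 "square_integrable M f \<Longrightarrow> square_integrable M (\<lambda>\<xi>. c * f \<xi>)"
 by (auto simp: square_integrable_def power_mult_distrib)

lemma (in prob_space) square_integrable_const: "square_integrable M (\<lambda>_. c)" by (auto simp: square_integrable_def)

lemma (in prob_space) square_integrable_sum:
 "(\<And>i. i \<in> I \<Longrightarrow> square_integrable M (f i)) \<Longrightarrow> square_integrable M (\<lambda>\<xi>. \<Sum>i\<in>I. f i \<xi>)"
 by (induction I rule: infinite_finite_induct) (auto simp: square_integrable_const intro!: square_integrable_add)

lemma (in prob_space) square_integrable_integrable: "square_integrable M f \<Longrightarrow> integrable M f"
 by (auto simp: square_integrable_def intro: square_integrable_imp_integrable)

text \<open>Common form of the closed loop of the game under a fixed profile and of the perceived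
  system of a true model without exploration.\<close>

primrec affine_path :: "real^'n \<Rightarrow> real^'n^'n \<Rightarrow> real^'n \<Rightarrow> (nat \<Rightarrow> real^'n) \<Rightarrow> nat \<Rightarrow> real^'n" where
 "affine_path c A x w 0 = x"
| "affine_path c A x w (Suc t) = c + A *v affine_path c A x w t + w t"

context
 fixes M :: "'a measure" and w :: "nat \<Rightarrow> 'a \<Rightarrow> real^'n::finite" and S :: "real^'n^'n"
  and c x :: "real^'n" and A :: "real^'n^'n"
 assumes M: "prob_space M" and w: "iid_noise M w S"
begin

interpretation prob_space M by (rule M)

abbreviation (input) "affX \<equiv> \<lambda>t \<xi>. affine_path c A x (\<lambda>s. w s \<xi>) t"

lemma noise_measurable: "w t \<in> borel_measurable M" using w by (auto simp: iid_noise_def indep_vars_def)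

lemma noise_transfer:
 obtains N where "noise_law N S" "\<And>t (f :: real^'n \<Rightarrow> real). f \<in> borel_measurable borel \<Longrightarrow> integrable M (\<lambda>\<xi>. f (w t \<xi>)) = integrable N f"
  "\<And>t (f :: real^'n \<Rightarrow> real). f \<in> borel_measurable borel \<Longrightarrow> (\<integral>\<xi>. f (w t \<xi>) \<partial>M) = (\<integral>z. f z \<partial>N)"
  "\<And>t (f :: real^'n \<Rightarrow> ennreal). f \<in> borel_measurable borel \<Longrightarrow> (\<integral>\<^sup>+\<xi>. f (w t \<xi>) \<partial>M) = (\<integral>\<^sup>+z. f z \<partial>N)"
proof -
 obtain N where N: "noise_law N S" "\<And>t. distr M borel (w t) = N" using w by (auto simp: iid_noise_def)
 show thesis
 proof (rule that[OF N(1)])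
  fix t and f :: "real^'n \<Rightarrow> real" assume f: "f \<in> borel_measurable borel"
  show "integrable M (\<lambda>\<xi>. f (w t \<xi>)) = integrable N f"
   unfolding N(2)[of t, symmetric] by (rule integrable_distr_eq[OF noise_measurable f, symmetric])
  show "(\<integral>\<xi>. f (w t \<xi>) \<partial>M) = (\<integral>z. f z \<partial>N)"
   unfolding N(2)[of t, symmetric] by (rule integral_distr[OF noise_measurable f, symmetric])
 next
  fix t and f :: "real^'n \<Rightarrow> ennreal" assume f: "f \<in> borel_measurable borel"
  show "(\<integral>\<^sup>+\<xi>. f (w t \<xi>) \<partial>M) = (\<integral>\<^sup>+z. f z \<partial>N)"
   unfolding N(2)[of t, symmetric] using f by (subst nn_integral_distr[OF noise_measurable]) auto
 qed
qed

lemma noise_square_integrable: "square_integrable M (\<lambda>\<xi>. y \<bullet> w t \<xi>)"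
 and noise_mean: "(\<integral>\<xi>. y \<bullet> w t \<xi> \<partial>M) = 0"
 and noise_covariance: "(\<integral>\<xi>. (y \<bullet> w t \<xi>) * (y' \<bullet> w t \<xi>) \<partial>M) = y \<bullet> (S *v y')"
proof -
 obtain N where N: "noise_law N S" "\<And>t (f :: real^'n \<Rightarrow> real). f \<in> borel_measurable borel \<Longrightarrow> integrable M (\<lambda>\<xi>. f (w t \<xi>)) = integrable N f"
  "\<And>t (f :: real^'n \<Rightarrow> real). f \<in> borel_measurable borel \<Longrightarrow> (\<integral>\<xi>. f (w t \<xi>) \<partial>M) = (\<integral>z. f z \<partial>N)"
  using noise_transfer by metis
 note m = noise_law_moments[OF N(1)]
 have sc: "square_integrable M (\<lambda>\<xi>. w t \<xi> $ i)" for t i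
  using N(2)[of "\<lambda>z. (z $ i)^2" t] m(2)[of i i] measurable_compose[OF noise_measurable[of t], of "\<lambda>z. z $ i" borel] by (auto simp: square_integrable_def power2_eq_square)
 have mc: "(\<integral>\<xi>. w t \<xi> $ i \<partial>M) = 0" for t i using N(3)[of "\<lambda>z. z $ i" t] m(3)[of i] by simp
 have cc: "(\<integral>\<xi>. w t \<xi> $ i * w t \<xi> $ j \<partial>M) = S $ i $ j" for t i j
  using N(3)[of "\<lambda>z. z $ i * z $ j" t] m(4)[of i j] by simp
 show "square_integrable M (\<lambda>\<xi>. y \<bullet> w t \<xi>)"
  unfolding inner_vec_def inner_real_def by (intro square_integrable_sum square_integrable_cmult sc)
 show "(\<integral>\<xi>. y \<bullet> w t \<xi> \<partial>M) = 0"
  unfolding inner_vec_def inner_real_def using sc by (subst Bochner_Integration.integral_sum) (auto simp: mc square_integrable_integrable)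
 have "(\<integral>\<xi>. (y \<bullet> w t \<xi>) * (y' \<bullet> w t \<xi>) \<partial>M) = (\<integral>\<xi>. (\<Sum>i\<in>UNIV. \<Sum>j\<in>UNIV. (y $ i * y' $ j) * (w t \<xi> $ i * w t \<xi> $ j)) \<partial>M)"
  by (simp add: inner_vec_def sum_product mult_ac)
 also have "\<dots> = (\<Sum>i\<in>UNIV. \<Sum>j\<in>UNIV. (y $ i * y' $ j) * S $ i $ j)"
 proof -
  have i: "integrable M (\<lambda>\<xi>. (y $ i * y' $ j) * (w t \<xi> $ i * w t \<xi> $ j))" for i j
   using square_integrable_mult[OF sc[of t i] sc[of t j]] by simp
  show ?thesis using i by (simp add: Bochner_Integration.integral_sum Bochner_Integration.integrable_sum cc)
 qed
 also have "\<dots> = y \<bullet> (S *v y')" by (simp add: inner_vec_def matrix_vector_mult_def sum_distrib_left mult_ac)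
 finally show "(\<integral>\<xi>. (y \<bullet> w t \<xi>) * (y' \<bullet> w t \<xi>) \<partial>M) = y \<bullet> (S *v y')" .
qed

lemma inner_affine_path_Suc: "y \<bullet> affX (Suc t) \<xi> = y \<bullet> c + (y v* A) \<bullet> affX t \<xi> + y \<bullet> w t \<xi>"
 by (simp add: inner_add_right dot_lmul_matrix)

lemma affine_path_square_integrable: "square_integrable M (\<lambda>\<xi>. y \<bullet> affX t \<xi>)"
proof (induction t arbitrary: y)
 case 0 show ?case by (simp add: square_integrable_const)
next
 case (Suc t)
 show ?case unfolding inner_affine_path_Suc by (intro square_integrable_add square_integrable_const Suc noise_square_integrable)
qed

lemma affine_path_noise_uncorrelated: "(\<integral>\<xi>. (y \<bullet> affX t \<xi>) * (y' \<bullet> w t \<xi>) \<partial>M) = 0"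
proof -
 obtain \<G> where \<G>: "innovation M \<G> w" using iid_noise_innovation[OF M w] .
 have spG: "space (\<G> t) = space M" for t using \<G> by (auto simp: innovation_def subalgebra_def)
 have Xm: "affX s \<in> borel_measurable (\<G> t)" if "s \<le> t" for s t using that
 proof (induction s)
  case 0 then show ?case by simp
 next
  case (Suc s)
  then have "w s \<in> borel_measurable (\<G> t)" "affX s \<in> borel_measurable (\<G> t)" using \<G> by (auto simp: innovation_def)
  moreover have "(\<lambda>z. A *v z) \<in> borel_measurable borel"
   by (intro borel_measurable_continuous_onI matrix_vector_mult_linear_continuous_on)
  ultimately show ?case by (auto intro!: borel_measurable_add measurable_compose[where g="\<lambda>z. A *v z"])
 qed
 have "innovation M \<G> (\<lambda>t \<xi>. y' \<bullet> w t \<xi>)" by (rule innovation_compose[OF M \<G>]) simp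
 then have "indep_var borel (\<lambda>\<xi>. y \<bullet> affX t \<xi>) borel (\<lambda>\<xi>. y' \<bullet> w t \<xi>)"
  using Xm[of t t] by (intro innovation_indep_var[OF M, of "\<G> t"]) (auto simp: innovation_def)
 from indep_var_lebesgue_integral[OF this] show ?thesis
  using affine_path_square_integrable noise_square_integrable by (simp add: square_integrable_integrable noise_mean)
qed

lemma affine_path_mean_Suc:
 "(\<integral>\<xi>. y \<bullet> affX (Suc t) \<xi> \<partial>M) = y \<bullet> c + (\<integral>\<xi>. (y v* A) \<bullet> affX t \<xi> \<partial>M)"
 unfolding inner_affine_path_Suc using affine_path_square_integrable[of "y v* A" t] noise_square_integrable[of y t]
 by (simp add: square_integrable_integrable noise_mean prob_space)

lemma affine_path_second_moment_Suc:
 "(\<integral>\<xi>. (y \<bullet> affX (Suc t) \<xi>) * (y' \<bullet> affX (Suc t) \<xi>) \<partial>M) =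
   (y \<bullet> c) * (y' \<bullet> c) + (y \<bullet> c) * (\<integral>\<xi>. (y' v* A) \<bullet> affX t \<xi> \<partial>M) + (y' \<bullet> c) * (\<integral>\<xi>. (y v* A) \<bullet> affX t \<xi> \<partial>M)
   + (\<integral>\<xi>. ((y v* A) \<bullet> affX t \<xi>) * ((y' v* A) \<bullet> affX t \<xi>) \<partial>M) + y \<bullet> (S *v y')"
proof -
 let ?a = "\<lambda>\<xi>. (y v* A) \<bullet> affX t \<xi>" and ?a' = "\<lambda>\<xi>. (y' v* A) \<bullet> affX t \<xi>"
 let ?n = "\<lambda>\<xi>. y \<bullet> w t \<xi>" and ?n' = "\<lambda>\<xi>. y' \<bullet> w t \<xi>"
 note q = affine_path_square_integrable noise_square_integrable
 have i: "integrable M ?a" "integrable M ?a'" "integrable M ?n" "integrable M ?n'" using q by (auto intro: square_integrable_integrable)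
 have i2: "integrable M (\<lambda>\<xi>. ?a \<xi> * ?a' \<xi>)" "integrable M (\<lambda>\<xi>. ?a \<xi> * ?n' \<xi>)"
  "integrable M (\<lambda>\<xi>. ?a' \<xi> * ?n \<xi>)" "integrable M (\<lambda>\<xi>. ?n \<xi> * ?n' \<xi>)"
  using q by (auto intro: square_integrable_mult)
 have "(\<integral>\<xi>. (y \<bullet> affX (Suc t) \<xi>) * (y' \<bullet> affX (Suc t) \<xi>) \<partial>M) =
  (\<integral>\<xi>. (y \<bullet> c) * (y' \<bullet> c) + (y \<bullet> c) * ?a' \<xi> + (y' \<bullet> c) * ?a \<xi> + ?a \<xi> * ?a' \<xi>
    + (y \<bullet> c) * ?n' \<xi> + (y' \<bullet> c) * ?n \<xi> + ?a \<xi> * ?n' \<xi> + ?a' \<xi> * ?n \<xi> + ?n \<xi> * ?n' \<xi> \<partial>M)"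
  unfolding inner_affine_path_Suc by (simp add: algebra_simps)
 also have "\<dots> = (y \<bullet> c) * (y' \<bullet> c) + (y \<bullet> c) * (\<integral>\<xi>. ?a' \<xi> \<partial>M) + (y' \<bullet> c) * (\<integral>\<xi>. ?a \<xi> \<partial>M)
   + (\<integral>\<xi>. ?a \<xi> * ?a' \<xi> \<partial>M) + (y \<bullet> c) * (\<integral>\<xi>. ?n' \<xi> \<partial>M) + (y' \<bullet> c) * (\<integral>\<xi>. ?n \<xi> \<partial>M)
   + (\<integral>\<xi>. ?a \<xi> * ?n' \<xi> \<partial>M) + (\<integral>\<xi>. ?a' \<xi> * ?n \<xi> \<partial>M) + (\<integral>\<xi>. ?n \<xi> * ?n' \<xi> \<partial>M)"
  using i i2 by (simp add: prob_space)
 finally show ?thesis by (simp add: noise_mean noise_covariance affine_path_noise_uncorrelated)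
qed

end

text \<open>Means and second moments obey a recursion in which the noise occurs only through
  \<open>S\<close>. The directions \<open>y\<close> and \<open>y'\<close> stay arbitrary because a
  step replaces them by \<open>y v* A\<close> and \<open>y' v* A\<close>. The two probability spaces
  may differ: one carries the actual game, the other is the product space of a perceived
  model.\<close>

lemma affine_path_moments_determined:
 fixes M :: "'a measure" and w :: "nat \<Rightarrow> 'a \<Rightarrow> real^'n::finite" and M' :: "'b measure" and w' :: "nat \<Rightarrow> 'b \<Rightarrow> real^'n"
 assumes "prob_space M" "iid_noise M w S" "prob_space M'" "iid_noise M' w' S"
 shows "(\<integral>\<xi>. y \<bullet> affine_path c A x (\<lambda>s. w s \<xi>) t \<partial>M) = (\<integral>\<xi>. y \<bullet> affine_path c A x (\<lambda>s. w' s \<xi>) t \<partial>M')"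
  and "(\<integral>\<xi>. (y \<bullet> affine_path c A x (\<lambda>s. w s \<xi>) t) * (y' \<bullet> affine_path c A x (\<lambda>s. w s \<xi>) t) \<partial>M)
    = (\<integral>\<xi>. (y \<bullet> affine_path c A x (\<lambda>s. w' s \<xi>) t) * (y' \<bullet> affine_path c A x (\<lambda>s. w' s \<xi>) t) \<partial>M')"
proof (induction t arbitrary: y y')
 case 0
 interpret M: prob_space M by fact
 interpret M': prob_space M' by fact
 case 1 show ?case by (simp add: M.prob_space M'.prob_space)
 case 2 show ?case by (simp add: M.prob_space M'.prob_space)
next
 case (Suc t)
 case 1 show ?case by (simp only: affine_path_mean_Suc[OF assms(1,2)] affine_path_mean_Suc[OF assms(3,4)] Suc.IH(1))
 case 2 show ?case by (simp only: affine_path_second_moment_Suc[OF assms(1,2)] affine_path_second_moment_Suc[OF assms(3,4)] Suc.IH)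
qed

definition quadratic :: "(real^'n::finite \<Rightarrow> real) \<Rightarrow> bool" where
 "quadratic q \<longleftrightarrow> (\<exists>k b P. \<forall>x. q x = k + b \<bullet> x + x \<bullet> (P *v x))"

lemma quadratic_add:
 assumes "quadratic p" "quadratic q" shows "quadratic (\<lambda>x. p x + q x)"
proof -
 obtain k b P k' b' P' where "\<forall>x. p x = k + b \<bullet> x + x \<bullet> (P *v x)" "\<forall>x. q x = k' + b' \<bullet> x + x \<bullet> (P' *v x)"
  using assms unfolding quadratic_def by metis
 then have "\<forall>x. p x + q x = (k + k') + (b + b') \<bullet> x + x \<bullet> ((P + P') *v x)"
  by (simp add: inner_add_left inner_add_right matrix_vector_mult_add_rdistrib)
 then show ?thesis unfolding quadratic_def by blast
qed

lemma quadratic_inner_affine: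
 fixes A B :: "real^'n::finite^'m::finite"
 shows "quadratic (\<lambda>x. (a + A *v x) \<bullet> (b + B *v x))"
proof -
 have "\<forall>x. (a + A *v x) \<bullet> (b + B *v x) = a \<bullet> b + ((b v* A) + (a v* B)) \<bullet> x + x \<bullet> ((transpose A ** B) *v x)"
  by (simp add: inner_add_left inner_add_right dot_lmul_matrix matrix_vector_mul_assoc[symmetric] inner_commute)
   (metis dot_lmul_matrix inner_commute vector_transpose_matrix)
 then show ?thesis unfolding quadratic_def by blast
qed

lemma quadratic_expectation_determined:
 fixes M :: "'a measure" and w :: "nat \<Rightarrow> 'a \<Rightarrow> real^'n::finite" and M' :: "'b measure" and w' :: "nat \<Rightarrow> 'b \<Rightarrow> real^'n"
 assumes M: "prob_space M" "iid_noise M w S" and M': "prob_space M'" "iid_noise M' w' S" and q: "quadratic q"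
 shows "integrable M (\<lambda>\<xi>. q (affine_path c A x (\<lambda>s. w s \<xi>) t))"
  and "(\<integral>\<xi>. q (affine_path c A x (\<lambda>s. w s \<xi>) t) \<partial>M) = (\<integral>\<xi>. q (affine_path c A x (\<lambda>s. w' s \<xi>) t) \<partial>M')"
proof -
 obtain k b P where "\<forall>x. q x = k + b \<bullet> x + x \<bullet> (P *v x)" using q unfolding quadratic_def by metis
 then have qe: "q x = k + b \<bullet> x + (\<Sum>i\<in>UNIV. (axis i 1 \<bullet> x) * (P $ i \<bullet> x))" for x
  by (simp add: inner_vec_def[of x] matrix_vector_mul_component inner_axis')
 interpret M: prob_space M by fact
 interpret M': prob_space M' by fact
 have i: "integrable M (\<lambda>\<xi>. y \<bullet> affine_path c A x (\<lambda>s. w s \<xi>) t)"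
  "integrable M (\<lambda>\<xi>. (y \<bullet> affine_path c A x (\<lambda>s. w s \<xi>) t) * (y' \<bullet> affine_path c A x (\<lambda>s. w s \<xi>) t))" for y y'
  using affine_path_square_integrable[OF M] by (auto intro: M.square_integrable_integrable square_integrable_mult)
 have i': "integrable M' (\<lambda>\<xi>. y \<bullet> affine_path c A x (\<lambda>s. w' s \<xi>) t)"
  "integrable M' (\<lambda>\<xi>. (y \<bullet> affine_path c A x (\<lambda>s. w' s \<xi>) t) * (y' \<bullet> affine_path c A x (\<lambda>s. w' s \<xi>) t))" for y y'
  using affine_path_square_integrable[OF M'] by (auto intro: M'.square_integrable_integrable square_integrable_mult)
 show "integrable M (\<lambda>\<xi>. q (affine_path c A x (\<lambda>s. w s \<xi>) t))" unfolding qe using i by simp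
 have "(\<integral>\<xi>. q (affine_path c A x (\<lambda>s. w s \<xi>) t) \<partial>M) = k + (\<integral>\<xi>. b \<bullet> affine_path c A x (\<lambda>s. w s \<xi>) t \<partial>M)
   + (\<Sum>i\<in>UNIV. \<integral>\<xi>. (axis i 1 \<bullet> affine_path c A x (\<lambda>s. w s \<xi>) t) * (P $ i \<bullet> affine_path c A x (\<lambda>s. w s \<xi>) t) \<partial>M)"
  unfolding qe using i by (simp add: M.prob_space)
 also have "\<dots> = k + (\<integral>\<xi>. b \<bullet> affine_path c A x (\<lambda>s. w' s \<xi>) t \<partial>M')
   + (\<Sum>i\<in>UNIV. \<integral>\<xi>. (axis i 1 \<bullet> affine_path c A x (\<lambda>s. w' s \<xi>) t) * (P $ i \<bullet> affine_path c A x (\<lambda>s. w' s \<xi>) t) \<partial>M')"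
  by (simp only: affine_path_moments_determined[OF M M'])
 also have "\<dots> = (\<integral>\<xi>. q (affine_path c A x (\<lambda>s. w' s \<xi>) t) \<partial>M')"
  unfolding qe using i' by (simp add: M'.prob_space)
 finally show "(\<integral>\<xi>. q (affine_path c A x (\<lambda>s. w s \<xi>) t) \<partial>M) = (\<integral>\<xi>. q (affine_path c A x (\<lambda>s. w' s \<xi>) t) \<partial>M')" .
qed

section \<open>Spectral norm and the uniform contraction factor\<close>

lemma norm_matrix_vector_le: "norm (A *v x) \<le> spec_norm A * norm (x :: real^'b::finite)"
 for A :: "real^'b^'a::finite" unfolding spec_norm_def by (rule onorm) (rule matrix_vector_mul_bounded_linear)

lemma spec_norm_nonneg [simp]: "0 \<le> spec_norm (A :: real^'b::finite^'a::finite)"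
 unfolding spec_norm_def by (rule onorm_pos_le) (rule matrix_vector_mul_bounded_linear)

lemma spec_norm_least:
 fixes A :: "real^'b::finite^'a::finite"
 assumes "\<And>x. norm (A *v x) \<le> b * norm x" "0 \<le> b" shows "spec_norm A \<le> b"
 unfolding spec_norm_def using assms by (intro onorm_bound) auto

lemma spec_norm_zero [simp]: "spec_norm (0 :: real^'b::finite^'a::finite) = 0" by (rule antisym) (auto intro: spec_norm_least)

lemma spec_norm_add: "spec_norm (A + B) \<le> spec_norm A + spec_norm (B :: real^'b::finite^'a::finite)"
proof (rule spec_norm_least)
 fix x
 have "norm ((A + B) *v x) \<le> norm (A *v x) + norm (B *v x)" by (simp add: matrix_vector_mult_add_rdistrib norm_triangle_ineq)
 also have "\<dots> \<le> spec_norm A * norm x + spec_norm B * norm x" by (intro add_mono norm_matrix_vector_le)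
 finally show "norm ((A + B) *v x) \<le> (spec_norm A + spec_norm B) * norm x" by (simp add: algebra_simps)
qed simp

lemma spec_norm_minus [simp]: "spec_norm (- A) = spec_norm (A :: real^'b::finite^'a::finite)"
proof -
 have "(- A) *v x = - (A *v x)" for x using matrix_vector_mult_diff_rdistrib[of 0 A x] by simp
 then have "norm \<circ> (*v) (- A) = norm \<circ> (*v) A" by (auto simp: fun_eq_iff)
 then show ?thesis unfolding spec_norm_def onorm_def by (metis comp_apply)
qed

lemma spec_norm_diff: "spec_norm (A - B) \<le> spec_norm A + spec_norm (B :: real^'b::finite^'a::finite)"
 using spec_norm_add[of A "- B"] by simp

lemma spec_norm_sum: "spec_norm (sum f I) \<le> (\<Sum>i\<in>I. spec_norm (f i :: real^'b::finite^'a::finite))"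
proof (induction I rule: infinite_finite_induct)
 case (insert i I)
 then show ?case using spec_norm_add[of "f i" "sum f I"] by simp
qed auto

lemma spec_norm_mult:
 fixes A :: "real^'b::finite^'a::finite" and B :: "real^'c::finite^'b"
 shows "spec_norm (A ** B) \<le> spec_norm A * spec_norm B"
proof (rule spec_norm_least)
 fix x
 have "norm ((A ** B) *v x) \<le> spec_norm A * norm (B *v x)" by (simp add: matrix_vector_mul_assoc[symmetric] norm_matrix_vector_le)
 also have "\<dots> \<le> spec_norm A * (spec_norm B * norm x)" by (intro mult_left_mono norm_matrix_vector_le) simp
 finally show "norm ((A ** B) *v x) \<le> spec_norm A * spec_norm B * norm x" by (simp add: mult.assoc)
qed simp

text \<open>A supremum of reals bounds the members of a set only if the set is bounded above, so
  boundedness is first derived from the radii of the admissible gains. The maximum with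
  \<open>1/2\<close> makes \<open>\<gamma>\<close> positive.\<close>

lemma stability_factor:
 fixes G :: "('m::finite, 'n::finite, 'd::finite) lq_game"
 assumes "uniformly_stable G"
 obtains \<gamma> where "0 < \<gamma>" "\<gamma> < 1"
  "\<And>F x. F \<in> gain_profiles G \<Longrightarrow> norm ((Amat G - (\<Sum>m\<in>UNIV. Bmat G m ** F m)) *v x) \<le> \<gamma> * norm x"
proof -
 let ?g = "\<lambda>F. spec_norm (Amat G - (\<Sum>m\<in>UNIV. Bmat G m ** F m))"
 have bdd: "bdd_above (?g ` gain_profiles G)"
 proof (rule bdd_aboveI2)
  fix F assume F: "F \<in> gain_profiles G"
  have "?g F \<le> spec_norm (Amat G) + (\<Sum>m\<in>UNIV. spec_norm (Bmat G m ** F m))"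
   using spec_norm_diff[of "Amat G" "\<Sum>m\<in>UNIV. Bmat G m ** F m"] spec_norm_sum[of "\<lambda>m. Bmat G m ** F m" UNIV] by linarith
  also have "\<dots> \<le> spec_norm (Amat G) + (\<Sum>m\<in>UNIV. spec_norm (Bmat G m) * radF G m)"
  proof (intro add_left_mono sum_mono)
   fix m
   have "spec_norm (F m) \<le> radF G m" using F by (auto simp: gain_profiles_def gains_def)
   then have "spec_norm (Bmat G m) * spec_norm (F m) \<le> spec_norm (Bmat G m) * radF G m" by (intro mult_left_mono) auto
   then show "spec_norm (Bmat G m ** F m) \<le> spec_norm (Bmat G m) * radF G m" using spec_norm_mult[of "Bmat G m" "F m"] by linarith
  qed
  finally show "?g F \<le> spec_norm (Amat G) + (\<Sum>m\<in>UNIV. spec_norm (Bmat G m) * radF G m)" .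
 qed
 define \<gamma> where "\<gamma> = max (1/2) (SUP F\<in>gain_profiles G. ?g F)"
 show thesis
 proof (rule that[of \<gamma>])
  show "0 < \<gamma>" "\<gamma> < 1" using assms by (auto simp: \<gamma>_def uniformly_stable_def less_max_iff_disj)
  fix F x assume "F \<in> gain_profiles G"
  then have "?g F \<le> \<gamma>" unfolding \<gamma>_def using cSUP_upper[OF _ bdd] by (auto simp: le_max_iff_disj)
  then show "norm ((Amat G - (\<Sum>m\<in>UNIV. Bmat G m ** F m)) *v x) \<le> \<gamma> * norm x"
   using norm_matrix_vector_le[of "Amat G - (\<Sum>m\<in>UNIV. Bmat G m ** F m)" x] mult_right_mono[of "?g F" \<gamma> "norm x"] by simp
 qed
qed

section \<open>Discounted costs as convergent series\<close>

lemma ext_expectation_integrable: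
 assumes h: "integrable M h" and gh: "AE \<omega> in M. g \<omega> = ereal (h \<omega>)"
 shows "ext_expectation M g = ereal (\<integral>\<omega>. h \<omega> \<partial>M)"
proof -
 have p: "(\<integral>\<^sup>+\<omega>. e2ennreal (g \<omega>) \<partial>M) = (\<integral>\<^sup>+\<omega>. ennreal (h \<omega>) \<partial>M)"
  by (rule nn_integral_cong_AE) (use gh in \<open>auto simp: ennreal.abs_eq e2ennreal_ereal\<close>)
 have n: "(\<integral>\<^sup>+\<omega>. e2ennreal (- g \<omega>) \<partial>M) = (\<integral>\<^sup>+\<omega>. ennreal (- h \<omega>) \<partial>M)"
  by (rule nn_integral_cong_AE) (use gh in \<open>auto simp: ennreal.abs_eq e2ennreal_ereal\<close>)
 have "(\<integral>\<^sup>+\<omega>. ennreal (h \<omega>) \<partial>M) \<noteq> \<infinity>" "(\<integral>\<^sup>+\<omega>. ennreal (- h \<omega>) \<partial>M) \<noteq> \<infinity>"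
  using h by (auto simp: real_integrable_def)
 then obtain a b where ab: "(\<integral>\<^sup>+\<omega>. ennreal (h \<omega>) \<partial>M) = ennreal a" "0 \<le> a"
  "(\<integral>\<^sup>+\<omega>. ennreal (- h \<omega>) \<partial>M) = ennreal b" "0 \<le> b" by (metis ennreal_cases infinity_ennreal_def)
 then show ?thesis unfolding ext_expectation_def p n real_lebesgue_integral_def[OF h] by (simp add: enn2ereal_ennreal)
qed

text \<open>A uniform bound on the first absolute moments makes the discounted series absolutely
  convergent almost everywhere. The upper limit in the definition of the cost is then an ordinary
  limit, and sum and integral may be exchanged.\<close>

lemma discounted_cost_series:
 assumes M: "prob_space M" and \<rho>: "0 < \<rho>" "\<rho> < 1"
  and Y: "\<And>t. integrable M (\<lambda>\<omega>. Y \<omega> t)" and K: "\<And>t. (\<integral>\<omega>. \<bar>Y \<omega> t\<bar> \<partial>M) \<le> K"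
 shows "discounted_cost M \<rho> Y = ereal (\<Sum>t. \<rho> ^ t * (\<integral>\<omega>. Y \<omega> t \<partial>M))"
proof -
 let ?f = "\<lambda>t \<omega>. \<rho> ^ t * Y \<omega> t"
 have [measurable]: "(\<lambda>\<omega>. Y \<omega> t) \<in> borel_measurable M" for t using Y by (rule borel_measurable_integrable)
 have int: "integrable M (?f t)" for t using Y by simp
 have nrm: "(\<integral>\<omega>. norm (?f t \<omega>) \<partial>M) = \<rho> ^ t * (\<integral>\<omega>. \<bar>Y \<omega> t\<bar> \<partial>M)" for t
  using \<rho> by (simp add: abs_mult)
 have K0: "0 \<le> K" by (rule order.trans[OF integral_nonneg_AE K[of 0]]) simp
 have gs: "summable (\<lambda>t. \<rho> ^ t * K)" using \<rho> by (intro summable_mult2 summable_geometric) simp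
 have sn: "summable (\<lambda>t. \<integral>\<omega>. norm (?f t \<omega>) \<partial>M)"
  unfolding nrm by (rule summable_comparison_test'[OF gs, of 0]) (use \<rho> K in \<open>auto simp: abs_mult intro!: mult_left_mono\<close>)
 have "(\<integral>\<^sup>+\<omega>. (\<Sum>t. ennreal (norm (?f t \<omega>))) \<partial>M) = (\<Sum>t. \<integral>\<^sup>+\<omega>. ennreal (norm (?f t \<omega>)) \<partial>M)"
  using int by (intro nn_integral_suminf) auto
 also have "\<dots> = (\<Sum>t. ennreal (\<integral>\<omega>. norm (?f t \<omega>) \<partial>M))"
  using int by (intro suminf_cong nn_integral_eq_integral) auto
 also have "\<dots> < \<infinity>" using sn by (subst suminf_ennreal2) (auto intro: integral_nonneg_AE)
 finally have "AE \<omega> in M. (\<Sum>t. ennreal (norm (?f t \<omega>))) \<noteq> \<infinity>" by (intro nn_integral_PInf_AE) measurable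
 then have AEs: "AE \<omega> in M. summable (\<lambda>t. norm (?f t \<omega>))" by eventually_elim (auto intro: summable_suminf_not_top)
 have "AE \<omega> in M. limsup (\<lambda>T. ereal (\<Sum>t<T. ?f t \<omega>)) = ereal (\<Sum>t. ?f t \<omega>)" using AEs
 proof eventually_elim
  case (elim \<omega>)
  then have "summable (\<lambda>t. ?f t \<omega>)" by (rule summable_norm_cancel)
  then have "(\<lambda>T. \<Sum>t<T. ?f t \<omega>) \<longlonglongrightarrow> (\<Sum>t. ?f t \<omega>)" by (rule summable_LIMSEQ)
  then have "(\<lambda>T. ereal (\<Sum>t<T. ?f t \<omega>)) \<longlonglongrightarrow> ereal (\<Sum>t. ?f t \<omega>)" by simp
  then show ?case by (intro lim_imp_Limsup) auto
 qed
 then have "discounted_cost M \<rho> Y = ereal (\<integral>\<omega>. (\<Sum>t. ?f t \<omega>) \<partial>M)" unfolding discounted_cost_def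
  by (intro ext_expectation_integrable integrable_suminf[OF int AEs sn])
 also have "(\<integral>\<omega>. (\<Sum>t. ?f t \<omega>) \<partial>M) = (\<Sum>t. \<integral>\<omega>. ?f t \<omega> \<partial>M)" by (rule integral_suminf[OF int AEs sn])
 finally show ?thesis by simp
qed

lemma quadratic_bound:
 assumes "quadratic (q :: real^'n::finite \<Rightarrow> real)"
 obtains C where "0 \<le> C" "\<And>x. \<bar>q x\<bar> \<le> C * (1 + x \<bullet> x)"
proof -
 obtain k b and P :: "real^'n^'n" where q: "\<And>x::real^'n. q x = k + b \<bullet> x + x \<bullet> (P *v x)" using assms unfolding quadratic_def by metis
 show thesis
 proof (rule that[of "\<bar>k\<bar> + norm b + spec_norm P"])
  fix x :: "real^'n"
  have x2: "x \<bullet> x = (norm x)^2" by (simp add: power2_norm_eq_inner)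
  have "\<bar>b \<bullet> x\<bar> \<le> norm b * norm x" by (rule Cauchy_Schwarz_ineq2)
  also have "\<dots> \<le> norm b * (1 + (norm x)^2)"
  proof (rule mult_left_mono)
   have "0 \<le> (norm x - 1/2)^2" by simp
   then show "norm x \<le> 1 + (norm x)^2" by (simp add: power2_eq_square algebra_simps)
  qed simp
  finally have 1: "\<bar>b \<bullet> x\<bar> \<le> norm b * (1 + (norm x)^2)" .
  have "\<bar>x \<bullet> (P *v x)\<bar> \<le> norm x * norm (P *v x)" by (rule Cauchy_Schwarz_ineq2)
  also have "\<dots> \<le> norm x * (spec_norm P * norm x)" by (intro mult_left_mono norm_matrix_vector_le) simp
  also have "\<dots> \<le> spec_norm P * (1 + (norm x)^2)" by (simp add: power2_eq_square algebra_simps)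
  finally have 2: "\<bar>x \<bullet> (P *v x)\<bar> \<le> spec_norm P * (1 + (norm x)^2)" .
  have 3: "\<bar>k\<bar> \<le> \<bar>k\<bar> * (1 + (norm x)^2)" by (simp add: algebra_simps)
  have "\<bar>q x\<bar> \<le> \<bar>k\<bar> + \<bar>b \<bullet> x\<bar> + \<bar>x \<bullet> (P *v x)\<bar>" unfolding q by linarith
  then show "\<bar>q x\<bar> \<le> (\<bar>k\<bar> + norm b + spec_norm P) * (1 + x \<bullet> x)"
   unfolding x2 using 1 2 3 by (simp add: distrib_right)
 qed simp
qed

text \<open>The term of the stage cost that pairs the next state with the control contains the
  current noise times an affine function of the current state. The two are independent, so its
  expectation vanishes and only a quadratic function of the current state contributes to the
  expected cost.\<close>

lemma inner_noise_expectation: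
 fixes w :: "nat \<Rightarrow> 'a \<Rightarrow> real^'n::finite"
 assumes M: "prob_space M" and w: "iid_noise M w S"
 shows "integrable M (\<lambda>\<omega>. w t \<omega> \<bullet> (a + B *v affine_path c A x (\<lambda>s. w s \<omega>) t))" (is "integrable M ?f")
  and "(\<integral>\<omega>. w t \<omega> \<bullet> (a + B *v affine_path c A x (\<lambda>s. w s \<omega>) t) \<partial>M) = 0"
proof -
 interpret prob_space M by fact
 have e: "v \<bullet> (a + B *v z) = a \<bullet> v + (\<Sum>i\<in>UNIV. (B $ i \<bullet> z) * (axis i 1 \<bullet> v))" for v z
  unfolding inner_add_right inner_commute[of v a] by (simp add: inner_vec_def[of v] matrix_vector_mul_component inner_axis' mult.commute)
 have i: "integrable M (\<lambda>\<omega>. y \<bullet> w t \<omega>)" for y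
  using noise_square_integrable[OF M w] by (rule square_integrable_integrable)
 have i2: "integrable M (\<lambda>\<omega>. (y \<bullet> affine_path c A x (\<lambda>s. w s \<omega>) t) * (y' \<bullet> w t \<omega>))" for y y'
  by (intro square_integrable_mult affine_path_square_integrable[OF M w] noise_square_integrable[OF M w])
 show "integrable M ?f" unfolding e using i i2 by simp
 show "(\<integral>\<omega>. ?f \<omega> \<partial>M) = 0" unfolding e using i i2
  by (simp add: noise_mean[OF M w] affine_path_noise_uncorrelated[OF M w])
qed

lemma norm_noise_expectation:
 fixes w :: "nat \<Rightarrow> 'a \<Rightarrow> real^'n::finite"
 assumes M: "prob_space M" and w: "iid_noise M w S"
 shows "integrable M (\<lambda>\<omega>. w t \<omega> \<bullet> w t \<omega>)" "(\<integral>\<omega>. w t \<omega> \<bullet> w t \<omega> \<partial>M) = (\<Sum>i\<in>UNIV. S $ i $ i)"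
proof -
 interpret prob_space M by fact
 have e: "v \<bullet> v = (\<Sum>i\<in>UNIV. (axis i 1 \<bullet> v) * (axis i 1 \<bullet> v))" for v :: "real^'n"
  by (simp add: inner_vec_def[of v] inner_axis')
 have i: "integrable M (\<lambda>\<omega>. (axis i 1 \<bullet> w t \<omega>) * (axis i 1 \<bullet> w t \<omega>))" for i
  by (intro square_integrable_mult noise_square_integrable[OF M w])
 show "integrable M (\<lambda>\<omega>. w t \<omega> \<bullet> w t \<omega>)" unfolding e using i by simp
 show "(\<integral>\<omega>. w t \<omega> \<bullet> w t \<omega> \<partial>M) = (\<Sum>i\<in>UNIV. S $ i $ i)" unfolding e
  by (subst Bochner_Integration.integral_sum[OF i], simp only: noise_covariance[OF M w])
   (simp add: inner_axis' matrix_vector_mul_component inner_axis)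
qed

lemma affine_path_second_moment_bounded:
 fixes w :: "nat \<Rightarrow> 'a \<Rightarrow> real^'n::finite"
 assumes M: "prob_space M" and w: "iid_noise M w S" and \<gamma>: "0 < \<gamma>" "\<gamma> < 1" and A: "\<And>z. norm (A *v z) \<le> \<gamma> * norm z"
 obtains K where "\<And>t. (\<integral>\<omega>. affine_path c A x (\<lambda>s. w s \<omega>) t \<bullet> affine_path c A x (\<lambda>s. w s \<omega>) t \<partial>M) \<le> K"
proof -
 interpret prob_space M by fact
 let ?X = "\<lambda>t \<omega>. affine_path c A x (\<lambda>s. w s \<omega>) t"
 have q: "quadratic (\<lambda>z. z \<bullet> z)" using quadratic_inner_affine[of 0 "mat 1" 0 "mat 1"] by simp
 have iX: "integrable M (\<lambda>\<omega>. ?X t \<omega> \<bullet> ?X t \<omega>)" for t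
  by (rule quadratic_expectation_determined(1)[OF M w M w q])
 define D where "D = (norm c)^2 / (1 - \<gamma>) + (\<Sum>i\<in>UNIV. S $ i $ i)"
 have step: "(\<integral>\<omega>. ?X (Suc t) \<omega> \<bullet> ?X (Suc t) \<omega> \<partial>M) \<le> \<gamma> * (\<integral>\<omega>. ?X t \<omega> \<bullet> ?X t \<omega> \<partial>M) + D" for t
 proof -
  have iA: "integrable M (\<lambda>\<omega>. (c + A *v ?X t \<omega>) \<bullet> (c + A *v ?X t \<omega>))"
   by (rule quadratic_expectation_determined(1)[OF M w M w quadratic_inner_affine])
  note n = inner_noise_expectation[OF M w, of t c A c A x] norm_noise_expectation[OF M w, of t]
  have "?X (Suc t) \<omega> \<bullet> ?X (Suc t) \<omega> = (c + A *v ?X t \<omega>) \<bullet> (c + A *v ?X t \<omega>) + 2 * (w t \<omega> \<bullet> (c + A *v ?X t \<omega>)) + w t \<omega> \<bullet> w t \<omega>" for \<omega>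
   by (simp add: inner_add_left inner_add_right inner_commute)
  then have "(\<integral>\<omega>. ?X (Suc t) \<omega> \<bullet> ?X (Suc t) \<omega> \<partial>M) = (\<integral>\<omega>. (c + A *v ?X t \<omega>) \<bullet> (c + A *v ?X t \<omega>) + 2 * (w t \<omega> \<bullet> (c + A *v ?X t \<omega>)) + w t \<omega> \<bullet> w t \<omega> \<partial>M)"
   by (simp only:)
  also have "\<dots> = (\<integral>\<omega>. (c + A *v ?X t \<omega>) \<bullet> (c + A *v ?X t \<omega>) \<partial>M) + (\<Sum>i\<in>UNIV. S $ i $ i)"
   using n iA by simp
  also have "(\<integral>\<omega>. (c + A *v ?X t \<omega>) \<bullet> (c + A *v ?X t \<omega>) \<partial>M) \<le> (\<integral>\<omega>. \<gamma> * (?X t \<omega> \<bullet> ?X t \<omega>) + (norm c)^2 / (1 - \<gamma>) \<partial>M)"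
  proof (rule integral_mono)
   fix \<omega>
   let ?z = "?X t \<omega>"
   have "norm (c + A *v ?z) \<le> norm c + \<gamma> * norm ?z" using norm_triangle_ineq[of c "A *v ?z"] A[of ?z] by linarith
   then have "(norm (c + A *v ?z))^2 \<le> (norm c + \<gamma> * norm ?z)^2" by (intro power_mono) auto
   also have "\<dots> \<le> \<gamma> * (norm ?z)^2 + (norm c)^2 / (1 - \<gamma>)"
   proof -
    \<comment> \<open>Young's inequality in exact form: with these weights the gap is a multiple of
      a perfect square.\<close>
    have "\<gamma> * (norm ?z)^2 + (norm c)^2 / (1 - \<gamma>) - (norm c + \<gamma> * norm ?z)^2 = \<gamma> / (1 - \<gamma>) * (norm c - (1 - \<gamma>) * norm ?z)^2"
     using \<gamma> by (simp add: field_simps power2_eq_square)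
    moreover have "0 \<le> \<gamma> / (1 - \<gamma>) * (norm c - (1 - \<gamma>) * norm ?z)^2" using \<gamma> by simp
    ultimately show ?thesis by linarith
   qed
   finally show "(c + A *v ?z) \<bullet> (c + A *v ?z) \<le> \<gamma> * (?z \<bullet> ?z) + (norm c)^2 / (1 - \<gamma>)" by (simp add: power2_norm_eq_inner)
  qed (use iA iX in auto)
  also have "(\<integral>\<omega>. \<gamma> * (?X t \<omega> \<bullet> ?X t \<omega>) + (norm c)^2 / (1 - \<gamma>) \<partial>M) = \<gamma> * (\<integral>\<omega>. ?X t \<omega> \<bullet> ?X t \<omega> \<partial>M) + (norm c)^2 / (1 - \<gamma>)"
   using iX by (simp add: prob_space)
  finally show ?thesis by (simp add: D_def)
 qed
 show thesis
 proof (rule that[of "max (x \<bullet> x) (D / (1 - \<gamma>))"])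
  fix t show "(\<integral>\<omega>. ?X t \<omega> \<bullet> ?X t \<omega> \<partial>M) \<le> max (x \<bullet> x) (D / (1 - \<gamma>))"
  proof (induction t)
   case 0 show ?case by (simp add: prob_space)
  next
   case (Suc t)
   let ?m = "max (x \<bullet> x) (D / (1 - \<gamma>))"
   have "D \<le> (1 - \<gamma>) * ?m" using \<gamma> by (simp add: max_def field_simps)
   moreover have "\<gamma> * (\<integral>\<omega>. ?X t \<omega> \<bullet> ?X t \<omega> \<partial>M) \<le> \<gamma> * ?m" using Suc \<gamma> by (intro mult_left_mono) auto
   ultimately show ?case using step[of t] by (simp add: left_diff_distrib)
  qed
 qed
qed

text \<open>Each stage cost splits into a quadratic function \<open>q\<close> of the current state
  and a noise term of zero mean. The expected discounted cost is thus a series of expectations of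
  \<open>q\<close> along the path, and \<open>S\<close> determines these. Contraction of
  \<open>A\<close> supplies the uniform moment bound that the series needs.\<close>

lemma discounted_stage_cost_determined:
 fixes w :: "nat \<Rightarrow> 'a \<Rightarrow> real^'n::finite" and w' :: "nat \<Rightarrow> 'b \<Rightarrow> real^'n" and G :: "('m, 'n, 'd::finite) lq_game"
 assumes M: "prob_space M" "iid_noise M w S" and M': "prob_space M'" "iid_noise M' w' S"
  and \<rho>: "0 < \<rho>" "\<rho> < 1" and \<gamma>: "0 < \<gamma>" "\<gamma> < 1" and A: "\<And>z. norm (A *v z) \<le> \<gamma> * norm z"
 shows "discounted_cost M \<rho> (\<lambda>\<omega> t. let X = affine_path c A x (\<lambda>s. w s \<omega>) in stage_cost G m (X t) (X (Suc t)) (feedback s (X t)))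
  = discounted_cost M' \<rho> (\<lambda>\<omega> t. let X = affine_path c A x (\<lambda>s. w' s \<omega>) in stage_cost G m (X t) (X (Suc t)) (feedback s (X t)))"
proof -
 define q where "q z = stage_cost G m z (c + A *v z) (feedback s z)" for z
 define a where "a = Hmat G m *v snd s"
 define B where "B = - (Hmat G m ** fst s)"
 have neg: "(- F) *v z = - (F *v z)" for F :: "real^'n^'k::finite" and z using matrix_vector_mult_diff_rdistrib[of 0 F z] by simp
 have fb: "feedback s z = snd s + (- fst s) *v z" for z by (simp add: feedback_def neg)
 have Hf: "Hmat G m *v feedback s z = a + B *v z" for z
  unfolding fb a_def B_def neg matrix_vector_mul_assoc[symmetric] by (simp add: matrix_vector_right_distrib linear_neg[OF matrix_vector_mul_linear] linear_diff[OF matrix_vector_mul_linear])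
 have qq: "quadratic q"
 proof -
  have *: "q = (\<lambda>z. ((0 + mat 1 *v z) \<bullet> (0 + Qmat G m *v z)) + ((c + A *v z) \<bullet> (a + B *v z)) +
    ((snd s + (- fst s) *v z) \<bullet> (Rmat G m *v snd s + (Rmat G m ** (- fst s)) *v z)) + ((0 + mat 1 *v z) \<bullet> (qvec G m + 0 *v z)) +
    ((snd s + (- fst s) *v z) \<bullet> (rvec G m + 0 *v z)))"
   by (rule ext, unfold q_def stage_cost_def Hf, unfold matrix_vector_mul_assoc[symmetric] fb, simp add: matrix_vector_right_distrib)
  show ?thesis unfolding * by (intro quadratic_add quadratic_inner_affine)
 qed
 \<comment> \<open>Stated for an arbitrary space of a fresh type, since it is applied to both
   \<open>M\<close> and \<open>M'\<close>.\<close>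
 have main: "discounted_cost N \<rho> (\<lambda>\<omega> t. let X = affine_path c A x (\<lambda>s. n s \<omega>) in stage_cost G m (X t) (X (Suc t)) (feedback s (X t)))
   = ereal (\<Sum>t. \<rho> ^ t * (\<integral>\<omega>. q (affine_path c A x (\<lambda>s. n s \<omega>) t) \<partial>N))"
  if N: "prob_space N" "iid_noise N n S" for N :: "'c measure" and n
 proof -
  interpret prob_space N by fact
  let ?X = "\<lambda>t \<omega>. affine_path c A x (\<lambda>s. n s \<omega>) t"
  define Y where "Y \<omega> t = q (?X t \<omega>) + n t \<omega> \<bullet> (a + B *v ?X t \<omega>)" for \<omega> t
  have Yeq: "(\<lambda>\<omega> t. let X = affine_path c A x (\<lambda>s. n s \<omega>) in stage_cost G m (X t) (X (Suc t)) (feedback s (X t))) = Y"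
   by (intro ext) (simp add: Let_def Y_def q_def stage_cost_def Hf inner_add_left)
  obtain C where C: "0 \<le> C" "\<And>z. \<bar>q z\<bar> \<le> C * (1 + z \<bullet> z)" using quadratic_bound[OF qq] by blast
  obtain C' where C': "0 \<le> C'" "\<And>z. \<bar>(a + B *v z) \<bullet> (a + B *v z)\<bar> \<le> C' * (1 + z \<bullet> z)"
   using quadratic_bound[OF quadratic_inner_affine[of a B a B]] by blast
  obtain K where K: "\<And>t. (\<integral>\<omega>. ?X t \<omega> \<bullet> ?X t \<omega> \<partial>N) \<le> K" using affine_path_second_moment_bounded[OF N \<gamma> A] by blast
  note e = inner_noise_expectation[OF N, where c=c and A=A and x=x and a=a and B=B] norm_noise_expectation[OF N]
   quadratic_expectation_determined(1)[OF N N qq, of c A x]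
  have qs: "quadratic (\<lambda>z. z \<bullet> z)" using quadratic_inner_affine[of 0 "mat 1" 0 "mat 1"] by simp
  have iX: "integrable N (\<lambda>\<omega>. ?X t \<omega> \<bullet> ?X t \<omega>)" for t
   by (rule quadratic_expectation_determined(1)[OF N N qs])
  have iY: "integrable N (\<lambda>\<omega>. Y \<omega> t)" for t unfolding Y_def using e by simp
  have EY: "(\<integral>\<omega>. Y \<omega> t \<partial>N) = (\<integral>\<omega>. q (?X t \<omega>) \<partial>N)" for t unfolding Y_def using e by simp
  have "(\<integral>\<omega>. \<bar>Y \<omega> t\<bar> \<partial>N) \<le> (C + C') * (1 + K) + (\<Sum>i\<in>UNIV. S $ i $ i)" for t
  proof -
   have "(\<integral>\<omega>. \<bar>Y \<omega> t\<bar> \<partial>N) \<le> (\<integral>\<omega>. (C + C') * (1 + ?X t \<omega> \<bullet> ?X t \<omega>) + n t \<omega> \<bullet> n t \<omega> \<partial>N)"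
   proof (rule integral_mono)
    fix \<omega>
    let ?u = "a + B *v ?X t \<omega>"
    have "\<bar>n t \<omega> \<bullet> ?u\<bar> \<le> norm (n t \<omega>) * norm ?u" by (rule Cauchy_Schwarz_ineq2)
    also have "\<dots> \<le> (norm (n t \<omega>))^2 + (norm ?u)^2"
     using sum_squares_bound[of "norm (n t \<omega>)" "norm ?u"] mult_nonneg_nonneg[OF norm_ge_zero[of "n t \<omega>"] norm_ge_zero[of ?u]] by linarith
    also have "\<dots> = n t \<omega> \<bullet> n t \<omega> + ?u \<bullet> ?u" by (simp add: power2_norm_eq_inner)
    finally show "\<bar>Y \<omega> t\<bar> \<le> (C + C') * (1 + ?X t \<omega> \<bullet> ?X t \<omega>) + n t \<omega> \<bullet> n t \<omega>"
     unfolding Y_def distrib_right using C(2)[of "?X t \<omega>"] C'(2)[of "?X t \<omega>"] by linarith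
   qed (use iY iX e in auto)
   also have "\<dots> = (C + C') * (1 + (\<integral>\<omega>. ?X t \<omega> \<bullet> ?X t \<omega> \<partial>N)) + (\<Sum>i\<in>UNIV. S $ i $ i)"
    using iX e by (simp add: prob_space)
   also have "\<dots> \<le> (C + C') * (1 + K) + (\<Sum>i\<in>UNIV. S $ i $ i)"
    using K[of t] C(1) C'(1) by (intro add_right_mono mult_left_mono) auto
   finally show ?thesis .
  qed
  from discounted_cost_series[OF N(1) \<rho> iY this] show ?thesis unfolding Yeq EY .
 qed
 show ?thesis unfolding main[OF M] main[OF M'] by (simp only: quadratic_expectation_determined(2)[OF M M' qq])
qed

section \<open>True and perceived closed loops\<close>

lemma sum_regressor_index:
 fixes g :: "unit + ('n::finite + 'd::finite) \<Rightarrow> 'b::comm_monoid_add"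
 shows "(\<Sum>i\<in>UNIV. g i) = g (Inl ()) + ((\<Sum>j\<in>UNIV. g (Inr (Inl j))) + (\<Sum>j\<in>UNIV. g (Inr (Inr j))))"
 by (simp add: UNIV_Plus_UNIV[symmetric] sum.Plus UNIV_unit del: UNIV_Plus_UNIV)

lemma true_param_regressor:
 "transpose (true_param G m p) *v regressor x u = drift G + (\<Sum>j\<in>UNIV - {m}. Bmat G j *v snd p j)
   + (Amat G - (\<Sum>j\<in>UNIV - {m}. Bmat G j ** fst p j)) *v x + Bmat G m *v u"
 by (simp add: vec_eq_iff matrix_vector_mult_def transpose_def true_param_def regressor_def sum_regressor_index column_def)

lemma sum_UNIV_remove: "(\<Sum>j\<in>UNIV. f j) = f m + (\<Sum>j\<in>UNIV - {m}. f j)" for f :: "'m::finite \<Rightarrow> 'b::comm_monoid_add"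
 by (rule sum.remove) auto

lemma matrix_vector_mult_sum: "(\<Sum>j\<in>J. f j) *v x = (\<Sum>j\<in>J. f j *v x)" for f :: "'i \<Rightarrow> real^'n::finite^'k::finite"
proof (induction J rule: infinite_finite_induct)
 case (insert j J) then show ?case by (simp add: matrix_vector_mult_add_rdistrib)
qed auto

lemma game_step_feedback:
 "game_step G x (\<lambda>j. feedback (strategy_of p j) x) w
   = drift G + (\<Sum>j\<in>UNIV. Bmat G j *v snd p j) + (Amat G - (\<Sum>j\<in>UNIV. Bmat G j ** fst p j)) *v x + w"
proof -
 have "Bmat G j *v feedback (strategy_of p j) x = Bmat G j *v snd p j - (Bmat G j ** fst p j) *v x" for j
  by (simp add: feedback_def strategy_of_def matrix_vector_right_distrib matrix_vector_mul_assoc[symmetric]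
   linear_diff[OF matrix_vector_mul_linear])
 then have "(\<Sum>j\<in>UNIV. Bmat G j *v feedback (strategy_of p j) x) = (\<Sum>j\<in>UNIV. Bmat G j *v snd p j) - (\<Sum>j\<in>UNIV. Bmat G j ** fst p j) *v x"
  by (simp add: sum_subtractf matrix_vector_mult_sum)
 then show ?thesis by (simp add: game_step_def matrix_vector_mult_diff_rdistrib)
qed

lemma closed_loop_affine_path:
 "closed_loop G p x w t = affine_path (drift G + (\<Sum>j\<in>UNIV. Bmat G j *v snd p j))
   (Amat G - (\<Sum>j\<in>UNIV. Bmat G j ** fst p j)) x w t" by (induction t) (simp_all add: game_step_feedback)

lemma perceived_state_affine_path:
 fixes p :: "('m::finite, 'n::finite, 'd::finite) profile"
 shows "perceived_state (true_param G m p) s x 0 \<xi> t =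
  affine_path (drift G + (\<Sum>j\<in>UNIV. Bmat G j *v snd (deviate p m s) j))
   (Amat G - (\<Sum>j\<in>UNIV. Bmat G j ** fst (deviate p m s) j)) x (\<lambda>t. fst (\<xi> t)) t"
proof (induction t)
 case (Suc t)
 have 1: "(\<Sum>j\<in>UNIV - {m}. Bmat G j *v snd (deviate p m s) j) = (\<Sum>j\<in>UNIV - {m}. Bmat G j *v snd p j)"
  by (rule sum.cong) (auto simp: deviate_def)
 have 2: "(\<Sum>j\<in>UNIV - {m}. Bmat G j ** fst (deviate p m s) j) = (\<Sum>j\<in>UNIV - {m}. Bmat G j ** fst p j)"
  by (rule sum.cong) (auto simp: deviate_def)
 show ?case unfolding perceived_state.simps true_param_regressor Suc affine_path.simps
   sum_UNIV_remove[of "\<lambda>j. Bmat G j *v snd (deviate p m s) j" m] sum_UNIV_remove[of "\<lambda>j. Bmat G j ** fst (deviate p m s) j" m] 1 2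
  by (simp add: feedback_def deviate_def matrix_vector_mult_diff_rdistrib matrix_vector_mult_add_rdistrib
   matrix_vector_mul_assoc[symmetric] linear_neg[OF matrix_vector_mul_linear] linear_diff[OF matrix_vector_mul_linear] algebra_simps)
qed simp

lemma true_model:
 assumes "valid_game G"
 shows "(true_param G m p, noise_cov G) \<in> models G m"
proof -
 have "Bmat G m $ i $ k = 0" if "k \<notin> ctrl G m" for k i
  using assms that by (auto simp: valid_game_def supp_in_def transpose_def vec_eq_iff)
 moreover have "psd (noise_cov G)"
 proof -
  have "transpose (noise_cov G) = noise_cov G" "\<And>x. x \<noteq> 0 \<Longrightarrow> 0 < x \<bullet> (noise_cov G *v x)"
   using assms by (auto simp: valid_game_def pos_def_on_def supp_in_def)
  then show ?thesis unfolding psd_def by (metis inner_zero_left less_imp_le order_refl)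
 qed
 ultimately show ?thesis by (auto simp: models_def supp_in_def true_param_def column_def vec_eq_iff split: sum.split)
qed

lemma perceived_noise_iid:
 assumes W: "noise_law W S" and V: "noise_law V S'"
 shows "prob_space (\<Pi>\<^sub>M t\<in>(UNIV::nat set). W \<Otimes>\<^sub>M V)"
  and "iid_noise (\<Pi>\<^sub>M t\<in>(UNIV::nat set). W \<Otimes>\<^sub>M V) (\<lambda>t \<xi>. fst (\<xi> t)) S"
proof -
 interpret W: prob_space W using W by (simp add: noise_law_def)
 interpret V: prob_space V using V by (simp add: noise_law_def)
 interpret WV: pair_prob_space W V ..
 interpret P: product_prob_space "\<lambda>_::nat. W \<Otimes>\<^sub>M V" UNIV ..
 let ?P = "\<Pi>\<^sub>M t\<in>(UNIV::nat set). W \<Otimes>\<^sub>M V"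
 show "prob_space ?P" by (intro prob_space_PiM WV.prob_space_axioms)
 have sW: "sets W = sets borel" using W by (simp add: noise_law_def)
 have "P.indep_vars (\<lambda>_. W \<Otimes>\<^sub>M V) (\<lambda>t \<xi>. \<xi> t) UNIV"
  by (subst P.indep_vars_iff_distr_eq_PiM) (auto simp: P.PiM_component restrict_UNIV cong: distr_cong)
 then have 1: "P.indep_vars (\<lambda>_. borel) (\<lambda>t \<xi>. fst (\<xi> t)) UNIV"
  by (rule P.indep_vars_compose2) (simp add: measurable_cong_sets[OF refl sW[symmetric]])
 have "distr ?P borel (\<lambda>\<xi>. fst (\<xi> t)) = W" for t
 proof -
  have "distr ?P borel (\<lambda>\<xi>. fst (\<xi> t)) = distr ?P W (\<lambda>\<xi>. fst (\<xi> t))" by (rule distr_cong) (auto simp: sW)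
  also have "\<dots> = distr (distr ?P (W \<Otimes>\<^sub>M V) (\<lambda>\<xi>. \<xi> t)) W fst" by (subst distr_distr) (auto simp: comp_def)
  also have "distr ?P (W \<Otimes>\<^sub>M V) (\<lambda>\<xi>. \<xi> t) = W \<Otimes>\<^sub>M V" by (rule P.PiM_component) simp
  also have "distr (W \<Otimes>\<^sub>M V) W fst = W" by (rule V.distr_pair_fst)
  finally show ?thesis .
 qed
 then show "iid_noise ?P (\<lambda>t \<xi>. fst (\<xi> t)) S" unfolding iid_noise_def using 1 W by blast
qed

lemma deviate_profiles: "p \<in> profiles G \<Longrightarrow> s \<in> strategies G m \<Longrightarrow> deviate p m s \<in> profiles G"
 by (auto simp: profiles_def strategies_def gain_profiles_def offset_profiles_def deviate_def)

lemma game_cost_eq_perceived_cost: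
 fixes G :: "('m::finite, 'n::finite, 'd::finite) lq_game"
 assumes M: "prob_space M" "iid_noise M w (noise_cov G)" and G: "valid_game G" and st: "uniformly_stable G"
  and WV: "perceived_noise_laws G W V" and p: "p \<in> profiles G" and s: "s \<in> strategies G m"
 shows "game_cost M w G m (deviate p m s) x = perceived_cost G W V m (true_param G m p, noise_cov G) x 0 s"
proof -
 obtain \<gamma> where \<gamma>: "0 < \<gamma>" "\<gamma> < 1"
  "\<And>F x. F \<in> gain_profiles G \<Longrightarrow> norm ((Amat G - (\<Sum>m\<in>UNIV. Bmat G m ** F m)) *v x) \<le> \<gamma> * norm x"
  using stability_factor[OF st] by blast
 have F: "fst (deviate p m s) \<in> gain_profiles G" using deviate_profiles[OF p s] by (auto simp: profiles_def)
 have \<rho>: "0 < disc G" "disc G < 1" using G by (auto simp: valid_game_def)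
 have psdS: "psd (noise_cov G)" using true_model[OF G] by (auto simp: models_def)
 have W: "noise_law (W m (noise_cov G)) (noise_cov G)" and V: "noise_law (V m) (ident_on (ctrl G m))"
  using WV psdS by (auto simp: perceived_noise_laws_def)
 have sd: "strategy_of (deviate p m s) m = s" by (simp add: strategy_of_def deviate_def)
 show ?thesis
  unfolding game_cost_def perceived_cost_def closed_loop_affine_path[abs_def] fst_conv snd_conv sd perceived_state_affine_path[abs_def]
   scaleR_zero_left add_0_right
  by (rule discounted_stage_cost_determined[OF M perceived_noise_iid[OF W V] \<rho> \<gamma>(1,2) \<gamma>(3)[OF F]])
qed

lemma is_argmin_cong: "(\<And>q. q \<in> S \<Longrightarrow> J q = J' q) \<Longrightarrow> is_argmin S J s \<longleftrightarrow> is_argmin S J' s"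
 by (auto simp: is_argmin_def)

text \<open>Feasibility of the true model is the Lipschitz hypothesis at distance zero. Both costs
  agree on all admissible strategies, so existence and uniqueness of the minimizer carry over from
  the best response, and a selection must return a minimizer as soon as there is one.\<close>

lemma selection_eq_best_response:
 fixes G :: "('m::finite, 'n::finite, 'd::finite) lq_game"
 assumes M: "prob_space M" "iid_noise M w (noise_cov G)" and G: "valid_game G" and st: "uniformly_stable G"
  and WV: "perceived_noise_laws G W V" and sel: "optimal_selection G W V \<Phi>"
  and BR: "well_posed_best_responses M w G BR" and lip: "uniformly_lipschitz G W V \<Phi>" and p: "p \<in> profiles G"
 shows "\<Phi> m (true_param G m p, noise_cov G) x 0 = BR m p"
proof -
 let ?\<theta> = "(true_param G m p, noise_cov G)"
 have feas: "?\<theta> \<in> feasible G W V m"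
 proof -
  obtain \<delta> where "\<delta> > 0" "\<And>\<theta>. \<theta> \<in> models G m \<Longrightarrow> model_dist \<theta> ?\<theta> \<le> \<delta> \<Longrightarrow> \<theta> \<in> feasible G W V m"
   using lip p unfolding uniformly_lipschitz_def Let_def by meson
  then show ?thesis using true_model[OF G, of m p] by (simp add: model_dist_def)
 qed
 have am: "is_argmin (strategies G m) (perceived_cost G W V m ?\<theta> x 0) s
   \<longleftrightarrow> is_argmin (strategies G m) (\<lambda>s. game_cost M w G m (deviate p m s) x) s" for s
  by (rule is_argmin_cong) (rule game_cost_eq_perceived_cost[OF M G st WV p, symmetric])
 have BR': "is_argmin (strategies G m) (\<lambda>s. game_cost M w G m (deviate p m s) x) s \<longleftrightarrow> s = BR m p" for s
  using BR p unfolding well_posed_best_responses_def by blast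
 have "(\<exists>s. is_argmin (strategies G m) (perceived_cost G W V m ?\<theta> x 0) s)" unfolding am BR' by blast
 then have "is_argmin (strategies G m) (perceived_cost G W V m ?\<theta> x 0) (\<Phi> m ?\<theta> x 0)"
  using sel feas unfolding optimal_selection_def by blast
 then show ?thesis unfolding am BR' .
qed

section \<open>Epochs\<close>

context
 fixes c :: "'m schedule" and sh :: "'m \<Rightarrow> nat \<Rightarrow> real"
 assumes c: "valid_schedule c" and sh: "\<And>m k. 1 \<le> k \<Longrightarrow> sh m k \<in> {0..max_shift c}"
begin

lemma epoch_len_bounds:
 assumes "1 \<le> k"
 shows "scale_len c * growth c ^ k - 1 \<le> real (epoch_len c sh m k)"
  and "real (epoch_len c sh m k) \<le> (base_len c + scale_len c + max_shift c) * growth c ^ k"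
proof -
 have g: "1 \<le> growth c ^ k" using c by (intro one_le_power) (simp add: valid_schedule_def)
 have p: "0 \<le> base_len c" "0 < scale_len c" "0 \<le> max_shift c" using c by (auto simp: valid_schedule_def)
 have s: "0 \<le> sh m k" "sh m k \<le> max_shift c" using sh[OF assms] by auto
 have "base_len c \<le> base_len c * growth c ^ k" "max_shift c \<le> max_shift c * growth c ^ k"
  using mult_left_mono[OF g p(1)] mult_left_mono[OF g p(3)] by auto
 moreover have "0 \<le> scale_len c * growth c ^ k" using p g by simp
 ultimately show "scale_len c * growth c ^ k - 1 \<le> real (epoch_len c sh m k)"
  "real (epoch_len c sh m k) \<le> (base_len c + scale_len c + max_shift c) * growth c ^ k"
  unfolding epoch_len_def using p s by (simp_all add: distrib_right) linarith+
qed

lemma epoch_len_diff: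
 assumes "1 \<le> k"
 shows "\<bar>real (epoch_len c sh j k) - real (epoch_len c sh m k)\<bar> \<le> max_shift c + 1"
proof -
 have g: "1 \<le> growth c ^ k" using c by (intro one_le_power) (simp add: valid_schedule_def)
 have p: "0 \<le> base_len c" "0 < scale_len c" "0 \<le> max_shift c" using c by (auto simp: valid_schedule_def)
 have s: "0 \<le> sh m k" "sh m k \<le> max_shift c" "0 \<le> sh j k" "sh j k \<le> max_shift c" using sh[OF assms] by auto
 have "0 \<le> scale_len c * growth c ^ k" using p g by simp
 then show ?thesis unfolding epoch_len_def using p s by simp linarith
qed

lemma epoch_start_Suc: "epoch_start c sh m (Suc k) = epoch_start c sh m k + epoch_len c sh m (Suc k)" by (simp add: epoch_start_def)

lemma epoch_start_mono: "k \<le> l \<Longrightarrow> epoch_start c sh m k \<le> epoch_start c sh m l"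
 by (induction l rule: dec_induct) (auto simp: epoch_start_Suc)

lemma epoch_start_diff: "\<bar>real (epoch_start c sh j k) - real (epoch_start c sh m k)\<bar> \<le> real k * (max_shift c + 1)"
proof (induction k)
 case (Suc k)
 have "\<bar>real (epoch_len c sh j (Suc k)) - real (epoch_len c sh m (Suc k))\<bar> \<le> max_shift c + 1" by (rule epoch_len_diff) simp
 then show ?case using Suc by (simp add: epoch_start_Suc algebra_simps)
qed (simp add: epoch_start_def)

lemma epoch_start_upper:
 "real (epoch_start c sh m k) \<le> (base_len c + scale_len c + max_shift c) * growth c / (growth c - 1) * growth c ^ k"
proof -
 let ?C = "base_len c + scale_len c + max_shift c"
 have g: "1 < growth c" using c by (simp add: valid_schedule_def)
 have C: "0 \<le> ?C" using c by (auto simp: valid_schedule_def)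
 show ?thesis
 proof (induction k)
  case 0 show ?case using g C by (simp add: epoch_start_def)
 next
  case (Suc k)
  have "real (epoch_start c sh m (Suc k)) \<le> ?C * growth c / (growth c - 1) * growth c ^ k + ?C * growth c ^ Suc k"
   using Suc epoch_len_bounds(2)[of "Suc k" m] by (simp add: epoch_start_Suc)
  also have "\<dots> = ?C * growth c / (growth c - 1) * growth c ^ Suc k" using g by (simp add: field_simps)
  finally show ?case .
 qed
qed

lemma epoch_start_lower: "1 \<le> k \<Longrightarrow> scale_len c * growth c ^ k - 1 \<le> real (epoch_start c sh m k)"
 using epoch_len_bounds(1)[of k m] epoch_start_Suc[of m "k - 1"] by (cases k) auto

text \<open>\<open>epoch_at\<close> is a supremum of natural numbers, which is a true maximum for a
  finite nonempty set. Early epochs may have length zero, but the geometric lower bound on the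
  starting times leaves only finitely many of them up to \<open>t\<close>.\<close>

lemma finite_epochs: "finite {k. epoch_start c sh m k \<le> t}" and epochs_nonempty: "{k. epoch_start c sh m k \<le> t} \<noteq> {}"
proof -
 have g: "1 < growth c" and s: "0 < scale_len c" using c by (auto simp: valid_schedule_def)
 obtain N where N: "(real t + 2) / scale_len c < growth c ^ N" using real_arch_pow[OF g] by blast
 have "k \<le> N" if "epoch_start c sh m k \<le> t" for k
 proof (rule ccontr)
  assume "\<not> k \<le> N"
  then have k: "1 \<le> k" "N \<le> k" by auto
  have "growth c ^ N \<le> growth c ^ k" using g k by (intro power_increasing) auto
  then have "(real t + 2) / scale_len c < growth c ^ k" using N by linarith
  then have "real t + 2 < scale_len c * growth c ^ k" using s by (simp add: field_simps)
  then show False using epoch_start_lower[OF k(1), of m] that by linarith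
 qed
 then show "finite {k. epoch_start c sh m k \<le> t}" by (intro finite_subset[of "{k. epoch_start c sh m k \<le> t}" "{..N}"]) blast+
 have "epoch_start c sh m 0 \<le> t" by (simp add: epoch_start_def)
 then show "{k. epoch_start c sh m k \<le> t} \<noteq> {}" by blast
qed

lemma epoch_at_bounds:
 "epoch_start c sh m (epoch_at c sh m t) \<le> t" "t < epoch_start c sh m (epoch_at c sh m t + 1)"
proof -
 let ?S = "{k. epoch_start c sh m k \<le> t}"
 have e: "epoch_at c sh m t = Max ?S" unfolding epoch_at_def by (rule cSup_eq_Max[OF finite_epochs epochs_nonempty])
 show "epoch_start c sh m (epoch_at c sh m t) \<le> t" using Max_in[OF finite_epochs epochs_nonempty, of m t] e by simp
 show "t < epoch_start c sh m (epoch_at c sh m t + 1)"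
 proof (rule ccontr)
  assume "\<not> ?thesis"
  then have "epoch_at c sh m t + 1 \<in> ?S" by simp
  then have "epoch_at c sh m t + 1 \<le> Max ?S" by (intro Max_ge finite_epochs)
  then show False using e by simp
 qed
qed

lemma epoch_at_eqI:
 assumes "epoch_start c sh m k \<le> t" "t < epoch_start c sh m (k + 1)" shows "epoch_at c sh m t = k"
proof (rule antisym)
 show "epoch_at c sh m t \<le> k"
 proof (rule ccontr)
  assume "\<not> epoch_at c sh m t \<le> k"
  then have "epoch_start c sh m (k + 1) \<le> epoch_start c sh m (epoch_at c sh m t)" by (intro epoch_start_mono) auto
  then show False using epoch_at_bounds(1)[of m t] assms(2) by simp
 qed
 show "k \<le> epoch_at c sh m t"
 proof (rule ccontr)
  assume "\<not> k \<le> epoch_at c sh m t"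
  then have "epoch_start c sh m (epoch_at c sh m t + 1) \<le> epoch_start c sh m k" by (intro epoch_start_mono) auto
  then show False using epoch_at_bounds(2)[of t m] assms(1) by simp
 qed
qed

text \<open>The dictionary between epoch number and time: \<open>growth c ^ k\<close> and
  \<open>t\<close> agree up to constants, so geometric rates in \<open>k\<close> become powers of
  \<open>t\<close>. In the first constant one factor \<open>growth c\<close> stems from the bound on
  starting times, the other from passing to the next epoch.\<close>

lemma growth_epoch_at:
 assumes t: "1 \<le> t"
 shows "(growth c - 1) / ((base_len c + scale_len c + max_shift c) * growth c ^ 2) * real t \<le> growth c ^ epoch_at c sh m t"
  and "growth c ^ epoch_at c sh m t \<le> (2 / scale_len c + 1) * real t"
proof -
 let ?C = "base_len c + scale_len c + max_shift c" and ?k = "epoch_at c sh m t"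
 have g: "1 < growth c" and s: "0 < scale_len c" using c by (auto simp: valid_schedule_def)
 have C: "0 < ?C" using c by (auto simp: valid_schedule_def)
 have "real t \<le> ?C * growth c / (growth c - 1) * growth c ^ (?k + 1)"
  using epoch_at_bounds(2)[of t m] epoch_start_upper[of m "?k + 1"] by linarith
 then have "(growth c - 1) / (?C * growth c ^ 2) * real t \<le> (growth c - 1) / (?C * growth c ^ 2) * (?C * growth c / (growth c - 1) * growth c ^ (?k + 1))"
  using g C by (intro mult_left_mono) auto
 also have "\<dots> = growth c ^ ?k"
 proof -
  have "(\<gamma> - 1) / (C * \<gamma> ^ 2) * (C * \<gamma> / (\<gamma> - 1) * (\<gamma> ^ n * \<gamma>)) = \<gamma> ^ n" if "1 < \<gamma>" "0 < C" for \<gamma> C :: real and n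
   using that by (simp add: power2_eq_square)
  from this[OF g C, of ?k] show ?thesis by (simp add: mult.commute)
 qed
 finally show "(growth c - 1) / (?C * growth c ^ 2) * real t \<le> growth c ^ ?k" .
 show "growth c ^ ?k \<le> (2 / scale_len c + 1) * real t"
 proof (cases "?k = 0")
  case True
  then show ?thesis using t s mult_mono[of 1 "2 / scale_len c + 1" 1 "real t"] by simp
 next
  case False
  then have "scale_len c * growth c ^ ?k \<le> real t + 1" using epoch_start_lower[of ?k m] epoch_at_bounds(1)[of m t] by simp
  also have "\<dots> \<le> 2 * real t" using t by simp
  finally have "growth c ^ ?k \<le> 2 / scale_len c * real t" using s by (simp add: field_simps)
  then show ?thesis by (simp add: distrib_right)
 qed
qed

text \<open>Epoch \<open>k - 1\<close> of player \<open>m\<close> can stick out of that of player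
  \<open>j\<close> at either end, by the difference of their starting times. This difference grows
  per epoch by at most the largest shift plus 1 for the rounding of lengths.\<close>

lemma misaligned_card:
 assumes k: "1 \<le> k"
 shows "real (card {t \<in> {epoch_start c sh m (k - 1)..<epoch_start c sh m k}. epoch_at c sh j t \<noteq> k - 1}) \<le> 2 * real k * (max_shift c + 1)"
proof -
 let ?s = "epoch_start c sh"
 have sub: "{t \<in> {?s m (k - 1)..<?s m k}. epoch_at c sh j t \<noteq> k - 1} \<subseteq> {?s m (k - 1)..<?s j (k - 1)} \<union> {?s j k..<?s m k}"
 proof
  fix t assume "t \<in> {t \<in> {?s m (k - 1)..<?s m k}. epoch_at c sh j t \<noteq> k - 1}"
  then have t: "?s m (k - 1) \<le> t" "t < ?s m k" "epoch_at c sh j t \<noteq> k - 1" by auto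
  have "\<not> (?s j (k - 1) \<le> t \<and> t < ?s j k)" using epoch_at_eqI[of j "k - 1" t] t(3) k by auto
  then show "t \<in> {?s m (k - 1)..<?s j (k - 1)} \<union> {?s j k..<?s m k}" using t by auto
 qed
 have "card {t \<in> {?s m (k - 1)..<?s m k}. epoch_at c sh j t \<noteq> k - 1} \<le> card ({?s m (k - 1)..<?s j (k - 1)} \<union> {?s j k..<?s m k})"
  by (rule card_mono[OF _ sub]) simp
 also have "\<dots> \<le> (?s j (k - 1) - ?s m (k - 1)) + (?s m k - ?s j k)" by (rule order.trans[OF card_Un_le]) simp
 finally have "real (card {t \<in> {?s m (k - 1)..<?s m k}. epoch_at c sh j t \<noteq> k - 1}) \<le> real (?s j (k - 1) - ?s m (k - 1)) + real (?s m k - ?s j k)"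
  by linarith
 also have "\<dots> \<le> \<bar>real (?s j (k - 1)) - real (?s m (k - 1))\<bar> + \<bar>real (?s j k) - real (?s m k)\<bar>" by linarith
 also have "\<dots> \<le> real (k - 1) * (max_shift c + 1) + real k * (max_shift c + 1)" by (intro add_mono epoch_start_diff)
 also have "\<dots> \<le> real k * (max_shift c + 1) + real k * (max_shift c + 1)"
  using c by (intro add_mono mult_right_mono) (auto simp: valid_schedule_def)
 finally show ?thesis by simp
qed

lemma exploration_bounds:
 shows "0 \<le> exploration c sh m k" "exploration c sh m k \<le> expl_scale c"
proof -
 have p: "0 < expl_scale c" "0 < decay c m" using c by (auto simp: valid_schedule_def)
 show "0 \<le> exploration c sh m k" unfolding exploration_def using p by simp
 have "real (epoch_len c sh m (k + 1)) powr (- decay c m) \<le> 1"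
 proof (cases "epoch_len c sh m (k + 1) = 0")
  case False
  then show ?thesis using p powr_mono[of "- decay c m" 0 "real (epoch_len c sh m (k + 1))"] by simp
 qed simp
 then show "exploration c sh m k \<le> expl_scale c" unfolding exploration_def using p mult_left_mono[of _ 1 "expl_scale c"] by simp
qed

end

section \<open>Perturbed contractions\<close>

text \<open>For \<open>\<zeta> < r\<close> the terms with large \<open>i\<close> dominate and the
  sum is a geometric series in \<open>\<zeta> / r\<close>. Otherwise every term is at most
  \<open>\<zeta> ^ k\<close>, and counting the terms gives the factor \<open>k + 1\<close>; in the
  resonant case \<open>r = \<zeta>\<close> it is attained.\<close>

lemma geometric_convolution:
 fixes \<zeta> r :: real
 assumes "0 < \<zeta>" "0 < r"
 obtains C where "0 < C" "\<And>k. (\<Sum>i\<le>k. \<zeta> ^ (k - i) * r ^ i) \<le> C * r ^ k \<or> (\<Sum>i\<le>k. \<zeta> ^ (k - i) * r ^ i) \<le> C * (real k + 1) * \<zeta> ^ k"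
proof (cases "\<zeta> < r")
 case True
 define q where "q = \<zeta> / r"
 have q: "0 < q" "q < 1" using True assms by (auto simp: q_def)
 have "(\<Sum>i\<le>k. \<zeta> ^ (k - i) * r ^ i) \<le> 1 / (1 - q) * r ^ k" for k
 proof -
  have "(\<Sum>i\<le>k. \<zeta> ^ (k - i) * r ^ i) = (\<Sum>i\<le>k. r ^ k * q ^ (k - i))"
  proof (rule sum.cong)
   fix i assume "i \<in> {..k}"
   then have "r ^ k = r ^ (k - i) * r ^ i" by (simp flip: power_add)
   then show "\<zeta> ^ (k - i) * r ^ i = r ^ k * q ^ (k - i)" using assms by (simp add: q_def power_divide)
  qed simp
  also have "\<dots> = r ^ k * (\<Sum>i\<le>k. q ^ i)"
   using sum.nat_diff_reindex[of "\<lambda>i. q ^ i" "Suc k"] by (simp add: sum_distrib_left[symmetric] lessThan_Suc_atMost)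
  also have "(\<Sum>i\<le>k. q ^ i) \<le> 1 / (1 - q)"
  proof -
   have "(\<Sum>i\<le>k. q ^ i) = (1 - q ^ Suc k) / (1 - q)" using q sum_gp0[of q k] by simp
   also have "\<dots> \<le> 1 / (1 - q)" using q by (intro divide_right_mono) auto
   finally show ?thesis .
  qed
  finally show ?thesis using assms by (simp add: mult.commute mult_left_mono)
 qed
 then show thesis using that[of "1 / (1 - q)"] q by auto
next
 case False
 have "(\<Sum>i\<le>k. \<zeta> ^ (k - i) * r ^ i) \<le> 1 * (real k + 1) * \<zeta> ^ k" for k
 proof -
  have "(\<Sum>i\<le>k. \<zeta> ^ (k - i) * r ^ i) \<le> (\<Sum>i\<le>k. \<zeta> ^ k)"
  proof (rule sum_mono)
   fix i assume i: "i \<in> {..k}"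
   have "\<zeta> ^ (k - i) * r ^ i \<le> \<zeta> ^ (k - i) * \<zeta> ^ i" using False assms by (intro mult_left_mono power_mono) auto
   then show "\<zeta> ^ (k - i) * r ^ i \<le> \<zeta> ^ k" using i by (simp flip: power_add)
  qed
  then show ?thesis by (simp add: add.commute)
 qed
 then show thesis using that[of 1] by auto
qed

text \<open>The sum is extended to all \<open>i \<le> k\<close>, also before the start
  \<open>k1\<close>, so that it becomes a full convolution; nonnegativity of \<open>h\<close> allows
  this.\<close>

lemma affine_recursion_unroll:
 fixes e h :: "nat \<Rightarrow> real"
 assumes z: "0 \<le> \<zeta>" and h: "\<And>k. 0 \<le> h k" and step: "\<And>k. k1 < k \<Longrightarrow> e k \<le> \<zeta> * e (k - 1) + h k"
 shows "k1 \<le> k \<Longrightarrow> e k \<le> \<zeta> ^ (k - k1) * e k1 + (\<Sum>i\<le>k. \<zeta> ^ (k - i) * h i)"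
proof (induction k rule: dec_induct)
 case base
 have "0 \<le> (\<Sum>i\<le>k1. \<zeta> ^ (k1 - i) * h i)" using z h by (intro sum_nonneg) auto
 then show ?case by simp
next
 case (step k)
 have "e (Suc k) \<le> \<zeta> * e k + h (Suc k)" using assms(3)[of "Suc k"] step by simp
 also have "\<dots> \<le> \<zeta> * (\<zeta> ^ (k - k1) * e k1 + (\<Sum>i\<le>k. \<zeta> ^ (k - i) * h i)) + h (Suc k)"
  using step z by (intro add_right_mono mult_left_mono) auto
 also have "\<dots> = \<zeta> ^ (Suc k - k1) * e k1 + (\<Sum>i\<le>Suc k. \<zeta> ^ (Suc k - i) * h i)"
 proof -
  have "\<zeta> * (\<Sum>i\<le>k. \<zeta> ^ (k - i) * h i) = (\<Sum>i\<le>k. \<zeta> ^ (Suc k - i) * h i)"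
   unfolding sum_distrib_left by (rule sum.cong) (auto simp: Suc_diff_le)
  then show ?thesis using step by (simp add: Suc_diff_le algebra_simps)
 qed
 finally show ?case .
qed

text \<open>\<open>(k + L) ^ 3\<close> is at most \<open>8 * k ^ 3 + 8 * L ^ 3\<close>. The first
  part is below half of the exponential beyond a fixed \<open>k0\<close>, the second once
  \<open>k\<close> exceeds a multiple of \<open>ln (A * L ^ 3)\<close>. Therefore
  \<open>g powr k1\<close> is bounded by a power of \<open>L\<close> up to a constant, which makes
  the waiting time polylogarithmic in \<open>1 / \<delta>\<close>.\<close>

lemma cube_le_power_threshold:
 fixes g \<eta> \<epsilon> :: real
 assumes g: "1 < g" and \<eta>: "0 < \<eta>" and \<epsilon>: "0 < \<epsilon>"
 obtains K p where "0 < K" "0 < p"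
  "\<And>L. ln 2 \<le> L \<Longrightarrow> \<exists>k1. g powr real k1 \<le> K * L powr p \<and> (\<forall>k\<ge>k1. (real k + L) ^ 3 \<le> \<epsilon> * g powr (\<eta> * real k))"
proof -
 have lg: "0 < ln g" using g by simp
 define b where "b = \<eta> * ln g"
 have b: "b > 0" using lg \<eta> by (simp add: b_def)
 \<comment> \<open>From \<open>exp z \<ge> (z / 4) ^ 4\<close> with \<open>z = b * k\<close>: the
   term \<open>8 * k ^ 3\<close> has to stay below \<open>\<epsilon> / 2 * (b * k / 4) ^ 4\<close>,
   and \<open>4096 = 8 * 2 * 4 ^ 4\<close>.\<close>
 define k0 where "k0 = nat \<lceil>4096 / (\<epsilon> * b ^ 4)\<rceil>"
 \<comment> \<open>The second entry ensures \<open>A * L ^ 3 \<ge> 1\<close>, so that its logarithm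
   is nonnegative.\<close>
 define A where "A = max (16 / \<epsilon>) (1 / (ln 2) ^ 3)"
 have A: "A > 0" "A \<ge> 16 / \<epsilon>" "A \<ge> 1 / (ln 2) ^ 3" using \<epsilon> by (auto simp: A_def less_max_iff_disj)
 have ge: "g powr (\<eta> * real k) = exp (b * real k)" for k :: nat using g by (simp add: powr_def b_def mult_ac)
 show thesis
 proof (rule that[of "g powr (real k0 + 1) * A powr (1 / \<eta>)" "3 / \<eta>"])
  show "0 < g powr (real k0 + 1) * A powr (1 / \<eta>)" using g A by simp
  show "0 < 3 / \<eta>" using \<eta> by simp
  fix L :: real assume L: "ln 2 \<le> L"
  then have L0: "L > 0" using ln_gt_zero[of "2::real"] by linarith
  have AL: "A * L ^ 3 \<ge> 1"
  proof -
   have "(ln 2) ^ 3 \<le> L ^ 3" using L by (intro power_mono) auto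
   then have "1 / (ln 2) ^ 3 * (ln 2) ^ 3 \<le> A * L ^ 3" using A by (intro mult_mono) auto
   then show ?thesis by simp
  qed
  define k1 where "k1 = k0 + nat \<lceil>ln (A * L ^ 3) / b\<rceil>"
  have q0: "0 \<le> ln (A * L ^ 3) / b" using AL b by simp
  have k1u: "real k1 \<le> real k0 + 1 + ln (A * L ^ 3) / b" using q0 unfolding k1_def by linarith
  have k1l: "ln (A * L ^ 3) / b \<le> real k1" "real k0 \<le> real k1" unfolding k1_def using q0 by linarith+
  have "g powr real k1 \<le> g powr (real k0 + 1 + ln (A * L ^ 3) / b)" using g k1u by simp
  also have "\<dots> = g powr (real k0 + 1) * g powr (ln (A * L ^ 3) / b)" by (rule powr_add)
  also have "g powr (ln (A * L ^ 3) / b) = (A * L ^ 3) powr (1 / \<eta>)"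
  proof -
   have "ln (A * L ^ 3) / b * ln g = 1 / \<eta> * ln (A * L ^ 3)" using lg \<eta> by (simp add: b_def field_simps)
   moreover have "A * L ^ 3 \<noteq> 0" using AL by linarith
   ultimately show ?thesis using g unfolding powr_def by simp
  qed
  also have "\<dots> = A powr (1 / \<eta>) * L powr (3 / \<eta>)"
  proof -
   have L3: "L ^ 3 = L powr 3" using L0 by (simp add: powr_numeral)
   have "(L ^ 3) powr (1 / \<eta>) = L powr (3 / \<eta>)" unfolding L3 powr_powr by simp
   then show ?thesis using A(1) L0 by (simp add: powr_mult)
  qed
  finally have 1: "g powr real k1 \<le> g powr (real k0 + 1) * A powr (1 / \<eta>) * L powr (3 / \<eta>)" by (simp add: mult.assoc)
  have 2: "(real k + L) ^ 3 \<le> \<epsilon> * g powr (\<eta> * real k)" if k: "k1 \<le> k" for k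
  proof -
   have "real k0 \<le> real k" using k k1l by linarith
   moreover have "4096 / (\<epsilon> * b ^ 4) \<le> real k0" unfolding k0_def by linarith
   ultimately have kk: "4096 / (\<epsilon> * b ^ 4) \<le> real k" by linarith
   have "b * real k / 4 \<le> exp (b * real k / 4)" using exp_ge_add_one_self[of "b * real k / 4"] by linarith
   then have "(b * real k / 4) ^ 4 \<le> exp (b * real k / 4) ^ 4" using b by (intro power_mono) auto
   also have "\<dots> = exp (b * real k)" by (simp flip: exp_of_nat_mult)
   finally have E: "(b * real k / 4) ^ 4 \<le> exp (b * real k)" .
   have "4096 \<le> real k * (\<epsilon> * b ^ 4)" using kk \<epsilon> b by (simp add: field_simps)
   then have "4096 * real k ^ 3 \<le> (real k * (\<epsilon> * b ^ 4)) * real k ^ 3" by (intro mult_right_mono) auto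
   also have "\<dots> = 256 * \<epsilon> * (b * real k / 4) ^ 4" by (simp add: power_mult_distrib power_divide eval_nat_numeral)
   also have "\<dots> \<le> 256 * \<epsilon> * exp (b * real k)" using E \<epsilon> by (intro mult_left_mono) auto
   finally have K3: "8 * real k ^ 3 \<le> \<epsilon> / 2 * exp (b * real k)" by simp
   have "ln (A * L ^ 3) \<le> b * real k" using k1l(1) k b by (simp add: field_simps) (meson le_trans mult_left_mono of_nat_le_iff less_imp_le order_trans)
   then have "A * L ^ 3 \<le> exp (b * real k)" using AL by (metis exp_le_cancel_iff exp_ln less_le_trans zero_less_one)
   moreover have "16 / \<epsilon> * L ^ 3 \<le> A * L ^ 3" using A L0 by (intro mult_right_mono) auto
   ultimately have "16 / \<epsilon> * L ^ 3 \<le> exp (b * real k)" by linarith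
   then have L3: "8 * L ^ 3 \<le> \<epsilon> / 2 * exp (b * real k)" using \<epsilon> by (simp add: field_simps)
   have "(real k + L) ^ 3 \<le> (2 * max (real k) L) ^ 3" using L0 by (intro power_mono) auto
   also have "\<dots> \<le> 8 * real k ^ 3 + 8 * L ^ 3" using L0 by (auto simp: max_def power_mult_distrib)
   finally show ?thesis using K3 L3 unfolding ge by linarith
  qed
  show "\<exists>k1. g powr real k1 \<le> g powr (real k0 + 1) * A powr (1 / \<eta>) * L powr (3 / \<eta>) \<and>
    (\<forall>k\<ge>k1. (real k + L) ^ 3 \<le> \<epsilon> * g powr (\<eta> * real k))" using 1 2 by blast
 qed
qed

text \<open>Since \<open>L\<close> is bounded away from zero, a lower power is controlled by a
  higher one up to a constant. This merges several powers of \<open>L\<close> into a single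
  exponent.\<close>

lemma powr_le_rescale:
 fixes L a b :: real assumes "ln 2 \<le> L" "a \<le> b"
 shows "L powr a \<le> (ln 2) powr (a - b) * L powr b"
proof -
 have L0: "L > 0" using assms ln_gt_zero[of "2::real"] by linarith
 have "L powr (a - b) \<le> (ln 2) powr (a - b)" using assms by (intro powr_mono2') auto
 then have "L powr (a - b) * L powr b \<le> (ln 2) powr (a - b) * L powr b" by (intro mult_right_mono) auto
 then show ?thesis using L0 by (simp flip: powr_add)
qed

text \<open>The recursion is available only for epochs that satisfy the cubic condition; earlier
  errors are merely bounded by \<open>D\<close>. All constants are fixed before \<open>L\<close>,
  the sequence \<open>e\<close>, the time and the epoch, so they hold uniformly over sample paths,
  over \<open>\<delta>\<close>, and over players who are in different epochs at the same
  time.\<close>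

lemma contraction_rate:
 fixes g \<zeta> qa qb \<eta> \<epsilon> D Cr cl Cu :: real
 assumes g: "1 < g" and \<zeta>: "0 < \<zeta>" "\<zeta> < 1" and q: "0 < qa" "0 < qb" and \<eta>: "0 < \<eta>" and \<epsilon>: "0 < \<epsilon>"
  and D: "0 \<le> D" and Cr: "0 \<le> Cr" and cl: "0 < cl" "0 < Cu"
 obtains c0 c1 C K where "0 < c0" "0 < c1" "0 < C" "0 < K"
  "\<And>L e t k. ln 2 \<le> L \<Longrightarrow> (\<And>k. 0 \<le> e k \<and> e k \<le> D) \<Longrightarrow>
    (\<And>k. 1 \<le> k \<Longrightarrow> (real k + L) ^ 3 \<le> \<epsilon> * g powr (\<eta> * real k) \<Longrightarrow>
     e k \<le> \<zeta> * e (k - 1) + Cr * (sqrt (real k + L) * g powr (- qa * real k) + g powr (- qb * real k))) \<Longrightarrow>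
    K * L powr c1 \<le> t \<Longrightarrow> 3 \<le> t \<Longrightarrow> cl * t \<le> g powr real k \<Longrightarrow> g powr real k \<le> Cu * t \<Longrightarrow>
    e (k::nat) \<le> C * ((ln t powr (3/2) + L powr c0) * t powr (ln \<zeta> / ln g) + sqrt (ln t + L) * t powr (- qa) + t powr (- qb))"
proof -
 have lg: "0 < ln g" using g by simp
 define a where "a = g powr (- qa)"
 define b where "b = g powr (- qb)"
 define s where "s = - (ln \<zeta> / ln g)"
 have ab: "0 < a" "0 < b" using g by (auto simp: a_def b_def)
 have s: "0 < s" using lg \<zeta> by (simp add: s_def divide_neg_pos)
 obtain Ca where Ca: "0 < Ca" "\<And>k. (\<Sum>i\<le>k. \<zeta> ^ (k - i) * a ^ i) \<le> Ca * a ^ k \<or> (\<Sum>i\<le>k. \<zeta> ^ (k - i) * a ^ i) \<le> Ca * (real k + 1) * \<zeta> ^ k"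
  using geometric_convolution[OF \<zeta>(1) ab(1)] by blast
 obtain Cb where Cb: "0 < Cb" "\<And>k. (\<Sum>i\<le>k. \<zeta> ^ (k - i) * b ^ i) \<le> Cb * b ^ k \<or> (\<Sum>i\<le>k. \<zeta> ^ (k - i) * b ^ i) \<le> Cb * (real k + 1) * \<zeta> ^ k"
  using geometric_convolution[OF \<zeta>(1) ab(2)] by blast
 obtain K0 p where K0: "0 < K0" "0 < p"
  "\<And>L. ln 2 \<le> L \<Longrightarrow> \<exists>k1. g powr real k1 \<le> K0 * L powr p \<and> (\<forall>k\<ge>k1. (real k + L) ^ 3 \<le> \<epsilon> * g powr (\<eta> * real k))"
  using cube_le_power_threshold[OF g \<eta> \<epsilon>] by blast
 \<comment> \<open>Powers of \<open>L\<close> have two sources: the exponent \<open>3/2\<close>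
   comes from the convolution, \<open>p * s\<close> from the epochs before the threshold
   \<open>k1\<close>.\<close>
 define c0 where "c0 = max (3/2) (p * s)"
 \<comment> \<open>Chosen so that \<open>k \<le> (B - 1) * ln t\<close>, which follows from
   \<open>g powr k \<le> Cu * t\<close> and \<open>ln t \<ge> 1\<close>.\<close>
 define B where "B = (\<bar>ln Cu\<bar> + 1) / ln g + 1"
 have B: "1 \<le> B" using lg by (simp add: B_def)
 define A1 where "A1 = (ln 2) powr (3/2 - c0)"
 define A2 where "A2 = (ln 2) powr (p * s - c0)"
 have A12: "0 < A1" "0 < A2" by (auto simp: A1_def A2_def)
 define E1 where "E1 = cl powr (- s) * (D * K0 powr s * A2 + (Cr * Ca + Cr * Cb) * B ^ 2 * 4 * (1 + A1))"
 define E2 where "E2 = Cr * Ca * B * cl powr (- qa)"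
 define E3 where "E3 = Cr * Cb * cl powr (- qb)"
 have E: "0 \<le> E1" "0 \<le> E2" "0 \<le> E3" unfolding E1_def E2_def E3_def using D Cr Ca Cb A12 B by auto
 show thesis
 proof (rule that[of c0 p "E1 + E2 + E3 + 1" "K0 / cl"])
  show "0 < c0" by (simp add: c0_def)
  show "0 < p" "0 < K0 / cl" "0 < E1 + E2 + E3 + 1" using K0 cl E by auto
  fix L e t and k :: nat
  assume L: "ln 2 \<le> L" and e: "\<And>k. 0 \<le> e k \<and> e k \<le> D"
   and step: "\<And>k. 1 \<le> k \<Longrightarrow> (real k + L) ^ 3 \<le> \<epsilon> * g powr (\<eta> * real k) \<Longrightarrow>
     e k \<le> \<zeta> * e (k - 1) + Cr * (sqrt (real k + L) * g powr (- qa * real k) + g powr (- qb * real k))"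
   and tK: "K0 / cl * L powr p \<le> t" and t3: "3 \<le> t" and tl: "cl * t \<le> g powr real k" and tu: "g powr real k \<le> Cu * t"
  have L0: "L > 0" using L ln_gt_zero[of "2::real"] by linarith
  have t0: "t > 0" using t3 by simp
  have lt: "1 \<le> ln t"
  proof -
   have "exp 1 \<le> t" using exp_le t3 by linarith
   then show ?thesis using t0 by (simp add: ln_ge_iff)
  qed
  obtain k1 where k1: "g powr real k1 \<le> K0 * L powr p" "\<And>k. k1 \<le> k \<Longrightarrow> (real k + L) ^ 3 \<le> \<epsilon> * g powr (\<eta> * real k)"
   using K0(3)[OF L] by blast
  have "g powr real k1 \<le> g powr real k" using k1(1) tK tl cl by (simp add: field_simps)
  then have kk: "k1 \<le> k" using g by simp
  have pa: "g powr (- qa * real i) = a ^ i" for i :: nat unfolding a_def using g by (simp add: powr_power mult.commute)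
  have pb: "g powr (- qb * real i) = b ^ i" for i :: nat unfolding b_def using g by (simp add: powr_power mult.commute)
  define h where "h i = Cr * (sqrt (real i + L) * a ^ i + b ^ i)" for i :: nat
  have h0: "0 \<le> h i" for i unfolding h_def using Cr ab L0 by simp
  have st: "e i \<le> \<zeta> * e (i - 1) + h i" if "k1 < i" for i using step[of i] k1(2)[of i] that unfolding pa pb h_def by simp
  have "e k \<le> \<zeta> ^ (k - k1) * e k1 + (\<Sum>i\<le>k. \<zeta> ^ (k - i) * h i)"
   using affine_recursion_unroll[of \<zeta> h k1 e k] \<zeta> h0 st kk by simp
  also have "\<dots> \<le> \<zeta> ^ (k - k1) * D + (\<Sum>i\<le>k. \<zeta> ^ (k - i) * (Cr * (sqrt (real k + L) * a ^ i + b ^ i)))"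
   using e \<zeta> Cr ab unfolding h_def by (intro add_mono mult_left_mono sum_mono mult_right_mono real_sqrt_le_mono) auto
  also have "(\<Sum>i\<le>k. \<zeta> ^ (k - i) * (Cr * (sqrt (real k + L) * a ^ i + b ^ i))) =
    Cr * sqrt (real k + L) * (\<Sum>i\<le>k. \<zeta> ^ (k - i) * a ^ i) + Cr * (\<Sum>i\<le>k. \<zeta> ^ (k - i) * b ^ i)"
   by (simp add: sum_distrib_left sum.distrib[symmetric] algebra_simps)
  also have "\<dots> \<le> Cr * sqrt (real k + L) * (Ca * a ^ k + Ca * (real k + 1) * \<zeta> ^ k) + Cr * (Cb * b ^ k + Cb * (real k + 1) * \<zeta> ^ k)"
  proof (intro add_mono mult_left_mono)
   have "0 \<le> Ca * a ^ k" "0 \<le> Ca * (real k + 1) * \<zeta> ^ k" "0 \<le> Cb * b ^ k" "0 \<le> Cb * (real k + 1) * \<zeta> ^ k" using Ca Cb ab \<zeta> by auto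
   then show "(\<Sum>i\<le>k. \<zeta> ^ (k - i) * a ^ i) \<le> Ca * a ^ k + Ca * (real k + 1) * \<zeta> ^ k"
    "(\<Sum>i\<le>k. \<zeta> ^ (k - i) * b ^ i) \<le> Cb * b ^ k + Cb * (real k + 1) * \<zeta> ^ k"
    using Ca(2)[of k] Cb(2)[of k] by linarith+
  qed (use Cr L0 in auto)
  finally have ek: "e k \<le> \<zeta> ^ (k - k1) * D + (Cr * sqrt (real k + L) * (Ca * a ^ k + Ca * (real k + 1) * \<zeta> ^ k) + Cr * (Cb * b ^ k + Cb * (real k + 1) * \<zeta> ^ k))"
   by simp
  define Y where "Y = ln t + L"
  have Y: "1 \<le> Y" using lt L0 by (simp add: Y_def)
  have "real k * ln g = ln (g powr real k)" using g by (simp add: ln_powr)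
  also have "\<dots> \<le> ln (Cu * t)" using tu g by (intro ln_mono) auto
  also have "\<dots> = ln Cu + ln t" using cl t0 by (simp add: ln_mult)
  also have "\<dots> \<le> (\<bar>ln Cu\<bar> + 1) * ln t"
  proof -
   have "\<bar>ln Cu\<bar> * 1 \<le> \<bar>ln Cu\<bar> * ln t" using lt by (intro mult_left_mono) auto
   then show ?thesis by (simp add: distrib_right)
  qed
  finally have kB: "real k \<le> (B - 1) * ln t" using lg by (simp add: B_def field_simps)
  have kY: "real k + 1 \<le> B * Y" "real k + L \<le> B * Y"
  proof -
   have 1: "(B - 1) * ln t \<le> (B - 1) * Y" using B L0 by (intro mult_left_mono) (auto simp: Y_def)
   show "real k + 1 \<le> B * Y" using kB 1 Y by (simp add: left_diff_distrib)
   have "L \<le> Y" using lt by (simp add: Y_def)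
   then show "real k + L \<le> B * Y" using kB 1 by (simp add: left_diff_distrib)
  qed
  have sB: "sqrt B \<le> B" using B real_sqrt_le_mono[of B "B * B"] mult_left_mono[OF B, of B] by simp
  have sq: "sqrt (real k + L) \<le> B * sqrt Y"
  proof -
   have "sqrt (real k + L) \<le> sqrt B * sqrt Y" using real_sqrt_le_mono[OF kY(2)] by (simp add: real_sqrt_mult)
   also have "\<dots> \<le> B * sqrt Y" using sB Y by (intro mult_right_mono) auto
   finally show ?thesis .
  qed
  have Y32: "Y * sqrt Y = Y powr (3/2)" using Y powr_add[of Y 1 "1/2"] by (simp add: powr_half_sqrt)
  have m1: "(real k + 1) * sqrt (real k + L) \<le> B ^ 2 * Y powr (3/2)"
  proof -
   have "(real k + 1) * sqrt (real k + L) \<le> (B * Y) * (B * sqrt Y)" using kY sq B Y L0 by (intro mult_mono) auto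
   then show ?thesis unfolding Y32[symmetric] by (simp add: power2_eq_square mult_ac)
  qed
  have m2: "real k + 1 \<le> B ^ 2 * Y powr (3/2)"
  proof -
   have "1 * sqrt 1 \<le> B * sqrt Y" using Y B by (intro mult_mono real_sqrt_le_mono) auto
   then have "(B * Y) * 1 \<le> (B * Y) * (B * sqrt Y)" using B Y by (intro mult_left_mono) auto
   then show ?thesis using kY(1) unfolding Y32[symmetric] by (simp add: power2_eq_square mult_ac)
  qed
  have Yc: "Y powr (3/2) \<le> 4 * (ln t powr (3/2) + L powr (3/2))"
  proof -
   let ?m = "max (ln t) L"
   have m: "?m > 0" using lt by (simp add: less_max_iff_disj)
   have "Y powr (3/2) \<le> (2 * ?m) powr (3/2)" using Y by (intro powr_mono2) (auto simp: Y_def)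
   also have "\<dots> = 2 powr (3/2) * ?m powr (3/2)" using m by (simp add: powr_mult)
   also have "\<dots> \<le> 4 * ?m powr (3/2)"
   proof -
    have "(2::real) powr (3/2) \<le> 2 powr 2" by (intro powr_mono) auto
    then show ?thesis by (intro mult_right_mono) (auto simp: powr_numeral)
   qed
   also have "?m powr (3/2) \<le> ln t powr (3/2) + L powr (3/2)" by (auto simp: max_def)
   finally show ?thesis by simp
  qed
  have La: "L powr (3/2) \<le> A1 * L powr c0" unfolding A1_def by (rule powr_le_rescale[OF L]) (simp add: c0_def)
  have Lb: "L powr (p * s) \<le> A2 * L powr c0" unfolding A2_def by (rule powr_le_rescale[OF L]) (simp add: c0_def)
  define R where "R = ln t powr (3/2) + L powr c0"
  have R: "0 \<le> R" "ln t powr (3/2) \<le> R" "L powr c0 \<le> R" by (auto simp: R_def)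
  have YR: "Y powr (3/2) \<le> 4 * (1 + A1) * R"
  proof -
   have "A1 * L powr c0 \<le> A1 * R" using A12 R by (intro mult_left_mono) auto
   then have "ln t powr (3/2) + L powr (3/2) \<le> (1 + A1) * R" using La R by (simp add: distrib_right)
   then have "4 * (ln t powr (3/2) + L powr (3/2)) \<le> 4 * ((1 + A1) * R)" by simp
   then show ?thesis using Yc by (simp only: mult.assoc)
  qed
  have conv: "(g powr real k) powr (- x) \<le> cl powr (- x) * t powr (- x)" if "0 < x" for x
  proof -
   have "(g powr real k) powr (- x) \<le> (cl * t) powr (- x)" using tl cl t0 that by (intro powr_mono2') auto
   then show ?thesis using cl t0 by (simp add: powr_mult)
  qed
  have zs: "\<zeta> = g powr (- s)" unfolding s_def using g \<zeta> by (simp add: powr_def)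
  have zk: "\<zeta> ^ k \<le> cl powr (- s) * t powr (- s)" using conv[OF s] g unfolding zs by (simp add: powr_powr powr_power mult_ac)
  have ak: "a ^ k \<le> cl powr (- qa) * t powr (- qa)" using conv[OF q(1)] g unfolding a_def by (simp add: powr_powr powr_power mult_ac)
  have bk: "b ^ k \<le> cl powr (- qb) * t powr (- qb)" using conv[OF q(2)] g unfolding b_def by (simp add: powr_powr powr_power mult_ac)
  \<comment> \<open>The initial error is discounted only from \<open>k1\<close> on. The missing
    factor, the inverse of \<open>\<zeta> ^ k1\<close>, equals \<open>(g powr k1) powr s\<close> and
    is therefore bounded by a power of \<open>L\<close> up to a constant.\<close>
  have zk1: "\<zeta> ^ (k - k1) \<le> \<zeta> ^ k * (K0 powr s * A2 * R)"
  proof -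
   have "\<zeta> ^ k = \<zeta> ^ (k - k1) * \<zeta> ^ k1" using kk by (simp flip: power_add)
   moreover have "1 \<le> \<zeta> ^ k1 * (K0 powr s * A2 * R)"
   proof -
    have "(g powr real k1) powr s \<le> (K0 * L powr p) powr s" using k1(1) s by (intro powr_mono2) auto
    also have "\<dots> = K0 powr s * L powr (p * s)" using K0 L0 by (simp add: powr_mult powr_powr)
    also have "\<dots> \<le> K0 powr s * (A2 * R)" using order.trans[OF Lb mult_left_mono[OF R(3), of A2]] A12 by (intro mult_left_mono) auto
    finally have "(g powr real k1) powr s \<le> K0 powr s * A2 * R" by (simp add: mult.assoc)
    then have "\<zeta> ^ k1 * (g powr real k1) powr s \<le> \<zeta> ^ k1 * (K0 powr s * A2 * R)" using \<zeta> by (intro mult_left_mono) auto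
    moreover have "\<zeta> ^ k1 * (g powr real k1) powr s = 1"
     unfolding zs using g by (simp add: powr_powr powr_power mult_ac flip: powr_add)
    ultimately show ?thesis by simp
   qed
   ultimately show ?thesis using \<zeta> mult_left_mono[of 1 "\<zeta> ^ k1 * (K0 powr s * A2 * R)" "\<zeta> ^ (k - k1)"] by (simp add: mult.assoc)
  qed
  let ?z = "t powr (- s)" and ?X = "(Cr * Ca + Cr * Cb) * B ^ 2 * 4 * (1 + A1)"
  have "e k \<le> \<zeta> ^ (k - k1) * D + Cr * Ca * ((real k + 1) * sqrt (real k + L)) * \<zeta> ^ k + Cr * Cb * (real k + 1) * \<zeta> ^ k
    + Cr * Ca * sqrt (real k + L) * a ^ k + Cr * Cb * b ^ k" using ek by (simp add: algebra_simps)
  also have "\<dots> \<le> \<zeta> ^ k * (K0 powr s * A2 * R) * D + Cr * Ca * (B ^ 2 * (4 * (1 + A1) * R)) * \<zeta> ^ k + Cr * Cb * (B ^ 2 * (4 * (1 + A1) * R)) * \<zeta> ^ k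
    + Cr * Ca * (B * sqrt Y) * a ^ k + Cr * Cb * b ^ k"
  proof (intro add_mono mult_right_mono mult_left_mono order_refl)
   have "B ^ 2 * Y powr (3/2) \<le> B ^ 2 * (4 * (1 + A1) * R)" using YR by (intro mult_left_mono) auto
   then show "(real k + 1) * sqrt (real k + L) \<le> B ^ 2 * (4 * (1 + A1) * R)" "real k + 1 \<le> B ^ 2 * (4 * (1 + A1) * R)"
    using m1 m2 by linarith+
  qed (use zk1 sq D Cr Ca Cb \<zeta> ab in auto)
  also have "\<dots> = \<zeta> ^ k * (R * (D * K0 powr s * A2 + ?X)) + (Cr * Ca * B) * (sqrt Y * a ^ k) + Cr * Cb * b ^ k"
   by (simp add: algebra_simps)
  also have "\<dots> \<le> (cl powr (- s) * ?z) * (R * (D * K0 powr s * A2 + ?X)) + (Cr * Ca * B) * (sqrt Y * (cl powr (- qa) * t powr (- qa)))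
    + Cr * Cb * (cl powr (- qb) * t powr (- qb))"
   using R Cr Ca Cb A12 B D Y K0 by (intro add_mono mult_right_mono mult_left_mono zk ak bk) auto
  also have "\<dots> = E1 * (R * ?z) + E2 * (sqrt Y * t powr (- qa)) + E3 * t powr (- qb)" by (simp add: E1_def E2_def E3_def mult_ac)
  also have "\<dots> \<le> (E1 + E2 + E3 + 1) * (R * ?z + sqrt Y * t powr (- qa) + t powr (- qb))"
  proof -
   have "0 \<le> R * ?z" "0 \<le> sqrt Y * t powr (- qa)" "0 \<le> t powr (- qb)" using R Y by auto
   then have "E1 * (R * ?z) \<le> (E1 + E2 + E3 + 1) * (R * ?z)" "E2 * (sqrt Y * t powr (- qa)) \<le> (E1 + E2 + E3 + 1) * (sqrt Y * t powr (- qa))"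
     "E3 * t powr (- qb) \<le> (E1 + E2 + E3 + 1) * t powr (- qb)" using E by (auto intro!: mult_right_mono)
   then show ?thesis unfolding distrib_left by linarith
  qed
  finally show "e k \<le> (E1 + E2 + E3 + 1) * ((ln t powr (3/2) + L powr c0) * t powr (ln \<zeta> / ln g) + sqrt (ln t + L) * t powr (- qa) + t powr (- qb))"
   by (simp add: R_def Y_def s_def)
 qed
qed

section \<open>Regularized least squares\<close>

lemma linear_sum_bound:
 fixes p :: "'t \<Rightarrow> real^'n::finite" and r :: "'t \<Rightarrow> real"
 assumes "\<And>i. \<bar>\<Sum>t\<in>I. p t $ i * r t\<bar> \<le> B"
 shows "\<bar>\<Sum>t\<in>I. (b \<bullet> p t) * r t\<bar> \<le> real CARD('n) * B * norm b"
proof -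
 have "(\<Sum>t\<in>I. (b \<bullet> p t) * r t) = (\<Sum>t\<in>I. \<Sum>i\<in>UNIV. b $ i * (p t $ i * r t))"
  by (simp add: inner_vec_def sum_distrib_right sum_distrib_left mult_ac)
 also have "\<dots> = (\<Sum>i\<in>UNIV. b $ i * (\<Sum>t\<in>I. p t $ i * r t))" by (subst sum.swap) (simp add: sum_distrib_left)
 finally have "\<bar>\<Sum>t\<in>I. (b \<bullet> p t) * r t\<bar> \<le> (\<Sum>i\<in>UNIV. \<bar>b $ i * (\<Sum>t\<in>I. p t $ i * r t)\<bar>)"
  by (simp only: sum_abs)
 also have "\<dots> \<le> (\<Sum>i\<in>(UNIV::'n set). norm b * B)"
  unfolding abs_mult by (intro sum_mono mult_mono assms component_le_norm_cart) auto
 finally show ?thesis by (simp add: mult_ac)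
qed

lemma bilinear_sum_bound:
 fixes p :: "'t \<Rightarrow> real^'n::finite" and q :: "'t \<Rightarrow> real^'k::finite"
 assumes "\<And>i l. \<bar>\<Sum>t\<in>I. p t $ i * q t $ l\<bar> \<le> B"
 shows "\<bar>\<Sum>t\<in>I. (b \<bullet> p t) * (c \<bullet> q t)\<bar> \<le> real CARD('n) * real CARD('k) * B * norm b * norm c"
proof -
 have "\<bar>\<Sum>t\<in>I. q t $ l * (b \<bullet> p t)\<bar> \<le> real CARD('n) * B * norm b" for l
  using linear_sum_bound[of p "\<lambda>t. q t $ l" I B b] assms by (simp add: mult.commute)
 from linear_sum_bound[of q "\<lambda>t. b \<bullet> p t" I, OF this, of c] show ?thesis by (simp add: mult_ac)
qed

lemma second_moment_deviation:
 fixes p :: "'t \<Rightarrow> real^'n::finite"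
 assumes "\<And>i l. \<bar>(\<Sum>t\<in>I. p t $ i * p t $ l) - n * S $ i $ l\<bar> \<le> B"
 shows "\<bar>(\<Sum>t\<in>I. (b \<bullet> p t)^2) - n * (b \<bullet> (S *v b))\<bar> \<le> real CARD('n) * real CARD('n) * B * (norm b)^2"
proof -
 have 1: "(\<Sum>t\<in>I. (b \<bullet> p t)^2) = (\<Sum>i\<in>UNIV. \<Sum>l\<in>UNIV. b $ i * b $ l * (\<Sum>t\<in>I. p t $ i * p t $ l))"
 proof -
  have "(\<Sum>t\<in>I. (b \<bullet> p t)^2) = (\<Sum>t\<in>I. \<Sum>i\<in>UNIV. \<Sum>l\<in>UNIV. b $ i * b $ l * (p t $ i * p t $ l))"
   by (simp add: inner_vec_def power2_eq_square sum_product mult_ac)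
  also have "\<dots> = (\<Sum>i\<in>UNIV. \<Sum>t\<in>I. \<Sum>l\<in>UNIV. b $ i * b $ l * (p t $ i * p t $ l))" by (rule sum.swap)
  also have "\<dots> = (\<Sum>i\<in>UNIV. \<Sum>l\<in>UNIV. \<Sum>t\<in>I. b $ i * b $ l * (p t $ i * p t $ l))"
   by (intro sum.cong refl sum.swap)
  finally show ?thesis by (simp add: sum_distrib_left)
 qed
 have 2: "n * (b \<bullet> (S *v b)) = (\<Sum>i\<in>UNIV. \<Sum>l\<in>UNIV. b $ i * b $ l * (n * S $ i $ l))"
  by (simp add: inner_vec_def matrix_vector_mult_def sum_distrib_left mult_ac)
 have "(\<Sum>t\<in>I. (b \<bullet> p t)^2) - n * (b \<bullet> (S *v b)) = (\<Sum>i\<in>UNIV. \<Sum>l\<in>UNIV. b $ i * b $ l * ((\<Sum>t\<in>I. p t $ i * p t $ l) - n * S $ i $ l))"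
  unfolding 1 2 by (simp add: sum_subtractf right_diff_distrib)
 also have "\<bar>\<dots>\<bar> \<le> (\<Sum>i\<in>UNIV. \<Sum>l\<in>UNIV. \<bar>b $ i * b $ l * ((\<Sum>t\<in>I. p t $ i * p t $ l) - n * S $ i $ l)\<bar>)"
  by (intro order.trans[OF sum_abs] sum_mono sum_abs)
 also have "\<dots> \<le> (\<Sum>i\<in>(UNIV::'n set). \<Sum>l\<in>(UNIV::'n set). norm b * norm b * B)"
  unfolding abs_mult by (intro sum_mono mult_mono assms component_le_norm_cart) auto
 finally show ?thesis by (simp add: mult_ac power2_eq_square)
qed

lemma ident_on_quadratic: "supp_in J q \<Longrightarrow> q \<bullet> (ident_on J *v q) = (norm q)^2"
proof -
 assume q: "supp_in J q"
 have "(ident_on J *v q) $ i = (if i \<in> J then q $ i else 0)" for i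
  by (simp add: matrix_vector_mult_def ident_on_def if_distrib[of "\<lambda>x. x * _"] cong: if_cong)
 then have "(ident_on J *v q) $ i = q $ i" for i using q by (auto simp: supp_in_def)
 then have "ident_on J *v q = q" by (simp add: vec_eq_iff)
 then show ?thesis by (simp add: power2_norm_eq_inner)
qed

text \<open>Keeps a small multiple of \<open>a^2\<close> although \<open>a + y\<close> may cancel: a
  suitable \<open>\<theta>\<close> makes the loss \<open>2 * \<theta> * y^2\<close> small enough to
  be absorbed by other terms.\<close>

lemma square_shift_lower:
 fixes a y \<theta> :: real assumes "0 \<le> \<theta>" "\<theta> \<le> 1/2" shows "\<theta> * a^2 - 2 * \<theta> * y^2 \<le> (a + y)^2"
proof -
 have "a^2 = ((a + y) - y)^2" by simp
 also have "\<dots> \<le> 2 * (a + y)^2 + 2 * y^2" using sum_squares_bound[of "a + y" "- y"] by (simp add: power2_eq_square algebra_simps)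
 finally have "\<theta> * a^2 \<le> \<theta> * (2 * (a + y)^2 + 2 * y^2)" using assms by (intro mult_left_mono) auto
 also have "\<dots> = 2 * \<theta> * (a + y)^2 + 2 * \<theta> * y^2" by (simp add: algebra_simps)
 also have "2 * \<theta> * (a + y)^2 \<le> 1 * (a + y)^2" using assms by (intro mult_right_mono) auto
 finally show ?thesis by simp
qed

text \<open>The predictable part \<open>g\<close> of the state may be degenerate; the quadratic form is bounded below
 because the innovations \<open>w\<close> and \<open>v\<close> excite the directions \<open>b\<close> and \<open>q\<close>, and the constant
 direction \<open>a\<close> can only be cancelled by \<open>b \<bullet> g\<close> if \<open>b\<close> is large.\<close>
lemma gram_lower_bound:
 fixes g w :: "nat \<Rightarrow> real^'n::finite" and v :: "nat \<Rightarrow> real^'d::finite"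
 assumes n: "0 \<le> n" "real (card I) = n" and \<sigma>: "0 < \<sigma>" "\<And>b. \<sigma> * (norm b)^2 \<le> b \<bullet> (S *v b)" and K: "0 < K"
  and w1: "\<And>i. \<bar>\<Sum>t\<in>I. w t $ i\<bar> \<le> B" and v1: "\<And>i. \<bar>\<Sum>t\<in>I. v t $ i\<bar> \<le> B"
  and gw: "\<And>i l. \<bar>\<Sum>t\<in>I. g t $ i * w t $ l\<bar> \<le> B" and gv: "\<And>i l. \<bar>\<Sum>t\<in>I. g t $ i * v t $ l\<bar> \<le> B"
  and wv: "\<And>i l. \<bar>\<Sum>t\<in>I. w t $ i * v t $ l\<bar> \<le> B"
  and ww: "\<And>i l. \<bar>(\<Sum>t\<in>I. w t $ i * w t $ l) - n * S $ i $ l\<bar> \<le> B"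
  and vv: "\<And>i l. \<bar>(\<Sum>t\<in>I. v t $ i * v t $ l) - n * ident_on J $ i $ l\<bar> \<le> B"
  and g2: "(\<Sum>t\<in>I. (norm (g t))^2) \<le> K * n" and q: "supp_in J q"
  and D: "real CARD('n) \<le> D" "real CARD('d) \<le> D"
  and c: "c = min (min (1/2) (\<sigma> / (4 * K))) (\<sigma> / 2)" and small: "24 * D^2 * B \<le> c * n"
 shows "c / 2 * n * (a^2 + (norm b)^2 + (norm q)^2) \<le> (\<Sum>t\<in>I. (a + b \<bullet> (g t + w t) + q \<bullet> v t)^2)"
proof -
 \<comment> \<open>Small enough that cancelling the constant by the predictable part, whose energy
   is at most \<open>K * n\<close>, consumes at most half of the excitation
   \<open>n * (\<sigma> * (norm b)^2)\<close> due to the innovations.\<close>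
 define \<theta> where "\<theta> = min (1/2) (\<sigma> / (4 * K))"
 have \<theta>: "0 \<le> \<theta>" "\<theta> \<le> 1/2" "\<theta> \<le> \<sigma> / (4 * K)" using \<sigma> K by (auto simp: \<theta>_def)
 have cc: "c \<le> \<theta>" "c \<le> \<sigma> / 2" "c \<le> 1" using c \<theta> by (auto simp: \<theta>_def)
 have D1: "1 \<le> D"
 proof -
  have "0 < CARD('n)" by simp
  then have "1 \<le> real CARD('n)" by linarith
  then show ?thesis using D(1) by linarith
 qed
 have B: "0 \<le> B" using w1 by (meson abs_ge_zero order_trans)
 define N where "N = a^2 + (norm b)^2 + (norm q)^2"
 have N0: "0 \<le> N" by (simp add: N_def)
 have DD: "real CARD('n) * real CARD('n) \<le> D^2" "real CARD('n) * real CARD('d) \<le> D^2" "real CARD('d) * real CARD('d) \<le> D^2"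
  unfolding power2_eq_square using D D1 by (auto intro!: mult_mono)
 have "D \<le> D * D" using D1 mult_left_mono[of 1 D D] by simp
 then have DL: "real CARD('n) \<le> D^2" "real CARD('d) \<le> D^2" using D by (auto simp: power2_eq_square)
 have pr: "X * Y \<le> N" if "X^2 \<le> N" "Y^2 \<le> N" for X Y :: real using sum_squares_bound[of X Y] that by linarith
 have sqN: "\<bar>a\<bar>^2 \<le> N" "(norm b)^2 \<le> N" "(norm q)^2 \<le> N" by (auto simp: N_def)
 have est: "k * B * X * Y \<le> D^2 * B * N" if "k \<le> D^2" "0 \<le> k" "0 \<le> X" "0 \<le> Y" "X^2 \<le> N" "Y^2 \<le> N" for k X Y :: real
 proof -
  have "k * B * (X * Y) \<le> D^2 * B * N" using that B pr[OF that(5,6)] N0 by (intro mult_mono) auto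
  then show ?thesis by (simp add: mult_ac)
 qed
 have t1: "\<bar>a * (\<Sum>t\<in>I. b \<bullet> w t)\<bar> \<le> D^2 * B * N"
 proof -
  have "\<bar>a * (\<Sum>t\<in>I. b \<bullet> w t)\<bar> \<le> \<bar>a\<bar> * (real CARD('n) * B * norm b)"
   unfolding abs_mult using linear_sum_bound[of w "\<lambda>_. 1" I B b] w1 by (intro mult_left_mono) auto
  also have "\<dots> = real CARD('n) * B * norm b * \<bar>a\<bar>" by simp
  also have "\<dots> \<le> D^2 * B * N" by (rule est) (use DL sqN in auto)
  finally show ?thesis .
 qed
 have t2: "\<bar>a * (\<Sum>t\<in>I. q \<bullet> v t)\<bar> \<le> D^2 * B * N"
 proof -
  have "\<bar>a * (\<Sum>t\<in>I. q \<bullet> v t)\<bar> \<le> \<bar>a\<bar> * (real CARD('d) * B * norm q)"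
   unfolding abs_mult using linear_sum_bound[of v "\<lambda>_. 1" I B q] v1 by (intro mult_left_mono) auto
  also have "\<dots> = real CARD('d) * B * norm q * \<bar>a\<bar>" by simp
  also have "\<dots> \<le> D^2 * B * N" by (rule est) (use DL sqN in auto)
  finally show ?thesis .
 qed
 have t3: "\<bar>\<Sum>t\<in>I. (b \<bullet> g t) * (b \<bullet> w t)\<bar> \<le> D^2 * B * N"
  using bilinear_sum_bound[of g w I, OF gw, of b b] est[OF DD(1), of "norm b" "norm b"] sqN by simp
 have t4: "\<bar>\<Sum>t\<in>I. (b \<bullet> g t) * (q \<bullet> v t)\<bar> \<le> D^2 * B * N"
  using bilinear_sum_bound[of g v I, OF gv, of b q] est[OF DD(2), of "norm b" "norm q"] sqN by simp
 have t5: "\<bar>\<Sum>t\<in>I. (b \<bullet> w t) * (q \<bullet> v t)\<bar> \<le> D^2 * B * N"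
  using bilinear_sum_bound[of w v I, OF wv, of b q] est[OF DD(2), of "norm b" "norm q"] sqN by simp
 have t6: "n * (\<sigma> * (norm b)^2) - D^2 * B * N \<le> (\<Sum>t\<in>I. (b \<bullet> w t)^2)"
  using second_moment_deviation[of w I n S B b, OF ww] est[OF DD(1), of "norm b" "norm b"] sqN
   mult_left_mono[OF \<sigma>(2)[of b] n(1)] by (simp add: power2_eq_square mult.assoc)
 have t7: "n * (norm q)^2 - D^2 * B * N \<le> (\<Sum>t\<in>I. (q \<bullet> v t)^2)"
  using second_moment_deviation[of v I n "ident_on J" B q, OF vv] est[OF DD(3), of "norm q" "norm q"] sqN
  unfolding ident_on_quadratic[OF q] by (simp add: power2_eq_square mult.assoc)
 have t8: "n * (\<theta> * a^2) - n * (\<sigma> / 2 * (norm b)^2) \<le> (\<Sum>t\<in>I. (a + b \<bullet> g t)^2)"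
 proof -
  have "(\<Sum>t\<in>I. \<theta> * a^2 - 2 * \<theta> * ((norm b)^2 * (norm (g t))^2)) \<le> (\<Sum>t\<in>I. (a + b \<bullet> g t)^2)"
  proof (rule sum_mono)
   fix t
   have "(b \<bullet> g t)^2 \<le> (norm b)^2 * (norm (g t))^2" using Cauchy_Schwarz_ineq[of b "g t"] by (simp add: power2_norm_eq_inner)
   then have "2 * \<theta> * (b \<bullet> g t)^2 \<le> 2 * \<theta> * ((norm b)^2 * (norm (g t))^2)" using \<theta> by (intro mult_left_mono) auto
   then show "\<theta> * a^2 - 2 * \<theta> * ((norm b)^2 * (norm (g t))^2) \<le> (a + b \<bullet> g t)^2"
    using square_shift_lower[OF \<theta>(1,2), of a "b \<bullet> g t"] by linarith
  qed
  moreover have "(\<Sum>t\<in>I. \<theta> * a^2 - 2 * \<theta> * ((norm b)^2 * (norm (g t))^2)) = n * (\<theta> * a^2) - 2 * \<theta> * (norm b)^2 * (\<Sum>t\<in>I. (norm (g t))^2)"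
   using n(2) by (simp add: sum_subtractf sum_distrib_left mult_ac)
  moreover have "2 * \<theta> * (norm b)^2 * (\<Sum>t\<in>I. (norm (g t))^2) \<le> 2 * \<theta> * (norm b)^2 * (K * n)"
   using g2 \<theta> by (intro mult_left_mono) auto
  moreover have "2 * \<theta> * (norm b)^2 * (K * n) \<le> n * (\<sigma> / 2 * (norm b)^2)"
  proof -
   have "2 * \<theta> * K \<le> \<sigma> / 2" using \<theta>(3) K by (simp add: field_simps)
   then have "(2 * \<theta> * K) * (n * (norm b)^2) \<le> (\<sigma> / 2) * (n * (norm b)^2)" using n by (intro mult_right_mono) auto
   then show ?thesis by (simp add: mult_ac)
  qed
  ultimately show ?thesis by linarith
 qed
 have expand: "(\<Sum>t\<in>I. (a + b \<bullet> (g t + w t) + q \<bullet> v t)^2) =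
   (\<Sum>t\<in>I. (a + b \<bullet> g t)^2) + (\<Sum>t\<in>I. (b \<bullet> w t)^2) + (\<Sum>t\<in>I. (q \<bullet> v t)^2)
   + 2 * (a * (\<Sum>t\<in>I. b \<bullet> w t)) + 2 * (a * (\<Sum>t\<in>I. q \<bullet> v t)) + 2 * (\<Sum>t\<in>I. (b \<bullet> g t) * (b \<bullet> w t))
   + 2 * (\<Sum>t\<in>I. (b \<bullet> g t) * (q \<bullet> v t)) + 2 * (\<Sum>t\<in>I. (b \<bullet> w t) * (q \<bullet> v t))"
  unfolding sum_distrib_left sum.distrib[symmetric] by (rule sum.cong) (auto simp: inner_add_right power2_eq_square algebra_simps)
 \<comment> \<open>Five cross terms counted twice and two deviations of second moments make 12. The
   24 in the smallness hypothesis bounds them together by half of the main term.\<close>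
 have "n * (\<theta> * a^2) + n * (\<sigma> / 2 * (norm b)^2) + n * (norm q)^2 - 12 * (D^2 * B * N) \<le> (\<Sum>t\<in>I. (a + b \<bullet> (g t + w t) + q \<bullet> v t)^2)"
 proof -
  have h: "n * (\<sigma> * (norm b)^2) = 2 * (n * (\<sigma> / 2 * (norm b)^2))" by simp
  show ?thesis unfolding expand using t1 t2 t3 t4 t5 t6 t7 t8 unfolding abs_le_iff h by linarith
 qed
 moreover have "n * (c * N) \<le> n * (\<theta> * a^2) + n * (\<sigma> / 2 * (norm b)^2) + n * (norm q)^2"
 proof -
  have "c * a^2 \<le> \<theta> * a^2" "c * (norm b)^2 \<le> \<sigma> / 2 * (norm b)^2" "c * (norm q)^2 \<le> 1 * (norm q)^2"
   using cc by (intro mult_right_mono; simp)+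
  then have "c * N \<le> \<theta> * a^2 + \<sigma> / 2 * (norm b)^2 + (norm q)^2" by (simp add: N_def distrib_left)
  then have "n * (c * N) \<le> n * (\<theta> * a^2 + \<sigma> / 2 * (norm b)^2 + (norm q)^2)" using n(1) by (rule mult_left_mono)
  then show ?thesis by (simp only: distrib_left)
 qed
 moreover have "24 * D^2 * B * N \<le> c * n * N" using small N0 by (rule mult_right_mono)
 ultimately show ?thesis unfolding N_def[symmetric] by (simp add: mult_ac)
qed

section \<open>Normal equations and the errors of the two estimates\<close>

lemma ls_gram_vector: "ls_gram \<beta> z I *v y = \<beta> *\<^sub>R y + (\<Sum>t\<in>I. (z t \<bullet> y) *\<^sub>R z t)"
proof -
 have "outer (z t) (z t) *v y = (z t \<bullet> y) *\<^sub>R z t" for t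
  by (simp add: vec_eq_iff matrix_vector_mult_def outer_def inner_vec_def sum_distrib_left mult_ac)
 then show ?thesis by (simp add: ls_gram_def matrix_vector_mult_add_rdistrib matrix_vector_mult_sum scaleR_matrix_vector_assoc[symmetric])
qed

lemma ls_gram_quadratic: "y \<bullet> (ls_gram \<beta> z I *v y) = \<beta> * (norm y)^2 + (\<Sum>t\<in>I. (y \<bullet> z t)^2)"
 unfolding power2_norm_eq_inner by (simp add: ls_gram_vector inner_add_right inner_sum_right power2_eq_square inner_commute)

lemma invertible_mult_matrix_inv: "invertible A \<Longrightarrow> A ** matrix_inv A = mat 1"
 unfolding invertible_def matrix_inv_def by (rule conjunct1[OF someI_ex])

lemma ls_gram_ls_param:
 assumes "0 < \<beta>"
 shows "ls_gram \<beta> z I ** ls_param \<beta> z x I = (\<Sum>t\<in>I. outer (z t) (x (Suc t)))"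
proof -
 have "y = 0" if "ls_gram \<beta> z I *v y = 0" for y
 proof -
  have "\<beta> * (norm y)^2 + (\<Sum>t\<in>I. (y \<bullet> z t)^2) = 0" using ls_gram_quadratic[of y \<beta> z I] that by simp
  moreover have "0 \<le> (\<Sum>t\<in>I. (y \<bullet> z t)^2)" by (intro sum_nonneg) simp
  ultimately have "\<beta> * (norm y)^2 \<le> 0" by linarith
  then show ?thesis using assms by (simp add: mult_le_0_iff)
 qed
 then have "invertible (ls_gram \<beta> z I)" unfolding invertible_left_inverse matrix_left_invertible_ker by blast
 then show ?thesis by (simp add: ls_param_def matrix_mul_assoc invertible_mult_matrix_inv)
qed

lemma ls_param_column:
 assumes "0 < \<beta>"
 shows "ls_gram \<beta> z I *v column l (ls_param \<beta> z x I) = (\<Sum>t\<in>I. x (Suc t) $ l *\<^sub>R z t)"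
proof -
 have "ls_gram \<beta> z I *v column l (ls_param \<beta> z x I) = column l (ls_gram \<beta> z I ** ls_param \<beta> z x I)"
  by (simp add: vec_eq_iff column_def matrix_vector_mult_def matrix_matrix_mult_def)
 then show ?thesis unfolding ls_gram_ls_param[OF assms] by (simp add: vec_eq_iff column_def outer_def mult.commute)
qed

lemma vector_matrix_mult_component: "(y v* A) $ l = column l A \<bullet> (y :: real^'k::finite)"
 by (simp add: vector_matrix_mult_def column_def inner_vec_def mult.commute)

text \<open>The normal equations, rewritten for the error in one column: besides the residuals, the
  regularization enters as the bias \<open>\<beta> *\<^sub>R column l \<Theta>\<close>.\<close>

lemma ls_error_identity:
 assumes \<beta>: "0 < \<beta>" and r: "\<And>t. t \<in> I \<Longrightarrow> x (Suc t) = transpose \<Theta> *v z t + r t"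
 shows "ls_gram \<beta> z I *v (column l (ls_param \<beta> z x I) - column l \<Theta>) = (\<Sum>t\<in>I. r t $ l *\<^sub>R z t) - \<beta> *\<^sub>R column l \<Theta>"
proof -
 have "(\<Sum>t\<in>I. x (Suc t) $ l *\<^sub>R z t) = (\<Sum>t\<in>I. (column l \<Theta> \<bullet> z t) *\<^sub>R z t) + (\<Sum>t\<in>I. r t $ l *\<^sub>R z t)"
  unfolding sum.distrib[symmetric] by (rule sum.cong) (auto simp: r vector_matrix_mult_component scaleR_add_left)
 then show ?thesis
  by (simp add: matrix_vector_mult_diff_distrib ls_param_column[OF \<beta>] ls_gram_vector[of _ _ _ "column l \<Theta>"] inner_commute)
qed

text \<open>In a coordinate in which all regressors vanish, the normal equation reduces to
  \<open>\<beta>\<close> times the entry being zero. Thus the padded rows of an estimate vanish, as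
  membership in \<open>models\<close> demands.\<close>

lemma ls_param_support:
 assumes \<beta>: "0 < \<beta>" and z: "\<And>t. t \<in> I \<Longrightarrow> z t $ i = 0"
 shows "ls_param \<beta> z x I $ i = 0"
proof -
 have "ls_param \<beta> z x I $ i $ l = 0" for l
 proof -
  have "(\<beta> *\<^sub>R column l (ls_param \<beta> z x I) + (\<Sum>t\<in>I. (z t \<bullet> column l (ls_param \<beta> z x I)) *\<^sub>R z t)) $ i = (\<Sum>t\<in>I. x (Suc t) $ l *\<^sub>R z t) $ i"
   using ls_param_column[OF \<beta>, of z I l x] unfolding ls_gram_vector by simp
  then show ?thesis using z \<beta> by (simp add: column_def)
 qed
 then show ?thesis by (simp add: vec_eq_iff)
qed

lemma ls_cov_psd: "psd (ls_cov \<beta> z x I)"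
proof -
 define e where "e t = x (Suc t) - transpose (ls_param \<beta> z x I) *v z t" for t
 have ov: "outer (e t) (e t) *v y = (e t \<bullet> y) *\<^sub>R e t" for t y
  by (simp add: vec_eq_iff matrix_vector_mult_def outer_def inner_vec_def sum_distrib_left mult_ac)
 have c: "ls_cov \<beta> z x I = (1 / real (card I)) *\<^sub>R (\<Sum>t\<in>I. outer (e t) (e t))" by (simp add: ls_cov_def e_def Let_def)
 have "y \<bullet> (ls_cov \<beta> z x I *v y) = (1 / real (card I)) * (\<Sum>t\<in>I. (e t \<bullet> y)^2)" for y
  unfolding c scaleR_matrix_vector_assoc[symmetric] matrix_vector_mult_sum ov by (simp add: inner_sum_right power2_eq_square inner_commute)
 then have "0 \<le> y \<bullet> (ls_cov \<beta> z x I *v y)" for y by (simp add: sum_nonneg)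
 moreover have "transpose (ls_cov \<beta> z x I) = ls_cov \<beta> z x I"
  unfolding c by (simp add: vec_eq_iff transpose_def outer_def mult.commute)
 ultimately show ?thesis by (simp add: psd_def)
qed

definition reg_const :: "real^(unit + ('n::finite + 'd::finite)) \<Rightarrow> real" where "reg_const y = y $ Inl ()"
definition reg_state :: "real^(unit + ('n::finite + 'd::finite)) \<Rightarrow> real^'n" where "reg_state y = (\<chi> j. y $ Inr (Inl j))"
definition reg_control :: "real^(unit + ('n::finite + 'd::finite)) \<Rightarrow> real^'d" where "reg_control y = (\<chi> j. y $ Inr (Inr j))"

lemma inner_regressor: "y \<bullet> regressor x u = reg_const y + reg_state y \<bullet> x + reg_control y \<bullet> u"
 by (simp add: inner_vec_def sum_regressor_index regressor_def reg_const_def reg_state_def reg_control_def)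

lemma norm_reg: "(norm y)^2 = (reg_const y)^2 + (norm (reg_state y))^2 + (norm (reg_control y))^2" unfolding power2_norm_eq_inner
 by (simp add: inner_vec_def sum_regressor_index reg_const_def reg_state_def reg_control_def power2_eq_square)

lemma norm_regressor: "(norm (regressor x u))^2 = 1 + (norm x)^2 + (norm u)^2"
 unfolding norm_reg by (simp add: regressor_def reg_const_def reg_state_def reg_control_def)

lemma norm_vec_transpose: "norm (q v* F) \<le> spec_norm F * norm q" for F :: "real^'n::finite^'d::finite"
proof (cases "q v* F = 0")
 case False
 have "(norm (q v* F))^2 = q \<bullet> (F *v (q v* F))" by (simp add: power2_norm_eq_inner dot_lmul_matrix)
 also have "\<dots> \<le> norm q * norm (F *v (q v* F))" by (rule norm_cauchy_schwarz)
 also have "\<dots> \<le> norm q * (spec_norm F * norm (q v* F))" by (intro mult_left_mono norm_matrix_vector_le) simp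
 finally show ?thesis using False by (simp add: power2_eq_square mult_ac)
qed simp

text \<open>In the coordinates \<open>(1, x, v)\<close> instead of \<open>(1, x, u)\<close> the Gram matrix has all eigenvalues of
 order \<open>n\<close>; the factor \<open>1 / \<alpha>\<close> of the error enters only through the change of coordinates.\<close>
lemma ls_param_error:
 fixes x :: "nat \<Rightarrow> real^'n::finite" and v :: "nat \<Rightarrow> real^'d::finite" and F :: "real^'n^'d"
 assumes \<beta>: "0 < \<beta>" and \<alpha>: "0 < \<alpha>" "\<alpha> \<le> Amax"
  and u: "\<And>t. t \<in> I \<Longrightarrow> u t = - (F *v x t) + f + \<alpha> *\<^sub>R v t"
  and z: "\<And>t. z t = regressor (x t) (u t)"
  and r: "\<And>t. t \<in> I \<Longrightarrow> x (Suc t) = transpose \<Theta> *v z t + r t"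
  and F: "spec_norm F \<le> \<kappa>" and f: "norm f \<le> \<kappa>'" and \<Theta>: "\<And>l. norm (column l \<Theta>) \<le> T"
  and supp: "\<And>i. i \<notin> J \<Longrightarrow> \<Theta> $ Inr (Inr i) = 0" "\<And>t i. t \<in> I \<Longrightarrow> i \<notin> J \<Longrightarrow> u t $ i = 0"
  and cn: "0 < cn" and gram: "\<And>a b q. supp_in J q \<Longrightarrow> cn * (a^2 + (norm b)^2 + (norm q)^2) \<le> (\<Sum>t\<in>I. (a + b \<bullet> x t + q \<bullet> v t)^2)"
  and r1: "\<And>l. \<bar>\<Sum>t\<in>I. r t $ l\<bar> \<le> B" and rx: "\<And>i l. \<bar>\<Sum>t\<in>I. x t $ i * r t $ l\<bar> \<le> B"
  and rv: "\<And>i l. \<bar>\<Sum>t\<in>I. v t $ i * r t $ l\<bar> \<le> B"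
  and C1: "C1 = 2 * Amax + 1 + \<kappa> + \<kappa>'" and D: "1 + real CARD('n) + real CARD('d) \<le> D"
 shows "norm (column l (ls_param \<beta> z x I) - column l \<Theta>) \<le> C1 / (\<alpha> * cn) * (D * B + \<beta> * T * C1 / \<alpha>)"
proof -
 define e where "e = column l (ls_param \<beta> z x I) - column l \<Theta>"
 define q2 where "q2 = reg_control e"
 \<comment> \<open>Substituting \<open>u = - F x + f + \<alpha> v\<close> into
   \<open>e \<bullet> z\<close> and collecting the constant, the state and the noise yields the
   coefficients \<open>a\<close>, \<open>b\<close> and \<open>q\<close>.\<close>
 define a where "a = reg_const e + q2 \<bullet> f"
 define b where "b = reg_state e - q2 v* F"
 define q where "q = \<alpha> *\<^sub>R q2"
 have \<kappa>: "0 \<le> \<kappa>" "0 \<le> \<kappa>'" using F f spec_norm_nonneg[of F] norm_ge_zero[of f] by linarith+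
 have B: "0 \<le> B" using r1 by (meson abs_ge_zero order_trans)
 have T: "0 \<le> T" using \<Theta> norm_ge_zero order_trans by blast
 have ez: "e \<bullet> z t = a + b \<bullet> x t + q \<bullet> v t" if "t \<in> I" for t
  unfolding z inner_regressor u[OF that] a_def b_def q_def q2_def[symmetric]
  by (simp add: inner_add_right inner_diff_left inner_diff_right dot_lmul_matrix)
 have suppe: "supp_in J q"
 proof -
  have "q2 $ i = 0" if i: "i \<notin> J" for i
  proof -
   have "ls_param \<beta> z x I $ Inr (Inr i) = 0"
    by (rule ls_param_support[OF \<beta>]) (use supp(2)[OF _ i] in \<open>auto simp: z regressor_def\<close>)
   then show ?thesis using supp(1)[OF i] by (simp add: q2_def reg_control_def e_def column_def)
  qed
  then show ?thesis by (auto simp: supp_in_def q_def)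
 qed
 define N where "N = sqrt (a^2 + (norm b)^2 + (norm q)^2)"
 have N2: "N^2 = a^2 + (norm b)^2 + (norm q)^2" by (simp add: N_def)
 have N0: "0 \<le> N" by (simp add: N_def)
 have le: "\<bar>a\<bar> \<le> N" "norm b \<le> N" "norm q \<le> N" by (rule power2_le_imp_le[OF _ N0]; simp add: N2)+
 have "norm e \<le> \<bar>reg_const e\<bar> + norm (reg_state e) + norm q2"
 proof (rule power2_le_imp_le)
  have "0 \<le> \<bar>reg_const e\<bar> * norm (reg_state e)" "0 \<le> \<bar>reg_const e\<bar> * norm q2" "0 \<le> norm (reg_state e) * norm q2" by auto
  then show "(norm e)^2 \<le> (\<bar>reg_const e\<bar> + norm (reg_state e) + norm q2)^2"
   unfolding norm_reg q2_def[symmetric] by (simp add: power2_eq_square algebra_simps)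
 qed simp
 also have "\<dots> \<le> (N + N / \<alpha> * \<kappa>') + (N + \<kappa> * (N / \<alpha>)) + N / \<alpha>"
 proof -
  have q2: "norm q2 \<le> N / \<alpha>" using le(3) \<alpha> by (simp add: q_def field_simps)
  have "\<bar>q2 \<bullet> f\<bar> \<le> norm q2 * norm f" by (rule Cauchy_Schwarz_ineq2)
  also have "\<dots> \<le> N / \<alpha> * \<kappa>'" using q2 f N0 \<alpha> by (intro mult_mono) auto
  finally have 1: "\<bar>reg_const e\<bar> \<le> N + N / \<alpha> * \<kappa>'" using le(1) unfolding a_def by linarith
  have "norm (q2 v* F) \<le> spec_norm F * norm q2" by (rule norm_vec_transpose)
  also have "\<dots> \<le> \<kappa> * (N / \<alpha>)" using q2 F \<kappa> by (intro mult_mono) auto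
  finally have "norm (q2 v* F) \<le> \<kappa> * (N / \<alpha>)" .
  moreover have "norm (reg_state e) \<le> norm b + norm (q2 v* F)" unfolding b_def by (metis diff_add_cancel norm_triangle_ineq)
  ultimately show ?thesis using 1 q2 le(2) by linarith
 qed
 \<comment> \<open>The two terms without \<open>1 / \<alpha>\<close> are absorbed by
   \<open>1 \<le> Amax / \<alpha>\<close>, which explains \<open>2 * Amax\<close> in
   \<open>C1\<close>.\<close>
 also have "\<dots> \<le> C1 / \<alpha> * N"
 proof -
  have "2 * N \<le> 2 * Amax / \<alpha> * N" using \<alpha> N0 mult_right_mono[of 2 "2 * Amax / \<alpha>" N] by (simp add: field_simps)
  moreover have "C1 / \<alpha> * N = 2 * Amax / \<alpha> * N + N / \<alpha> + \<kappa> * (N / \<alpha>) + N / \<alpha> * \<kappa>'"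
   unfolding C1 by (simp add: add_divide_distrib algebra_simps)
  ultimately show ?thesis by linarith
 qed
 finally have eN: "norm e \<le> C1 / \<alpha> * N" .
 \<comment> \<open>The excitation gives a lower bound quadratic in \<open>N\<close>, the error
   identity an upper bound linear in \<open>N\<close>; dividing by \<open>N\<close> bounds the
   error.\<close>
 have "cn * N^2 \<le> (\<Sum>t\<in>I. (e \<bullet> z t)^2)" unfolding N2 using gram[OF suppe, of a b] ez by simp
 also have "\<dots> \<le> e \<bullet> (ls_gram \<beta> z I *v e)" unfolding ls_gram_quadratic using \<beta> by simp
 also have "\<dots> = (\<Sum>t\<in>I. r t $ l * (e \<bullet> z t)) - \<beta> * (e \<bullet> column l \<Theta>)"
 proof -
  have "ls_gram \<beta> z I *v e = (\<Sum>t\<in>I. r t $ l *\<^sub>R z t) - \<beta> *\<^sub>R column l \<Theta>"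
   unfolding e_def by (rule ls_error_identity[OF \<beta>]) (rule r)
  then show ?thesis by (simp add: inner_diff_right inner_sum_right)
 qed
 also have "(\<Sum>t\<in>I. r t $ l * (e \<bullet> z t)) = a * (\<Sum>t\<in>I. r t $ l) + (\<Sum>t\<in>I. (b \<bullet> x t) * r t $ l) + (\<Sum>t\<in>I. (q \<bullet> v t) * r t $ l)"
  unfolding sum_distrib_left sum.distrib[symmetric] by (rule sum.cong) (auto simp: ez algebra_simps)
 also have "\<dots> - \<beta> * (e \<bullet> column l \<Theta>) \<le> D * B * N + \<beta> * (C1 / \<alpha> * N * T)"
 proof -
  have "a * (\<Sum>t\<in>I. r t $ l) \<le> \<bar>a\<bar> * \<bar>\<Sum>t\<in>I. r t $ l\<bar>" by (metis abs_ge_self abs_mult)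
  also have "\<dots> \<le> N * B" using le r1 N0 by (intro mult_mono) auto
  finally have 1: "a * (\<Sum>t\<in>I. r t $ l) \<le> N * B" .
  have "real CARD('n) * B * norm b \<le> real CARD('n) * B * N" using le B by (intro mult_left_mono) auto
  then have 2: "(\<Sum>t\<in>I. (b \<bullet> x t) * r t $ l) \<le> real CARD('n) * B * N" using linear_sum_bound[of x "\<lambda>t. r t $ l" I B b, OF rx] by linarith
  have "real CARD('d) * B * norm q \<le> real CARD('d) * B * N" using le B by (intro mult_left_mono) auto
  then have 3: "(\<Sum>t\<in>I. (q \<bullet> v t) * r t $ l) \<le> real CARD('d) * B * N" using linear_sum_bound[of v "\<lambda>t. r t $ l" I B q, OF rv] by linarith
  have "- (e \<bullet> column l \<Theta>) \<le> norm e * norm (column l \<Theta>)" using Cauchy_Schwarz_ineq2[of e "column l \<Theta>"] by linarith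
  also have "\<dots> \<le> C1 / \<alpha> * N * T" using eN \<Theta> order_trans[OF norm_ge_zero eN] by (intro mult_mono) auto
  finally have "\<beta> * - (e \<bullet> column l \<Theta>) \<le> \<beta> * (C1 / \<alpha> * N * T)" using \<beta> by (intro mult_left_mono) auto
  then have 4: "- (\<beta> * (e \<bullet> column l \<Theta>)) \<le> \<beta> * (C1 / \<alpha> * N * T)" by simp
  have "(1 + real CARD('n) + real CARD('d)) * (B * N) \<le> D * (B * N)" using D B N0 by (intro mult_right_mono) auto
  then have "N * B + real CARD('n) * B * N + real CARD('d) * B * N \<le> D * B * N" by (simp add: algebra_simps)
  then show ?thesis using 1 2 3 4 by linarith
 qed
 finally have "cn * N * N \<le> (D * B + \<beta> * T * C1 / \<alpha>) * N" by (simp add: power2_eq_square algebra_simps)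
 moreover have "0 \<le> D * B + \<beta> * T * C1 / \<alpha>"
  using D B T \<alpha> \<beta> \<kappa> C1 by (intro add_nonneg_nonneg mult_nonneg_nonneg divide_nonneg_nonneg) auto
 ultimately have "cn * N \<le> D * B + \<beta> * T * C1 / \<alpha>" using N0 by (cases "N = 0") (auto simp: mult_le_cancel_right)
 then have "N \<le> (D * B + \<beta> * T * C1 / \<alpha>) / cn" using cn by (simp add: field_simps)
 then have "C1 / \<alpha> * N \<le> C1 / \<alpha> * ((D * B + \<beta> * T * C1 / \<alpha>) / cn)" using C1 \<kappa> \<alpha> by (intro mult_left_mono) auto
 then show ?thesis using eN unfolding e_def[symmetric] by (simp add: mult_ac)
qed

text \<open>The residual is noise plus a perturbation \<open>\<rho>\<close>. The mixed sums are
  estimated by Cauchy-Schwarz from the two energies, without using cancellation; this is linear in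
  \<open>P\<close>, which will already be of the size of the target rates.\<close>

lemma ls_cov_error:
 fixes x :: "nat \<Rightarrow> real^'n::finite" and w \<rho> :: "nat \<Rightarrow> real^'n"
 assumes I: "finite I" "real (card I) = n" "0 < n"
  and e: "\<And>t. t \<in> I \<Longrightarrow> x (Suc t) - transpose (ls_param \<beta> z x I) *v z t = w t + \<rho> t"
  and ww: "\<bar>(\<Sum>t\<in>I. w t $ i * w t $ l) - n * S $ i $ l\<bar> \<le> B"
  and w2: "(\<Sum>t\<in>I. (norm (w t))^2) \<le> K * n" and \<rho>2: "(\<Sum>t\<in>I. (norm (\<rho> t))^2) \<le> P^2 * n" and P: "0 \<le> P" and K: "0 \<le> K"
 shows "\<bar>(ls_cov \<beta> z x I - S) $ i $ l\<bar> \<le> B / n + 2 * sqrt K * P + P^2"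
proof -
 have cs: "\<bar>\<Sum>t\<in>I. p t $ i * q t $ l\<bar> \<le> sqrt (\<Sum>t\<in>I. (norm (p t))^2) * sqrt (\<Sum>t\<in>I. (norm (q t))^2)" for p q :: "nat \<Rightarrow> real^'n" and i l
 proof -
  have "\<bar>\<Sum>t\<in>I. p t $ i * q t $ l\<bar> \<le> (\<Sum>t\<in>I. \<bar>norm (p t)\<bar> * \<bar>norm (q t)\<bar>)"
   by (rule order.trans[OF sum_abs]) (auto simp: abs_mult intro!: sum_mono mult_mono component_le_norm_cart)
  also have "\<dots> \<le> L2_set (\<lambda>t. norm (p t)) I * L2_set (\<lambda>t. norm (q t)) I" by (rule L2_set_mult_ineq)
  finally show ?thesis by (simp add: L2_set_def)
 qed
 have sw: "sqrt (\<Sum>t\<in>I. (norm (w t))^2) \<le> sqrt (K * n)" and sr: "sqrt (\<Sum>t\<in>I. (norm (\<rho> t))^2) \<le> sqrt (P^2 * n)"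
  using w2 \<rho>2 by auto
 have m: "sqrt (K * n) * sqrt (P^2 * n) = sqrt K * P * n" using I P by (simp add: real_sqrt_mult)
 have m2: "sqrt (P^2 * n) * sqrt (P^2 * n) = P^2 * n" using I P by simp
 have 1: "\<bar>\<Sum>t\<in>I. w t $ i * \<rho> t $ l\<bar> \<le> sqrt K * P * n" "\<bar>\<Sum>t\<in>I. \<rho> t $ i * w t $ l\<bar> \<le> sqrt K * P * n"
  using order_trans[OF cs[of w i \<rho> l] mult_mono[OF sw sr]] order_trans[OF cs[of \<rho> i w l] mult_mono[OF sr sw]] m I K
  by (simp_all add: sum_nonneg mult.commute)
 have 2: "\<bar>\<Sum>t\<in>I. \<rho> t $ i * \<rho> t $ l\<bar> \<le> P^2 * n"
  using order_trans[OF cs[of \<rho> i \<rho> l] mult_mono[OF sr sr]] m2 I by (simp add: sum_nonneg)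
 have "ls_cov \<beta> z x I $ i $ l = (1 / n) * (\<Sum>t\<in>I. (w t + \<rho> t) $ i * (w t + \<rho> t) $ l)"
  using I e by (simp add: ls_cov_def Let_def outer_def cong: sum.cong)
 also have "(\<Sum>t\<in>I. (w t + \<rho> t) $ i * (w t + \<rho> t) $ l) = (\<Sum>t\<in>I. w t $ i * w t $ l) + (\<Sum>t\<in>I. w t $ i * \<rho> t $ l) + (\<Sum>t\<in>I. \<rho> t $ i * w t $ l) + (\<Sum>t\<in>I. \<rho> t $ i * \<rho> t $ l)"
  unfolding sum.distrib[symmetric] by (rule sum.cong) (auto simp: algebra_simps)
 finally have "(ls_cov \<beta> z x I - S) $ i $ l = (1 / n) * (((\<Sum>t\<in>I. w t $ i * w t $ l) - n * S $ i $ l) + (\<Sum>t\<in>I. w t $ i * \<rho> t $ l) + (\<Sum>t\<in>I. \<rho> t $ i * w t $ l) + (\<Sum>t\<in>I. \<rho> t $ i * \<rho> t $ l))"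
  using I by (simp add: field_simps)
 then have "\<bar>(ls_cov \<beta> z x I - S) $ i $ l\<bar> = (1 / n) * \<bar>((\<Sum>t\<in>I. w t $ i * w t $ l) - n * S $ i $ l) + (\<Sum>t\<in>I. w t $ i * \<rho> t $ l) + (\<Sum>t\<in>I. \<rho> t $ i * w t $ l) + (\<Sum>t\<in>I. \<rho> t $ i * \<rho> t $ l)\<bar>"
  using I by (simp add: abs_mult)
 also have "\<dots> \<le> (1 / n) * (B + sqrt K * P * n + sqrt K * P * n + P^2 * n)"
 proof (rule mult_left_mono)
  show "\<bar>((\<Sum>t\<in>I. w t $ i * w t $ l) - n * S $ i $ l) + (\<Sum>t\<in>I. w t $ i * \<rho> t $ l) + (\<Sum>t\<in>I. \<rho> t $ i * w t $ l) + (\<Sum>t\<in>I. \<rho> t $ i * \<rho> t $ l)\<bar>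
   \<le> B + sqrt K * P * n + sqrt K * P * n + P^2 * n" using ww 1 2 by linarith
 qed (use I in simp)
 also have "\<dots> = B / n + 2 * sqrt K * P + P^2" using I by (simp add: field_simps)
 finally show ?thesis .
qed

section \<open>Regular sample paths\<close>

text \<open>The conclusion of the self-normalized bound for all intervals. \<open>L\<close> stands
  for \<open>ln (1 / \<delta>)\<close>, and the added 1 keeps the logarithmic factor at least 1 for
  \<open>L \<ge> 0\<close>.\<close>

definition deviation_bound :: "real \<Rightarrow> real \<Rightarrow> (nat \<Rightarrow> real) \<Rightarrow> (nat \<Rightarrow> real) \<Rightarrow> bool" where
 "deviation_bound C L X Y \<longleftrightarrow> (\<forall>a b. a < b \<longrightarrow> \<bar>\<Sum>t\<in>{a..<b}. X t * Y t\<bar>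
   \<le> C * (sqrt ((ln (real b + 1) + L + 1) / real (b - a)) * (\<Sum>t\<in>{a..<b}. (X t)^2) + sqrt ((ln (real b + 1) + L + 1) * real (b - a))))"

definition average_bound :: "real \<Rightarrow> real \<Rightarrow> (nat \<Rightarrow> real) \<Rightarrow> real \<Rightarrow> bool" where
 "average_bound C L X \<mu> \<longleftrightarrow> (\<forall>a b. a < b \<longrightarrow> \<bar>(\<Sum>t\<in>{a..<b}. X t) - real (b - a) * \<mu>\<bar>
   \<le> C * sqrt (real (b - a)) * (ln (real b + 1) + L + 1))"

text \<open>Apart from the two covariance averages, each clause pairs a noise with a multiplier
  known before it. The state at time \<open>t\<close> is excited by the noise of time
  \<open>t - 1\<close>. Hence the correlation of that noise with the predictable part
  \<open>x (Suc t) - w t\<close> is included, and so is that of \<open>w (t - 1)\<close> with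
  exploration noise of time \<open>t\<close>, where the multiplier is set to zero at
  \<open>t = 0\<close>.\<close>

definition regular_path ::
 "real \<Rightarrow> real \<Rightarrow> ('m, 'n::finite, 'd::finite) lq_game \<Rightarrow> (nat \<Rightarrow> real^'n) \<Rightarrow> (nat \<Rightarrow> real^'n) \<Rightarrow> ('m \<Rightarrow> nat \<Rightarrow> real^'d) \<Rightarrow> bool" where
 "regular_path C L G x w v \<longleftrightarrow>
   (\<forall>i. deviation_bound C L (\<lambda>_. 1) (\<lambda>t. w t $ i)) \<and>
   (\<forall>m i. deviation_bound C L (\<lambda>_. 1) (\<lambda>t. v m t $ i)) \<and>
   (\<forall>i l. deviation_bound C L (\<lambda>t. x t $ i) (\<lambda>t. w t $ l)) \<and>
   (\<forall>i m l. deviation_bound C L (\<lambda>t. x t $ i) (\<lambda>t. v m t $ l)) \<and>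
   (\<forall>m i l. deviation_bound C L (\<lambda>t. v m t $ i) (\<lambda>t. w t $ l)) \<and>
   (\<forall>m i j l. m \<noteq> j \<longrightarrow> deviation_bound C L (\<lambda>t. v m t $ i) (\<lambda>t. v j t $ l)) \<and>
   (\<forall>i l. deviation_bound C L (\<lambda>t. (x (Suc t) - w t) $ i) (\<lambda>t. w t $ l)) \<and>
   (\<forall>i m l. deviation_bound C L (\<lambda>t. if t = 0 then 0 else w (t - 1) $ i) (\<lambda>t. v m t $ l)) \<and>
   (\<forall>i l. average_bound C L (\<lambda>t. w t $ i * w t $ l) (noise_cov G $ i $ l)) \<and>
   (\<forall>m i l. average_bound C L (\<lambda>t. v m t $ i * v m t $ l) (ident_on (ctrl G m) $ i $ l))"

lemma deviation_bound_mono: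
 assumes "deviation_bound C L X Y" "C \<le> C'" "0 \<le> L" shows "deviation_bound C' L X Y"
proof -
 have "0 \<le> sqrt ((ln (real b + 1) + L + 1) / real (b - a)) * (\<Sum>t\<in>{a..<b}. (X t)^2) + sqrt ((ln (real b + 1) + L + 1) * real (b - a))" for a b
  using assms(3) by (intro add_nonneg_nonneg mult_nonneg_nonneg sum_nonneg) auto
 then show ?thesis using assms(1,2) unfolding deviation_bound_def by (meson mult_right_mono order_trans)
qed

lemma average_bound_mono:
 assumes "average_bound C L X \<mu>" "C \<le> C'" "0 \<le> L" shows "average_bound C' L X \<mu>"
proof -
 have "0 \<le> sqrt (real (b - a)) * (ln (real b + 1) + L + 1)" for a b using assms(3) by simp
 then show ?thesis using assms(1,2) unfolding average_bound_def mult.assoc by (meson mult_right_mono order_trans)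
qed

lemma deviation_boundI:
 assumes L: "0 \<le> L" and k: "0 < k" "0 \<le> c"
  and d: "\<And>a b. a < b \<Longrightarrow> \<bar>\<Sum>t\<in>{a..<b}. X t * Y t\<bar> \<le> sqrt ((3 * ln (real b + 1) + L + k) / real (b - a)) * c * (\<Sum>t\<in>{a..<b}. (X t)^2)
     + sqrt ((3 * ln (real b + 1) + L + k) * real (b - a))"
 shows "deviation_bound (sqrt (3 + k) * (1 + c)) L X Y" unfolding deviation_bound_def
proof (intro allI impI)
 fix a b :: nat assume ab: "a < b"
 let ?U = "3 * ln (real b + 1) + L + k" and ?V = "ln (real b + 1) + L + 1" and ?n = "real (b - a)"
 have U: "?U \<le> (3 + k) * ?V"
 proof -
  have "0 \<le> k * (ln (real b + 1) + L)" "0 \<le> L" using L k by auto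
  then show ?thesis by (simp add: algebra_simps)
 qed
 have V: "0 \<le> ?V" using L by simp
 have 1: "sqrt (?U / ?n) \<le> sqrt (3 + k) * sqrt (?V / ?n)" using U ab by (simp add: real_sqrt_mult[symmetric] divide_right_mono)
 have 2: "sqrt (?U * ?n) \<le> sqrt (3 + k) * sqrt (?V * ?n)"
  using mult_right_mono[OF U, of ?n] by (simp add: real_sqrt_mult[symmetric] mult.assoc)
 define S where "S = (\<Sum>t\<in>{a..<b}. (X t)^2)"
 have S: "0 \<le> S" by (simp add: S_def sum_nonneg)
 have "\<bar>\<Sum>t\<in>{a..<b}. X t * Y t\<bar> \<le> sqrt (?U / ?n) * c * S + sqrt (?U * ?n)" unfolding S_def by (rule d[OF ab])
 also have "\<dots> \<le> sqrt (3 + k) * sqrt (?V / ?n) * (1 + c) * S + sqrt (3 + k) * sqrt (?V * ?n) * (1 + c)"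
 proof (rule add_mono)
  show "sqrt (?U / ?n) * c * S \<le> sqrt (3 + k) * sqrt (?V / ?n) * (1 + c) * S" using 1 k V L S by (intro mult_right_mono mult_mono) auto
  have "sqrt (3 + k) * sqrt (?V * ?n) * 1 \<le> sqrt (3 + k) * sqrt (?V * ?n) * (1 + c)" using V k by (intro mult_left_mono) auto
  then show "sqrt (?U * ?n) \<le> sqrt (3 + k) * sqrt (?V * ?n) * (1 + c)" using 2 by linarith
 qed
 also have "\<dots> = sqrt (3 + k) * (1 + c) * (sqrt (?V / ?n) * S + sqrt (?V * ?n))" by (simp only: distrib_left mult_ac)
 finally show "\<bar>\<Sum>t\<in>{a..<b}. X t * Y t\<bar> \<le> sqrt (3 + k) * (1 + c) * (sqrt (?V / ?n) * (\<Sum>t\<in>{a..<b}. (X t)^2) + sqrt (?V * ?n))"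
  by (simp only: S_def)
qed

lemma average_boundI:
 assumes L: "0 \<le> L" and k: "0 < k" "0 \<le> c" "0 < y"
  and d: "\<And>a b. a < b \<Longrightarrow> \<bar>\<Sum>t\<in>{a..<b}. X t - \<mu>\<bar> \<le> sqrt (real (b - a)) * ((3 * ln (real b + 1) + L + k) / y + c * y)"
 shows "average_bound ((3 + k) / y + c * y) L X \<mu>" unfolding average_bound_def
proof (intro allI impI)
 fix a b :: nat assume ab: "a < b"
 let ?U = "3 * ln (real b + 1) + L + k" and ?V = "ln (real b + 1) + L + 1" and ?n = "real (b - a)"
 have U: "?U \<le> (3 + k) * ?V"
 proof -
  have "0 \<le> k * (ln (real b + 1) + L)" "0 \<le> L" using L k by auto
  then show ?thesis by (simp add: algebra_simps)
 qed
 have V: "1 \<le> ?V" using L by simp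
 have "?U / y \<le> (3 + k) * ?V / y" using U k by (intro divide_right_mono) auto
 moreover have "c * y * 1 \<le> c * y * ?V" using V k by (intro mult_left_mono) auto
 ultimately have "?U / y + c * y \<le> ((3 + k) / y + c * y) * ?V" by (simp add: distrib_right)
 then have "sqrt ?n * (?U / y + c * y) \<le> sqrt ?n * (((3 + k) / y + c * y) * ?V)" by (intro mult_left_mono) auto
 moreover have "(\<Sum>t\<in>{a..<b}. X t) - ?n * \<mu> = (\<Sum>t\<in>{a..<b}. X t - \<mu>)" by (simp add: sum_subtractf)
 ultimately show "\<bar>(\<Sum>t\<in>{a..<b}. X t) - ?n * \<mu>\<bar> \<le> ((3 + k) / y + c * y) * sqrt ?n * ?V"
  using d[OF ab] by (simp add: mult_ac)
qed

lemma borel_measurable_matrix_vector_mult [measurable]: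
 fixes A :: "'a \<Rightarrow> real^'n::finite^'k::finite" and x :: "'a \<Rightarrow> real^'n"
 assumes "A \<in> borel_measurable N" "x \<in> borel_measurable N"
 shows "(\<lambda>\<xi>. A \<xi> *v x \<xi>) \<in> borel_measurable N"
proof (rule borel_measurable_continuous_Pair[OF assms])
 show "continuous_on UNIV (\<lambda>p. fst p *v (snd p :: real^'n) :: real^'k)"
  unfolding matrix_vector_mult_def by (intro continuous_intros)
qed

section \<open>Filtrations and measurability of the learning process\<close>

locale learning_setup =
 fixes M :: "'a measure"
  and G :: "('m::finite, 'n::finite, 'd::finite) lq_game"
  and c :: "'m schedule"
  and W :: "'m \<Rightarrow> real^'n^'n \<Rightarrow> (real^'n) measure"
  and V :: "'m \<Rightarrow> (real^'d) measure"
  and \<Phi> :: "'m \<Rightarrow> ('n, 'd) model \<Rightarrow> real^'n \<Rightarrow> real \<Rightarrow> ('n, 'd) strategy"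
  and \<beta> :: "'m \<Rightarrow> real"
  and init :: "'m \<Rightarrow> ('n, 'd) model"
  and x0 :: "real^'n"
  and w :: "nat \<Rightarrow> 'a \<Rightarrow> real^'n"
  and v :: "'m \<Rightarrow> nat \<Rightarrow> 'a \<Rightarrow> real^'d"
  and sh :: "'m \<Rightarrow> nat \<Rightarrow> 'a \<Rightarrow> real"
  and r :: "('a, 'm, 'n, 'd) run"
 assumes M: "prob_space M" and G: "valid_game G" and c: "valid_schedule c"
  and noise: "learning_noise M G c w v sh"
  and run: "runs_algorithm M G c W V \<Phi> \<beta> init x0 w v sh r"
  and adapted: "adapted_play M c w v sh r"
begin

sublocale prob_space M by (rule M)

abbreviation "SE \<equiv> source_events M w v sh"
abbreviation "GW \<equiv> past_and_others M SE State_Noise w"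
abbreviation "GV m \<equiv> past_and_others M SE (Exploration m) (v m)"
abbreviation "hist \<equiv> history M w v sh"
abbreviation "x \<equiv> state r"

lemma iidw: "iid_noise M w (noise_cov G)" and iidv: "iid_noise M (v m) (ident_on (ctrl G m))"
 and indSE: "indep_sets SE UNIV" using noise by (auto simp: learning_noise_def)

lemma shift_range: "\<xi> \<in> space M \<Longrightarrow> 1 \<le> k \<Longrightarrow> sh m k \<xi> \<in> {0..max_shift c}"
 using noise by (auto simp: learning_noise_def)

lemma Int_stable_SE: "Int_stable (SE s)" by (cases s) (auto intro: Int_stable_generated)

lemma SE_Pow: "SE s \<subseteq> Pow (space M)" by (cases s) (simp_all add: generated_Pow)

lemma innovation_w: "innovation M GW w"
 using iidw by (intro innovation_past_and_others[OF M indSE Int_stable_SE]) (auto simp: iid_noise_def)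

lemma innovation_v: "innovation M (GV m) (v m)"
 using iidv[of m] by (intro innovation_past_and_others[OF M indSE Int_stable_SE]) (auto simp: iid_noise_def)

lemma hist_space: "space (hist t) = space M"
 and hist_sets: "sets (hist t) = sigma_sets (space M) (generated M {..<t} w \<union> (\<Union>m. generated M {..<t} (v m)) \<union> SE Shifts)"
proof -
 have "generated M {..<t} w \<union> (\<Union>m. generated M {..<t} (v m)) \<union> generated M (UNIV \<times> {1..}) (\<lambda>(m, k). sh m k) \<subseteq> Pow (space M)"
  using generated_Pow[of M "{..<t}" w] generated_Pow[of M "{..<t}" "v _"] generated_Pow[of M "UNIV \<times> {1..}" "\<lambda>(m, k). sh m k"] by blast
 then show "space (hist t) = space M"
  "sets (hist t) = sigma_sets (space M) (generated M {..<t} w \<union> (\<Union>m. generated M {..<t} (v m)) \<union> SE Shifts)"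
  unfolding history_def by auto
qed

lemma GW_space [simp]: "space (GW t) = space M" and GV_space [simp]: "space (GV m t) = space M"
 by (simp_all add: past_and_others_space(1)[of SE, OF SE_Pow])

lemma SE_GW: "s \<noteq> State_Noise \<Longrightarrow> SE s \<subseteq> sets (GW t)"
 unfolding past_and_others_space(2)[of SE, OF SE_Pow] by (intro order.trans[OF _ sigma_sets_superset_generator]) blast

lemma SE_GV: "s \<noteq> Exploration m \<Longrightarrow> SE s \<subseteq> sets (GV m t)"
 unfolding past_and_others_space(2)[of SE, OF SE_Pow] by (intro order.trans[OF _ sigma_sets_superset_generator]) blast

lemma hist_GW: "subalgebra (GW t) (hist t)"
proof -
 have "generated M {..<t} w \<subseteq> sets (GW t)"
  unfolding past_and_others_space(2)[of SE, OF SE_Pow] by (intro order.trans[OF _ sigma_sets_superset_generator]) blast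
 moreover have "generated M {..<t} (v m) \<subseteq> sets (GW t)" for m
  using generated_mono[of "{..<t}" UNIV M "v m"] SE_GW[of "Exploration m" t] by auto
 moreover have "SE Shifts \<subseteq> sets (GW t)" by (rule SE_GW) simp
 ultimately have "sets (hist t) \<subseteq> sets (GW t)"
  unfolding hist_sets GW_space[of t, symmetric] by (intro sets.sigma_sets_subset) auto
 then show ?thesis by (simp add: subalgebra_def hist_space)
qed

lemma hist_GV: "subalgebra (GV j t) (hist t)"
proof -
 have 0: "generated M {..<t} (v j) \<subseteq> sets (GV j t)"
  unfolding past_and_others_space(2)[of SE, OF SE_Pow] by (intro order.trans[OF _ sigma_sets_superset_generator]) blast
 have "generated M {..<t} w \<subseteq> sets (GV j t)" using generated_mono[of "{..<t}" UNIV M w] SE_GV[of State_Noise j t] by auto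
 moreover have "generated M {..<t} (v m) \<subseteq> sets (GV j t)" for m
  using generated_mono[of "{..<t}" UNIV M "v m"] SE_GV[of "Exploration m" j t] 0 by (cases "m = j") auto
 moreover have "SE Shifts \<subseteq> sets (GV j t)" by (rule SE_GV) simp
 ultimately have "sets (hist t) \<subseteq> sets (GV j t)"
  unfolding hist_sets GV_space[of j t, symmetric] by (intro sets.sigma_sets_subset) auto
 then show ?thesis by (simp add: subalgebra_def hist_space)
qed

lemma hist_M: "subalgebra M (hist t)" using hist_GW[of t] innovation_w by (auto simp: innovation_def subalgebra_def)

lemma hist_mono: "s \<le> t \<Longrightarrow> subalgebra (hist t) (hist s)"
proof -
 assume st: "s \<le> t"
 have "generated M {..<s} w \<subseteq> generated M {..<t} w" "\<And>m. generated M {..<s} (v m) \<subseteq> generated M {..<t} (v m)"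
  by (rule generated_mono; use st in auto)+
 then have "generated M {..<s} w \<union> (\<Union>m. generated M {..<s} (v m)) \<union> SE Shifts
  \<subseteq> generated M {..<t} w \<union> (\<Union>m. generated M {..<t} (v m)) \<union> SE Shifts" by (intro Un_mono UN_mono) auto
 then show ?thesis unfolding subalgebra_def hist_space hist_sets by (intro conjI refl sigma_sets_mono')
qed

lemma w_hist: "s < t \<Longrightarrow> w s \<in> borel_measurable (hist t)"
 by (rule measurable_if_generated[where I="{..<t}" and M=M]) (auto simp: hist_space hist_sets)

lemma v_hist: "s < t \<Longrightarrow> v m s \<in> borel_measurable (hist t)"
 by (rule measurable_if_generated[where I="{..<t}" and M=M]) (auto simp: hist_space hist_sets)

lemma sh_hist: "1 \<le> k \<Longrightarrow> sh m k \<in> borel_measurable (hist t)"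
 using measurable_if_generated[where I="UNIV \<times> {1..}" and M=M and X="\<lambda>(m, k). sh m k" and i="(m, k)" and N="hist t"]
 by (auto simp: hist_space hist_sets)

lemma v_GW: "v m s \<in> borel_measurable (GW t)"
 by (rule measurable_if_generated[where I=UNIV and M=M]) (use SE_GW[of "Exploration m" t] in auto)

lemma w_GV: "w s \<in> borel_measurable (GV j t)"
 by (rule measurable_if_generated[where I=UNIV and M=M]) (use SE_GV[of State_Noise j t] in auto)

lemma v_GV: "m \<noteq> j \<Longrightarrow> v m s \<in> borel_measurable (GV j t)"
 by (rule measurable_if_generated[where I=UNIV and M=M]) (use SE_GV[of "Exploration m" j t] in auto)

abbreviation "shp \<xi> \<equiv> (\<lambda>m k. sh m k \<xi>)"
abbreviation "ep \<xi> \<equiv> epoch_at c (shp \<xi>)"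
abbreviation "al \<xi> \<equiv> exploration c (shp \<xi>)"

text \<open>Every history contains the shifts of all epochs, so the epoch containing
  \<open>t\<close> and its exploration scale are known at any time \<open>s\<close>, even before
  \<open>t\<close>.\<close>

lemma exploration_measurable: "(\<lambda>\<xi>. al \<xi> m (ep \<xi> m t)) \<in> borel_measurable (hist s)"
proof -
 have len: "(\<lambda>\<xi>. epoch_len c (shp \<xi>) m k) \<in> measurable (hist s) (count_space UNIV)" if "1 \<le> k" for k
  unfolding epoch_len_def using sh_hist[OF that, of m s] by measurable
 have start: "(\<lambda>\<xi>. epoch_start c (shp \<xi>) m k) \<in> measurable (hist s) (count_space UNIV)" for k
  unfolding epoch_start_def by (intro measurable_sum_nat len) auto
 have "(\<lambda>\<xi>. ep \<xi> m t) \<in> measurable (hist s) (count_space UNIV)" unfolding epoch_at_def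
 proof (rule measurable_Sup_nat)
  fix k show "Measurable.pred (hist s) (\<lambda>\<xi>. k \<in> {k. epoch_start c (shp \<xi>) m k \<le> t})" using start[of k] by simp
 qed
 then show ?thesis
 proof (rule measurable_compose_countable[rotated])
  fix k
  have "(\<lambda>\<xi>. real (epoch_len c (shp \<xi>) m (k + 1))) \<in> borel_measurable (hist s)"
   using measurable_compose[OF len[of "k + 1"], of real borel] by simp
  then show "(\<lambda>\<xi>. al \<xi> m k) \<in> borel_measurable (hist s)" unfolding exploration_def by measurable
 qed
qed

lemma control_eq:
 assumes \<xi>: "\<xi> \<in> space M"
 shows "control r m t \<xi> = feedback (policy r m (ep \<xi> m t) \<xi>) (x t \<xi>) + al \<xi> m (ep \<xi> m t) *\<^sub>R v m t \<xi>"
proof -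
 have "epoch_start c (shp \<xi>) m (ep \<xi> m t) \<le> t" "t < epoch_start c (shp \<xi>) m (ep \<xi> m t + 1)"
  by (rule epoch_at_bounds[where sh="shp \<xi>", OF c]; erule shift_range[OF \<xi>])+
 then show ?thesis using run \<xi> unfolding runs_algorithm_def Let_def by blast
qed

lemma state_Suc: "\<xi> \<in> space M \<Longrightarrow> x (Suc t) \<xi> = game_step G (x t \<xi>) (\<lambda>m. control r m t \<xi>) (w t \<xi>)"
 and state_0: "\<xi> \<in> space M \<Longrightarrow> x 0 \<xi> = x0" using run unfolding runs_algorithm_def Let_def by blast+

lemma played_strategy: "strategy_of (played c sh r t \<xi>) m = policy r m (ep \<xi> m t) \<xi>" by (simp add: strategy_of_def played_def)

text \<open>Stated for any \<sigma>-algebra \<open>N\<close> beyond the history: it serves for the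
  next history, where all noises of time \<open>t\<close> are known, and for \<open>GW t\<close>,
  which knows the exploration noise of time \<open>t\<close> but state noise only from earlier
  times.\<close>

lemma control_measurable:
 assumes x: "x t \<in> borel_measurable N" and v: "v m t \<in> borel_measurable N" and sub: "subalgebra N (hist t)"
 shows "control r m t \<in> borel_measurable N"
proof -
 have spN: "space N = space M" using sub by (simp add: subalgebra_def hist_space)
 have s: "(\<lambda>\<xi>. policy r m (ep \<xi> m t) \<xi>) \<in> borel_measurable N"
  using adapted measurable_from_subalg[OF sub] unfolding adapted_play_def played_strategy by blast
 have s1: "(\<lambda>\<xi>. fst (policy r m (ep \<xi> m t) \<xi>)) \<in> borel_measurable N" and s2: "(\<lambda>\<xi>. snd (policy r m (ep \<xi> m t) \<xi>)) \<in> borel_measurable N"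
  using measurable_compose[OF s, of fst borel] measurable_compose[OF s, of snd borel] by (auto simp: borel_prod[symmetric])
 have a: "(\<lambda>\<xi>. al \<xi> m (ep \<xi> m t)) \<in> borel_measurable N" by (rule measurable_from_subalg[OF sub exploration_measurable])
 have "(\<lambda>\<xi>. feedback (policy r m (ep \<xi> m t) \<xi>) (x t \<xi>) + al \<xi> m (ep \<xi> m t) *\<^sub>R v m t \<xi>) \<in> borel_measurable N"
  unfolding feedback_def
  by (intro borel_measurable_add borel_measurable_uminus borel_measurable_scaleR borel_measurable_matrix_vector_mult s1 s2 a x v)
 then show ?thesis by (rule measurable_cong[THEN iffD1, rotated]) (simp add: control_eq spN)
qed

lemma next_state_measurable:
 assumes x: "x t \<in> borel_measurable N" and v: "\<And>m. v m t \<in> borel_measurable N" and sub: "subalgebra N (hist t)"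
 shows "(\<lambda>\<xi>. game_step G (x t \<xi>) (\<lambda>m. control r m t \<xi>) 0) \<in> borel_measurable N" unfolding game_step_def
 by (intro borel_measurable_add borel_measurable_sum borel_measurable_matrix_vector_mult borel_measurable_const control_measurable x v sub)

lemma state_measurable: "x t \<in> borel_measurable (hist t)"
proof (induction t)
 case 0
 have "(\<lambda>_. x0) \<in> borel_measurable (hist 0)" by simp
 then show ?case by (rule measurable_cong[THEN iffD1, rotated]) (simp add: state_0 hist_space)
next
 case (Suc t)
 have "(\<lambda>\<xi>. game_step G (x t \<xi>) (\<lambda>m. control r m t \<xi>) 0 + w t \<xi>) \<in> borel_measurable (hist (Suc t))"
  by (intro borel_measurable_add next_state_measurable measurable_from_subalg[OF hist_mono Suc] v_hist w_hist hist_mono) auto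
 then show ?case by (rule measurable_cong[THEN iffD1, rotated]) (simp add: state_Suc hist_space game_step_def)
qed

text \<open>The next state without its noise still involves the exploration noises of time
  \<open>t\<close>. It belongs to \<open>GW t\<close> because that algebra contains the exploration
  sources for all times.\<close>

lemma predictable_state_noise: "(\<lambda>\<xi>. x (Suc t) \<xi> - w t \<xi>) \<in> borel_measurable (GW t)"
proof -
 have "(\<lambda>\<xi>. game_step G (x t \<xi>) (\<lambda>m. control r m t \<xi>) 0) \<in> borel_measurable (GW t)"
  by (intro next_state_measurable measurable_from_subalg[OF hist_GW state_measurable] v_GW hist_GW)
 then show ?thesis by (rule measurable_cong[THEN iffD1, rotated]) (simp add: state_Suc game_step_def)
qed

end

section \<open>The event on which all sums have their typical size\<close>

context learning_setup begin

lemma component_mgf: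
 fixes X :: "nat \<Rightarrow> 'a \<Rightarrow> real^'k::finite"
 assumes "iid_noise M X S"
 obtains cc where "0 < cc" "\<And>i t y. (\<integral>\<^sup>+\<omega>. ennreal (exp (y * X t \<omega> $ i)) \<partial>M) \<le> ennreal (exp (cc * y^2))"
proof -
 obtain N where N: "noise_law N S" "\<And>t (f :: real^'k \<Rightarrow> ennreal). f \<in> borel_measurable borel \<Longrightarrow> (\<integral>\<^sup>+\<omega>. f (X t \<omega>) \<partial>M) = (\<integral>\<^sup>+z. f z \<partial>N)"
 proof (rule noise_transfer[OF M assms])
  fix N assume a: "noise_law N S" "\<And>t (f :: real^'k \<Rightarrow> ennreal). f \<in> borel_measurable borel \<Longrightarrow> (\<integral>\<^sup>+\<omega>. f (X t \<omega>) \<partial>M) = (\<integral>\<^sup>+z. f z \<partial>N)"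
  show thesis by (rule that[OF a])
 qed
 obtain cc where cc: "0 < cc" "\<And>i y. (\<integral>\<^sup>+z. ennreal (exp (y * z $ i)) \<partial>N) \<le> ennreal (exp (cc * y^2))"
  using noise_law_component_mgf[OF N(1)] by blast
 show thesis
 proof (rule that[OF cc(1)])
  fix i t y
  have "(\<integral>\<^sup>+\<omega>. ennreal (exp (y * X t \<omega> $ i)) \<partial>M) = (\<integral>\<^sup>+z. ennreal (exp (y * z $ i)) \<partial>N)"
   by (rule N(2)[of "\<lambda>z. ennreal (exp (y * z $ i))"]) simp
  then show "(\<integral>\<^sup>+\<omega>. ennreal (exp (y * X t \<omega> $ i)) \<partial>M) \<le> ennreal (exp (cc * y^2))" using cc(2) by simp
 qed
qed

lemma covariance_mgf:
 fixes X :: "nat \<Rightarrow> 'a \<Rightarrow> real^'k::finite"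
 assumes "iid_noise M X S"
 obtains y0 cc where "0 < y0" "0 \<le> cc" "\<And>i l t y. \<bar>y\<bar> \<le> y0 \<Longrightarrow> (\<integral>\<^sup>+\<omega>. ennreal (exp (y * (X t \<omega> $ i * X t \<omega> $ l - S $ i $ l))) \<partial>M) \<le> ennreal (exp (cc * y^2))"
proof -
 obtain N where N: "noise_law N S" "\<And>t (f :: real^'k \<Rightarrow> ennreal). f \<in> borel_measurable borel \<Longrightarrow> (\<integral>\<^sup>+\<omega>. f (X t \<omega>) \<partial>M) = (\<integral>\<^sup>+z. f z \<partial>N)"
 proof (rule noise_transfer[OF M assms])
  fix N assume a: "noise_law N S" "\<And>t (f :: real^'k \<Rightarrow> ennreal). f \<in> borel_measurable borel \<Longrightarrow> (\<integral>\<^sup>+\<omega>. f (X t \<omega>) \<partial>M) = (\<integral>\<^sup>+z. f z \<partial>N)"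
  show thesis by (rule that[OF a])
 qed
 obtain y0 cc where cc: "0 < y0" "0 \<le> cc" "\<And>i l y. \<bar>y\<bar> \<le> y0 \<Longrightarrow> (\<integral>\<^sup>+z. ennreal (exp (y * (z $ i * z $ l - S $ i $ l))) \<partial>N) \<le> ennreal (exp (cc * y^2))"
  using noise_law_covariance_mgf[OF N(1)] by blast
 show thesis
 proof (rule that[OF cc(1,2)])
  fix i l t and y :: real assume y: "\<bar>y\<bar> \<le> y0"
  have "(\<integral>\<^sup>+\<omega>. ennreal (exp (y * (X t \<omega> $ i * X t \<omega> $ l - S $ i $ l))) \<partial>M) = (\<integral>\<^sup>+z. ennreal (exp (y * (z $ i * z $ l - S $ i $ l))) \<partial>N)"
   by (rule N(2)[of "\<lambda>z. ennreal (exp (y * (z $ i * z $ l - S $ i $ l)))"]) simp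
  then show "(\<integral>\<^sup>+\<omega>. ennreal (exp (y * (X t \<omega> $ i * X t \<omega> $ l - S $ i $ l))) \<partial>M) \<le> ennreal (exp (cc * y^2))" using cc(3)[OF y] by simp
 qed
qed

text \<open>Failure of a deviation bound at level \<open>u\<close>, kept as a predicate. Together
  with \<open>Avg\<close> this puts sums of both kinds into one finite set of predicates, to which a
  single union bound applies.\<close>

definition Dev :: "(nat \<Rightarrow> 'a \<Rightarrow> real) \<Rightarrow> (nat \<Rightarrow> 'a \<Rightarrow> real) \<Rightarrow> real \<Rightarrow> nat \<Rightarrow> nat \<Rightarrow> real \<Rightarrow> 'a \<Rightarrow> bool" where
 "Dev \<xi> \<epsilon> cc a b u \<omega> \<longleftrightarrow> sqrt (u / real (b - a)) * cc * (\<Sum>t\<in>{a..<b}. (\<xi> t \<omega>)^2) + sqrt (u * real (b - a)) \<le> \<bar>\<Sum>t\<in>{a..<b}. \<xi> t \<omega> * \<epsilon> t \<omega>\<bar>"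

definition Avg :: "(nat \<Rightarrow> 'a \<Rightarrow> real) \<Rightarrow> real \<Rightarrow> real \<Rightarrow> nat \<Rightarrow> nat \<Rightarrow> real \<Rightarrow> 'a \<Rightarrow> bool" where
 "Avg \<epsilon> y cc a b u \<omega> \<longleftrightarrow> sqrt (real (b - a)) * (u / y + cc * y) \<le> \<bar>\<Sum>t\<in>{a..<b}. \<epsilon> t \<omega>\<bar>"

definition bound_event :: "(nat \<Rightarrow> nat \<Rightarrow> real \<Rightarrow> 'a \<Rightarrow> bool) \<Rightarrow> bool" where
 "bound_event D \<longleftrightarrow> (\<forall>a b u. a < b \<longrightarrow> 0 < u \<longrightarrow> prob {\<omega>\<in>space M. D a b u \<omega>} \<le> 2 * exp (- u)) \<and>
   (\<forall>a b u. {\<omega>\<in>space M. D a b u \<omega>} \<in> events)"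

lemma bound_event_Dev:
 assumes inn: "innovation M \<G> \<epsilon>" and \<xi>: "\<And>t. \<xi> t \<in> borel_measurable (\<G> t)"
  and mgf: "\<And>t y. (\<integral>\<^sup>+\<omega>'. ennreal (exp (y * \<epsilon> t \<omega>')) \<partial>M) \<le> ennreal (exp (cc * y^2))"
 shows "bound_event (Dev \<xi> \<epsilon> cc)"
proof -
 have [measurable]: "\<xi> t \<in> borel_measurable M" for t using inn measurable_from_subalg[OF _ \<xi>] by (auto simp: innovation_def)
 have [measurable]: "\<epsilon> t \<in> borel_measurable M" for t using inn by (auto simp: innovation_def)
 show ?thesis unfolding bound_event_def Dev_def using sub_gaussian_sum_deviation[OF M inn \<xi> mgf] by auto
qed

lemma bound_event_Avg:
 assumes inn: "innovation M \<G> \<epsilon>" and y: "0 < y0" "0 \<le> cc"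
  and mgf: "\<And>t y. \<bar>y\<bar> \<le> y0 \<Longrightarrow> (\<integral>\<^sup>+\<omega>'. ennreal (exp (y * \<epsilon> t \<omega>')) \<partial>M) \<le> ennreal (exp (cc * y^2))"
 shows "bound_event (Avg \<epsilon> y0 cc)"
proof -
 have [measurable]: "\<epsilon> t \<in> borel_measurable M" for t using inn by (auto simp: innovation_def)
 show ?thesis unfolding bound_event_def Avg_def using sub_exponential_sum_deviation[OF M inn y mgf] by auto
qed

lemma regular_event:
 obtains C where "0 < C" "\<And>\<delta>. 0 < \<delta> \<Longrightarrow> \<delta> < 1 \<Longrightarrow> \<exists>A\<in>events. 1 - \<delta> \<le> prob A \<and>
   (\<forall>\<omega>\<in>A. regular_path C (ln (1 / \<delta>)) G (\<lambda>t. x t \<omega>) (\<lambda>t. w t \<omega>) (\<lambda>m t. v m t \<omega>))"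
proof -
 obtain cW where cW: "0 < cW" "\<And>i t y. (\<integral>\<^sup>+\<omega>. ennreal (exp (y * w t \<omega> $ i)) \<partial>M) \<le> ennreal (exp (cW * y^2))"
 proof (rule component_mgf[OF iidw])
  fix cc assume a: "0 < cc" "\<And>i t y. (\<integral>\<^sup>+\<omega>. ennreal (exp (y * w t \<omega> $ i)) \<partial>M) \<le> ennreal (exp (cc * y^2))"
  show thesis by (rule that[OF a])
 qed
 have "\<exists>cc>0. \<forall>i t y. (\<integral>\<^sup>+\<omega>. ennreal (exp (y * v m t \<omega> $ i)) \<partial>M) \<le> ennreal (exp (cc * y^2))" for m
 proof (rule component_mgf[OF iidv[of m]])
  fix cc assume "0 < cc" "\<And>i t y. (\<integral>\<^sup>+\<omega>. ennreal (exp (y * v m t \<omega> $ i)) \<partial>M) \<le> ennreal (exp (cc * y^2))"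
  then show ?thesis by (intro exI[of _ cc] conjI allI)
 qed
 then obtain cV where cV: "\<And>m. 0 < cV m" "\<And>m i t y. (\<integral>\<^sup>+\<omega>. ennreal (exp (y * v m t \<omega> $ i)) \<partial>M) \<le> ennreal (exp (cV m * y^2))"
  by metis
 obtain yW kW where W: "0 < yW" "0 \<le> kW" "\<And>i l t y. \<bar>y\<bar> \<le> yW \<Longrightarrow> (\<integral>\<^sup>+\<omega>. ennreal (exp (y * (w t \<omega> $ i * w t \<omega> $ l - noise_cov G $ i $ l))) \<partial>M) \<le> ennreal (exp (kW * y^2))"
 proof (rule covariance_mgf[OF iidw])
  fix y0 cc assume a: "0 < y0" "0 \<le> cc" "\<And>i l t y. \<bar>y\<bar> \<le> y0 \<Longrightarrow> (\<integral>\<^sup>+\<omega>. ennreal (exp (y * (w t \<omega> $ i * w t \<omega> $ l - noise_cov G $ i $ l))) \<partial>M) \<le> ennreal (exp (cc * y^2))"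
  show thesis by (rule that[OF a])
 qed
 define R where "R m y0 cc \<longleftrightarrow> 0 < y0 \<and> 0 \<le> cc \<and> (\<forall>i l t y. \<bar>y\<bar> \<le> y0 \<longrightarrow> (\<integral>\<^sup>+\<omega>. ennreal (exp (y * (v m t \<omega> $ i * v m t \<omega> $ l - ident_on (ctrl G m) $ i $ l))) \<partial>M) \<le> ennreal (exp (cc * y^2)))" for m y0 cc
 have "\<exists>y0 cc. R m y0 cc" for m
 proof (rule covariance_mgf[OF iidv[of m]])
  fix y0 cc assume "0 < y0" "0 \<le> cc" "\<And>i l t y. \<bar>y\<bar> \<le> y0 \<Longrightarrow> (\<integral>\<^sup>+\<omega>. ennreal (exp (y * (v m t \<omega> $ i * v m t \<omega> $ l - ident_on (ctrl G m) $ i $ l))) \<partial>M) \<le> ennreal (exp (cc * y^2))"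
  then show ?thesis unfolding R_def by (intro exI[of _ y0] exI[of _ cc] conjI allI impI)
 qed
 then obtain yV kV where RV: "\<And>m. R m (yV m) (kV m)" by metis
 have VV: "\<And>m. 0 < yV m" "\<And>m. 0 \<le> kV m" using RV by (auto simp: R_def)
 have Vm: "(\<integral>\<^sup>+\<omega>. ennreal (exp (y * (v m t \<omega> $ i * v m t \<omega> $ l - ident_on (ctrl G m) $ i $ l))) \<partial>M) \<le> ennreal (exp (kV m * y^2))" if "\<bar>y\<bar> \<le> yV m" for m t i l y
  using RV[of m] that unfolding R_def by blast
 define xi where "xi i = (\<lambda>t \<omega>. x t \<omega> $ i)" for i
 define wi where "wi i = (\<lambda>t \<omega>. w t \<omega> $ i)" for i
 define vi where "vi = (\<lambda>(m, i) t \<omega>. v m t \<omega> $ i)"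
 define gi where "gi i = (\<lambda>t \<omega>. (x (Suc t) \<omega> - w t \<omega>) $ i)" for i
 define pi where "pi i = (\<lambda>t \<omega>. if t = 0 then 0 else w (t - 1) \<omega> $ i)" for i
 define one where "one = (\<lambda>(t::nat) (\<omega>::'a). 1::real)"
 \<comment> \<open>The admissible multipliers of the two kinds of innovations. State noise may be
   paired with exploration noise of any player at the same time, exploration noise of player
   \<open>j\<close> only with that of the other players.\<close>
 define \<Xi>W where "\<Xi>W = insert one (range xi \<union> range vi \<union> range gi)"
 define \<Xi>V where "\<Xi>V j = insert one (range xi \<union> vi ` ((UNIV - {j}) \<times> UNIV) \<union> range pi)" for j
 define I where "I = (\<Union>l. (\<lambda>\<xi>. Dev \<xi> (wi l) cW) ` \<Xi>W) \<union> (\<Union>j. \<Union>l. (\<lambda>\<xi>. Dev \<xi> (vi (j, l)) (cV j)) ` \<Xi>V j)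
   \<union> (\<Union>i. \<Union>l. {Avg (\<lambda>t \<omega>. w t \<omega> $ i * w t \<omega> $ l - noise_cov G $ i $ l) yW kW})
   \<union> (\<Union>m. \<Union>i. \<Union>l. {Avg (\<lambda>t \<omega>. v m t \<omega> $ i * v m t \<omega> $ l - ident_on (ctrl G m) $ i $ l) (yV m) (kV m)})"
 have finI: "finite I" by (auto simp: I_def \<Xi>W_def \<Xi>V_def)
 have comp: "(\<lambda>\<omega>. f \<omega> $ i) \<in> borel_measurable N" if "f \<in> borel_measurable N" for f :: "'a \<Rightarrow> real^'k::finite" and i N
  using measurable_compose[OF that, of "\<lambda>z. z $ i" borel] by simp
 have xW: "x t \<in> borel_measurable (GW t)" for t by (rule measurable_from_subalg[OF hist_GW state_measurable])
 have xV: "x t \<in> borel_measurable (GV j t)" for t j by (rule measurable_from_subalg[OF hist_GV state_measurable])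
 have mW: "\<xi> t \<in> borel_measurable (GW t)" if "\<xi> \<in> \<Xi>W" for \<xi> t
  using that by (auto simp: \<Xi>W_def one_def xi_def vi_def gi_def
   intro!: comp[OF predictable_state_noise, unfolded vector_minus_component] comp[OF xW] comp[OF v_GW])
 have mV: "\<xi> t \<in> borel_measurable (GV j t)" if "\<xi> \<in> \<Xi>V j" for \<xi> t j
  using that by (cases "t = 0") (auto simp: \<Xi>V_def one_def xi_def vi_def pi_def intro!: comp xV v_GV w_GV)
 have inW: "innovation M GW (\<lambda>t \<omega>. h (w t \<omega>))" if "h \<in> borel_measurable borel" for h :: "_ \<Rightarrow> real"
  by (rule innovation_compose[OF M innovation_w that])
 have inV: "innovation M (GV m) (\<lambda>t \<omega>. h (v m t \<omega>))" if "h \<in> borel_measurable borel" for h :: "_ \<Rightarrow> real" and m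
  by (rule innovation_compose[OF M innovation_v that])
 have bI: "bound_event D" if "D \<in> I" for D
 proof -
  consider (1) l \<xi> where "\<xi> \<in> \<Xi>W" "D = Dev \<xi> (wi l) cW" | (2) j l \<xi> where "\<xi> \<in> \<Xi>V j" "D = Dev \<xi> (vi (j, l)) (cV j)"
   | (3) i l where "D = Avg (\<lambda>t \<omega>. w t \<omega> $ i * w t \<omega> $ l - noise_cov G $ i $ l) yW kW"
   | (4) m i l where "D = Avg (\<lambda>t \<omega>. v m t \<omega> $ i * v m t \<omega> $ l - ident_on (ctrl G m) $ i $ l) (yV m) (kV m)"
   using \<open>D \<in> I\<close> unfolding I_def by blast
  then show ?thesis
  proof cases
   case 1
   show ?thesis unfolding 1(2) wi_def by (rule bound_event_Dev[OF inW[of "\<lambda>z. z $ l"] mW[OF 1(1)] cW(2)]) simp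
  next
   case 2
   show ?thesis unfolding 2(2) vi_def prod.case by (rule bound_event_Dev[OF inV[of "\<lambda>z. z $ l"] mV[OF 2(1)] cV(2)]) simp
  next
   case 3
   show ?thesis unfolding 3 by (rule bound_event_Avg[OF inW[of "\<lambda>z. z $ i * z $ l - noise_cov G $ i $ l"] W]) simp
  next
   case 4
   show ?thesis unfolding 4 by (rule bound_event_Avg[OF inV[of "\<lambda>z. z $ i * z $ l - ident_on (ctrl G m) $ i $ l"] VV Vm]) simp
  qed
 qed
 obtain k where k: "0 < k" "\<And>\<delta>. 0 < \<delta> \<Longrightarrow> \<delta> < 1 \<Longrightarrow>
   prob {\<omega>\<in>space M. \<forall>D\<in>I. \<forall>b. \<forall>a<b. \<not> D a b (3 * ln (real b + 1) + ln (1 / \<delta>) + k) \<omega>} \<ge> 1 - \<delta>"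
  "\<And>\<delta>. {\<omega>\<in>space M. \<forall>D\<in>I. \<forall>b. \<forall>a<b. \<not> D a b (3 * ln (real b + 1) + ln (1 / \<delta>) + k) \<omega>} \<in> events"
 proof (rule uniform_union_bound[OF finI, of "\<lambda>D. D"])
  show "prob {\<omega>\<in>space M. i a b u \<omega>} \<le> 2 * exp (- u)" if "i \<in> I" "a < b" "0 < u" for i a b u
   using bI[OF that(1)] that unfolding bound_event_def by blast
  show "{\<omega>\<in>space M. i a b u \<omega>} \<in> events" if "i \<in> I" for i a b u
   using bI[OF that(1)] unfolding bound_event_def by blast
 qed blast
 define C1 where "C1 = sqrt (3 + k) * (1 + cW)"
 define C2 where "C2 m = sqrt (3 + k) * (1 + cV m)" for m
 define C3 where "C3 = (3 + k) / yW + kW * yW"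
 define C4 where "C4 m = (3 + k) / yV m + kV m * yV m" for m
 define C where "C = C1 + sum C2 UNIV + C3 + sum C4 UNIV"
 have pos: "0 < C1" "\<And>m. 0 \<le> C2 m" "0 \<le> C3" "\<And>m. 0 \<le> C4 m"
  using k(1) cW cV W VV by (auto simp: C1_def C2_def C3_def C4_def less_imp_le add_nonneg_nonneg)
 have sp: "0 \<le> sum C2 UNIV" "0 \<le> sum C4 UNIV" using pos by (auto intro: sum_nonneg)
 have mem: "C2 m \<le> sum C2 UNIV" "C4 m \<le> sum C4 UNIV" for m using pos by (auto intro: member_le_sum)
 have leC: "C1 \<le> C" "C2 m \<le> C" "C3 \<le> C" "C4 m \<le> C" for m using pos(1,3) sp mem[of m] unfolding C_def by linarith+
 have C0: "0 < C" using leC(1) pos(1) by linarith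
 show thesis
 proof (rule that[OF C0])
  fix \<delta> :: real assume \<delta>: "0 < \<delta>" "\<delta> < 1"
  define L where "L = ln (1 / \<delta>)"
  have L: "0 \<le> L" using \<delta> by (simp add: L_def)
  define A where "A = {\<omega>\<in>space M. \<forall>D\<in>I. \<forall>b. \<forall>a<b. \<not> D a b (3 * ln (real b + 1) + L + k) \<omega>}"
  have "regular_path C L G (\<lambda>t. x t \<omega>) (\<lambda>t. w t \<omega>) (\<lambda>m t. v m t \<omega>)" if "\<omega> \<in> A" for \<omega>
  proof -
   have nD: "\<not> D a b (3 * ln (real b + 1) + L + k) \<omega>" if "D \<in> I" "a < b" for D a b using \<open>\<omega> \<in> A\<close> that by (auto simp: A_def)
   have dW: "deviation_bound C L (\<lambda>t. \<xi> t \<omega>) (\<lambda>t. w t \<omega> $ l)" if "\<xi> \<in> \<Xi>W" for \<xi> l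
   proof (rule deviation_bound_mono[OF _ leC(1) L], unfold C1_def, rule deviation_boundI[OF L k(1)])
    fix a b :: nat assume "a < b"
    have "Dev \<xi> (wi l) cW \<in> I" using that unfolding I_def by blast
    from nD[OF this \<open>a < b\<close>] show "\<bar>\<Sum>t\<in>{a..<b}. \<xi> t \<omega> * w t \<omega> $ l\<bar> \<le> sqrt ((3 * ln (real b + 1) + L + k) / real (b - a)) * cW * (\<Sum>t\<in>{a..<b}. (\<xi> t \<omega>)^2) + sqrt ((3 * ln (real b + 1) + L + k) * real (b - a))"
     unfolding Dev_def wi_def by linarith
   qed (use cW in auto)
   have dV: "deviation_bound C L (\<lambda>t. \<xi> t \<omega>) (\<lambda>t. v j t \<omega> $ l)" if "\<xi> \<in> \<Xi>V j" for \<xi> l j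
   proof (rule deviation_bound_mono[OF _ leC(2)[of j] L], unfold C2_def, rule deviation_boundI[OF L k(1)])
    fix a b :: nat assume "a < b"
    have "Dev \<xi> (vi (j, l)) (cV j) \<in> I" using that unfolding I_def by blast
    from nD[OF this \<open>a < b\<close>] show "\<bar>\<Sum>t\<in>{a..<b}. \<xi> t \<omega> * v j t \<omega> $ l\<bar> \<le> sqrt ((3 * ln (real b + 1) + L + k) / real (b - a)) * cV j * (\<Sum>t\<in>{a..<b}. (\<xi> t \<omega>)^2) + sqrt ((3 * ln (real b + 1) + L + k) * real (b - a))"
     unfolding Dev_def vi_def prod.case by linarith
   qed (use cV(1)[of j] in \<open>auto intro: less_imp_le\<close>)
   have aW: "average_bound C L (\<lambda>t. w t \<omega> $ i * w t \<omega> $ l) (noise_cov G $ i $ l)" for i l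
   proof (rule average_bound_mono[OF _ leC(3) L], unfold C3_def, rule average_boundI[OF L k(1) W(2,1)])
    fix a b :: nat assume "a < b"
    have "Avg (\<lambda>t \<omega>. w t \<omega> $ i * w t \<omega> $ l - noise_cov G $ i $ l) yW kW \<in> I"
     unfolding I_def by (rule UnI1, rule UnI2, rule UN_I[of i], rule UNIV_I, rule UN_I[of l], rule UNIV_I, rule singletonI)
    from nD[OF this \<open>a < b\<close>] show "\<bar>\<Sum>t\<in>{a..<b}. w t \<omega> $ i * w t \<omega> $ l - noise_cov G $ i $ l\<bar> \<le> sqrt (real (b - a)) * ((3 * ln (real b + 1) + L + k) / yW + kW * yW)"
     unfolding Avg_def by linarith
   qed
   have aV: "average_bound C L (\<lambda>t. v m t \<omega> $ i * v m t \<omega> $ l) (ident_on (ctrl G m) $ i $ l)" for i l m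
   proof (rule average_bound_mono[OF _ leC(4)[of m] L], unfold C4_def, rule average_boundI[OF L k(1) VV(2,1)])
    fix a b :: nat assume "a < b"
    have "Avg (\<lambda>t \<omega>. v m t \<omega> $ i * v m t \<omega> $ l - ident_on (ctrl G m) $ i $ l) (yV m) (kV m) \<in> I"
     unfolding I_def by (rule UnI2, rule UN_I[of m], rule UNIV_I, rule UN_I[of i], rule UNIV_I, rule UN_I[of l], rule UNIV_I, rule singletonI)
    from nD[OF this \<open>a < b\<close>] show "\<bar>\<Sum>t\<in>{a..<b}. v m t \<omega> $ i * v m t \<omega> $ l - ident_on (ctrl G m) $ i $ l\<bar> \<le> sqrt (real (b - a)) * ((3 * ln (real b + 1) + L + k) / yV m + kV m * yV m)"
     unfolding Avg_def by linarith
   qed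
   have o: "one \<in> \<Xi>W" "one \<in> \<Xi>V j" "xi i \<in> \<Xi>W" "xi i \<in> \<Xi>V j" "vi (m, l) \<in> \<Xi>W" "m \<noteq> j \<Longrightarrow> vi (m, l) \<in> \<Xi>V j"
    "gi i \<in> \<Xi>W" "pi i \<in> \<Xi>V j" for i j m l by (auto simp: \<Xi>W_def \<Xi>V_def)
   show ?thesis unfolding regular_path_def
    using dW[OF o(1)] dV[OF o(2)] dW[OF o(3)] dV[OF o(4)] dW[OF o(5)] dV[OF o(6)] dW[OF o(7)] dV[OF o(8)] aW aV
    unfolding one_def xi_def vi_def gi_def pi_def prod.case by blast
  qed
  moreover have "A \<in> events" "1 - \<delta> \<le> prob A" using k(2)[OF \<delta>] k(3)[of \<delta>] unfolding A_def L_def by auto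
  ultimately show "\<exists>A\<in>events. 1 - \<delta> \<le> prob A \<and> (\<forall>\<omega>\<in>A. regular_path C (ln (1 / \<delta>)) G (\<lambda>t. x t \<omega>) (\<lambda>t. w t \<omega>) (\<lambda>m t. v m t \<omega>))"
   unfolding L_def by blast
 qed
qed

end

section \<open>Stable trajectories\<close>

lemma norm_le_component_bound:
 fixes y :: "real^'k::finite" assumes "\<And>i. \<bar>y $ i\<bar> \<le> b" shows "norm y \<le> real CARD('k) * b"
proof -
 have "norm y \<le> (\<Sum>i\<in>UNIV. \<bar>y $ i\<bar>)" by (rule norm_le_l1_cart)
 also have "\<dots> \<le> (\<Sum>i\<in>(UNIV::'k set). b)" by (intro sum_mono assms)
 finally show ?thesis by simp
qed

locale stable_learning = learning_setup M G c W V \<Phi> \<beta> init x0 w v sh r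
 for M :: "'a measure" and G :: "('m::finite, 'n::finite, 'd::finite) lq_game" and c W V \<Phi> \<beta> init x0 w v sh r +
 assumes sel: "optimal_selection G W V \<Phi>" and stable: "uniformly_stable G"
begin

abbreviation "regular C L \<xi> \<equiv> regular_path C L G (\<lambda>t. x t \<xi>) (\<lambda>t. w t \<xi>) (\<lambda>m t. v m t \<xi>)"
abbreviation "lam \<equiv> growth c"
abbreviation "st \<xi> \<equiv> epoch_start c (shp \<xi>)"
abbreviation "len \<xi> \<equiv> epoch_len c (shp \<xi>)"
abbreviation "rlen \<xi> m k \<equiv> real (len \<xi> m k)"
abbreviation "iv \<xi> m k \<equiv> {st \<xi> m (k - 1)..<st \<xi> m k}"

definition "numin = (MIN m. decay c m)"
definition "numax = (MAX m. decay c m)"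
text \<open>The slower of the two polynomial rates. Logarithmic quantities will be required to stay
  below the power \<open>\<eta>\<close> of \<open>lam ^ k\<close>, so that they outweigh neither
  rate.\<close>

definition "\<eta> = min numin (1/2 - numax)"

lemma decay_bounds: "numin \<le> decay c m" "decay c m \<le> numax" "0 < numin" "numin \<le> numax" "numax < 1/2" "0 < \<eta>" "\<eta> \<le> numin" "\<eta> \<le> 1/2 - numax"
proof -
 have f: "finite (range (decay c))" "range (decay c) \<noteq> {}" by auto
 have d: "0 < decay c m" "decay c m < 1/2" for m using c by (auto simp: valid_schedule_def)
 show 1: "numin \<le> decay c m" "decay c m \<le> numax" unfolding numin_def numax_def by auto
 show 2: "0 < numin" unfolding numin_def using d f by (subst Min_gr_iff) auto
 show 3: "numax < 1/2" unfolding numax_def using d f by (subst Max_less_iff) auto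
 show "numin \<le> numax" using 1 by linarith
 show "0 < \<eta>" "\<eta> \<le> numin" "\<eta> \<le> 1/2 - numax" using 2 3 by (auto simp: \<eta>_def)
qed

lemma lam: "1 < lam" using c by (simp add: valid_schedule_def)

lemma epoch_facts: assumes "\<xi> \<in> space M"
 shows "1 \<le> k \<Longrightarrow> scale_len c * lam ^ k - 1 \<le> rlen \<xi> m k"
  and "1 \<le> k \<Longrightarrow> rlen \<xi> m k \<le> (base_len c + scale_len c + max_shift c) * lam ^ k"
  and "st \<xi> m (Suc k) = st \<xi> m k + len \<xi> m (Suc k)"
  and "1 \<le> k \<Longrightarrow> scale_len c * lam ^ k - 1 \<le> real (st \<xi> m k)"
  and "real (st \<xi> m k) \<le> (base_len c + scale_len c + max_shift c) * lam / (lam - 1) * lam ^ k"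
  and "st \<xi> m (ep \<xi> m t) \<le> t" "t < st \<xi> m (ep \<xi> m t + 1)"
  and "1 \<le> k \<Longrightarrow> real (card {t \<in> iv \<xi> m k. ep \<xi> j t \<noteq> k - 1}) \<le> 2 * real k * (max_shift c + 1)"
  and "0 \<le> al \<xi> m k" "al \<xi> m k \<le> expl_scale c"
  and "1 \<le> t \<Longrightarrow> (lam - 1) / ((base_len c + scale_len c + max_shift c) * lam ^ 2) * real t \<le> lam ^ ep \<xi> m t"
  and "1 \<le> t \<Longrightarrow> lam ^ ep \<xi> m t \<le> (2 / scale_len c + 1) * real t"
  and "st \<xi> m k \<le> t \<Longrightarrow> t < st \<xi> m (k + 1) \<Longrightarrow> ep \<xi> m t = k"
proof -
 have s: "shp \<xi> m k \<in> {0..max_shift c}" if "1 \<le> k" for m k using shift_range[OF assms that] .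
 note b = epoch_len_bounds[where sh="shp \<xi>", OF c s] epoch_start_Suc[where sh="shp \<xi>", OF c s]
  epoch_start_lower[where sh="shp \<xi>", OF c s] epoch_start_upper[where sh="shp \<xi>", OF c s]
  epoch_at_bounds[where sh="shp \<xi>", OF c s] misaligned_card[where sh="shp \<xi>", OF c s]
  exploration_bounds[where sh="shp \<xi>", OF c s] growth_epoch_at[where sh="shp \<xi>", OF c s] epoch_at_eqI[where sh="shp \<xi>", OF c s]
 show "1 \<le> k \<Longrightarrow> scale_len c * lam ^ k - 1 \<le> rlen \<xi> m k"
  "1 \<le> k \<Longrightarrow> rlen \<xi> m k \<le> (base_len c + scale_len c + max_shift c) * lam ^ k"
  "st \<xi> m (Suc k) = st \<xi> m k + len \<xi> m (Suc k)"
  "1 \<le> k \<Longrightarrow> scale_len c * lam ^ k - 1 \<le> real (st \<xi> m k)"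
  "real (st \<xi> m k) \<le> (base_len c + scale_len c + max_shift c) * lam / (lam - 1) * lam ^ k"
  "st \<xi> m (ep \<xi> m t) \<le> t" "t < st \<xi> m (ep \<xi> m t + 1)"
  "1 \<le> k \<Longrightarrow> real (card {t \<in> iv \<xi> m k. ep \<xi> j t \<noteq> k - 1}) \<le> 2 * real k * (max_shift c + 1)"
  "0 \<le> al \<xi> m k" "al \<xi> m k \<le> expl_scale c"
  "1 \<le> t \<Longrightarrow> (lam - 1) / ((base_len c + scale_len c + max_shift c) * lam ^ 2) * real t \<le> lam ^ ep \<xi> m t"
  "1 \<le> t \<Longrightarrow> lam ^ ep \<xi> m t \<le> (2 / scale_len c + 1) * real t"
  "st \<xi> m k \<le> t \<Longrightarrow> t < st \<xi> m (k + 1) \<Longrightarrow> ep \<xi> m t = k" by (rule b; assumption)+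
qed

text \<open>Once \<open>lam ^ k\<close> exceeds this value, rounding costs at most half of the main
  term of the epoch length, and the data interval of estimate \<open>k\<close> starts at time 1 or
  later. The second point makes \<open>w (t - 1)\<close> a genuine past noise at every time of the
  interval.\<close>

definition X0 :: real where "X0 = max (lam ^ 2) (2 * lam / scale_len c + 2 / scale_len c)"

lemma large_epoch:
 assumes \<xi>: "\<xi> \<in> space M" and k: "1 \<le> k" "X0 \<le> lam ^ k"
 shows "2 \<le> k" "1 \<le> st \<xi> m (k - 1)" "scale_len c / 2 * lam ^ k \<le> rlen \<xi> m k" "1 \<le> rlen \<xi> m k"
  "st \<xi> m k = st \<xi> m (k - 1) + len \<xi> m k"
proof -
 have s: "0 < scale_len c" using c by (simp add: valid_schedule_def)
 have "lam ^ 2 \<le> lam ^ k" using k(2) by (simp add: X0_def)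
 then show k2: "2 \<le> k" using lam by simp
 have "2 * lam / scale_len c + 2 / scale_len c \<le> lam ^ k" using k(2) by (simp add: X0_def)
 then have b: "2 * lam + 2 \<le> scale_len c * lam ^ k" using s by (simp add: field_simps)
 have "scale_len c * lam ^ k = lam * (scale_len c * lam ^ (k - 1))" using k by (simp add: power_eq_if)
 then have "lam * 2 \<le> lam * (scale_len c * lam ^ (k - 1))" using b by linarith
 then have "2 \<le> scale_len c * lam ^ (k - 1)" using lam by simp
 then show "1 \<le> st \<xi> m (k - 1)"
 proof -
  have "1 \<le> k - 1" using k2 by simp
  from epoch_facts(4)[OF \<xi> this, of m] \<open>2 \<le> scale_len c * lam ^ (k - 1)\<close> show ?thesis by linarith
 qed
 show l: "scale_len c / 2 * lam ^ k \<le> rlen \<xi> m k" using epoch_facts(1)[OF \<xi> k(1), of m] b lam by simp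
 show "1 \<le> rlen \<xi> m k" using l b lam by simp
 show "st \<xi> m k = st \<xi> m (k - 1) + len \<xi> m k" using epoch_facts(3)[OF \<xi>, of m "k - 1"] k by simp
qed

definition "\<theta>hat \<xi> m k = (ls_param (\<beta> m) (\<lambda>t. regressor (x t \<xi>) (control r m t \<xi>)) (\<lambda>t. x t \<xi>) (iv \<xi> m k),
  ls_cov (\<beta> m) (\<lambda>t. regressor (x t \<xi>) (control r m t \<xi>)) (\<lambda>t. x t \<xi>) (iv \<xi> m k))"

lemma estimate_eq:
 assumes "\<xi> \<in> space M" "1 \<le> k"
 shows "estimate r m k \<xi> = (if \<theta>hat \<xi> m k \<in> feasible G W V m then \<theta>hat \<xi> m k else estimate r m (k - 1) \<xi>)"
 using run assms unfolding runs_algorithm_def Let_def \<theta>hat_def by blast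

lemma policy_eq:
 assumes "\<xi> \<in> space M"
 shows "policy r m k \<xi> = \<Phi> m (estimate r m k \<xi>) (x (st \<xi> m k) \<xi>) (al \<xi> m k)"
 using run assms unfolding runs_algorithm_def Let_def by blast

text \<open>The initial model is feasible and infeasible estimates are discarded, so the adopted
  model is always feasible and the selection returns an admissible strategy. This holds on every
  path, also where the estimates are poor.\<close>

lemma policy_strategy:
 assumes \<xi>: "\<xi> \<in> space M" shows "policy r m k \<xi> \<in> strategies G m"
proof -
 have i: "init m \<in> feasible G W V m" using run by (simp add: runs_algorithm_def)
 have e0: "estimate r m 0 \<xi> = init m" using run \<xi> unfolding runs_algorithm_def Let_def by blast
 have "estimate r m (Suc k) \<xi> \<in> feasible G W V m \<or> estimate r m (Suc k) \<xi> = estimate r m k \<xi>" for k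
  using estimate_eq[OF \<xi>, of "Suc k" m] by simp
 then have "estimate r m k \<xi> \<in> feasible G W V m" for k by (induction k) (metis e0 i, metis)
 then show ?thesis unfolding policy_eq[OF \<xi>] using sel epoch_facts(9)[OF \<xi>, of m k] unfolding optimal_selection_def by simp
qed

lemma policy_bounds:
 assumes \<xi>: "\<xi> \<in> space M"
 shows "spec_norm (fst (policy r m k \<xi>)) \<le> radF G m" "norm (snd (policy r m k \<xi>)) \<le> radf G m"
  "supp_in (ctrl G m) (fst (policy r m k \<xi>))" "supp_in (ctrl G m) (snd (policy r m k \<xi>))"
 using policy_strategy[OF \<xi>, of m k] by (auto simp: strategies_def gains_def offsets_def)

text \<open>The Euclidean norm of the state is a Lyapunov function common to all admissible gain
  profiles, with the same factor \<open>\<gamma>\<close>. Policy changes at epochs that are not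
  synchronized between players therefore cost nothing.\<close>

lemma one_step:
 obtains \<gamma> b where "0 < \<gamma>" "\<gamma> < 1" "0 \<le> b"
  "\<And>\<xi> t. \<xi> \<in> space M \<Longrightarrow> norm (x (Suc t) \<xi>) \<le> \<gamma> * norm (x t \<xi>) + (norm (w t \<xi>) + b * (1 + (\<Sum>j\<in>UNIV. norm (v j t \<xi>))))"
proof -
 obtain \<gamma> where \<gamma>: "0 < \<gamma>" "\<gamma> < 1"
  "\<And>F x. F \<in> gain_profiles G \<Longrightarrow> norm ((Amat G - (\<Sum>m\<in>UNIV. Bmat G m ** F m)) *v x) \<le> \<gamma> * norm x"
  using stability_factor[OF stable] by blast
 define b1 where "b1 = norm (drift G) + (\<Sum>j\<in>UNIV. spec_norm (Bmat G j) * radf G j)"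
 define b2 where "b2 = (\<Sum>j\<in>UNIV. spec_norm (Bmat G j) * expl_scale c)"
 have ex: "0 < expl_scale c" using c by (simp add: valid_schedule_def)
 have rd: "0 < radf G j" for j using G by (simp add: valid_game_def)
 have b: "0 \<le> b1" "0 \<le> b2"
  unfolding b1_def b2_def by (intro add_nonneg_nonneg sum_nonneg mult_nonneg_nonneg norm_ge_zero spec_norm_nonneg less_imp_le[OF rd] less_imp_le[OF ex])+
 show thesis
 proof (rule that[OF \<gamma>(1,2), of "b1 + b2"])
  show "0 \<le> b1 + b2" using b by simp
  fix \<xi> t assume \<xi>: "\<xi> \<in> space M"
  let ?p = "\<lambda>j. policy r j (ep \<xi> j t) \<xi>"
  let ?F = "\<lambda>j. fst (?p j)" and ?a = "\<lambda>j. al \<xi> j (ep \<xi> j t)"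
  have F: "?F \<in> gain_profiles G" using policy_strategy[OF \<xi>] by (auto simp: gain_profiles_def strategies_def mem_Times_iff)
  have Bu: "Bmat G j *v control r j t \<xi> = Bmat G j *v snd (?p j) - (Bmat G j ** ?F j) *v x t \<xi> + ?a j *\<^sub>R (Bmat G j *v v j t \<xi>)" for j
   unfolding control_eq[OF \<xi>] feedback_def
   by (simp add: matrix_vector_right_distrib matrix_vector_mul_assoc[symmetric] linear_diff[OF matrix_vector_mul_linear]
     linear_neg[OF matrix_vector_mul_linear] linear_scale[OF matrix_vector_mul_linear])
  have "x (Suc t) \<xi> = (Amat G - (\<Sum>j\<in>UNIV. Bmat G j ** ?F j)) *v x t \<xi> + (w t \<xi> + (drift G + (\<Sum>j\<in>UNIV. Bmat G j *v snd (?p j))) + (\<Sum>j\<in>UNIV. ?a j *\<^sub>R (Bmat G j *v v j t \<xi>)))"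
   unfolding state_Suc[OF \<xi>] game_step_def Bu
   by (simp add: sum.distrib sum_subtractf matrix_vector_mult_diff_rdistrib matrix_vector_mult_sum)
  then have "norm (x (Suc t) \<xi>) \<le> norm ((Amat G - (\<Sum>j\<in>UNIV. Bmat G j ** ?F j)) *v x t \<xi>) + (norm (w t \<xi>) + norm (drift G + (\<Sum>j\<in>UNIV. Bmat G j *v snd (?p j))) + norm (\<Sum>j\<in>UNIV. ?a j *\<^sub>R (Bmat G j *v v j t \<xi>)))"
  proof -
   have "norm (p + (q + s + z)) \<le> norm p + (norm q + norm s + norm z)" for p q s z :: "real^'n" by norm
   then show ?thesis using \<open>x (Suc t) \<xi> = _\<close> by simp
  qed
  moreover have "norm (drift G + (\<Sum>j\<in>UNIV. Bmat G j *v snd (?p j))) \<le> b1" unfolding b1_def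
  proof (intro norm_triangle_le add_left_mono sum_norm_le)
   fix j
   have "norm (Bmat G j *v snd (?p j)) \<le> spec_norm (Bmat G j) * norm (snd (?p j))" by (rule norm_matrix_vector_le)
   also have "\<dots> \<le> spec_norm (Bmat G j) * radf G j" using policy_bounds(2)[OF \<xi>] by (intro mult_left_mono) auto
   finally show "norm (Bmat G j *v snd (?p j)) \<le> spec_norm (Bmat G j) * radf G j" .
  qed
  moreover have "norm (\<Sum>j\<in>UNIV. ?a j *\<^sub>R (Bmat G j *v v j t \<xi>)) \<le> b2 * (\<Sum>j\<in>UNIV. norm (v j t \<xi>))"
  proof -
   have "norm (\<Sum>j\<in>UNIV. ?a j *\<^sub>R (Bmat G j *v v j t \<xi>)) \<le> (\<Sum>j\<in>UNIV. b2 * norm (v j t \<xi>))"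
   proof (rule sum_norm_le)
    fix j
    have "norm (?a j *\<^sub>R (Bmat G j *v v j t \<xi>)) \<le> expl_scale c * (spec_norm (Bmat G j) * norm (v j t \<xi>))"
     unfolding norm_scaleR using epoch_facts(9,10)[OF \<xi>, of j "ep \<xi> j t"] ex by (intro mult_mono norm_matrix_vector_le) auto
    also have "\<dots> = spec_norm (Bmat G j) * expl_scale c * norm (v j t \<xi>)" by simp
    also have "\<dots> \<le> b2 * norm (v j t \<xi>)" unfolding b2_def using ex by (intro mult_right_mono member_le_sum) auto
    finally show "norm (?a j *\<^sub>R (Bmat G j *v v j t \<xi>)) \<le> b2 * norm (v j t \<xi>)" .
   qed
   then show ?thesis by (simp add: sum_distrib_left)
  qed
  moreover have "0 \<le> (\<Sum>j\<in>UNIV. norm (v j t \<xi>))" by (intro sum_nonneg) auto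
  then have "b1 + b2 * (\<Sum>j\<in>UNIV. norm (v j t \<xi>)) \<le> (b1 + b2) * (1 + (\<Sum>j\<in>UNIV. norm (v j t \<xi>)))"
   using b by (simp add: algebra_simps)
  ultimately show "norm (x (Suc t) \<xi>) \<le> \<gamma> * norm (x t \<xi>) + (norm (w t \<xi>) + (b1 + b2) * (1 + (\<Sum>j\<in>UNIV. norm (v j t \<xi>))))"
   using \<gamma>(3)[OF F, of "x t \<xi>"] by linarith
 qed
qed

text \<open>The cube is the price of the unsynchronized steps: there are of order
  \<open>k + L\<close> of them, each contributes a product of two factors of order
  \<open>sqrt (k + L)\<close>, and the total \<open>(k + L)^2\<close> must not exceed the order of
  \<open>sqrt ((k + L) * n)\<close> for epoch length \<open>n\<close>.\<close>

definition good :: "real \<Rightarrow> 'a \<Rightarrow> real \<Rightarrow> nat \<Rightarrow> bool" where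
 "good C \<xi> L k \<longleftrightarrow> \<xi> \<in> space M \<and> 0 \<le> L \<and> 1 \<le> k \<and> X0 \<le> lam ^ k \<and> (real k + L) ^ 3 \<le> lam powr (\<eta> * real k) \<and>
   regular C L \<xi>"

lemma goodD:
 assumes "good C \<xi> L k"
 shows "\<xi> \<in> space M" "0 \<le> L" "1 \<le> k" "1 \<le> real k + L" "(real k + L) ^ 3 \<le> (lam ^ k) powr \<eta>" "real k + L \<le> (real k + L) ^ 3"
  "1 \<le> lam ^ k" "real k + L \<le> sqrt (lam ^ k)" "sqrt (real k + L) \<le> (lam ^ k) powr numin" "real k + L \<le> lam ^ k" "(real k + L) ^ 3 \<le> lam ^ k"
proof -
 show 1: "\<xi> \<in> space M" "0 \<le> L" "1 \<le> k" using assms by (auto simp: good_def)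
 show 2: "1 \<le> real k + L" using 1 by simp
 have e: "lam powr (\<eta> * real k) = (lam ^ k) powr \<eta>" using lam by (simp add: powr_realpow[symmetric] powr_powr mult.commute)
 show 3: "(real k + L) ^ 3 \<le> (lam ^ k) powr \<eta>" using assms unfolding good_def e by simp
 show 4: "real k + L \<le> (real k + L) ^ 3" using 2 by (rule self_le_power) simp
 show 5: "1 \<le> lam ^ k" using lam by (simp add: one_le_power)
 have "(lam ^ k) powr \<eta> \<le> (lam ^ k) powr (1/2)" using decay_bounds(3-8) 5 by (intro powr_mono) auto
 then show "real k + L \<le> sqrt (lam ^ k)" using 3 4 5 by (simp add: powr_half_sqrt)
 have "sqrt (real k + L) \<le> real k + L" using 2 real_sqrt_le_mono[of "real k + L" "(real k + L)^2"] by (simp add: self_le_power power2_eq_square)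
 moreover have "(lam ^ k) powr \<eta> \<le> (lam ^ k) powr numin" using decay_bounds(3-8) 5 by (intro powr_mono) auto
 ultimately show "sqrt (real k + L) \<le> (lam ^ k) powr numin" using 3 4 by linarith
 have "(lam ^ k) powr \<eta> \<le> (lam ^ k) powr 1" using decay_bounds(3-8) 5 by (intro powr_mono) auto
 then show "(real k + L) ^ 3 \<le> lam ^ k" "real k + L \<le> lam ^ k" using 3 4 5 by auto
qed

text \<open>The end of the data interval is of order \<open>lam ^ k\<close>, so logarithms of its
  times are of order \<open>k\<close>. From here on \<open>k + L\<close> replaces all logarithmic
  factors.\<close>

lemma log_bound:
 obtains Cu where "1 \<le> Cu" "\<And>C \<xi> L k m b. good C \<xi> L k \<Longrightarrow> b \<le> st \<xi> m k \<Longrightarrow> ln (real b + 1) + L + 1 \<le> Cu * (real k + L)"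
proof -
 define e1 where "e1 = (base_len c + scale_len c + max_shift c) * lam / (lam - 1)"
 have e1: "0 \<le> e1" using c lam by (auto simp: e1_def valid_schedule_def)
 show thesis
 proof (rule that[of "ln (e1 + 1) + ln lam + 2"])
  show "1 \<le> ln (e1 + 1) + ln lam + 2" using e1 lam by (simp add: add_nonneg_nonneg)
  fix C \<xi> L k m b assume g: "good C \<xi> L k" and b: "b \<le> st \<xi> m k"
  note g' = goodD[OF g]
  have "real b + 1 \<le> e1 * lam ^ k + 1" using epoch_facts(5)[OF g'(1), of m k] b unfolding e1_def by linarith
  also have "\<dots> \<le> (e1 + 1) * lam ^ k" using g'(7) by (simp add: distrib_right)
  finally have "ln (real b + 1) \<le> ln ((e1 + 1) * lam ^ k)" by (intro ln_mono) auto
  also have "\<dots> = ln (e1 + 1) + real k * ln lam" using e1 lam by (simp add: ln_mult ln_realpow)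
  also have "\<dots> \<le> ln (e1 + 1) * (real k + L) + ln lam * (real k + L)"
  proof (rule add_mono)
   show "ln (e1 + 1) \<le> ln (e1 + 1) * (real k + L)" using e1 g'(4) mult_left_mono[of 1 "real k + L" "ln (e1 + 1)"] by simp
   show "real k * ln lam \<le> ln lam * (real k + L)" using lam g'(2) by (simp add: distrib_left mult.commute)
  qed
  moreover have "L + 1 \<le> 2 * (real k + L)" using g' by simp
  ultimately show "ln (real b + 1) + L + 1 \<le> (ln (e1 + 1) + ln lam + 2) * (real k + L)" by (simp add: distrib_right)
 qed
qed

text \<open>On an interval of length one with constant multiplier the sum is a single noise value,
  so the deviation bound also controls the maximum of the noises, without a separate tail
  estimate.\<close>

lemma noise_sup_bound:
 obtains K where "0 \<le> K" "\<And>\<xi> L k m t. good C \<xi> L k \<Longrightarrow> t < st \<xi> m k \<Longrightarrow> norm (w t \<xi>) \<le> K * sqrt (real k + L)"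
  "\<And>\<xi> L k m t j. good C \<xi> L k \<Longrightarrow> t < st \<xi> m k \<Longrightarrow> norm (v j t \<xi>) \<le> K * sqrt (real k + L)"
proof -
 obtain Cu where Cu: "1 \<le> Cu" "\<And>C \<xi> L k m b. good C \<xi> L k \<Longrightarrow> b \<le> st \<xi> m k \<Longrightarrow> ln (real b + 1) + L + 1 \<le> Cu * (real k + L)"
  using log_bound by blast
 define b where "b = 2 * \<bar>C\<bar> * sqrt Cu"
 have dev: "\<bar>Y t\<bar> \<le> b * sqrt (real k + L)"
  if g: "good C \<xi> L k" and t: "t < st \<xi> m k" and d: "deviation_bound C L (\<lambda>_. 1) Y" for \<xi> L k m t Y
 proof -
  let ?U = "ln (real (Suc t) + 1) + L + 1"
  have U: "?U \<le> Cu * (real k + L)" using Cu(2)[OF g, of "Suc t" m] t by simp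
  have "\<bar>Y t\<bar> \<le> C * (sqrt ?U + sqrt ?U)" using d[unfolded deviation_bound_def, rule_format, of t "Suc t"] by simp
  also have "\<dots> \<le> \<bar>C\<bar> * (sqrt ?U + sqrt ?U)" using goodD(2)[OF g] by (intro mult_right_mono) auto
  also have "\<dots> \<le> \<bar>C\<bar> * (2 * (sqrt Cu * sqrt (real k + L)))"
   using real_sqrt_le_mono[OF U] unfolding real_sqrt_mult by (intro mult_left_mono) auto
  finally show ?thesis by (simp add: b_def mult_ac)
 qed
 define K where "K = max (real CARD('n)) (real CARD('d)) * b"
 have b0: "0 \<le> b" using Cu(1) by (simp add: b_def)
 show thesis
 proof (rule that[of K])
  show "0 \<le> K" using b0 by (simp add: K_def le_max_iff_disj)
 next
  fix \<xi> L k m t assume g: "good C \<xi> L k" and t: "t < st \<xi> m k"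
  have "norm (w t \<xi>) \<le> real CARD('n) * (b * sqrt (real k + L))"
   by (intro norm_le_component_bound dev[OF g t]) (use g in \<open>auto simp: good_def regular_path_def\<close>)
  also have "\<dots> \<le> max (real CARD('n)) (real CARD('d)) * (b * sqrt (real k + L))"
   using b0 goodD(4)[OF g] by (intro mult_right_mono) auto
  finally show "norm (w t \<xi>) \<le> K * sqrt (real k + L)" by (simp add: K_def mult.assoc)
 next
  fix \<xi> L k m t j assume g: "good C \<xi> L k" and t: "t < st \<xi> m k"
  have "norm (v j t \<xi>) \<le> real CARD('d) * (b * sqrt (real k + L))"
   by (intro norm_le_component_bound dev[OF g t]) (use g in \<open>auto simp: good_def regular_path_def\<close>)
  also have "\<dots> \<le> max (real CARD('n)) (real CARD('d)) * (b * sqrt (real k + L))"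
   using b0 goodD(4)[OF g] by (intro mult_right_mono) auto
  finally show "norm (v j t \<xi>) \<le> K * sqrt (real k + L)" by (simp add: K_def mult.assoc)
 qed
qed

lemma state_sup_bound:
 obtains K where "0 \<le> K" "\<And>\<xi> L k m t. good C \<xi> L k \<Longrightarrow> t \<le> st \<xi> m k \<Longrightarrow> norm (x t \<xi>) \<le> K * sqrt (real k + L)"
proof -
 obtain \<gamma> b where \<gamma>: "0 < \<gamma>" "\<gamma> < 1" "0 \<le> b"
  "\<And>\<xi> t. \<xi> \<in> space M \<Longrightarrow> norm (x (Suc t) \<xi>) \<le> \<gamma> * norm (x t \<xi>) + (norm (w t \<xi>) + b * (1 + (\<Sum>j\<in>UNIV. norm (v j t \<xi>))))"
  using one_step by blast
 obtain K where K: "0 \<le> K" "\<And>\<xi> L k m t. good C \<xi> L k \<Longrightarrow> t < st \<xi> m k \<Longrightarrow> norm (w t \<xi>) \<le> K * sqrt (real k + L)"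
  "\<And>\<xi> L k m t j. good C \<xi> L k \<Longrightarrow> t < st \<xi> m k \<Longrightarrow> norm (v j t \<xi>) \<le> K * sqrt (real k + L)"
  using noise_sup_bound[of C] by blast
 define N where "N = K + b * (1 + real CARD('m) * K)"
 \<comment> \<open>Satisfies \<open>\<gamma> * K' + N \<le> K'\<close>, so that the bound reproduces
   itself under \<open>one_step\<close>.\<close>
 define K' where "K' = norm x0 + N / (1 - \<gamma>)"
 have N0: "0 \<le> N" using K \<gamma> by (simp add: N_def)
 show thesis
 proof (rule that[of K'])
  show "0 \<le> K'" using N0 \<gamma> by (simp add: K'_def)
  fix \<xi> L k m t assume g: "good C \<xi> L k" and t: "t \<le> st \<xi> m k"
  let ?s = "sqrt (real k + L)"
  have s1: "1 \<le> ?s" using goodD(4)[OF g] by simp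
  show "norm (x t \<xi>) \<le> K' * ?s" using t
  proof (induction t)
   case 0
   have "norm x0 * 1 \<le> K' * ?s" using s1 N0 \<gamma> by (intro mult_mono) (auto simp: K'_def)
   then show ?case using state_0[OF goodD(1)[OF g]] by simp
  next
   case (Suc t)
   then have t: "t < st \<xi> m k" by simp
   have "(\<Sum>j\<in>UNIV. norm (v j t \<xi>)) \<le> (\<Sum>j\<in>(UNIV::'m set). K * ?s)" by (intro sum_mono K(3)[OF g t])
   then have "norm (w t \<xi>) + b * (1 + (\<Sum>j\<in>UNIV. norm (v j t \<xi>))) \<le> K * ?s + b * (?s + real CARD('m) * K * ?s)"
    using K(2)[OF g t] \<gamma>(3) s1 by (intro add_mono mult_left_mono) auto
   also have "\<dots> = N * ?s" by (simp add: N_def algebra_simps)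
   finally have 1: "norm (w t \<xi>) + b * (1 + (\<Sum>j\<in>UNIV. norm (v j t \<xi>))) \<le> N * ?s" .
   have "\<gamma> * norm (x t \<xi>) \<le> \<gamma> * (K' * ?s)" using Suc \<gamma> by (intro mult_left_mono) auto
   moreover have "\<gamma> * K' + N \<le> K'"
   proof -
    have "\<gamma> * norm x0 \<le> norm x0" using \<gamma> mult_right_mono[of \<gamma> 1 "norm x0"] by simp
    moreover have "\<gamma> * (N / (1 - \<gamma>)) + N = N / (1 - \<gamma>)" using \<gamma> by (simp add: field_simps)
    ultimately show ?thesis by (simp add: K'_def distrib_left)
   qed
   then have "(\<gamma> * K' + N) * ?s \<le> K' * ?s" using s1 by (intro mult_right_mono) auto
   ultimately show ?case using \<gamma>(4)[OF goodD(1)[OF g], of t] 1 by (simp add: distrib_right)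
  qed
 qed
qed

lemma avg_sum:
 obtains K where "0 \<le> K" "\<And>\<xi> L k m X \<mu> a b. good C \<xi> L k \<Longrightarrow> a < b \<Longrightarrow> b \<le> st \<xi> m k \<Longrightarrow> average_bound C L X \<mu> \<Longrightarrow>
   \<bar>(\<Sum>t\<in>{a..<b}. X t) - real (b - a) * \<mu>\<bar> \<le> K * (sqrt (real (b - a)) * (real k + L))"
proof -
 obtain Cu where Cu: "1 \<le> Cu" "\<And>C \<xi> L k m b. good C \<xi> L k \<Longrightarrow> b \<le> st \<xi> m k \<Longrightarrow> ln (real b + 1) + L + 1 \<le> Cu * (real k + L)"
  using log_bound by blast
 show thesis
 proof (rule that[of "\<bar>C\<bar> * Cu"])
  show "0 \<le> \<bar>C\<bar> * Cu" using Cu by simp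
  fix \<xi> L k m X \<mu> a b assume g: "good C \<xi> L k" and ab: "a < b" "b \<le> st \<xi> m k" and A: "average_bound C L X \<mu>"
  let ?U = "ln (real b + 1) + L + 1"
  have "\<bar>(\<Sum>t\<in>{a..<b}. X t) - real (b - a) * \<mu>\<bar> \<le> C * (sqrt (real (b - a)) * ?U)"
   using A ab(1) unfolding average_bound_def by (simp add: mult.assoc)
  also have "\<dots> \<le> \<bar>C\<bar> * (sqrt (real (b - a)) * ?U)" using goodD(2)[OF g] by (intro mult_right_mono) auto
  also have "\<dots> \<le> \<bar>C\<bar> * (sqrt (real (b - a)) * (Cu * (real k + L)))" using Cu(2)[OF g ab(2)] by (intro mult_left_mono) auto
  finally show "\<bar>(\<Sum>t\<in>{a..<b}. X t) - real (b - a) * \<mu>\<bar> \<le> \<bar>C\<bar> * Cu * (sqrt (real (b - a)) * (real k + L))" by (simp add: mult_ac)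
 qed
qed

text \<open>Once the energy of the multiplier is known to be of the order of the interval length,
  the two summands of the self-normalized bound have the same order, the square root of
  \<open>k + L\<close> times the length.\<close>

lemma dev_sum:
 assumes "0 \<le> K"
 obtains B where "0 \<le> B" "\<And>\<xi> L k m X Y a b. good C \<xi> L k \<Longrightarrow> a < b \<Longrightarrow> b \<le> st \<xi> m k \<Longrightarrow> deviation_bound C L X Y \<Longrightarrow>
   (\<Sum>t\<in>{a..<b}. (X t)^2) \<le> K * real (b - a) \<Longrightarrow> \<bar>\<Sum>t\<in>{a..<b}. X t * Y t\<bar> \<le> B * sqrt ((real k + L) * real (b - a))"
proof -
 obtain Cu where Cu: "1 \<le> Cu" "\<And>C \<xi> L k m b. good C \<xi> L k \<Longrightarrow> b \<le> st \<xi> m k \<Longrightarrow> ln (real b + 1) + L + 1 \<le> Cu * (real k + L)"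
  using log_bound by blast
 show thesis
 proof (rule that[of "\<bar>C\<bar> * (sqrt Cu * (K + 1))"])
  show "0 \<le> \<bar>C\<bar> * (sqrt Cu * (K + 1))" using Cu assms by simp
  fix \<xi> L k m X Y a b assume g: "good C \<xi> L k" and ab: "a < b" "b \<le> st \<xi> m k" and A: "deviation_bound C L X Y"
   and X: "(\<Sum>t\<in>{a..<b}. (X t)^2) \<le> K * real (b - a)"
  let ?U = "ln (real b + 1) + L + 1" and ?n = "real (b - a)" and ?u = "real k + L"
  have n: "0 < ?n" using ab by simp
  have U: "?U \<le> Cu * ?u" by (rule Cu(2)[OF g ab(2)])
  have Cu0: "0 \<le> Cu * ?u" using Cu(1) goodD(2)[OF g] by simp
  then have r0: "0 \<le> sqrt (Cu * ?u / ?n)" using n by simp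
  have "\<bar>\<Sum>t\<in>{a..<b}. X t * Y t\<bar> \<le> C * (sqrt (?U / ?n) * (\<Sum>t\<in>{a..<b}. (X t)^2) + sqrt (?U * ?n))"
   using A ab(1) unfolding deviation_bound_def by blast
  also have "\<dots> \<le> \<bar>C\<bar> * (sqrt (?U / ?n) * (\<Sum>t\<in>{a..<b}. (X t)^2) + sqrt (?U * ?n))"
   using goodD(2)[OF g] by (intro mult_right_mono add_nonneg_nonneg mult_nonneg_nonneg sum_nonneg) auto
  also have "\<dots> \<le> \<bar>C\<bar> * (sqrt (Cu * ?u / ?n) * (K * ?n) + sqrt (Cu * ?u * ?n))"
   using U X n goodD(2)[OF g] Cu0 r0 by (intro mult_left_mono add_mono mult_mono real_sqrt_le_mono divide_right_mono mult_right_mono sum_nonneg) auto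
  also have "sqrt (Cu * ?u / ?n) * (K * ?n) = K * sqrt (Cu * ?u * ?n)"
  proof -
   have "sqrt (Cu * ?u / ?n) * ?n = sqrt (Cu * ?u) * (?n / sqrt ?n)" by (simp add: real_sqrt_divide)
   also have "?n / sqrt ?n = sqrt ?n" using n by (simp add: real_div_sqrt)
   finally show ?thesis by (simp add: real_sqrt_mult mult_ac)
  qed
  also have "\<bar>C\<bar> * (K * sqrt (Cu * ?u * ?n) + sqrt (Cu * ?u * ?n)) = \<bar>C\<bar> * (sqrt Cu * (K + 1)) * sqrt (?u * ?n)"
  proof -
   have e: "sqrt (Cu * ?u * ?n) = sqrt Cu * sqrt (?u * ?n)" by (simp only: real_sqrt_mult[symmetric] mult.assoc)
   have "p * (K * (s * z) + s * z) = p * (s * (K + 1)) * z" for p s z :: real by (simp add: algebra_simps)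
   then show ?thesis unfolding e .
  qed
  finally show "\<bar>\<Sum>t\<in>{a..<b}. X t * Y t\<bar> \<le> \<bar>C\<bar> * (sqrt Cu * (K + 1)) * sqrt (?u * ?n)" .
 qed
qed

lemma length_scale:
 obtains a b where "0 < a" "0 < b" "\<And>C \<xi> L k m. good C \<xi> L k \<Longrightarrow> a * lam ^ k \<le> rlen \<xi> m k"
  "\<And>C \<xi> L k m. good C \<xi> L k \<Longrightarrow> rlen \<xi> m k \<le> b * lam ^ k"
proof (rule that[of "scale_len c / 2" "base_len c + scale_len c + max_shift c"])
 show "0 < scale_len c / 2" "0 < base_len c + scale_len c + max_shift c" using c by (auto simp: valid_schedule_def)
 show "scale_len c / 2 * lam ^ k \<le> rlen \<xi> m k" if "good C \<xi> L k" for C \<xi> L k m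
  using large_epoch(3)[of \<xi> k m] that by (auto simp: good_def)
 show "rlen \<xi> m k \<le> (base_len c + scale_len c + max_shift c) * lam ^ k" if "good C \<xi> L k" for C \<xi> L k m
  using epoch_facts(2)[of \<xi> k m] that by (auto simp: good_def)
qed

lemma good_interval:
 assumes "good C \<xi> L k"
 shows "st \<xi> m (k - 1) < st \<xi> m k" "1 \<le> st \<xi> m (k - 1)" "real (st \<xi> m k - st \<xi> m (k - 1)) = rlen \<xi> m k"
  "card (iv \<xi> m k) = len \<xi> m k" "1 \<le> rlen \<xi> m k" "st \<xi> m k - 1 - (st \<xi> m (k - 1) - 1) = len \<xi> m k" "st \<xi> m (k - 1) - 1 < st \<xi> m k - 1"
proof -
 have a: "\<xi> \<in> space M" "1 \<le> k" "X0 \<le> lam ^ k" using assms by (auto simp: good_def)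
 note e = large_epoch(2-5)[OF a, of m]
 show "1 \<le> st \<xi> m (k - 1)" "1 \<le> rlen \<xi> m k" using e by auto
 show "st \<xi> m (k - 1) < st \<xi> m k" "real (st \<xi> m k - st \<xi> m (k - 1)) = rlen \<xi> m k"
  "card (iv \<xi> m k) = len \<xi> m k" "st \<xi> m k - 1 - (st \<xi> m (k - 1) - 1) = len \<xi> m k" "st \<xi> m (k - 1) - 1 < st \<xi> m k - 1"
  using e by auto
qed

lemma sum_shift_iv:
 assumes "good C \<xi> L k"
 shows "(\<Sum>t\<in>iv \<xi> m k. f (t - 1)) = (\<Sum>t\<in>{st \<xi> m (k - 1) - 1..<st \<xi> m k - 1}. f t)"
 using good_interval(1,2)[OF assms, of m] by (intro sum.reindex_bij_witness[of _ Suc "\<lambda>t. t - 1"]) auto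

lemma log_sq_le_length:
 obtains K where "0 \<le> K" "\<And>C \<xi> L k m. good C \<xi> L k \<Longrightarrow> sqrt (rlen \<xi> m k) * (real k + L) \<le> K * rlen \<xi> m k"
  "\<And>C \<xi> L k m. good C \<xi> L k \<Longrightarrow> (real k + L) \<le> K * rlen \<xi> m k"
  "\<And>C \<xi> L k m. good C \<xi> L k \<Longrightarrow> (real k + L) ^ 3 \<le> K * rlen \<xi> m k"
proof -
 obtain a b where ab: "0 < a" "0 < b" "\<And>C \<xi> L k m. good C \<xi> L k \<Longrightarrow> a * lam ^ k \<le> rlen \<xi> m k"
  "\<And>C \<xi> L k m. good C \<xi> L k \<Longrightarrow> rlen \<xi> m k \<le> b * lam ^ k" using length_scale by blast
 have l: "lam ^ k \<le> 1 / a * rlen \<xi> m k" if "good C \<xi> L k" for C \<xi> L k m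
  using ab(3)[OF that, of m] ab(1) by (simp add: field_simps)
 let ?K = "1 / a + sqrt (1 / a)"
 show thesis
 proof (rule that[of ?K])
  show "0 \<le> ?K" using ab by simp
  fix C \<xi> L k m assume g: "good C \<xi> L k"
  let ?n = "rlen \<xi> m k"
  have le: "1 / a * ?n \<le> ?K * ?n" "sqrt (1 / a) * ?n \<le> ?K * ?n"
  proof -
   have "1 / a \<le> ?K" "sqrt (1 / a) \<le> ?K" using ab(1) by auto
   then show "1 / a * ?n \<le> ?K * ?n" "sqrt (1 / a) * ?n \<le> ?K * ?n" by (intro mult_right_mono; simp)+
  qed
  show "real k + L \<le> ?K * ?n" using goodD(10)[OF g] l[OF g, of m] le by linarith
  show "(real k + L) ^ 3 \<le> ?K * ?n" using goodD(11)[OF g] l[OF g, of m] le by linarith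
  have "real k + L \<le> sqrt (1 / a) * sqrt ?n"
   using goodD(8)[OF g] real_sqrt_le_mono[OF l[OF g, of m]] unfolding real_sqrt_mult by linarith
  then have "sqrt ?n * (real k + L) \<le> sqrt ?n * (sqrt (1 / a) * sqrt ?n)" by (intro mult_left_mono) simp_all
  also have "\<dots> = sqrt (1 / a) * ?n" by simp
  finally show "sqrt ?n * (real k + L) \<le> ?K * ?n" using le by linarith
 qed
qed

lemma norm_sq_components: "(norm (y :: real^'k::finite))^2 = (\<Sum>i\<in>UNIV. y $ i * y $ i)"
 by (simp add: power2_norm_eq_inner inner_vec_def)

lemma noise_energy:
 obtains K where "0 \<le> K" "\<And>\<xi> L k m. good C \<xi> L k \<Longrightarrow> (\<Sum>t\<in>iv \<xi> m k. (norm (w t \<xi>))^2) \<le> K * rlen \<xi> m k"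
  "\<And>\<xi> L k m j. good C \<xi> L k \<Longrightarrow> (\<Sum>t\<in>iv \<xi> m k. (norm (v j t \<xi>))^2) \<le> K * rlen \<xi> m k"
  "\<And>\<xi> L k m. good C \<xi> L k \<Longrightarrow> (\<Sum>t\<in>iv \<xi> m k. (norm (w (t - 1) \<xi>))^2) \<le> K * rlen \<xi> m k"
proof -
 obtain Ka where Ka: "0 \<le> Ka" "\<And>\<xi> L k m X \<mu> a b. good C \<xi> L k \<Longrightarrow> a < b \<Longrightarrow> b \<le> st \<xi> m k \<Longrightarrow> average_bound C L X \<mu> \<Longrightarrow>
   \<bar>(\<Sum>t\<in>{a..<b}. X t) - real (b - a) * \<mu>\<bar> \<le> Ka * (sqrt (real (b - a)) * (real k + L))"
  using avg_sum[of C] by blast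
 obtain Kl where Kl: "0 \<le> Kl" "\<And>C \<xi> L k m. good C \<xi> L k \<Longrightarrow> sqrt (rlen \<xi> m k) * (real k + L) \<le> Kl * rlen \<xi> m k"
  "\<And>C \<xi> L k m. good C \<xi> L k \<Longrightarrow> real k + L \<le> Kl * rlen \<xi> m k"
  "\<And>C \<xi> L k m. good C \<xi> L k \<Longrightarrow> (real k + L) ^ 3 \<le> Kl * rlen \<xi> m k" using log_sq_le_length by blast
 have one: "(\<Sum>t\<in>{a..<b}. X t) \<le> (\<bar>\<mu>\<bar> + Ka * Kl) * rlen \<xi> m k"
  if g: "good C \<xi> L k" and ab: "a < b" "b \<le> st \<xi> m k" "b - a = len \<xi> m k" and A: "average_bound C L X \<mu>" for \<xi> L k m X \<mu> a b
 proof -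
  have "(\<Sum>t\<in>{a..<b}. X t) \<le> rlen \<xi> m k * \<mu> + Ka * (sqrt (rlen \<xi> m k) * (real k + L))"
   using Ka(2)[OF g ab(1,2) A] unfolding ab(3) by linarith
  also have "\<dots> \<le> rlen \<xi> m k * \<bar>\<mu>\<bar> + Ka * (Kl * rlen \<xi> m k)"
   using Kl(2)[OF g] Ka(1) by (intro add_mono mult_left_mono) auto
  finally show ?thesis by (simp add: algebra_simps)
 qed
 define KW where "KW = (\<Sum>i\<in>UNIV. \<bar>noise_cov G $ i $ i\<bar> + Ka * Kl)"
 define KV where "KV = (\<Sum>i\<in>(UNIV::'d set). 1 + Ka * Kl)"
 have W: "(\<Sum>t\<in>{a..<b}. (norm (w t \<xi>))^2) \<le> KW * rlen \<xi> m k"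
  if g: "good C \<xi> L k" and ab: "a < b" "b \<le> st \<xi> m k" "b - a = len \<xi> m k" for \<xi> L k m a b
 proof -
  have "(\<Sum>t\<in>{a..<b}. (norm (w t \<xi>))^2) = (\<Sum>i\<in>UNIV. \<Sum>t\<in>{a..<b}. w t \<xi> $ i * w t \<xi> $ i)"
   unfolding norm_sq_components by (rule sum.swap)
  also have "\<dots> \<le> (\<Sum>i\<in>UNIV. (\<bar>noise_cov G $ i $ i\<bar> + Ka * Kl) * rlen \<xi> m k)"
   by (intro sum_mono one[OF g ab]) (use g in \<open>simp add: good_def regular_path_def\<close>)
  finally show ?thesis by (simp add: KW_def sum_distrib_right)
 qed
 have Vb: "(\<Sum>t\<in>{a..<b}. (norm (v j t \<xi>))^2) \<le> KV * rlen \<xi> m k"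
  if g: "good C \<xi> L k" and ab: "a < b" "b \<le> st \<xi> m k" "b - a = len \<xi> m k" for \<xi> L k m a b j
 proof -
  have "(\<Sum>t\<in>{a..<b}. (norm (v j t \<xi>))^2) = (\<Sum>i\<in>UNIV. \<Sum>t\<in>{a..<b}. v j t \<xi> $ i * v j t \<xi> $ i)"
   unfolding norm_sq_components by (rule sum.swap)
  also have "\<dots> \<le> (\<Sum>i\<in>UNIV. (\<bar>ident_on (ctrl G j) $ i $ i\<bar> + Ka * Kl) * rlen \<xi> m k)"
   by (intro sum_mono one[OF g ab]) (use g in \<open>simp add: good_def regular_path_def\<close>)
  also have "\<dots> \<le> (\<Sum>i\<in>(UNIV::'d set). (1 + Ka * Kl) * rlen \<xi> m k)"
   by (intro sum_mono mult_right_mono add_right_mono) (auto simp: ident_on_def)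
  finally show ?thesis by (simp only: KV_def sum_distrib_right)
 qed
 have K0: "0 \<le> KW" "0 \<le> KV" unfolding KW_def KV_def using Ka Kl by (auto intro!: sum_nonneg)
 show thesis
 proof (rule that[of "KW + KV"])
  show "0 \<le> KW + KV" using K0 by simp
  fix \<xi> L k m assume g: "good C \<xi> L k"
  have n0: "0 \<le> rlen \<xi> m k" by simp
  have le: "KW * rlen \<xi> m k \<le> (KW + KV) * rlen \<xi> m k" "KV * rlen \<xi> m k \<le> (KW + KV) * rlen \<xi> m k"
   using K0 by (auto intro!: mult_right_mono)
  note gi = good_interval[OF g, of m]
  have l: "st \<xi> m k - st \<xi> m (k - 1) = len \<xi> m k" using gi(4) by simp
  show "(\<Sum>t\<in>iv \<xi> m k. (norm (w t \<xi>))^2) \<le> (KW + KV) * rlen \<xi> m k" using W[OF g gi(1) order_refl l] le by linarith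
  show "(\<Sum>t\<in>iv \<xi> m k. (norm (w (t - 1) \<xi>))^2) \<le> (KW + KV) * rlen \<xi> m k"
   unfolding sum_shift_iv[OF g, of "\<lambda>t. (norm (w t \<xi>))^2"] using W[OF g gi(7) _ gi(6)] le by simp
  show "(\<Sum>t\<in>iv \<xi> m k. (norm (v j t \<xi>))^2) \<le> (KW + KV) * rlen \<xi> m k" for j
   using Vb[OF g gi(1) order_refl l, of j] le by linarith
 qed
qed

lemma sum_recursion_bound:
 fixes y e :: "nat \<Rightarrow> real"
 assumes \<gamma>: "\<gamma> < 1" and y: "\<And>t. 0 \<le> y t" and rec: "\<And>t. y (Suc t) \<le> \<gamma> * y t + e t" and e: "\<And>t. 0 \<le> e t" and ab: "a \<le> b"
 shows "(1 - \<gamma>) * (\<Sum>t\<in>{a..<b}. y t) \<le> y a + (\<Sum>t\<in>{a..<b}. e t)"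
proof -
 have "(1 - \<gamma>) * (\<Sum>t\<in>{a..<b}. y t) + y b \<le> y a + (\<Sum>t\<in>{a..<b}. e t)" using ab
 proof (induction b rule: dec_induct)
  case (step b)
  then show ?case using rec[of b] by (simp add: algebra_simps)
 qed simp
 then show ?thesis using y[of b] by linarith
qed

text \<open>Summing the recursion for squared norms gives an average energy of order one, whereas
  the maximal norm would cost a factor \<open>k + L\<close>. The maximal norm is used only for the
  initial state of the interval, where its square is absorbed by the epoch length.\<close>

lemma state_energy:
 obtains K where "0 \<le> K" "\<And>\<xi> L k m. good C \<xi> L k \<Longrightarrow> (\<Sum>t\<in>iv \<xi> m k. (norm (x t \<xi>))^2) \<le> K * rlen \<xi> m k"
  "\<And>\<xi> L k m. good C \<xi> L k \<Longrightarrow> (\<Sum>t\<in>iv \<xi> m k. (norm (x t \<xi> - w (t - 1) \<xi>))^2) \<le> K * rlen \<xi> m k"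
proof -
 obtain \<gamma> b where \<gamma>: "0 < \<gamma>" "\<gamma> < 1" "0 \<le> b"
  "\<And>\<xi> t. \<xi> \<in> space M \<Longrightarrow> norm (x (Suc t) \<xi>) \<le> \<gamma> * norm (x t \<xi>) + (norm (w t \<xi>) + b * (1 + (\<Sum>j\<in>UNIV. norm (v j t \<xi>))))"
  using one_step by blast
 obtain Ks where Ks: "0 \<le> Ks" "\<And>\<xi> L k m t. good C \<xi> L k \<Longrightarrow> t \<le> st \<xi> m k \<Longrightarrow> norm (x t \<xi>) \<le> Ks * sqrt (real k + L)"
  using state_sup_bound[of C] by blast
 obtain Kn where Kn: "0 \<le> Kn" "\<And>\<xi> L k m. good C \<xi> L k \<Longrightarrow> (\<Sum>t\<in>iv \<xi> m k. (norm (w t \<xi>))^2) \<le> Kn * rlen \<xi> m k"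
  "\<And>\<xi> L k m j. good C \<xi> L k \<Longrightarrow> (\<Sum>t\<in>iv \<xi> m k. (norm (v j t \<xi>))^2) \<le> Kn * rlen \<xi> m k"
  "\<And>\<xi> L k m. good C \<xi> L k \<Longrightarrow> (\<Sum>t\<in>iv \<xi> m k. (norm (w (t - 1) \<xi>))^2) \<le> Kn * rlen \<xi> m k"
  using noise_energy[of C] by blast
 obtain Kl where Kl: "0 \<le> Kl" "\<And>C \<xi> L k m. good C \<xi> L k \<Longrightarrow> sqrt (rlen \<xi> m k) * (real k + L) \<le> Kl * rlen \<xi> m k"
  "\<And>C \<xi> L k m. good C \<xi> L k \<Longrightarrow> real k + L \<le> Kl * rlen \<xi> m k"
  "\<And>C \<xi> L k m. good C \<xi> L k \<Longrightarrow> (real k + L) ^ 3 \<le> Kl * rlen \<xi> m k" using log_sq_le_length by blast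
 let ?M = "real CARD('m)"
 define Q where "Q = 2 * Kn + 4 * b^2 + 4 * b^2 * ?M * (?M * Kn)"
 define K where "K = (Ks^2 * Kl + Q / (1 - \<gamma>)) / (1 - \<gamma>)"
 have Q0: "0 \<le> Q" using Kn by (simp add: Q_def)
 have K0: "0 \<le> K" using Kl Q0 \<gamma> by (simp add: K_def)
 have X: "(\<Sum>t\<in>iv \<xi> m k. (norm (x t \<xi>))^2) \<le> K * rlen \<xi> m k" if g: "good C \<xi> L k" for \<xi> L k m
 proof -
  define N where "N t = norm (w t \<xi>) + b * (1 + (\<Sum>j\<in>UNIV. norm (v j t \<xi>)))" for t
  let ?n = "rlen \<xi> m k"
  have N2: "(\<Sum>t\<in>iv \<xi> m k. (N t)^2) \<le> Q * ?n"
  proof -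
   have pt: "(N t)^2 \<le> 2 * (norm (w t \<xi>))^2 + 4 * b^2 + 4 * b^2 * ?M * (\<Sum>j\<in>UNIV. (norm (v j t \<xi>))^2)" for t
   proof -
    let ?S = "\<Sum>j\<in>UNIV. norm (v j t \<xi>)"
    have s2: "(p + q)^2 \<le> 2 * p^2 + 2 * q^2" for p q :: real using sum_squares_bound[of p q] by (simp add: power2_sum)
    have "?S^2 \<le> (\<Sum>j\<in>UNIV. (norm (v j t \<xi>))^2) * ?M"
     using sum_squared_le_sum_of_squares[of "\<lambda>j. norm (v j t \<xi>)" UNIV] by (simp add: mult.commute)
    then have "b^2 * (2 * ?S^2) \<le> b^2 * (2 * ((\<Sum>j\<in>UNIV. (norm (v j t \<xi>))^2) * ?M))" by (intro mult_left_mono) auto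
    moreover have "(b * (1 + ?S))^2 \<le> b^2 * (2 + 2 * ?S^2)" using s2[of 1 ?S] by (simp add: power_mult_distrib mult_left_mono)
    ultimately show ?thesis using s2[of "norm (w t \<xi>)" "b * (1 + ?S)"] unfolding N_def by (simp add: algebra_simps)
   qed
   have "(\<Sum>t\<in>iv \<xi> m k. (N t)^2) \<le> (\<Sum>t\<in>iv \<xi> m k. 2 * (norm (w t \<xi>))^2 + 4 * b^2 + 4 * b^2 * ?M * (\<Sum>j\<in>UNIV. (norm (v j t \<xi>))^2))"
    by (intro sum_mono pt)
   also have "\<dots> = 2 * (\<Sum>t\<in>iv \<xi> m k. (norm (w t \<xi>))^2) + 4 * b^2 * ?n + 4 * b^2 * ?M * (\<Sum>j\<in>UNIV. \<Sum>t\<in>iv \<xi> m k. (norm (v j t \<xi>))^2)"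
   proof -
    have sw: "(\<Sum>t\<in>iv \<xi> m k. \<Sum>j\<in>UNIV. (norm (v j t \<xi>))^2) = (\<Sum>j\<in>UNIV. \<Sum>t\<in>iv \<xi> m k. (norm (v j t \<xi>))^2)"
     by (rule sum.swap)
    show ?thesis unfolding sum.distrib sum_distrib_left[symmetric] sw using good_interval(4)[OF g, of m] by simp
   qed
   also have "\<dots> \<le> 2 * (Kn * ?n) + 4 * b^2 * ?n + 4 * b^2 * ?M * (\<Sum>j\<in>(UNIV::'m set). Kn * ?n)"
    using Kn(2,3)[OF g] by (intro add_mono mult_left_mono sum_mono) auto
   also have "\<dots> = Q * ?n" by (simp add: Q_def algebra_simps)
   finally show ?thesis .
  qed
  have rec: "(norm (x (Suc t) \<xi>))^2 \<le> \<gamma> * (norm (x t \<xi>))^2 + (N t)^2 / (1 - \<gamma>)" for t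
  proof -
   have "(norm (x (Suc t) \<xi>))^2 \<le> (\<gamma> * norm (x t \<xi>) + N t)^2"
    using \<gamma>(4)[OF goodD(1)[OF g], of t] unfolding N_def by (intro power_mono) auto
   also have "\<dots> \<le> \<gamma> * (norm (x t \<xi>))^2 + (N t)^2 / (1 - \<gamma>)"
   proof -
    have "\<gamma> * y^2 + z^2 / (1 - \<gamma>) - (\<gamma> * y + z)^2 = \<gamma> / (1 - \<gamma>) * (z - (1 - \<gamma>) * y)^2" for y z
     using \<gamma> by (simp add: field_simps power2_eq_square)
    moreover have "0 \<le> \<gamma> / (1 - \<gamma>) * (z - (1 - \<gamma>) * y)^2" for y z using \<gamma> by simp
    ultimately show ?thesis by (metis diff_ge_0_iff_ge)
   qed
   finally show ?thesis .
  qed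
  have "(1 - \<gamma>) * (\<Sum>t\<in>iv \<xi> m k. (norm (x t \<xi>))^2) \<le> (norm (x (st \<xi> m (k - 1)) \<xi>))^2 + (\<Sum>t\<in>iv \<xi> m k. (N t)^2 / (1 - \<gamma>))"
   using good_interval(1)[OF g, of m] \<gamma> by (intro sum_recursion_bound rec) auto
  also have "\<dots> \<le> Ks^2 * Kl * ?n + Q / (1 - \<gamma>) * ?n"
  proof (rule add_mono)
   have "(norm (x (st \<xi> m (k - 1)) \<xi>))^2 \<le> (Ks * sqrt (real k + L))^2"
    using Ks(2)[OF g, of "st \<xi> m (k - 1)" m] good_interval(1)[OF g, of m] by (intro power_mono) auto
   also have "\<dots> = Ks^2 * (real k + L)" using goodD(4)[OF g] by (simp add: power_mult_distrib)
   also have "\<dots> \<le> Ks^2 * (Kl * ?n)" using Kl(3)[OF g] by (intro mult_left_mono) auto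
   finally show "(norm (x (st \<xi> m (k - 1)) \<xi>))^2 \<le> Ks^2 * Kl * ?n" by simp
   show "(\<Sum>t\<in>iv \<xi> m k. (N t)^2 / (1 - \<gamma>)) \<le> Q / (1 - \<gamma>) * ?n"
    unfolding sum_divide_distrib[symmetric] using divide_right_mono[OF N2, of "1 - \<gamma>"] \<gamma> by simp
  qed
  finally have "(\<Sum>t\<in>iv \<xi> m k. (norm (x t \<xi>))^2) * (1 - \<gamma>) \<le> Ks^2 * Kl * ?n + Q / (1 - \<gamma>) * ?n"
   by (simp only: mult.commute)
  then have "(\<Sum>t\<in>iv \<xi> m k. (norm (x t \<xi>))^2) \<le> (Ks^2 * Kl * ?n + Q / (1 - \<gamma>) * ?n) / (1 - \<gamma>)"
   using \<gamma>(2) by (intro mult_imp_le_div_pos) auto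
  then show ?thesis by (simp add: K_def add_divide_distrib distrib_right)
 qed
 show thesis
 proof (rule that[of "2 * K + 2 * Kn"])
  show "0 \<le> 2 * K + 2 * Kn" using K0 Kn by simp
  fix \<xi> L k m assume g: "good C \<xi> L k"
  let ?n = "rlen \<xi> m k"
  have "0 \<le> K * ?n" "0 \<le> Kn * ?n" using K0 Kn by auto
  then show "(\<Sum>t\<in>iv \<xi> m k. (norm (x t \<xi>))^2) \<le> (2 * K + 2 * Kn) * ?n" using X[OF g, of m] by (simp add: distrib_right)
  have "(\<Sum>t\<in>iv \<xi> m k. (norm (x t \<xi> - w (t - 1) \<xi>))^2) \<le> (\<Sum>t\<in>iv \<xi> m k. 2 * (norm (x t \<xi>))^2 + 2 * (norm (w (t - 1) \<xi>))^2)"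
  proof (rule sum_mono)
   fix t
   have "(norm (x t \<xi> - w (t - 1) \<xi>))^2 \<le> (norm (x t \<xi>) + norm (w (t - 1) \<xi>))^2" by (intro power_mono norm_triangle_ineq4) auto
   also have "\<dots> \<le> 2 * (norm (x t \<xi>))^2 + 2 * (norm (w (t - 1) \<xi>))^2"
    using sum_squares_bound[of "norm (x t \<xi>)" "norm (w (t - 1) \<xi>)"] by (simp add: power2_sum)
   finally show "(norm (x t \<xi> - w (t - 1) \<xi>))^2 \<le> 2 * (norm (x t \<xi>))^2 + 2 * (norm (w (t - 1) \<xi>))^2" .
  qed
  also have "\<dots> \<le> 2 * (K * ?n) + 2 * (Kn * ?n)"
   unfolding sum.distrib sum_distrib_left[symmetric] using X[OF g, of m] Kn(4)[OF g, of m] by (intro add_mono mult_left_mono) auto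
  finally show "(\<Sum>t\<in>iv \<xi> m k. (norm (x t \<xi> - w (t - 1) \<xi>))^2) \<le> (2 * K + 2 * Kn) * ?n" by (simp add: algebra_simps)
 qed
qed

end

section \<open>Persistent excitation\<close>

lemma pos_def_lower:
 fixes S :: "real^'k::finite^'k"
 assumes "pos_def_on UNIV S"
 obtains \<sigma> where "0 < \<sigma>" "\<And>b. \<sigma> * (norm b)^2 \<le> b \<bullet> (S *v b)"
proof -
 let ?f = "\<lambda>b. b \<bullet> (S *v b)"
 have co: "continuous_on (sphere 0 1) ?f" by (intro continuous_intros matrix_vector_mult_linear_continuous_on)
 have ne: "sphere (0::real^'k) 1 \<noteq> {}" by simp
 obtain b0 where b0: "b0 \<in> sphere 0 1" "\<And>b. b \<in> sphere 0 1 \<Longrightarrow> ?f b0 \<le> ?f b"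
  using continuous_attains_inf[OF compact_sphere ne co] by blast
 show thesis
 proof (rule that[of "?f b0"])
  have "b0 \<noteq> 0" using b0(1) by auto
  then show "0 < ?f b0" using assms by (auto simp: pos_def_on_def supp_in_def)
  fix b :: "real^'k"
  show "?f b0 * (norm b)^2 \<le> ?f b"
  proof (cases "b = 0")
   case False
   have "?f b0 \<le> ?f ((1 / norm b) *\<^sub>R b)" using False by (intro b0(2)) simp
   also have "\<dots> = ?f b / (norm b)^2" by (simp add: linear_scale[OF matrix_vector_mul_linear] power2_eq_square)
   finally show ?thesis using False by (simp add: field_simps)
  qed simp
 qed
qed

context stable_learning begin

text \<open>Products of a noise with an earlier or independent quantity deviate by \<open>s\<close>,
  of order \<open>sqrt ((k + L) * n)\<close>. Squares of noises are only sub-exponential and deviate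
  by \<open>a\<close>, with the full factor \<open>k + L\<close>. Sums with \<open>w (t - 1)\<close>
  describe the noise that has just entered \<open>x t\<close>.\<close>

definition cross :: "real \<Rightarrow> 'a \<Rightarrow> real \<Rightarrow> nat \<Rightarrow> 'm \<Rightarrow> bool" where
 "cross B \<xi> L k m \<longleftrightarrow> (let s = B * sqrt ((real k + L) * rlen \<xi> m k); a = B * (sqrt (rlen \<xi> m k) * (real k + L)); I = iv \<xi> m k; n = rlen \<xi> m k in
   (\<forall>l. \<bar>\<Sum>t\<in>I. w t \<xi> $ l\<bar> \<le> s) \<and> (\<forall>j l. \<bar>\<Sum>t\<in>I. v j t \<xi> $ l\<bar> \<le> s) \<and>
   (\<forall>i l. \<bar>\<Sum>t\<in>I. x t \<xi> $ i * w t \<xi> $ l\<bar> \<le> s) \<and> (\<forall>i j l. \<bar>\<Sum>t\<in>I. x t \<xi> $ i * v j t \<xi> $ l\<bar> \<le> s) \<and>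
   (\<forall>j i l. \<bar>\<Sum>t\<in>I. v j t \<xi> $ i * w t \<xi> $ l\<bar> \<le> s) \<and> (\<forall>j' j i l. j' \<noteq> j \<longrightarrow> \<bar>\<Sum>t\<in>I. v j' t \<xi> $ i * v j t \<xi> $ l\<bar> \<le> s) \<and>
   (\<forall>l. \<bar>\<Sum>t\<in>I. w (t - 1) \<xi> $ l\<bar> \<le> s) \<and> (\<forall>i l. \<bar>\<Sum>t\<in>I. (x t \<xi> - w (t - 1) \<xi>) $ i * w (t - 1) \<xi> $ l\<bar> \<le> s) \<and>
   (\<forall>j i l. \<bar>\<Sum>t\<in>I. w (t - 1) \<xi> $ i * v j t \<xi> $ l\<bar> \<le> s) \<and>
   (\<forall>i l. \<bar>(\<Sum>t\<in>I. w (t - 1) \<xi> $ i * w (t - 1) \<xi> $ l) - n * noise_cov G $ i $ l\<bar> \<le> a) \<and>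
   (\<forall>i l. \<bar>(\<Sum>t\<in>I. w t \<xi> $ i * w t \<xi> $ l) - n * noise_cov G $ i $ l\<bar> \<le> a) \<and>
   (\<forall>j i l. \<bar>(\<Sum>t\<in>I. v j t \<xi> $ i * v j t \<xi> $ l) - n * ident_on (ctrl G j) $ i $ l\<bar> \<le> a))"

lemma sum_component_sq_le: "(\<Sum>t\<in>I. (y t $ i)^2) \<le> (\<Sum>t\<in>I. (norm (y t :: real^'k::finite))^2)"
 by (intro sum_mono) (metis abs_norm_cancel component_le_norm_cart power2_abs power_mono abs_ge_zero)

lemma cross_sums:
 obtains B where "0 < B" "\<And>\<xi> L k m. good C \<xi> L k \<Longrightarrow> cross B \<xi> L k m"
proof -
 obtain Kn where Kn: "0 \<le> Kn" "\<And>\<xi> L k m. good C \<xi> L k \<Longrightarrow> (\<Sum>t\<in>iv \<xi> m k. (norm (w t \<xi>))^2) \<le> Kn * rlen \<xi> m k"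
  "\<And>\<xi> L k m j. good C \<xi> L k \<Longrightarrow> (\<Sum>t\<in>iv \<xi> m k. (norm (v j t \<xi>))^2) \<le> Kn * rlen \<xi> m k"
  "\<And>\<xi> L k m. good C \<xi> L k \<Longrightarrow> (\<Sum>t\<in>iv \<xi> m k. (norm (w (t - 1) \<xi>))^2) \<le> Kn * rlen \<xi> m k"
  using noise_energy[of C] by blast
 obtain Kx where Kx: "0 \<le> Kx" "\<And>\<xi> L k m. good C \<xi> L k \<Longrightarrow> (\<Sum>t\<in>iv \<xi> m k. (norm (x t \<xi>))^2) \<le> Kx * rlen \<xi> m k"
  "\<And>\<xi> L k m. good C \<xi> L k \<Longrightarrow> (\<Sum>t\<in>iv \<xi> m k. (norm (x t \<xi> - w (t - 1) \<xi>))^2) \<le> Kx * rlen \<xi> m k"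
  using state_energy[of C] by blast
 define K where "K = Kn + Kx + 1"
 have K: "0 \<le> K" "Kn \<le> K" "Kx \<le> K" "1 \<le> K" using Kn Kx by (auto simp: K_def)
 obtain B where B: "0 \<le> B" "\<And>\<xi> L k m X Y a b. good C \<xi> L k \<Longrightarrow> a < b \<Longrightarrow> b \<le> st \<xi> m k \<Longrightarrow> deviation_bound C L X Y \<Longrightarrow>
   (\<Sum>t\<in>{a..<b}. (X t)^2) \<le> K * real (b - a) \<Longrightarrow> \<bar>\<Sum>t\<in>{a..<b}. X t * Y t\<bar> \<le> B * sqrt ((real k + L) * real (b - a))"
  using dev_sum[OF K(1), of C] by blast
 obtain Ka where Ka: "0 \<le> Ka" "\<And>\<xi> L k m X \<mu> a b. good C \<xi> L k \<Longrightarrow> a < b \<Longrightarrow> b \<le> st \<xi> m k \<Longrightarrow> average_bound C L X \<mu> \<Longrightarrow>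
   \<bar>(\<Sum>t\<in>{a..<b}. X t) - real (b - a) * \<mu>\<bar> \<le> Ka * (sqrt (real (b - a)) * (real k + L))"
  using avg_sum[of C] by blast
 define B' where "B' = B + Ka + 1"
 have B': "B \<le> B'" "Ka \<le> B'" "0 < B'" using B Ka by (auto simp: B'_def)
 show thesis
 proof (rule that[OF B'(3)])
  fix \<xi> L k m assume g: "good C \<xi> L k"
  let ?n = "rlen \<xi> m k" and ?u = "real k + L" and ?I = "iv \<xi> m k"
  note gi = good_interval[OF g, of m]
  have u: "0 \<le> ?u" using goodD(4)[OF g] by simp
  have n: "real (st \<xi> m k - st \<xi> m (k - 1)) = ?n" using gi(3) .
  have n': "real (st \<xi> m k - 1 - (st \<xi> m (k - 1) - 1)) = ?n" using gi(6) by simp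
  define s where "s = B' * sqrt (?u * ?n)"
  define a where "a = B' * (sqrt ?n * ?u)"
  have Bs: "B * sqrt (?u * ?n) \<le> s" unfolding s_def using B' u by (intro mult_right_mono) auto
  have Ba: "Ka * (sqrt ?n * ?u) \<le> a" unfolding a_def using B' u by (intro mult_right_mono) auto
  have D: "\<bar>\<Sum>t\<in>?I. X t * Y t\<bar> \<le> s" if "deviation_bound C L X Y" "(\<Sum>t\<in>?I. (X t)^2) \<le> K * ?n" for X Y
   using B(2)[OF g gi(1) order_refl that(1)] that(2) Bs unfolding n by linarith
  have D': "\<bar>\<Sum>t\<in>?I. X (t - 1) * Y (t - 1)\<bar> \<le> s" if "deviation_bound C L X Y" "(\<Sum>t\<in>?I. (X (t - 1))^2) \<le> K * ?n" for X Y
  proof -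
   have "\<bar>\<Sum>t\<in>{st \<xi> m (k - 1) - 1..<st \<xi> m k - 1}. X t * Y t\<bar> \<le> B * sqrt (?u * real (st \<xi> m k - 1 - (st \<xi> m (k - 1) - 1)))"
    by (rule B(2)[OF g gi(7) diff_le_self that(1)])
     (use that(2) in \<open>simp only: n' sum_shift_iv[OF g, of "\<lambda>t. (X t)^2" m]\<close>)
   then show ?thesis using Bs unfolding n' sum_shift_iv[OF g, of "\<lambda>t. X t * Y t" m, symmetric] by linarith
  qed
  have A: "\<bar>(\<Sum>t\<in>?I. X t) - ?n * \<mu>\<bar> \<le> a" if "average_bound C L X \<mu>" for X \<mu>
   using Ka(2)[OF g gi(1) order_refl that] Ba unfolding n by linarith
  have A': "\<bar>(\<Sum>t\<in>?I. X (t - 1)) - ?n * \<mu>\<bar> \<le> a" if "average_bound C L X \<mu>" for X \<mu>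
   using Ka(2)[OF g gi(7) diff_le_self that] Ba unfolding n' sum_shift_iv[OF g, of X m, symmetric] by linarith
  have R: "regular C L \<xi>" using g by (simp add: good_def)
  have Kle: "Kn * ?n \<le> K * ?n" "Kx * ?n \<le> K * ?n" "?n \<le> K * ?n" using K by (auto intro!: mult_right_mono simp: mult_le_cancel_right1)
  have c1: "(\<Sum>t\<in>?I. (1::real)^2) \<le> K * ?n" using gi(4) Kle by simp
  have cx: "(\<Sum>t\<in>?I. (x t \<xi> $ i)^2) \<le> K * ?n" for i using sum_component_sq_le[of "\<lambda>t. x t \<xi>" i ?I] Kx(2)[OF g, of m] Kle by linarith
  have cv: "(\<Sum>t\<in>?I. (v j t \<xi> $ i)^2) \<le> K * ?n" for i j using sum_component_sq_le[of "\<lambda>t. v j t \<xi>" i ?I] Kn(3)[OF g, of j m] Kle by linarith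
  have cw': "(\<Sum>t\<in>?I. (w (t - 1) \<xi> $ i)^2) \<le> K * ?n" for i using sum_component_sq_le[of "\<lambda>t. w (t - 1) \<xi>" i ?I] Kn(4)[OF g, of m] Kle by linarith
  have cg: "(\<Sum>t\<in>?I. ((x t \<xi> - w (t - 1) \<xi>) $ i)^2) \<le> K * ?n" for i using sum_component_sq_le[of "\<lambda>t. x t \<xi> - w (t - 1) \<xi>" i ?I] Kx(3)[OF g, of m] Kle by linarith
  have pos: "t \<noteq> 0" "Suc (t - 1) = t" if "t \<in> ?I" for t using that gi(2) by auto
  note Rs = R[unfolded regular_path_def]
  have f1: "\<bar>\<Sum>t\<in>?I. w t \<xi> $ l\<bar> \<le> s" for l using D[of "\<lambda>_. 1" "\<lambda>t. w t \<xi> $ l"] Rs c1 by simp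
  have f2: "\<bar>\<Sum>t\<in>?I. v j t \<xi> $ l\<bar> \<le> s" for j l using D[of "\<lambda>_. 1" "\<lambda>t. v j t \<xi> $ l"] Rs c1 by simp
  have f3: "\<bar>\<Sum>t\<in>?I. x t \<xi> $ i * w t \<xi> $ l\<bar> \<le> s" for i l using Rs cx by (intro D) auto
  have f4: "\<bar>\<Sum>t\<in>?I. x t \<xi> $ i * v j t \<xi> $ l\<bar> \<le> s" for i j l using Rs cx by (intro D) auto
  have f5: "\<bar>\<Sum>t\<in>?I. v j t \<xi> $ i * w t \<xi> $ l\<bar> \<le> s" for i j l using Rs cv by (intro D) auto
  have f6: "\<bar>\<Sum>t\<in>?I. v j' t \<xi> $ i * v j t \<xi> $ l\<bar> \<le> s" if "j' \<noteq> j" for i j' j l using Rs cv that by (intro D) auto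
  have f7: "\<bar>\<Sum>t\<in>?I. w (t - 1) \<xi> $ l\<bar> \<le> s" for l using D'[of "\<lambda>_. 1" "\<lambda>t. w t \<xi> $ l"] Rs c1 by simp
  have f8: "\<bar>\<Sum>t\<in>?I. (x t \<xi> - w (t - 1) \<xi>) $ i * w (t - 1) \<xi> $ l\<bar> \<le> s" for i l
  proof -
   have d: "deviation_bound C L (\<lambda>t. (x (Suc t) \<xi> - w t \<xi>) $ i) (\<lambda>t. w t \<xi> $ l)" using Rs by auto
   \<comment> \<open>Times in the interval are at least 1, so \<open>Suc (t - 1)\<close> is
     \<open>t\<close>.\<close>
   have e: "(\<Sum>t\<in>?I. f (x (Suc (t - 1)) \<xi>) t) = (\<Sum>t\<in>?I. f (x t \<xi>) t)" for f :: "real^'n \<Rightarrow> nat \<Rightarrow> real"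
    by (rule sum.cong) (simp_all only: pos)
   have q: "(\<Sum>t\<in>?I. ((x (Suc (t - 1)) \<xi> - w (t - 1) \<xi>) $ i)^2) \<le> K * ?n"
    using cg[of i] e[of "\<lambda>y t. ((y - w (t - 1) \<xi>) $ i)^2"] by simp
   show ?thesis using D'[OF d q] e[of "\<lambda>y t. (y - w (t - 1) \<xi>) $ i * w (t - 1) \<xi> $ l"] by simp
  qed
  have f9: "\<bar>\<Sum>t\<in>?I. w (t - 1) \<xi> $ i * v j t \<xi> $ l\<bar> \<le> s" for i j l
  proof -
   have d: "deviation_bound C L (\<lambda>t. if t = 0 then 0 else w (t - 1) \<xi> $ i) (\<lambda>t. v j t \<xi> $ l)" using Rs by auto
   have e: "(\<Sum>t\<in>?I. f (if t = 0 then 0 else w (t - 1) \<xi> $ i) t) = (\<Sum>t\<in>?I. f (w (t - 1) \<xi> $ i) t)" for f :: "real \<Rightarrow> nat \<Rightarrow> real"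
    by (rule sum.cong) (simp_all add: pos(1))
   have q: "(\<Sum>t\<in>?I. (if t = 0 then 0 else w (t - 1) \<xi> $ i)^2) \<le> K * ?n" unfolding e[of "\<lambda>y t. y^2"] by (rule cw')
   show ?thesis using D[OF d q] unfolding e[of "\<lambda>y t. y * v j t \<xi> $ l"] .
  qed
  have f10: "\<bar>(\<Sum>t\<in>?I. w (t - 1) \<xi> $ i * w (t - 1) \<xi> $ l) - ?n * noise_cov G $ i $ l\<bar> \<le> a" for i l
   using A'[of "\<lambda>t. w t \<xi> $ i * w t \<xi> $ l"] Rs by simp
  have f11: "\<bar>(\<Sum>t\<in>?I. w t \<xi> $ i * w t \<xi> $ l) - ?n * noise_cov G $ i $ l\<bar> \<le> a" for i l using Rs by (intro A) auto
  have f12: "\<bar>(\<Sum>t\<in>?I. v j t \<xi> $ i * v j t \<xi> $ l) - ?n * ident_on (ctrl G j) $ i $ l\<bar> \<le> a" for i j l using Rs by (intro A) auto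
  show "cross B' \<xi> L k m" unfolding cross_def Let_def s_def[symmetric] a_def[symmetric]
   by (intro conjI allI impI f1 f2 f3 f4 f5 f6 f7 f8 f9 f10 f11 f12)
 qed
qed

lemma crossD:
 assumes "cross B \<xi> L k m"
 shows "\<bar>\<Sum>t\<in>iv \<xi> m k. w t \<xi> $ l\<bar> \<le> B * sqrt ((real k + L) * rlen \<xi> m k)"
  "\<bar>\<Sum>t\<in>iv \<xi> m k. v j t \<xi> $ l'\<bar> \<le> B * sqrt ((real k + L) * rlen \<xi> m k)"
  "\<bar>\<Sum>t\<in>iv \<xi> m k. x t \<xi> $ i * w t \<xi> $ l\<bar> \<le> B * sqrt ((real k + L) * rlen \<xi> m k)"
  "\<bar>\<Sum>t\<in>iv \<xi> m k. x t \<xi> $ i * v j t \<xi> $ l'\<bar> \<le> B * sqrt ((real k + L) * rlen \<xi> m k)"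
  "\<bar>\<Sum>t\<in>iv \<xi> m k. v j t \<xi> $ i' * w t \<xi> $ l\<bar> \<le> B * sqrt ((real k + L) * rlen \<xi> m k)"
  "j' \<noteq> j \<Longrightarrow> \<bar>\<Sum>t\<in>iv \<xi> m k. v j' t \<xi> $ i' * v j t \<xi> $ l'\<bar> \<le> B * sqrt ((real k + L) * rlen \<xi> m k)"
  "\<bar>\<Sum>t\<in>iv \<xi> m k. w (t - 1) \<xi> $ l\<bar> \<le> B * sqrt ((real k + L) * rlen \<xi> m k)"
  "\<bar>\<Sum>t\<in>iv \<xi> m k. (x t \<xi> - w (t - 1) \<xi>) $ i * w (t - 1) \<xi> $ l\<bar> \<le> B * sqrt ((real k + L) * rlen \<xi> m k)"
  "\<bar>\<Sum>t\<in>iv \<xi> m k. w (t - 1) \<xi> $ i * v j t \<xi> $ l'\<bar> \<le> B * sqrt ((real k + L) * rlen \<xi> m k)"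
  "\<bar>(\<Sum>t\<in>iv \<xi> m k. w (t - 1) \<xi> $ i * w (t - 1) \<xi> $ l) - rlen \<xi> m k * noise_cov G $ i $ l\<bar> \<le> B * (sqrt (rlen \<xi> m k) * (real k + L))"
  "\<bar>(\<Sum>t\<in>iv \<xi> m k. w t \<xi> $ i * w t \<xi> $ l) - rlen \<xi> m k * noise_cov G $ i $ l\<bar> \<le> B * (sqrt (rlen \<xi> m k) * (real k + L))"
  "\<bar>(\<Sum>t\<in>iv \<xi> m k. v j t \<xi> $ i' * v j t \<xi> $ l') - rlen \<xi> m k * ident_on (ctrl G j) $ i' $ l'\<bar> \<le> B * (sqrt (rlen \<xi> m k) * (real k + L))"
proof -
 note X = assms[unfolded cross_def Let_def]
 show "\<bar>\<Sum>t\<in>iv \<xi> m k. w t \<xi> $ l\<bar> \<le> B * sqrt ((real k + L) * rlen \<xi> m k)" by (rule X[THEN conjunct1, rule_format])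
 show "\<bar>\<Sum>t\<in>iv \<xi> m k. v j t \<xi> $ l'\<bar> \<le> B * sqrt ((real k + L) * rlen \<xi> m k)" by (rule X[THEN conjunct2, THEN conjunct1, rule_format])
 show "\<bar>\<Sum>t\<in>iv \<xi> m k. x t \<xi> $ i * w t \<xi> $ l\<bar> \<le> B * sqrt ((real k + L) * rlen \<xi> m k)" by (rule X[THEN conjunct2, THEN conjunct2, THEN conjunct1, rule_format])
 show "\<bar>\<Sum>t\<in>iv \<xi> m k. x t \<xi> $ i * v j t \<xi> $ l'\<bar> \<le> B * sqrt ((real k + L) * rlen \<xi> m k)" by (rule X[THEN conjunct2, THEN conjunct2, THEN conjunct2, THEN conjunct1, rule_format])
 show "\<bar>\<Sum>t\<in>iv \<xi> m k. v j t \<xi> $ i' * w t \<xi> $ l\<bar> \<le> B * sqrt ((real k + L) * rlen \<xi> m k)" by (rule X[THEN conjunct2, THEN conjunct2, THEN conjunct2, THEN conjunct2, THEN conjunct1, rule_format])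
 show "j' \<noteq> j \<Longrightarrow> \<bar>\<Sum>t\<in>iv \<xi> m k. v j' t \<xi> $ i' * v j t \<xi> $ l'\<bar> \<le> B * sqrt ((real k + L) * rlen \<xi> m k)" by (rule X[THEN conjunct2, THEN conjunct2, THEN conjunct2, THEN conjunct2, THEN conjunct2, THEN conjunct1, rule_format])
 show "\<bar>\<Sum>t\<in>iv \<xi> m k. w (t - 1) \<xi> $ l\<bar> \<le> B * sqrt ((real k + L) * rlen \<xi> m k)" by (rule X[THEN conjunct2, THEN conjunct2, THEN conjunct2, THEN conjunct2, THEN conjunct2, THEN conjunct2, THEN conjunct1, rule_format])
 show "\<bar>\<Sum>t\<in>iv \<xi> m k. (x t \<xi> - w (t - 1) \<xi>) $ i * w (t - 1) \<xi> $ l\<bar> \<le> B * sqrt ((real k + L) * rlen \<xi> m k)" by (rule X[THEN conjunct2, THEN conjunct2, THEN conjunct2, THEN conjunct2, THEN conjunct2, THEN conjunct2, THEN conjunct2, THEN conjunct1, rule_format])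
 show "\<bar>\<Sum>t\<in>iv \<xi> m k. w (t - 1) \<xi> $ i * v j t \<xi> $ l'\<bar> \<le> B * sqrt ((real k + L) * rlen \<xi> m k)" by (rule X[THEN conjunct2, THEN conjunct2, THEN conjunct2, THEN conjunct2, THEN conjunct2, THEN conjunct2, THEN conjunct2, THEN conjunct2, THEN conjunct1, rule_format])
 show "\<bar>(\<Sum>t\<in>iv \<xi> m k. w (t - 1) \<xi> $ i * w (t - 1) \<xi> $ l) - rlen \<xi> m k * noise_cov G $ i $ l\<bar> \<le> B * (sqrt (rlen \<xi> m k) * (real k + L))" by (rule X[THEN conjunct2, THEN conjunct2, THEN conjunct2, THEN conjunct2, THEN conjunct2, THEN conjunct2, THEN conjunct2, THEN conjunct2, THEN conjunct2, THEN conjunct1, rule_format])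
 show "\<bar>(\<Sum>t\<in>iv \<xi> m k. w t \<xi> $ i * w t \<xi> $ l) - rlen \<xi> m k * noise_cov G $ i $ l\<bar> \<le> B * (sqrt (rlen \<xi> m k) * (real k + L))" by (rule X[THEN conjunct2, THEN conjunct2, THEN conjunct2, THEN conjunct2, THEN conjunct2, THEN conjunct2, THEN conjunct2, THEN conjunct2, THEN conjunct2, THEN conjunct2, THEN conjunct1, rule_format])
 show "\<bar>(\<Sum>t\<in>iv \<xi> m k. v j t \<xi> $ i' * v j t \<xi> $ l') - rlen \<xi> m k * ident_on (ctrl G j) $ i' $ l'\<bar> \<le> B * (sqrt (rlen \<xi> m k) * (real k + L))" by (rule X[THEN conjunct2, THEN conjunct2, THEN conjunct2, THEN conjunct2, THEN conjunct2, THEN conjunct2, THEN conjunct2, THEN conjunct2, THEN conjunct2, THEN conjunct2, THEN conjunct2, rule_format])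
qed

text \<open>The state is split as \<open>x t = g t + w (t - 1)\<close>. The correlation of
  \<open>g t\<close> with the exploration noise of time \<open>t\<close> is a difference of two
  controlled sums, hence the deviation \<open>2 * a'\<close>. The constant \<open>cs\<close> makes
  this deviation a fixed small fraction of the epoch length.\<close>

lemma gram_bound:
 obtains cg cs where "0 < cg" "0 < cs"
  "\<And>\<xi> L k m a b q. good C \<xi> L k \<Longrightarrow> real k + L \<le> cs * sqrt (rlen \<xi> m k) \<Longrightarrow> supp_in (ctrl G m) q \<Longrightarrow>
    cg * rlen \<xi> m k * (a^2 + (norm b)^2 + (norm q)^2) \<le> (\<Sum>t\<in>iv \<xi> m k. (a + b \<bullet> x t \<xi> + q \<bullet> v m t \<xi>)^2)"
proof -
 have "pos_def_on UNIV (noise_cov G)" using G by (simp add: valid_game_def)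
 then obtain \<sigma> where \<sigma>: "0 < \<sigma>" "\<And>b. \<sigma> * (norm b)^2 \<le> b \<bullet> (noise_cov G *v b)" using pos_def_lower by blast
 obtain B where B: "0 < B" "\<And>\<xi> L k m. good C \<xi> L k \<Longrightarrow> cross B \<xi> L k m" using cross_sums[of C] by blast
 obtain Kx where Kx: "0 \<le> Kx" "\<And>\<xi> L k m. good C \<xi> L k \<Longrightarrow> (\<Sum>t\<in>iv \<xi> m k. (norm (x t \<xi>))^2) \<le> Kx * rlen \<xi> m k"
  "\<And>\<xi> L k m. good C \<xi> L k \<Longrightarrow> (\<Sum>t\<in>iv \<xi> m k. (norm (x t \<xi> - w (t - 1) \<xi>))^2) \<le> Kx * rlen \<xi> m k"
  using state_energy[of C] by blast
 define K where "K = Kx + 1"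
 have K: "0 < K" "Kx \<le> K" using Kx by (auto simp: K_def)
 define cc where "cc = min (min (1/2) (\<sigma> / (4 * K))) (\<sigma> / 2)"
 have cc: "0 < cc" using \<sigma> K by (simp add: cc_def)
 define D where "D = max (real CARD('n)) (real CARD('d))"
 have D: "0 < D" "real CARD('n) \<le> D" "real CARD('d) \<le> D" by (auto simp: D_def less_max_iff_disj)
 define cs where "cs = cc / (24 * D^2 * (2 * B))"
 have cs: "0 < cs" using cc D B by (simp add: cs_def)
 show thesis
 proof (rule that[OF _ cs, of "cc / 2"])
  show "0 < cc / 2" using cc by simp
  fix \<xi> L k m a and b :: "real^'n" and q :: "real^'d" assume g: "good C \<xi> L k" and small: "real k + L \<le> cs * sqrt (rlen \<xi> m k)" and q: "supp_in (ctrl G m) q"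
  let ?n = "rlen \<xi> m k" and ?u = "real k + L" and ?I = "iv \<xi> m k"
  define s where "s = B * sqrt (?u * ?n)"
  define a' where "a' = B * (sqrt ?n * ?u)"
  have u1: "1 \<le> ?u" by (rule goodD(4)[OF g])
  have "sqrt ?u \<le> ?u" using u1 real_sqrt_le_mono[of ?u "?u^2"] by (simp add: self_le_power power2_eq_square)
  then have "sqrt ?n * sqrt ?u \<le> sqrt ?n * ?u" by (intro mult_left_mono) auto
  then have "sqrt (?u * ?n) \<le> sqrt ?n * ?u" by (simp add: real_sqrt_mult mult.commute)
  then have sa: "s \<le> a'" unfolding s_def a'_def using B by (intro mult_left_mono) auto
  have a0: "0 \<le> a'" unfolding a'_def using B u1 by simp
  note cr = crossD[OF B(2)[OF g, of m], folded s_def a'_def]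
  have en: "(\<Sum>t\<in>?I. (norm (x t \<xi> - w (t - 1) \<xi>))^2) \<le> K * ?n"
   using Kx(3)[OF g, of m] mult_right_mono[OF K(2), of ?n] by linarith
  have gv: "\<bar>\<Sum>t\<in>?I. (x t \<xi> - w (t - 1) \<xi>) $ i * v m t \<xi> $ l\<bar> \<le> 2 * a'" for i l
  proof -
   have "(\<Sum>t\<in>?I. (x t \<xi> - w (t - 1) \<xi>) $ i * v m t \<xi> $ l) = (\<Sum>t\<in>?I. x t \<xi> $ i * v m t \<xi> $ l) - (\<Sum>t\<in>?I. w (t - 1) \<xi> $ i * v m t \<xi> $ l)"
    by (simp add: sum_subtractf left_diff_distrib)
   moreover have "\<bar>\<Sum>t\<in>?I. x t \<xi> $ i * v m t \<xi> $ l\<bar> \<le> s" "\<bar>\<Sum>t\<in>?I. w (t - 1) \<xi> $ i * v m t \<xi> $ l\<bar> \<le> s" by (rule cr)+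
   ultimately show ?thesis using sa by linarith
  qed
  have sm: "24 * D^2 * (2 * a') \<le> cc * ?n"
  proof -
   have "24 * D^2 * (2 * a') = 24 * D^2 * (2 * B) * sqrt ?n * ?u" by (simp add: a'_def)
   also have "\<dots> \<le> 24 * D^2 * (2 * B) * sqrt ?n * (cs * sqrt ?n)" using small B D by (intro mult_left_mono) auto
   also have "\<dots> = 24 * D^2 * (2 * B) * cs * (sqrt ?n * sqrt ?n)" by (simp only: mult_ac)
   also have "\<dots> = cc * ?n" using B D by (simp add: cs_def)
   finally show ?thesis .
  qed
  have le: "y \<le> 2 * a'" if "y \<le> s" for y using that sa a0 by linarith
  have le': "y \<le> 2 * a'" if "y \<le> a'" for y using that a0 by linarith
  have "cc / 2 * ?n * (a^2 + (norm b)^2 + (norm q)^2) \<le> (\<Sum>t\<in>?I. (a + b \<bullet> ((x t \<xi> - w (t - 1) \<xi>) + w (t - 1) \<xi>) + q \<bullet> v m t \<xi>)^2)"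
  proof (rule gram_lower_bound[where S="noise_cov G" and K=K and B="2 * a'" and J="ctrl G m" and D=D and c=cc and \<sigma>=\<sigma>
    and g="\<lambda>t. x t \<xi> - w (t - 1) \<xi>" and w="\<lambda>t. w (t - 1) \<xi>" and v="\<lambda>t. v m t \<xi>" and n="?n" and I="?I", OF _ _ \<sigma> K(1) _ _ _ gv _ _ _ en q D(2,3) cc_def sm])
   show "\<bar>\<Sum>t\<in>?I. w (t - 1) \<xi> $ i\<bar> \<le> 2 * a'" "\<bar>\<Sum>t\<in>?I. v m t \<xi> $ i'\<bar> \<le> 2 * a'" for i i'
    by (rule le, rule cr)+
   show "\<bar>\<Sum>t\<in>?I. (x t \<xi> - w (t - 1) \<xi>) $ i * w (t - 1) \<xi> $ l\<bar> \<le> 2 * a'" "\<bar>\<Sum>t\<in>?I. w (t - 1) \<xi> $ i * v m t \<xi> $ l'\<bar> \<le> 2 * a'" for i l l'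
    by (rule le, rule cr)+
   show "\<bar>(\<Sum>t\<in>?I. w (t - 1) \<xi> $ i * w (t - 1) \<xi> $ l) - ?n * noise_cov G $ i $ l\<bar> \<le> 2 * a'" for i l
    by (rule le', rule cr)
   show "\<bar>(\<Sum>t\<in>?I. v m t \<xi> $ i * v m t \<xi> $ l) - ?n * ident_on (ctrl G m) $ i $ l\<bar> \<le> 2 * a'" for i l
    by (rule le', rule cr)
  qed (use good_interval(4)[OF g, of m] in simp_all)
  then show "cc / 2 * ?n * (a^2 + (norm b)^2 + (norm q)^2) \<le> (\<Sum>t\<in>?I. (a + b \<bullet> x t \<xi> + q \<bullet> v m t \<xi>)^2)" by simp
 qed
qed

section \<open>Estimation errors\<close>

text \<open>The profile of epoch-\<open>k\<close> policies. The epochs of different players overlap only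
 approximately, so that this profile need not be played at any time.\<close>
definition profile_at :: "'a \<Rightarrow> nat \<Rightarrow> ('m, 'n, 'd) profile" where
 "profile_at \<xi> k = (\<lambda>j. fst (policy r j k \<xi>), \<lambda>j. snd (policy r j k \<xi>))"

abbreviation "reg \<xi> m t \<equiv> regressor (x t \<xi>) (control r m t \<xi>)"

text \<open>The exploration scales are frozen at epoch \<open>k - 1\<close> of each player. They are
  then constant on the data interval of player \<open>m\<close> and can be pulled out of all sums;
  what this misrepresents is collected in \<open>mismatch\<close>.\<close>

definition others_noise :: "'a \<Rightarrow> 'm \<Rightarrow> nat \<Rightarrow> nat \<Rightarrow> real^'n" where
 "others_noise \<xi> m k t = (\<Sum>j\<in>UNIV - {m}. al \<xi> j (k - 1) *\<^sub>R (Bmat G j *v v j t \<xi>))"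

text \<open>Vanishes at every time at which all other players are in their epoch
  \<open>k - 1\<close>, hence on all but few steps of the interval.\<close>

definition mismatch :: "'a \<Rightarrow> 'm \<Rightarrow> nat \<Rightarrow> nat \<Rightarrow> real^'n" where
 "mismatch \<xi> m k t = (\<Sum>j\<in>UNIV - {m}. Bmat G j *v (control r j t \<xi> - feedback (policy r j (k - 1) \<xi>) (x t \<xi>) - al \<xi> j (k - 1) *\<^sub>R v j t \<xi>))"

lemma profile_at_profiles: "\<xi> \<in> space M \<Longrightarrow> profile_at \<xi> k \<in> profiles G"
 using policy_strategy[of \<xi> _ k] by (auto simp: profile_at_def profiles_def gain_profiles_def offset_profiles_def strategies_def mem_Times_iff)

lemma residual_eq:
 assumes \<xi>: "\<xi> \<in> space M"
 shows "x (Suc t) \<xi> = transpose (true_param G m (profile_at \<xi> (k - 1))) *v reg \<xi> m t + (w t \<xi> + others_noise \<xi> m k t + mismatch \<xi> m k t)"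
proof -
 have "Bmat G j *v control r j t \<xi> = (Bmat G j *v snd (profile_at \<xi> (k - 1)) j - (Bmat G j ** fst (profile_at \<xi> (k - 1)) j) *v x t \<xi>)
   + (al \<xi> j (k - 1) *\<^sub>R (Bmat G j *v v j t \<xi>) + Bmat G j *v (control r j t \<xi> - feedback (policy r j (k - 1) \<xi>) (x t \<xi>) - al \<xi> j (k - 1) *\<^sub>R v j t \<xi>))" for j
  by (simp add: profile_at_def feedback_def matrix_vector_mul_assoc[symmetric] linear_diff[OF matrix_vector_mul_linear]
   linear_add[OF matrix_vector_mul_linear] linear_scale[OF matrix_vector_mul_linear] linear_neg[OF matrix_vector_mul_linear])
 then have "(\<Sum>j\<in>UNIV - {m}. Bmat G j *v control r j t \<xi>) = (\<Sum>j\<in>UNIV - {m}. Bmat G j *v snd (profile_at \<xi> (k - 1)) j)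
   - (\<Sum>j\<in>UNIV - {m}. Bmat G j ** fst (profile_at \<xi> (k - 1)) j) *v x t \<xi> + (others_noise \<xi> m k t + mismatch \<xi> m k t)"
  unfolding others_noise_def mismatch_def matrix_vector_mult_sum sum_subtractf[symmetric] sum.distrib[symmetric] by (rule sum.cong[OF refl])
 then show ?thesis
  unfolding state_Suc[OF \<xi>] game_step_def true_param_regressor sum_UNIV_remove[of "\<lambda>j. Bmat G j *v control r j t \<xi>" m]
  by (simp add: matrix_vector_mult_diff_rdistrib algebra_simps)
qed

lemma control_bound:
 obtains K where "0 \<le> K" "\<And>\<xi> m t. \<xi> \<in> space M \<Longrightarrow> norm (control r m t \<xi>) \<le> K * (1 + norm (x t \<xi>) + norm (v m t \<xi>))"
  "\<And>\<xi> m t k. \<xi> \<in> space M \<Longrightarrow> norm (feedback (policy r m k \<xi>) (x t \<xi>)) \<le> K * (1 + norm (x t \<xi>))"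
proof -
 define K where "K = (\<Sum>j\<in>UNIV. radF G j + radf G j) + expl_scale c"
 have rd: "0 < radf G j" "0 < radF G j" for j using G by (auto simp: valid_game_def)
 have ex: "0 < expl_scale c" using c by (simp add: valid_schedule_def)
 have "radF G m + radf G m \<le> (\<Sum>j\<in>UNIV. radF G j + radf G j)" for m
  using rd by (intro member_le_sum) (auto intro!: less_imp_le[OF add_pos_pos])
 then have le: "radF G m + radf G m + expl_scale c \<le> K" for m unfolding K_def by simp
 have K1: "radF G m \<le> K" "radf G m \<le> K" "expl_scale c \<le> K" for m using le[of m] rd[of m] ex by linarith+
 have K0: "0 \<le> K" using K1(3) ex by linarith
 have fb: "norm (feedback (policy r m k \<xi>) (x t \<xi>)) \<le> K * (1 + norm (x t \<xi>))" if \<xi>: "\<xi> \<in> space M" for \<xi> m t k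
 proof -
  have "norm (fst (policy r m k \<xi>) *v x t \<xi>) \<le> spec_norm (fst (policy r m k \<xi>)) * norm (x t \<xi>)" by (rule norm_matrix_vector_le)
  also have "\<dots> \<le> K * norm (x t \<xi>)" using policy_bounds(1)[OF \<xi>, of m k] K1(1)[of m] by (intro mult_right_mono) auto
  finally have "norm (fst (policy r m k \<xi>) *v x t \<xi>) \<le> K * norm (x t \<xi>)" .
  moreover have "norm (snd (policy r m k \<xi>)) \<le> K" using policy_bounds(2)[OF \<xi>, of m k] K1(2)[of m] by linarith
  moreover have "norm (feedback (policy r m k \<xi>) (x t \<xi>)) \<le> norm (fst (policy r m k \<xi>) *v x t \<xi>) + norm (snd (policy r m k \<xi>))"
   unfolding feedback_def by (metis norm_minus_cancel norm_triangle_ineq)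
  ultimately show ?thesis by (simp add: distrib_left)
 qed
 show thesis
 proof (rule that[OF K0 _ fb])
  fix \<xi> m t assume \<xi>: "\<xi> \<in> space M"
  have "norm (al \<xi> m (ep \<xi> m t) *\<^sub>R v m t \<xi>) \<le> K * norm (v m t \<xi>)"
   using epoch_facts(9,10)[OF \<xi>, of m "ep \<xi> m t"] K1(3) by (auto intro!: mult_right_mono)
  then show "norm (control r m t \<xi>) \<le> K * (1 + norm (x t \<xi>) + norm (v m t \<xi>))"
   unfolding control_eq[OF \<xi>] using fb[OF \<xi>, of m "ep \<xi> m t" t]
    norm_triangle_ineq[of "feedback (policy r m (ep \<xi> m t) \<xi>) (x t \<xi>)" "al \<xi> m (ep \<xi> m t) *\<^sub>R v m t \<xi>"]
   by (simp add: distrib_left)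
 qed
qed

text \<open>At a misaligned time the control of another player and the one attributed to her need
  not be close; their difference is only bounded by the size of the largest states and noises. It is
  the small number of such times that makes the term harmless.\<close>

lemma mismatch_bounds:
 obtains K where "0 \<le> K" "\<And>\<xi> L k m t. good C \<xi> L k \<Longrightarrow> t \<in> iv \<xi> m k \<Longrightarrow> norm (mismatch \<xi> m k t) \<le> K * sqrt (real k + L)"
  "\<And>\<xi> L k m. good C \<xi> L k \<Longrightarrow> real (card {t \<in> iv \<xi> m k. mismatch \<xi> m k t \<noteq> 0}) \<le> K * (real k + L)"
proof -
 obtain Kc where Kc: "0 \<le> Kc" "\<And>\<xi> m t. \<xi> \<in> space M \<Longrightarrow> norm (control r m t \<xi>) \<le> Kc * (1 + norm (x t \<xi>) + norm (v m t \<xi>))"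
  "\<And>\<xi> m t k. \<xi> \<in> space M \<Longrightarrow> norm (feedback (policy r m k \<xi>) (x t \<xi>)) \<le> Kc * (1 + norm (x t \<xi>))"
  using control_bound by blast
 obtain Ks where Ks: "0 \<le> Ks" "\<And>\<xi> L k m t. good C \<xi> L k \<Longrightarrow> t \<le> st \<xi> m k \<Longrightarrow> norm (x t \<xi>) \<le> Ks * sqrt (real k + L)"
  using state_sup_bound[of C] by blast
 obtain Kv where Kv: "0 \<le> Kv" "\<And>\<xi> L k m t. good C \<xi> L k \<Longrightarrow> t < st \<xi> m k \<Longrightarrow> norm (w t \<xi>) \<le> Kv * sqrt (real k + L)"
  "\<And>\<xi> L k m t j. good C \<xi> L k \<Longrightarrow> t < st \<xi> m k \<Longrightarrow> norm (v j t \<xi>) \<le> Kv * sqrt (real k + L)"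
  using noise_sup_bound[of C] by blast
 have ex: "0 < expl_scale c" and ms: "0 < max_shift c" using c by (auto simp: valid_schedule_def)
 define Kd where "Kd = Kc * (1 + Ks + Kv) + Kc * (1 + Ks) + expl_scale c * Kv"
 have Kd0: "0 \<le> Kd" using Kc Ks Kv ex by (simp add: Kd_def)
 define K1 where "K1 = (\<Sum>j\<in>UNIV. spec_norm (Bmat G j) * Kd)"
 define K2 where "K2 = real CARD('m) * (2 * (max_shift c + 1))"
 have K0: "0 \<le> K1" "0 \<le> K2" using Kd0 ms by (auto simp: K1_def K2_def intro!: sum_nonneg)
 have d: "norm (control r j t \<xi> - feedback (policy r j (k - 1) \<xi>) (x t \<xi>) - al \<xi> j (k - 1) *\<^sub>R v j t \<xi>) \<le> Kd * sqrt (real k + L)"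
  if g: "good C \<xi> L k" and t: "t \<in> iv \<xi> m k" for \<xi> L k m t j
 proof -
  note \<xi> = goodD(1)[OF g]
  let ?s = "sqrt (real k + L)"
  have s1: "1 \<le> ?s" using goodD(4)[OF g] by simp
  have xs: "norm (x t \<xi>) \<le> Ks * ?s" using Ks(2)[OF g, of t m] t by simp
  have vs: "norm (v j t \<xi>) \<le> Kv * ?s" using Kv(3)[OF g, of t m] t by simp
  have "norm (control r j t \<xi>) \<le> Kc * (?s + Ks * ?s + Kv * ?s)"
   by (rule order_trans[OF Kc(2)[OF \<xi>]]) (intro mult_left_mono add_mono xs vs s1 Kc(1))
  moreover have "norm (feedback (policy r j (k - 1) \<xi>) (x t \<xi>)) \<le> Kc * (?s + Ks * ?s)"
   by (rule order_trans[OF Kc(3)[OF \<xi>]]) (intro mult_left_mono add_mono xs s1 Kc(1))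
  moreover have "norm (al \<xi> j (k - 1) *\<^sub>R v j t \<xi>) \<le> expl_scale c * (Kv * ?s)"
   unfolding norm_scaleR using epoch_facts(9,10)[OF \<xi>, of j "k - 1"] ex vs by (intro mult_mono) auto
  moreover have "norm (p - q - z) \<le> norm p + norm q + norm z" for p q z :: "real^'d" by norm
  ultimately have "norm (control r j t \<xi> - feedback (policy r j (k - 1) \<xi>) (x t \<xi>) - al \<xi> j (k - 1) *\<^sub>R v j t \<xi>)
   \<le> Kc * (?s + Ks * ?s + Kv * ?s) + Kc * (?s + Ks * ?s) + expl_scale c * (Kv * ?s)" by (meson add_mono order_trans)
  also have "\<dots> = Kd * ?s" by (simp add: Kd_def algebra_simps)
  finally show ?thesis .
 qed
 show thesis
 proof (rule that[of "K1 + K2"])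
  show "0 \<le> K1 + K2" using K0 by simp
  fix \<xi> L k m t assume g: "good C \<xi> L k" and t: "t \<in> iv \<xi> m k"
  let ?s = "sqrt (real k + L)"
  have s0: "0 \<le> ?s" using goodD(4)[OF g] by simp
  have "norm (mismatch \<xi> m k t) \<le> (\<Sum>j\<in>UNIV - {m}. spec_norm (Bmat G j) * (Kd * ?s))" unfolding mismatch_def
   by (rule sum_norm_le) (rule order_trans[OF norm_matrix_vector_le mult_left_mono[OF d[OF g t]]], simp)
  also have "\<dots> \<le> (\<Sum>j\<in>UNIV. spec_norm (Bmat G j) * (Kd * ?s))" using Kd0 s0 by (intro sum_mono2) auto
  also have "\<dots> = K1 * ?s" by (simp add: K1_def sum_distrib_right mult.assoc)
  also have "\<dots> \<le> (K1 + K2) * ?s" using K0 s0 by (intro mult_right_mono) auto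
  finally show "norm (mismatch \<xi> m k t) \<le> (K1 + K2) * ?s" .
 next
  fix \<xi> L k m assume g: "good C \<xi> L k"
  note \<xi> = goodD(1)[OF g]
  have sub: "{t \<in> iv \<xi> m k. mismatch \<xi> m k t \<noteq> 0} \<subseteq> (\<Union>j\<in>UNIV. {t \<in> iv \<xi> m k. ep \<xi> j t \<noteq> k - 1})"
  proof safe
   fix t assume t: "t \<in> iv \<xi> m k" "mismatch \<xi> m k t \<noteq> 0"
   have "\<exists>j. ep \<xi> j t \<noteq> k - 1"
   proof (rule ccontr)
    assume "\<nexists>j. ep \<xi> j t \<noteq> k - 1"
    then have "mismatch \<xi> m k t = 0" unfolding mismatch_def control_eq[OF \<xi>] by simp
    then show False using t by simp
   qed
   then show "t \<in> (\<Union>j\<in>UNIV. {t \<in> iv \<xi> m k. ep \<xi> j t \<noteq> k - 1})" using t by blast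
  qed
  have "card {t \<in> iv \<xi> m k. mismatch \<xi> m k t \<noteq> 0} \<le> card (\<Union>j\<in>UNIV. {t \<in> iv \<xi> m k. ep \<xi> j t \<noteq> k - 1})"
   by (rule card_mono[OF _ sub]) auto
  also have "\<dots> \<le> (\<Sum>j\<in>UNIV. card {t \<in> iv \<xi> m k. ep \<xi> j t \<noteq> k - 1})" by (rule card_UN_le) simp
  finally have "real (card {t \<in> iv \<xi> m k. mismatch \<xi> m k t \<noteq> 0}) \<le> (\<Sum>j\<in>UNIV. real (card {t \<in> iv \<xi> m k. ep \<xi> j t \<noteq> k - 1}))"
   by (simp only: of_nat_le_iff of_nat_sum[symmetric])
  also have "\<dots> \<le> (\<Sum>j\<in>(UNIV::'m set). 2 * real k * (max_shift c + 1))"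
   using epoch_facts(8)[OF \<xi> goodD(3)[OF g]] by (intro sum_mono) auto
  also have "\<dots> = K2 * real k" by (simp add: K2_def)
  also have "\<dots> \<le> (K1 + K2) * (real k + L)" using K0 goodD(2)[OF g] by (intro mult_mono) auto
  finally show "real (card {t \<in> iv \<xi> m k. mismatch \<xi> m k t \<noteq> 0}) \<le> (K1 + K2) * (real k + L)" .
 qed
qed

lemma mismatch_sum:
 assumes "0 \<le> Kp" "0 \<le> Kd" and fin: "finite I" and p: "\<And>t. t \<in> I \<Longrightarrow> \<bar>p t\<bar> \<le> Kp" and d: "\<And>t. t \<in> I \<Longrightarrow> \<bar>q t\<bar> \<le> norm (e t)" "\<And>t. t \<in> I \<Longrightarrow> norm (e t) \<le> Kd"
  and card: "real (card {t \<in> I. e t \<noteq> 0}) \<le> N"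
 shows "\<bar>\<Sum>t\<in>I. p t * q t\<bar> \<le> N * (Kp * Kd)"
proof -
 let ?J = "{t \<in> I. e t \<noteq> 0}"
 have "(\<Sum>t\<in>I. p t * q t) = (\<Sum>t\<in>?J. p t * q t)" using fin d(1) by (intro sum.mono_neutral_right) force+
 also have "\<bar>\<dots>\<bar> \<le> (\<Sum>t\<in>?J. \<bar>p t * q t\<bar>)" by (rule sum_abs)
 also have "\<dots> \<le> (\<Sum>t\<in>?J. Kp * Kd)"
  unfolding abs_mult using assms(1) p d by (intro sum_mono mult_mono) (auto intro: order_trans)
 also have "\<dots> = real (card ?J) * (Kp * Kd)" by simp
 also have "real (card ?J) * (Kp * Kd) \<le> N * (Kp * Kd)" using card assms(1,2) by (intro mult_right_mono) auto
 finally show ?thesis .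
qed

end

lemma norm_row_le: "norm (A $ l) \<le> spec_norm (A :: real^'n::finite^'k::finite)"
proof -
 have "A $ l = axis l 1 v* A" by (simp add: vec_eq_iff vector_matrix_mult_component inner_axis column_def)
 then show ?thesis using norm_vec_transpose[of "axis l 1" A] by simp
qed

lemma norm_reg_le: "norm e \<le> \<bar>reg_const e\<bar> + norm (reg_state e) + norm (reg_control e)"
proof (rule power2_le_imp_le)
 have "0 \<le> \<bar>reg_const e\<bar> * norm (reg_state e)" "0 \<le> \<bar>reg_const e\<bar> * norm (reg_control e)" "0 \<le> norm (reg_state e) * norm (reg_control e)" by auto
 then show "(norm e)^2 \<le> (\<bar>reg_const e\<bar> + norm (reg_state e) + norm (reg_control e))^2"
  unfolding norm_reg by (simp add: power2_eq_square algebra_simps)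
qed simp

lemma spec_norm_le_columns: "spec_norm A \<le> (\<Sum>l\<in>UNIV. norm (column l A))" for A :: "real^'n::finite^'k::finite"
proof (rule spec_norm_least)
 fix y :: "real^'n"
 have "A *v y = (\<Sum>l\<in>UNIV. y $ l *\<^sub>R column l A)" by (simp add: vec_eq_iff matrix_vector_mult_def column_def mult.commute)
 also have "norm \<dots> \<le> (\<Sum>l\<in>UNIV. norm (column l A) * norm y)"
  by (rule sum_norm_le) (simp add: mult.commute[of _ "norm y"] mult_right_mono component_le_norm_cart)
 finally show "norm (A *v y) \<le> (\<Sum>l\<in>UNIV. norm (column l A)) * norm y" by (simp add: sum_distrib_right)
qed (simp add: sum_nonneg)

lemma spec_norm_le_entries:
 fixes A :: "real^'n::finite^'k::finite"
 assumes "\<And>i l. \<bar>A $ i $ l\<bar> \<le> b" shows "spec_norm A \<le> real CARD('n) * (real CARD('k) * b)"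
proof -
 have "norm (column l A) \<le> real CARD('k) * b" for l by (rule norm_le_component_bound) (simp add: column_def assms)
 then have "(\<Sum>l\<in>UNIV. norm (column l A)) \<le> (\<Sum>l\<in>(UNIV::'n set). real CARD('k) * b)" by (intro sum_mono)
 then show ?thesis using spec_norm_le_columns[of A] by simp
qed

context stable_learning begin

text \<open>A bound uniform over profiles, hence over epochs and paths, for the bias caused by the
  regularization.\<close>

lemma true_param_column_bound:
 obtains T where "0 \<le> T" "\<And>p m l. p \<in> profiles G \<Longrightarrow> norm (column l (true_param G m p)) \<le> T"
proof -
 have rd: "0 < radf G j" "0 < radF G j" for j using G by (auto simp: valid_game_def)
 define T1 where "T1 = norm (drift G) + (\<Sum>j\<in>UNIV. spec_norm (Bmat G j) * radf G j)"
 define T2 where "T2 = spec_norm (Amat G) + (\<Sum>j\<in>UNIV. spec_norm (Bmat G j) * radF G j)"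
 define T3 where "T3 = (\<Sum>j\<in>UNIV. spec_norm (Bmat G j))"
 have T: "0 \<le> T1" "0 \<le> T2" "0 \<le> T3" unfolding T1_def T2_def T3_def
  by (intro add_nonneg_nonneg sum_nonneg mult_nonneg_nonneg norm_ge_zero spec_norm_nonneg less_imp_le[OF rd(1)] less_imp_le[OF rd(2)])+
 show thesis
 proof (rule that[of "T1 + T2 + T3"])
  show "0 \<le> T1 + T2 + T3" using T by simp
  fix p m l assume p: "p \<in> profiles G"
  let ?e = "column l (true_param G m p)"
  have pf: "spec_norm (fst p j) \<le> radF G j" "norm (snd p j) \<le> radf G j" for j
   using p by (auto simp: profiles_def gain_profiles_def offset_profiles_def gains_def offsets_def)
  have "reg_const ?e = (drift G + (\<Sum>j\<in>UNIV - {m}. Bmat G j *v snd p j)) $ l" by (simp add: reg_const_def column_def true_param_def)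
  then have "\<bar>reg_const ?e\<bar> \<le> norm (drift G + (\<Sum>j\<in>UNIV - {m}. Bmat G j *v snd p j))" by (simp add: component_le_norm_cart del: vector_add_component)
  also have "\<dots> \<le> norm (drift G) + (\<Sum>j\<in>UNIV - {m}. spec_norm (Bmat G j) * radf G j)"
  proof (intro norm_triangle_le add_left_mono sum_norm_le)
   fix j
   show "norm (Bmat G j *v snd p j) \<le> spec_norm (Bmat G j) * radf G j"
    by (rule order_trans[OF norm_matrix_vector_le mult_left_mono[OF pf(2)]]) simp
  qed
  also have "\<dots> \<le> T1" unfolding T1_def by (intro add_left_mono sum_mono2 mult_nonneg_nonneg spec_norm_nonneg less_imp_le[OF rd(1)] less_imp_le[OF rd(2)]) auto
  finally have 1: "\<bar>reg_const ?e\<bar> \<le> T1" .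
  have "reg_state ?e = (Amat G - (\<Sum>j\<in>UNIV - {m}. Bmat G j ** fst p j)) $ l"
   by (simp add: reg_state_def column_def true_param_def vec_eq_iff)
  then have "norm (reg_state ?e) \<le> spec_norm (Amat G - (\<Sum>j\<in>UNIV - {m}. Bmat G j ** fst p j))" by (simp only: norm_row_le)
  also have "\<dots> \<le> spec_norm (Amat G) + (\<Sum>j\<in>UNIV - {m}. spec_norm (Bmat G j ** fst p j))"
   using spec_norm_diff[of "Amat G" "\<Sum>j\<in>UNIV - {m}. Bmat G j ** fst p j"] spec_norm_sum[of "\<lambda>j. Bmat G j ** fst p j" "UNIV - {m}"] by linarith
  also have "\<dots> \<le> spec_norm (Amat G) + (\<Sum>j\<in>UNIV - {m}. spec_norm (Bmat G j) * radF G j)"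
   by (intro add_left_mono sum_mono order_trans[OF spec_norm_mult mult_left_mono[OF pf(1)]]) simp
  also have "\<dots> \<le> T2" unfolding T2_def by (intro add_left_mono sum_mono2 mult_nonneg_nonneg spec_norm_nonneg less_imp_le[OF rd(1)] less_imp_le[OF rd(2)]) auto
  finally have 2: "norm (reg_state ?e) \<le> T2" .
  have "reg_control ?e = Bmat G m $ l" by (simp add: reg_control_def column_def true_param_def vec_eq_iff)
  then have "norm (reg_control ?e) \<le> spec_norm (Bmat G m)" by (simp only: norm_row_le)
  also have "\<dots> \<le> T3" unfolding T3_def by (intro member_le_sum) auto
  finally show "norm ?e \<le> T1 + T2 + T3" using 1 2 norm_reg_le[of ?e] by linarith
 qed
qed

abbreviation "resid \<xi> m k t \<equiv> w t \<xi> + others_noise \<xi> m k t + mismatch \<xi> m k t"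

text \<open>The residual is not an innovation, but two of its three parts are nearly uncorrelated
  with the regressor: the state noise, and the exploration noise of the others, which is independent
  of that of player \<open>m\<close>. The third part, \<open>mismatch\<close>, shows no cancellation
  and is controlled by counting its nonzero terms.\<close>

lemma residual_sums:
 obtains B where "0 \<le> B"
  "\<And>\<xi> L k m l. good C \<xi> L k \<Longrightarrow> \<bar>\<Sum>t\<in>iv \<xi> m k. resid \<xi> m k t $ l\<bar> \<le> B * sqrt ((real k + L) * rlen \<xi> m k)"
  "\<And>\<xi> L k m i l. good C \<xi> L k \<Longrightarrow> \<bar>\<Sum>t\<in>iv \<xi> m k. x t \<xi> $ i * resid \<xi> m k t $ l\<bar> \<le> B * sqrt ((real k + L) * rlen \<xi> m k)"
  "\<And>\<xi> L k m i l. good C \<xi> L k \<Longrightarrow> \<bar>\<Sum>t\<in>iv \<xi> m k. v m t \<xi> $ i * resid \<xi> m k t $ l\<bar> \<le> B * sqrt ((real k + L) * rlen \<xi> m k)"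
proof -
 obtain Bc where Bc: "0 < Bc" "\<And>\<xi> L k m. good C \<xi> L k \<Longrightarrow> cross Bc \<xi> L k m" using cross_sums[of C] by blast
 obtain Ks where Ks: "0 \<le> Ks" "\<And>\<xi> L k m t. good C \<xi> L k \<Longrightarrow> t \<le> st \<xi> m k \<Longrightarrow> norm (x t \<xi>) \<le> Ks * sqrt (real k + L)"
  using state_sup_bound[of C] by blast
 obtain Kv where Kv: "0 \<le> Kv" "\<And>\<xi> L k m t. good C \<xi> L k \<Longrightarrow> t < st \<xi> m k \<Longrightarrow> norm (w t \<xi>) \<le> Kv * sqrt (real k + L)"
  "\<And>\<xi> L k m t j. good C \<xi> L k \<Longrightarrow> t < st \<xi> m k \<Longrightarrow> norm (v j t \<xi>) \<le> Kv * sqrt (real k + L)"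
  using noise_sup_bound[of C] by blast
 obtain Kd where Kd: "0 \<le> Kd" "\<And>\<xi> L k m t. good C \<xi> L k \<Longrightarrow> t \<in> iv \<xi> m k \<Longrightarrow> norm (mismatch \<xi> m k t) \<le> Kd * sqrt (real k + L)"
  "\<And>\<xi> L k m. good C \<xi> L k \<Longrightarrow> real (card {t \<in> iv \<xi> m k. mismatch \<xi> m k t \<noteq> 0}) \<le> Kd * (real k + L)"
  using mismatch_bounds[of C] by blast
 obtain Kl where Kl: "0 \<le> Kl" "\<And>C \<xi> L k m. good C \<xi> L k \<Longrightarrow> sqrt (rlen \<xi> m k) * (real k + L) \<le> Kl * rlen \<xi> m k"
  "\<And>C \<xi> L k m. good C \<xi> L k \<Longrightarrow> real k + L \<le> Kl * rlen \<xi> m k"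
  "\<And>C \<xi> L k m. good C \<xi> L k \<Longrightarrow> (real k + L) ^ 3 \<le> Kl * rlen \<xi> m k" using log_sq_le_length by blast
 have ex: "0 < expl_scale c" using c by (simp add: valid_schedule_def)
 define KB where "KB = (\<Sum>j\<in>UNIV. \<Sum>l\<in>UNIV. expl_scale c * (real CARD('d) * norm (Bmat G j $ l)))"
 define Kp where "Kp = 1 + Ks + Kv"
 define B where "B = Bc + KB * Bc + Kd * (Kp * Kd) * sqrt Kl"
 have KB0: "0 \<le> KB" unfolding KB_def using ex by (intro sum_nonneg) auto
 have Kp0: "0 \<le> Kp" using Ks Kv by (simp add: Kp_def)
 have gen: "\<bar>\<Sum>t\<in>iv \<xi> m k. p t * resid \<xi> m k t $ l\<bar> \<le> B * sqrt ((real k + L) * rlen \<xi> m k)"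
  if g: "good C \<xi> L k" and p: "\<And>t. t \<in> iv \<xi> m k \<Longrightarrow> \<bar>p t\<bar> \<le> Kp * sqrt (real k + L)"
   and pw: "\<bar>\<Sum>t\<in>iv \<xi> m k. p t * w t \<xi> $ l\<bar> \<le> Bc * sqrt ((real k + L) * rlen \<xi> m k)"
   and pv: "\<And>j i. j \<noteq> m \<Longrightarrow> \<bar>\<Sum>t\<in>iv \<xi> m k. p t * v j t \<xi> $ i\<bar> \<le> Bc * sqrt ((real k + L) * rlen \<xi> m k)"
  for \<xi> L k m l and p :: "nat \<Rightarrow> real"
 proof -
  let ?I = "iv \<xi> m k" and ?u = "real k + L" and ?n = "rlen \<xi> m k"
  define s where "s = sqrt (?u * ?n)"
  have u: "1 \<le> ?u" by (rule goodD(4)[OF g])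
  have s0: "0 \<le> s" using u by (simp add: s_def)
  have a: "\<bar>\<Sum>t\<in>?I. p t * others_noise \<xi> m k t $ l\<bar> \<le> KB * Bc * s"
  proof -
   have e1: "(\<Sum>t\<in>?I. p t * others_noise \<xi> m k t $ l) = (\<Sum>t\<in>?I. \<Sum>j\<in>UNIV - {m}. al \<xi> j (k - 1) * ((Bmat G j $ l \<bullet> v j t \<xi>) * p t))"
    by (simp add: others_noise_def sum_distrib_left matrix_vector_mul_component mult_ac)
   have e2: "\<dots> = (\<Sum>j\<in>UNIV - {m}. al \<xi> j (k - 1) * (\<Sum>t\<in>?I. (Bmat G j $ l \<bullet> v j t \<xi>) * p t))"
    by (subst sum.swap) (simp add: sum_distrib_left)
   have "\<bar>\<Sum>t\<in>?I. p t * others_noise \<xi> m k t $ l\<bar> \<le> (\<Sum>j\<in>UNIV - {m}. \<bar>al \<xi> j (k - 1) * (\<Sum>t\<in>?I. (Bmat G j $ l \<bullet> v j t \<xi>) * p t)\<bar>)"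
    unfolding e1 e2 by (rule sum_abs)
   also have "\<dots> \<le> (\<Sum>j\<in>UNIV - {m}. expl_scale c * (real CARD('d) * (Bc * s) * norm (Bmat G j $ l)))"
   proof (rule sum_mono)
    fix j assume "j \<in> UNIV - {m}"
    then have j: "j \<noteq> m" by simp
    have "\<bar>\<Sum>t\<in>?I. (Bmat G j $ l \<bullet> v j t \<xi>) * p t\<bar> \<le> real CARD('d) * (Bc * s) * norm (Bmat G j $ l)"
     by (rule linear_sum_bound) (use pv[OF j] in \<open>simp add: s_def mult.commute\<close>)
    then show "\<bar>al \<xi> j (k - 1) * (\<Sum>t\<in>?I. (Bmat G j $ l \<bullet> v j t \<xi>) * p t)\<bar> \<le> expl_scale c * (real CARD('d) * (Bc * s) * norm (Bmat G j $ l))"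
     unfolding abs_mult using epoch_facts(9,10)[OF goodD(1)[OF g], of j "k - 1"] ex by (intro mult_mono) auto
   qed
   also have "\<dots> = (\<Sum>j\<in>UNIV - {m}. expl_scale c * (real CARD('d) * norm (Bmat G j $ l))) * (Bc * s)"
    by (simp add: sum_distrib_right sum_distrib_left mult_ac)
   also have "(\<Sum>j\<in>UNIV - {m}. expl_scale c * (real CARD('d) * norm (Bmat G j $ l))) \<le> KB"
   proof -
    have "(\<Sum>j\<in>UNIV - {m}. expl_scale c * (real CARD('d) * norm (Bmat G j $ l))) \<le> (\<Sum>j\<in>UNIV. expl_scale c * (real CARD('d) * norm (Bmat G j $ l)))"
     using ex by (intro sum_mono2) auto
    also have "\<dots> \<le> KB" unfolding KB_def
    proof (rule sum_mono)
     fix j show "expl_scale c * (real CARD('d) * norm (Bmat G j $ l)) \<le> (\<Sum>l\<in>UNIV. expl_scale c * (real CARD('d) * norm (Bmat G j $ l)))"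
      using ex by (intro member_le_sum[of l UNIV "\<lambda>l. expl_scale c * (real CARD('d) * norm (Bmat G j $ l))"]) auto
    qed
    finally show ?thesis .
   qed
   finally show ?thesis using Bc(1) s0 by (simp add: mult.assoc mult_right_mono)
  qed
  have b: "\<bar>\<Sum>t\<in>?I. p t * mismatch \<xi> m k t $ l\<bar> \<le> Kd * (Kp * Kd) * sqrt Kl * s"
  proof -
   have "\<bar>\<Sum>t\<in>?I. p t * mismatch \<xi> m k t $ l\<bar> \<le> (Kd * ?u) * ((Kp * sqrt ?u) * (Kd * sqrt ?u))"
    by (rule mismatch_sum[where e="mismatch \<xi> m k"])
     (use Kp0 Kd u p component_le_norm_cart g in auto)
   also have "\<dots> = Kd * (Kp * Kd) * (?u * (sqrt ?u * sqrt ?u))" by (simp only: mult_ac)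
   \<comment> \<open>Written in this form, the cube can be traded for the epoch length, which leaves
     the same order \<open>sqrt (?u * ?n)\<close> as the other parts.\<close>
   also have "?u * (sqrt ?u * sqrt ?u) = sqrt (?u * ?u ^ 3)"
   proof -
    have "?u * ?u ^ 3 = (?u * ?u)^2" by (simp add: power2_eq_square power3_eq_cube)
    then show ?thesis using u by simp
   qed
   also have "Kd * (Kp * Kd) * sqrt (?u * ?u ^ 3) \<le> Kd * (Kp * Kd) * sqrt (?u * (Kl * ?n))"
    using Kl(4)[OF g, of m] u Kd(1) Kp0 by (intro mult_left_mono real_sqrt_le_mono) auto
   also have "sqrt (?u * (Kl * ?n)) = sqrt Kl * s" by (simp add: s_def real_sqrt_mult)
   finally show ?thesis by (simp add: mult.assoc)
  qed
  have "(\<Sum>t\<in>?I. p t * resid \<xi> m k t $ l) = (\<Sum>t\<in>?I. p t * w t \<xi> $ l) + (\<Sum>t\<in>?I. p t * others_noise \<xi> m k t $ l) + (\<Sum>t\<in>?I. p t * mismatch \<xi> m k t $ l)"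
   by (simp add: sum.distrib distrib_left)
  moreover have "B * s = Bc * s + KB * Bc * s + Kd * (Kp * Kd) * sqrt Kl * s" by (simp add: B_def algebra_simps)
  ultimately show ?thesis using a b pw unfolding s_def by linarith
 qed
 show thesis
 proof (rule that[of B])
  show "0 \<le> B" unfolding B_def using Bc(1) KB0 Kd(1) Kp0 Kl(1) by simp
  fix \<xi> L k m l assume g: "good C \<xi> L k"
  note cr = crossD[OF Bc(2)[OF g, of m]]
  have s1: "1 \<le> sqrt (real k + L)" using goodD(4)[OF g] by simp
  have K: "1 \<le> Kp * sqrt (real k + L)" "Ks * sqrt (real k + L) \<le> Kp * sqrt (real k + L)" "Kv * sqrt (real k + L) \<le> Kp * sqrt (real k + L)"
   using s1 Ks Kv mult_mono[of 1 Kp 1 "sqrt (real k + L)"] by (auto simp: Kp_def intro!: mult_right_mono)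
  show "\<bar>\<Sum>t\<in>iv \<xi> m k. resid \<xi> m k t $ l\<bar> \<le> B * sqrt ((real k + L) * rlen \<xi> m k)"
   using gen[OF g, of m "\<lambda>_. 1" l] K(1) cr(1,2) by simp
  show "\<bar>\<Sum>t\<in>iv \<xi> m k. x t \<xi> $ i * resid \<xi> m k t $ l\<bar> \<le> B * sqrt ((real k + L) * rlen \<xi> m k)" for i
  proof (rule gen[OF g])
   fix t assume "t \<in> iv \<xi> m k"
   then show "\<bar>x t \<xi> $ i\<bar> \<le> Kp * sqrt (real k + L)"
    using Ks(2)[OF g, of t m] K(2) component_le_norm_cart[of "x t \<xi>" i] by simp
  qed (rule cr)+
  show "\<bar>\<Sum>t\<in>iv \<xi> m k. v m t \<xi> $ i * resid \<xi> m k t $ l\<bar> \<le> B * sqrt ((real k + L) * rlen \<xi> m k)" for i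
  proof (rule gen[OF g])
   fix t assume "t \<in> iv \<xi> m k"
   then show "\<bar>v m t \<xi> $ i\<bar> \<le> Kp * sqrt (real k + L)"
    using Kv(3)[OF g, of t m m] K(3) component_le_norm_cart[of "v m t \<xi>" i] by simp
  next
   show "\<bar>\<Sum>t\<in>iv \<xi> m k. v m t \<xi> $ i * v j t \<xi> $ i'\<bar> \<le> Bc * sqrt ((real k + L) * rlen \<xi> m k)" if "j \<noteq> m" for j i'
    by (rule cr(6)) (use that in simp)
  qed (rule cr)
 qed
qed

lemma length_powr:
 assumes "0 < e"
 obtains K where "0 \<le> K" "\<And>C \<xi> L k m. good C \<xi> L k \<Longrightarrow> rlen \<xi> m k powr (- e) \<le> K * (lam ^ k) powr (- e)"
proof -
 obtain a b where ab: "0 < a" "0 < b" "\<And>C \<xi> L k m. good C \<xi> L k \<Longrightarrow> a * lam ^ k \<le> rlen \<xi> m k"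
  "\<And>C \<xi> L k m. good C \<xi> L k \<Longrightarrow> rlen \<xi> m k \<le> b * lam ^ k" using length_scale by blast
 show thesis
 proof (rule that[of "a powr (- e)"])
  fix C \<xi> L k m assume g: "good C \<xi> L k"
  have "rlen \<xi> m k powr (- e) \<le> (a * lam ^ k) powr (- e)" using ab(3)[OF g, of m] ab(1) lam assms by (intro powr_mono2') auto
  then show "rlen \<xi> m k powr (- e) \<le> a powr (- e) * (lam ^ k) powr (- e)" using ab lam by (simp add: powr_mult)
 qed simp
qed

text \<open>\<open>rateA\<close> is the statistical error
  \<open>sqrt (k + L) / (\<alpha> * sqrt n)\<close> for the slowest player, with exploration scale
  \<alpha> of order \<open>n powr (- \<nu>)\<close>; \<open>rateB\<close> is the largest order of an
  exploration scale. Both use \<open>lam ^ k\<close> in place of the lengths \<open>n\<close>, which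
  differ between players.\<close>

definition "rateA k L = sqrt (real k + L) * (lam ^ k) powr (- (1/2 - numax))"
definition "rateB k = (lam ^ k) powr (- numin)"

lemma exploration_eq: "1 \<le> k \<Longrightarrow> al \<xi> m (k - 1) = expl_scale c * rlen \<xi> m k powr (- decay c m)"
 by (simp add: exploration_def)

lemma control_affine:
 assumes g: "good C \<xi> L k" and t: "t \<in> iv \<xi> m k"
 shows "control r m t \<xi> = - (fst (policy r m (k - 1) \<xi>) *v x t \<xi>) + snd (policy r m (k - 1) \<xi>) + al \<xi> m (k - 1) *\<^sub>R v m t \<xi>"
proof -
 have "ep \<xi> m t = k - 1" using t goodD(3)[OF g] by (intro epoch_facts(13)[OF goodD(1)[OF g]]) auto
 then show ?thesis by (simp add: control_eq[OF goodD(1)[OF g]] feedback_def)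
qed

lemma control_support:
 assumes \<xi>: "\<xi> \<in> space M" and i: "i \<notin> ctrl G m" shows "control r m t \<xi> $ i = 0"
proof -
 have "supp_in (ctrl G m) (v m t \<xi>)" using noise \<xi> by (auto simp: learning_noise_def)
 then have "v m t \<xi> $ i = 0" using i by (simp add: supp_in_def)
 moreover have "snd (policy r m (ep \<xi> m t) \<xi>) $ i = 0" "fst (policy r m (ep \<xi> m t) \<xi>) $ i = 0"
  using policy_bounds(3,4)[OF \<xi>, of m "ep \<xi> m t"] i by (auto simp: supp_in_def)
 ultimately show ?thesis by (simp add: control_eq[OF \<xi>] feedback_def matrix_vector_mul_component)
qed

text \<open>Only \<open>rateA\<close> occurs: the exploration noise of the others is uncorrelated
  with the regressor and acts like additional state noise, so its magnitude does not bias the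
  parameter. It will reappear in the covariance estimate.\<close>

lemma param_error:
 obtains K cs where "0 \<le> K" "0 < cs" "\<And>\<xi> L k l. good C \<xi> L k \<Longrightarrow> real k + L \<le> cs * sqrt (rlen \<xi> m k) \<Longrightarrow>
   norm (column l (fst (\<theta>hat \<xi> m k)) - column l (true_param G m (profile_at \<xi> (k - 1)))) \<le> K * rateA k L"
proof -
 obtain cg cs where cg: "0 < cg" "0 < cs"
  "\<And>\<xi> L k m a b q. good C \<xi> L k \<Longrightarrow> real k + L \<le> cs * sqrt (rlen \<xi> m k) \<Longrightarrow> supp_in (ctrl G m) q \<Longrightarrow>
    cg * rlen \<xi> m k * (a^2 + (norm b)^2 + (norm q)^2) \<le> (\<Sum>t\<in>iv \<xi> m k. (a + b \<bullet> x t \<xi> + q \<bullet> v m t \<xi>)^2)"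
  using gram_bound[of C] by blast
 obtain B where B: "0 \<le> B"
  "\<And>\<xi> L k m l. good C \<xi> L k \<Longrightarrow> \<bar>\<Sum>t\<in>iv \<xi> m k. resid \<xi> m k t $ l\<bar> \<le> B * sqrt ((real k + L) * rlen \<xi> m k)"
  "\<And>\<xi> L k m i l. good C \<xi> L k \<Longrightarrow> \<bar>\<Sum>t\<in>iv \<xi> m k. x t \<xi> $ i * resid \<xi> m k t $ l\<bar> \<le> B * sqrt ((real k + L) * rlen \<xi> m k)"
  "\<And>\<xi> L k m i l. good C \<xi> L k \<Longrightarrow> \<bar>\<Sum>t\<in>iv \<xi> m k. v m t \<xi> $ i * resid \<xi> m k t $ l\<bar> \<le> B * sqrt ((real k + L) * rlen \<xi> m k)"
  using residual_sums[of C] by blast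
 obtain T where T: "0 \<le> T" "\<And>p m l. p \<in> profiles G \<Longrightarrow> norm (column l (true_param G m p)) \<le> T" using true_param_column_bound by blast
 have qa: "0 < 1/2 - numax" using decay_bounds(5) by simp
 obtain Kp where Kp: "0 \<le> Kp" "\<And>C \<xi> L k m. good C \<xi> L k \<Longrightarrow> rlen \<xi> m k powr (- (1/2 - numax)) \<le> Kp * (lam ^ k) powr (- (1/2 - numax))"
  using length_powr[OF qa] by blast
 have ex: "0 < expl_scale c" using c by (simp add: valid_schedule_def)
 have \<beta>: "0 < \<beta> m" using run by (simp add: runs_algorithm_def)
 have rd: "0 < radf G m" "0 < radF G m" using G by (auto simp: valid_game_def)
 define C1 where "C1 = 2 * expl_scale c + 1 + radF G m + radf G m"
 define D where "D = 1 + real CARD('n) + real CARD('d)"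
 have C10: "0 \<le> C1" using ex rd by (simp add: C1_def)
 define K where "K = (C1 * D * B / (expl_scale c * cg) + C1 * (\<beta> m * T * C1) / ((expl_scale c)^2 * cg)) * Kp"
 define \<nu> where "\<nu> = decay c m"
 have \<nu>: "0 < \<nu>" "\<nu> \<le> numax" "\<nu> < 1/2" using c decay_bounds(2)[of m] by (auto simp: valid_schedule_def \<nu>_def)
 show thesis
 proof (rule that[OF _ cg(2), of K])
  have "0 \<le> D" by (simp add: D_def)
  then show "0 \<le> K" unfolding K_def
   by (intro mult_nonneg_nonneg add_nonneg_nonneg divide_nonneg_nonneg zero_le_power C10 B(1) T(1) Kp(1) less_imp_le[OF ex] less_imp_le[OF cg(1)] less_imp_le[OF \<beta>])
  fix \<xi> L k l assume g: "good C \<xi> L k" and small: "real k + L \<le> cs * sqrt (rlen \<xi> m k)"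
  note \<xi> = goodD(1)[OF g]
  let ?u = "real k + L" and ?I = "iv \<xi> m k" and ?\<Theta> = "true_param G m (profile_at \<xi> (k - 1))" and ?a = "al \<xi> m (k - 1)"
  define n where "n = rlen \<xi> m k"
  have n1: "1 \<le> n" using good_interval(5)[OF g, of m] by (simp add: n_def)
  have u1: "1 \<le> ?u" by (rule goodD(4)[OF g])
  have a: "?a = expl_scale c * n powr (- \<nu>)" unfolding n_def \<nu>_def by (rule exploration_eq[OF goodD(3)[OF g]])
  have a0: "0 < ?a" unfolding a using ex n1 by simp
  have Th: "\<theta>hat \<xi> m k = (ls_param (\<beta> m) (reg \<xi> m) (\<lambda>t. x t \<xi>) ?I, ls_cov (\<beta> m) (reg \<xi> m) (\<lambda>t. x t \<xi>) ?I)"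
   by (simp add: \<theta>hat_def)
  have supB: "?\<Theta> $ Inr (Inr i) = 0" if "i \<notin> ctrl G m" for i
   using true_model[OF G, of m "profile_at \<xi> (k - 1)"] that by (auto simp: models_def supp_in_def)
  have "norm (column l (ls_param (\<beta> m) (reg \<xi> m) (\<lambda>t. x t \<xi>) ?I) - column l ?\<Theta>)
    \<le> C1 / (?a * (cg * n)) * (D * (B * sqrt (?u * n)) + \<beta> m * T * C1 / ?a)"
  proof (rule ls_param_error[where u="\<lambda>t. control r m t \<xi>" and v="\<lambda>t. v m t \<xi>" and F="fst (policy r m (k - 1) \<xi>)"
    and f="snd (policy r m (k - 1) \<xi>)" and r="resid \<xi> m k" and \<kappa>="radF G m" and \<kappa>'="radf G m" and J="ctrl G m" and Amax="expl_scale c", OF \<beta> a0])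
   show "?a \<le> expl_scale c" by (rule epoch_facts(10)[OF \<xi>])
   show "control r m t \<xi> = - (fst (policy r m (k - 1) \<xi>) *v x t \<xi>) + snd (policy r m (k - 1) \<xi>) + ?a *\<^sub>R v m t \<xi>" if "t \<in> ?I" for t
    by (rule control_affine[OF g that])
   show "x (Suc t) \<xi> = transpose ?\<Theta> *v reg \<xi> m t + resid \<xi> m k t" for t by (rule residual_eq[OF \<xi>])
   show "spec_norm (fst (policy r m (k - 1) \<xi>)) \<le> radF G m" "norm (snd (policy r m (k - 1) \<xi>)) \<le> radf G m"
    by (rule policy_bounds[OF \<xi>])+
   show "norm (column l ?\<Theta>) \<le> T" for l by (rule T(2)[OF profile_at_profiles[OF \<xi>]])
   show "?\<Theta> $ Inr (Inr i) = 0" if "i \<notin> ctrl G m" for i by (rule supB[OF that])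
   show "control r m t \<xi> $ i = 0" if "i \<notin> ctrl G m" for t i by (rule control_support[OF \<xi> that])
   show "0 < cg * n" using cg n1 by simp
   show "cg * n * (a^2 + (norm b)^2 + (norm q)^2) \<le> (\<Sum>t\<in>?I. (a + b \<bullet> x t \<xi> + q \<bullet> v m t \<xi>)^2)" if "supp_in (ctrl G m) q" for a b q
    unfolding n_def by (rule cg(3)[OF g small that])
   show "\<bar>\<Sum>t\<in>?I. resid \<xi> m k t $ l\<bar> \<le> B * sqrt (?u * n)" for l unfolding n_def by (rule B(2)[OF g])
   show "\<bar>\<Sum>t\<in>?I. x t \<xi> $ i * resid \<xi> m k t $ l\<bar> \<le> B * sqrt (?u * n)" for i l unfolding n_def by (rule B(3)[OF g])
   show "\<bar>\<Sum>t\<in>?I. v m t \<xi> $ i * resid \<xi> m k t $ l\<bar> \<le> B * sqrt (?u * n)" for i l unfolding n_def by (rule B(4)[OF g])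
   show "C1 = 2 * expl_scale c + 1 + radF G m + radf G m" by (rule C1_def)
   show "1 + real CARD('n) + real CARD('d) \<le> D" by (simp add: D_def)
  qed simp_all
  \<comment> \<open>The statistical term is of order \<open>n powr (\<nu> - 1/2)\<close> and the
    regularization bias of order \<open>n powr (2 * \<nu> - 1)\<close>, the square of the former
    apart from \<open>sqrt ?u\<close>; the bias is therefore dominated.\<close>
  also have "\<dots> = C1 * D * B / (expl_scale c * cg) * (sqrt ?u * (sqrt n / (n * n powr (- \<nu>)))) + C1 * (\<beta> m * T * C1) / ((expl_scale c)^2 * cg) * (1 / (n * (n powr (- \<nu>))^2))"
  proof -
   have gen: "C1 / (e * q * (h * y)) * (D * (B * (s * z)) + b * C1 / (e * q)) = C1 * D * B / (e * h) * (s * (z / (y * q))) + C1 * (b * C1) / (e^2 * h) * (1 / (y * q^2))"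
    if "0 < e" "0 < q" "0 < h" "0 < y" for e q h y s z b :: real using that by (simp add: field_simps power2_eq_square)
   have "0 < n powr (- \<nu>)" using n1 by simp
   then show ?thesis unfolding a real_sqrt_mult using gen[OF ex _ cg(1), of "n powr (- \<nu>)" n] n1 by simp
  qed
  also have "sqrt n / (n * n powr (- \<nu>)) = n powr (\<nu> - 1/2)"
  proof -
   have "n powr (\<nu> - 1/2) * (n powr 1 * n powr (- \<nu>)) = n powr (1/2)" by (simp only: powr_add[symmetric]) simp
   then show ?thesis using n1 by (simp add: powr_half_sqrt field_simps)
  qed
  also have "1 / (n * (n powr (- \<nu>))^2) = n powr (2 * \<nu> - 1)"
  proof -
   have "n powr (2 * \<nu> - 1) * (n powr 1 * (n powr (- \<nu>) * n powr (- \<nu>))) = n powr 0" by (simp only: powr_add[symmetric]) simp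
   then show ?thesis using n1 by (simp add: field_simps power2_eq_square)
  qed
  also have "C1 * D * B / (expl_scale c * cg) * (sqrt ?u * n powr (\<nu> - 1/2)) + C1 * (\<beta> m * T * C1) / ((expl_scale c)^2 * cg) * n powr (2 * \<nu> - 1)
   \<le> C1 * D * B / (expl_scale c * cg) * (sqrt ?u * n powr (- (1/2 - numax))) + C1 * (\<beta> m * T * C1) / ((expl_scale c)^2 * cg) * (sqrt ?u * n powr (- (1/2 - numax)))"
  proof (intro add_mono mult_left_mono)
   show "n powr (\<nu> - 1/2) \<le> n powr (- (1/2 - numax))" using \<nu> n1 by (intro powr_mono) auto
   have "n powr (2 * \<nu> - 1) \<le> 1 * n powr (- (1/2 - numax))" using \<nu> n1 by (simp add: powr_mono)
   also have "\<dots> \<le> sqrt ?u * n powr (- (1/2 - numax))" using u1 by (intro mult_right_mono) auto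
   finally show "n powr (2 * \<nu> - 1) \<le> sqrt ?u * n powr (- (1/2 - numax))" .
  qed (use C10 B T ex cg \<beta> u1 in \<open>auto simp: D_def\<close>)
  also have "\<dots> = (C1 * D * B / (expl_scale c * cg) + C1 * (\<beta> m * T * C1) / ((expl_scale c)^2 * cg)) * (sqrt ?u * n powr (- (1/2 - numax)))"
   by (simp only: distrib_right)
  also have "\<dots> \<le> (C1 * D * B / (expl_scale c * cg) + C1 * (\<beta> m * T * C1) / ((expl_scale c)^2 * cg)) * (sqrt ?u * (Kp * (lam ^ k) powr (- (1/2 - numax))))"
  proof (rule mult_left_mono)
   show "sqrt ?u * n powr (- (1/2 - numax)) \<le> sqrt ?u * (Kp * (lam ^ k) powr (- (1/2 - numax)))"
    unfolding n_def by (rule mult_left_mono[OF Kp(2)[OF g]]) (use u1 in simp)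
   have "0 \<le> D" by (simp add: D_def)
   then show "0 \<le> C1 * D * B / (expl_scale c * cg) + C1 * (\<beta> m * T * C1) / ((expl_scale c)^2 * cg)"
    by (intro mult_nonneg_nonneg add_nonneg_nonneg divide_nonneg_nonneg zero_le_power C10 B(1) T(1) less_imp_le[OF ex] less_imp_le[OF cg(1)] less_imp_le[OF \<beta>])
  qed
  also have "\<dots> = K * rateA k L" by (simp add: K_def rateA_def mult_ac)
  finally show "norm (column l (fst (\<theta>hat \<xi> m k)) - column l ?\<Theta>) \<le> K * rateA k L" unfolding Th by simp
 qed
qed

lemma rate_facts:
 assumes "good C \<xi> L k"
 shows "0 \<le> rateA k L" "0 \<le> rateB k" "rateA k L \<le> 1" "rateB k \<le> 1"
proof -
 note g = goodD[OF assms]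
 show 0: "0 \<le> rateA k L" "0 \<le> rateB k" using g by (auto simp: rateA_def rateB_def)
 have "sqrt (real k + L) \<le> real k + L" using g(4) real_sqrt_le_mono[of "real k + L" "(real k + L)^2"] by (simp add: self_le_power power2_eq_square)
 also have "\<dots> \<le> (lam ^ k) powr \<eta>" using g(5,6) by linarith
 also have "\<dots> \<le> (lam ^ k) powr (1/2 - numax)" using decay_bounds(8) g(7) by (intro powr_mono) auto
 finally have "rateA k L \<le> (lam ^ k) powr (1/2 - numax) * (lam ^ k) powr (- (1/2 - numax))"
  unfolding rateA_def by (intro mult_right_mono) auto
 also have "\<dots> = 1" using lam by (simp add: powr_minus field_simps)
 finally show "rateA k L \<le> 1" .
 have "(lam ^ k) powr (- numin) \<le> (lam ^ k) powr 0" using g(7) decay_bounds(3) by (intro powr_mono) auto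
 then show "rateB k \<le> 1" unfolding rateB_def using lam by simp
qed

text \<open>One of the two factors \<open>sqrt (k + L)\<close> is exchanged for
  \<open>(lam ^ k) powr numin\<close>. The exponent \<open>numin - 1/2\<close> obtained in this way
  is at most that of \<open>rateA\<close>, because \<open>numin \<le> numax\<close>.\<close>

lemma log_over_root_length:
 obtains K where "0 \<le> K" "\<And>C \<xi> L k m. good C \<xi> L k \<Longrightarrow> (real k + L) / sqrt (rlen \<xi> m k) \<le> K * rateA k L"
proof -
 have half: "(0::real) < 1/2" by simp
 show thesis
 proof (rule length_powr[OF half])
 fix K assume K: "0 \<le> K" "\<And>C \<xi> L k m. good C \<xi> L k \<Longrightarrow> rlen \<xi> m k powr (- (1/2)) \<le> K * (lam ^ k) powr (- (1/2))"
 show thesis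
 proof (rule that[OF K(1)])
  fix C \<xi> L k m assume g: "good C \<xi> L k"
  note g' = goodD[OF g]
  have n1: "1 \<le> rlen \<xi> m k" by (rule good_interval(5)[OF g])
  have "(real k + L) / sqrt (rlen \<xi> m k) = (real k + L) * rlen \<xi> m k powr (- (1/2))"
   by (simp only: powr_minus[of _ "1/2"] powr_half_sqrt[OF of_nat_0_le_iff] divide_inverse[of "real k + L"])
  also have "\<dots> \<le> (real k + L) * (K * (lam ^ k) powr (- (1/2)))" using K(2)[OF g, of m] g'(4) by (intro mult_left_mono) auto
  also have "real k + L = sqrt (real k + L) * sqrt (real k + L)" using g'(4) by simp
  also have "sqrt (real k + L) * sqrt (real k + L) * (K * (lam ^ k) powr (- (1/2))) \<le> sqrt (real k + L) * (lam ^ k) powr numin * (K * (lam ^ k) powr (- (1/2)))"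
   using g'(4,9) K(1) by (intro mult_right_mono mult_left_mono) auto
  also have "\<dots> = K * (sqrt (real k + L) * ((lam ^ k) powr numin * (lam ^ k) powr (- (1/2))))" by (simp only: mult_ac)
  also have "(lam ^ k) powr numin * (lam ^ k) powr (- (1/2)) = (lam ^ k) powr (numin - 1/2)" by (simp add: powr_add[symmetric])
  also have "K * (sqrt (real k + L) * (lam ^ k) powr (numin - 1/2)) \<le> K * (sqrt (real k + L) * (lam ^ k) powr (- (1/2 - numax)))"
   using K(1) g'(4,7) decay_bounds(4) by (intro mult_left_mono powr_mono) auto
  finally show "(real k + L) / sqrt (rlen \<xi> m k) \<le> K * rateA k L" using g'(4) by (simp add: rateA_def)
 qed
 qed
qed

text \<open>Two indices are needed: the scale of epoch \<open>k - 1\<close> was in force while the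
  data were collected, and the scale of epoch \<open>k\<close> enters the perceived problem that is
  solved with them.\<close>

lemma exploration_rate:
 obtains K where "0 \<le> K" "\<And>C \<xi> L k m. good C \<xi> L k \<Longrightarrow> al \<xi> m (k - 1) \<le> K * rateB k"
  "\<And>C \<xi> L k m. good C \<xi> L k \<Longrightarrow> al \<xi> m k \<le> K * rateB k"
proof -
 have s: "0 < scale_len c" and ex: "0 < expl_scale c" using c by (auto simp: valid_schedule_def)
 define a where "a = scale_len c / 2"
 have a: "0 < a" using s by (simp add: a_def)
 have main: "expl_scale c * real (len \<xi> m i) powr (- decay c m) \<le> expl_scale c * a powr (- numin) * rateB k"
  if \<xi>: "\<xi> \<in> space M" and i: "1 \<le> i" "X0 \<le> lam ^ i" "k \<le> i" for \<xi> m i k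
 proof -
  have l: "a * lam ^ i \<le> real (len \<xi> m i)" "1 \<le> real (len \<xi> m i)" using large_epoch(3,4)[OF \<xi> i(1,2), of m] by (auto simp: a_def)
  have "lam ^ k \<le> lam ^ i" using lam i(3) by (intro power_increasing) auto
  then have l2: "a * lam ^ k \<le> real (len \<xi> m i)" using l(1) a mult_left_mono[of "lam ^ k" "lam ^ i" a] by linarith
  have "real (len \<xi> m i) powr (- decay c m) \<le> real (len \<xi> m i) powr (- numin)" using l(2) decay_bounds(1)[of m] by (intro powr_mono) auto
  also have "\<dots> \<le> (a * lam ^ k) powr (- numin)" using l2 a lam decay_bounds(3) by (intro powr_mono2') auto
  also have "\<dots> = a powr (- numin) * rateB k" using a lam by (simp add: powr_mult rateB_def)
  finally show ?thesis using ex by (simp add: mult.assoc mult_left_mono)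
 qed
 show thesis
 proof (rule that[of "expl_scale c * a powr (- numin)"])
  show "0 \<le> expl_scale c * a powr (- numin)" using ex by simp
  fix C \<xi> L k m assume g: "good C \<xi> L k"
  then have X: "X0 \<le> lam ^ k" by (simp add: good_def)
  show "al \<xi> m (k - 1) \<le> expl_scale c * a powr (- numin) * rateB k"
   unfolding exploration_eq[OF goodD(3)[OF g]] by (rule main[OF goodD(1,3)[OF g] X order_refl])
  have "lam ^ k \<le> lam ^ Suc k" using lam by simp
  then have X': "X0 \<le> lam ^ Suc k" using X by linarith
  have "al \<xi> m k = expl_scale c * real (len \<xi> m (Suc k)) powr (- decay c m)" by (simp add: exploration_def)
  also have "\<dots> \<le> expl_scale c * a powr (- numin) * rateB k" by (rule main[OF goodD(1)[OF g] _ X']) auto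
  finally show "al \<xi> m k \<le> expl_scale c * a powr (- numin) * rateB k" .
 qed
qed

lemma others_energy:
 obtains K where "0 \<le> K" "\<And>\<xi> L k m. good C \<xi> L k \<Longrightarrow> (\<Sum>t\<in>iv \<xi> m k. (norm (others_noise \<xi> m k t))^2) \<le> K * (rateB k)^2 * rlen \<xi> m k"
proof -
 obtain Kn where Kn: "0 \<le> Kn" "\<And>\<xi> L k m. good C \<xi> L k \<Longrightarrow> (\<Sum>t\<in>iv \<xi> m k. (norm (w t \<xi>))^2) \<le> Kn * rlen \<xi> m k"
  "\<And>\<xi> L k m j. good C \<xi> L k \<Longrightarrow> (\<Sum>t\<in>iv \<xi> m k. (norm (v j t \<xi>))^2) \<le> Kn * rlen \<xi> m k"
  "\<And>\<xi> L k m. good C \<xi> L k \<Longrightarrow> (\<Sum>t\<in>iv \<xi> m k. (norm (w (t - 1) \<xi>))^2) \<le> Kn * rlen \<xi> m k"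
  using noise_energy[of C] by blast
 obtain Ka where Ka: "0 \<le> Ka" "\<And>C \<xi> L k m. good C \<xi> L k \<Longrightarrow> al \<xi> m (k - 1) \<le> Ka * rateB k"
  "\<And>C \<xi> L k m. good C \<xi> L k \<Longrightarrow> al \<xi> m k \<le> Ka * rateB k" using exploration_rate by blast
 let ?b = "\<lambda>j. spec_norm (Bmat G j)" and ?M = "real CARD('m)"
 define H where "H = ?M * (\<Sum>j\<in>UNIV. (?b j)^2 * Kn)"
 have H0: "0 \<le> H" unfolding H_def using Kn by (auto intro!: mult_nonneg_nonneg sum_nonneg)
 show thesis
 proof (rule that[of "Ka^2 * H"])
  show "0 \<le> Ka^2 * H" using H0 by simp
  fix \<xi> L k m assume g: "good C \<xi> L k"
  define A where "A = Ka * rateB k"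
  have A0: "0 \<le> A" using Ka(1) rate_facts(2)[OF g] by (simp add: A_def)
  have pt: "(norm (others_noise \<xi> m k t))^2 \<le> A^2 * (?M * (\<Sum>j\<in>UNIV. (?b j)^2 * (norm (v j t \<xi>))^2))" for t
  proof -
   have "norm (others_noise \<xi> m k t) \<le> (\<Sum>j\<in>UNIV - {m}. A * (?b j * norm (v j t \<xi>)))" unfolding others_noise_def
   proof (rule sum_norm_le)
    fix j
    show "norm (al \<xi> j (k - 1) *\<^sub>R (Bmat G j *v v j t \<xi>)) \<le> A * (?b j * norm (v j t \<xi>))"
     unfolding norm_scaleR using epoch_facts(9)[OF goodD(1)[OF g], of j "k - 1"] Ka(2)[OF g, of j] A0
     by (intro mult_mono norm_matrix_vector_le) (auto simp: A_def)
   qed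
   also have "\<dots> \<le> (\<Sum>j\<in>UNIV. A * (?b j * norm (v j t \<xi>)))" using A0 by (intro sum_mono2) auto
   also have "\<dots> = A * (\<Sum>j\<in>UNIV. ?b j * norm (v j t \<xi>))" by (simp only: sum_distrib_left)
   finally have "(norm (others_noise \<xi> m k t))^2 \<le> (A * (\<Sum>j\<in>UNIV. ?b j * norm (v j t \<xi>)))^2" by (intro power_mono) auto
   also have "\<dots> = A^2 * (\<Sum>j\<in>UNIV. ?b j * norm (v j t \<xi>))^2" by (rule power_mult_distrib)
   also have "\<dots> \<le> A^2 * (?M * (\<Sum>j\<in>UNIV. (?b j)^2 * (norm (v j t \<xi>))^2))"
    using sum_squared_le_sum_of_squares[of "\<lambda>j. ?b j * norm (v j t \<xi>)" UNIV]
    by (intro mult_left_mono) (auto simp: power_mult_distrib mult.commute)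
   finally show ?thesis .
  qed
  have "(\<Sum>t\<in>iv \<xi> m k. (norm (others_noise \<xi> m k t))^2) \<le> (\<Sum>t\<in>iv \<xi> m k. A^2 * (?M * (\<Sum>j\<in>UNIV. (?b j)^2 * (norm (v j t \<xi>))^2)))"
   by (intro sum_mono pt)
  also have "\<dots> = A^2 * (?M * (\<Sum>j\<in>UNIV. (?b j)^2 * (\<Sum>t\<in>iv \<xi> m k. (norm (v j t \<xi>))^2)))"
  proof -
   have "(\<Sum>t\<in>iv \<xi> m k. \<Sum>j\<in>UNIV. (?b j)^2 * (norm (v j t \<xi>))^2) = (\<Sum>j\<in>UNIV. \<Sum>t\<in>iv \<xi> m k. (?b j)^2 * (norm (v j t \<xi>))^2)" by (rule sum.swap)
   then show ?thesis by (simp only: sum_distrib_left[symmetric])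
  qed
  also have "\<dots> \<le> A^2 * (?M * (\<Sum>j\<in>UNIV. (?b j)^2 * (Kn * rlen \<xi> m k)))"
   by (intro mult_left_mono sum_mono Kn(3)[OF g]) auto
  also have "\<dots> = Ka^2 * H * (rateB k)^2 * rlen \<xi> m k"
   by (simp add: A_def H_def power_mult_distrib sum_distrib_right sum_distrib_left mult_ac)
  finally show "(\<Sum>t\<in>iv \<xi> m k. (norm (others_noise \<xi> m k t))^2) \<le> Ka^2 * H * (rateB k)^2 * rlen \<xi> m k" .
 qed
qed

text \<open>Of order \<open>k + L\<close> nonzero terms with squares of order \<open>k + L\<close>
  give an energy of order \<open>(k + L)^2\<close>, which is \<open>((k + L) / sqrt n)^2 * n\<close>
  and thus of order \<open>rateA\<close> squared per step.\<close>

lemma mismatch_energy: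
 obtains K where "0 \<le> K" "\<And>\<xi> L k m. good C \<xi> L k \<Longrightarrow> (\<Sum>t\<in>iv \<xi> m k. (norm (mismatch \<xi> m k t))^2) \<le> K * (rateA k L)^2 * rlen \<xi> m k"
proof -
 obtain Kd where Kd: "0 \<le> Kd" "\<And>\<xi> L k m t. good C \<xi> L k \<Longrightarrow> t \<in> iv \<xi> m k \<Longrightarrow> norm (mismatch \<xi> m k t) \<le> Kd * sqrt (real k + L)"
  "\<And>\<xi> L k m. good C \<xi> L k \<Longrightarrow> real (card {t \<in> iv \<xi> m k. mismatch \<xi> m k t \<noteq> 0}) \<le> Kd * (real k + L)"
  using mismatch_bounds[of C] by blast
 obtain Kh where Kh: "0 \<le> Kh" "\<And>C \<xi> L k m. good C \<xi> L k \<Longrightarrow> (real k + L) / sqrt (rlen \<xi> m k) \<le> Kh * rateA k L"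
  using log_over_root_length by blast
 show thesis
 proof (rule that[of "Kd ^ 3 * Kh^2"])
  show "0 \<le> Kd ^ 3 * Kh^2" using Kd by simp
  fix \<xi> L k m assume g: "good C \<xi> L k"
  let ?n = "rlen \<xi> m k" and ?u = "real k + L"
  have u: "0 \<le> ?u" using goodD(4)[OF g] by simp
  have n1: "1 \<le> ?n" by (rule good_interval(5)[OF g])
  have "\<bar>\<Sum>t\<in>iv \<xi> m k. norm (mismatch \<xi> m k t) * norm (mismatch \<xi> m k t)\<bar> \<le> (Kd * ?u) * ((Kd * sqrt ?u) * (Kd * sqrt ?u))"
   by (rule mismatch_sum[where e="mismatch \<xi> m k"]) (use Kd u g in auto)
  then have "(\<Sum>t\<in>iv \<xi> m k. (norm (mismatch \<xi> m k t))^2) \<le> (Kd * ?u) * ((Kd * sqrt ?u) * (Kd * sqrt ?u))"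
   by (simp add: power2_eq_square)
  also have "\<dots> = Kd ^ 3 * (?u * (sqrt ?u * sqrt ?u))" by (simp only: power3_eq_cube mult_ac)
  also have "\<dots> = Kd ^ 3 * (?u / sqrt ?n)^2 * ?n" using u n1 by (simp add: power_divide power2_eq_square)
  also have "\<dots> \<le> Kd ^ 3 * (Kh * rateA k L)^2 * ?n"
   using Kh(2)[OF g, of m] u Kd(1) by (intro mult_right_mono mult_left_mono power_mono) auto
  finally show "(\<Sum>t\<in>iv \<xi> m k. (norm (mismatch \<xi> m k t))^2) \<le> Kd ^ 3 * Kh^2 * (rateA k L)^2 * ?n"
   by (simp add: power_mult_distrib mult.assoc)
 qed
qed

lemma regressor_energy:
 obtains K where "0 \<le> K" "\<And>\<xi> L k m. good C \<xi> L k \<Longrightarrow> (\<Sum>t\<in>iv \<xi> m k. (norm (reg \<xi> m t))^2) \<le> K * rlen \<xi> m k"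
proof -
 obtain Kn where Kn: "0 \<le> Kn" "\<And>\<xi> L k m. good C \<xi> L k \<Longrightarrow> (\<Sum>t\<in>iv \<xi> m k. (norm (w t \<xi>))^2) \<le> Kn * rlen \<xi> m k"
  "\<And>\<xi> L k m j. good C \<xi> L k \<Longrightarrow> (\<Sum>t\<in>iv \<xi> m k. (norm (v j t \<xi>))^2) \<le> Kn * rlen \<xi> m k"
  "\<And>\<xi> L k m. good C \<xi> L k \<Longrightarrow> (\<Sum>t\<in>iv \<xi> m k. (norm (w (t - 1) \<xi>))^2) \<le> Kn * rlen \<xi> m k"
  using noise_energy[of C] by blast
 obtain Kx where Kx: "0 \<le> Kx" "\<And>\<xi> L k m. good C \<xi> L k \<Longrightarrow> (\<Sum>t\<in>iv \<xi> m k. (norm (x t \<xi>))^2) \<le> Kx * rlen \<xi> m k"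
  "\<And>\<xi> L k m. good C \<xi> L k \<Longrightarrow> (\<Sum>t\<in>iv \<xi> m k. (norm (x t \<xi> - w (t - 1) \<xi>))^2) \<le> Kx * rlen \<xi> m k"
  using state_energy[of C] by blast
 obtain Kc where Kc: "0 \<le> Kc" "\<And>\<xi> m t. \<xi> \<in> space M \<Longrightarrow> norm (control r m t \<xi>) \<le> Kc * (1 + norm (x t \<xi>) + norm (v m t \<xi>))"
  "\<And>\<xi> m t k. \<xi> \<in> space M \<Longrightarrow> norm (feedback (policy r m k \<xi>) (x t \<xi>)) \<le> Kc * (1 + norm (x t \<xi>))"
  using control_bound by blast
 define K where "K = (1 + 3 * Kc^2) * (1 + Kx + Kn)"
 show thesis
 proof (rule that[of K])
  show "0 \<le> K" using Kx Kn by (simp add: K_def)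
  fix \<xi> L k m assume g: "good C \<xi> L k"
  let ?n = "rlen \<xi> m k"
  have pt: "(norm (reg \<xi> m t))^2 \<le> (1 + 3 * Kc^2) * (1 + (norm (x t \<xi>))^2 + (norm (v m t \<xi>))^2)" for t
  proof -
   have "(norm (control r m t \<xi>))^2 \<le> (Kc * (1 + norm (x t \<xi>) + norm (v m t \<xi>)))^2"
    using Kc(2)[OF goodD(1)[OF g], of m t] by (intro power_mono) auto
   also have "\<dots> = Kc^2 * (1 + norm (x t \<xi>) + norm (v m t \<xi>))^2" by (rule power_mult_distrib)
   also have "\<dots> \<le> Kc^2 * (3 * (1 + (norm (x t \<xi>))^2 + (norm (v m t \<xi>))^2))"
   proof (rule mult_left_mono)
    have "(1 + p + q)^2 \<le> 3 * (1 + p^2 + q^2)" for p q :: real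
     using sum_squares_bound[of 1 p] sum_squares_bound[of 1 q] sum_squares_bound[of p q] by (simp add: power2_eq_square algebra_simps)
    then show "(1 + norm (x t \<xi>) + norm (v m t \<xi>))^2 \<le> 3 * (1 + (norm (x t \<xi>))^2 + (norm (v m t \<xi>))^2)" .
   qed simp
   finally have a: "(norm (control r m t \<xi>))^2 \<le> 3 * Kc^2 * (1 + (norm (x t \<xi>))^2 + (norm (v m t \<xi>))^2)" by (simp only: mult_ac)
   show ?thesis unfolding norm_regressor distrib_right[of 1] mult_1_left using a zero_le_power2[of "norm (v m t \<xi>)"] by linarith
  qed
  have "(\<Sum>t\<in>iv \<xi> m k. (norm (reg \<xi> m t))^2) \<le> (\<Sum>t\<in>iv \<xi> m k. (1 + 3 * Kc^2) * (1 + (norm (x t \<xi>))^2 + (norm (v m t \<xi>))^2))"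
   by (intro sum_mono pt)
  also have "\<dots> = (1 + 3 * Kc^2) * (?n + (\<Sum>t\<in>iv \<xi> m k. (norm (x t \<xi>))^2) + (\<Sum>t\<in>iv \<xi> m k. (norm (v m t \<xi>))^2))"
   unfolding sum_distrib_left[symmetric] sum.distrib using good_interval(4)[OF g, of m] by simp
  also have "\<dots> \<le> (1 + 3 * Kc^2) * (?n + Kx * ?n + Kn * ?n)"
   by (intro mult_left_mono add_mono order_refl Kx(2)[OF g] Kn(3)[OF g]) simp
  also have "\<dots> = K * ?n" by (simp add: K_def algebra_simps)
  finally show "(\<Sum>t\<in>iv \<xi> m k. (norm (reg \<xi> m t))^2) \<le> K * ?n" .
 qed
qed

text \<open>The residuals of the estimated model differ from the state noise by the exploration of
  the others, by misaligned steps and by the parameter error. Their energies per step are of the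
  orders \<open>rateB\<close> squared, \<open>rateA\<close> squared and again \<open>rateA\<close>
  squared.\<close>

lemma cov_error:
 obtains K cs where "0 \<le> K" "0 < cs" "\<And>\<xi> L k i l. good C \<xi> L k \<Longrightarrow> real k + L \<le> cs * sqrt (rlen \<xi> m k) \<Longrightarrow>
   \<bar>(snd (\<theta>hat \<xi> m k) - noise_cov G) $ i $ l\<bar> \<le> K * (rateA k L + rateB k)"
proof -
 obtain Ke cs where Ke: "0 \<le> Ke" "0 < cs" "\<And>\<xi> L k l. good C \<xi> L k \<Longrightarrow> real k + L \<le> cs * sqrt (rlen \<xi> m k) \<Longrightarrow>
   norm (column l (fst (\<theta>hat \<xi> m k)) - column l (true_param G m (profile_at \<xi> (k - 1)))) \<le> Ke * rateA k L"
  using param_error[of C m] by blast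
 obtain Kn where Kn: "0 \<le> Kn" "\<And>\<xi> L k m. good C \<xi> L k \<Longrightarrow> (\<Sum>t\<in>iv \<xi> m k. (norm (w t \<xi>))^2) \<le> Kn * rlen \<xi> m k"
  "\<And>\<xi> L k m j. good C \<xi> L k \<Longrightarrow> (\<Sum>t\<in>iv \<xi> m k. (norm (v j t \<xi>))^2) \<le> Kn * rlen \<xi> m k"
  "\<And>\<xi> L k m. good C \<xi> L k \<Longrightarrow> (\<Sum>t\<in>iv \<xi> m k. (norm (w (t - 1) \<xi>))^2) \<le> Kn * rlen \<xi> m k"
  using noise_energy[of C] by blast
 obtain Ho where Ho: "0 \<le> Ho" "\<And>\<xi> L k m. good C \<xi> L k \<Longrightarrow> (\<Sum>t\<in>iv \<xi> m k. (norm (others_noise \<xi> m k t))^2) \<le> Ho * (rateB k)^2 * rlen \<xi> m k"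
  using others_energy[of C] by blast
 obtain Hm where Hm: "0 \<le> Hm" "\<And>\<xi> L k m. good C \<xi> L k \<Longrightarrow> (\<Sum>t\<in>iv \<xi> m k. (norm (mismatch \<xi> m k t))^2) \<le> Hm * (rateA k L)^2 * rlen \<xi> m k"
  using mismatch_energy[of C] by blast
 obtain Z where Z: "0 \<le> Z" "\<And>\<xi> L k m. good C \<xi> L k \<Longrightarrow> (\<Sum>t\<in>iv \<xi> m k. (norm (reg \<xi> m t))^2) \<le> Z * rlen \<xi> m k"
  using regressor_energy[of C] by blast
 obtain Bc where Bc: "0 < Bc" "\<And>\<xi> L k m. good C \<xi> L k \<Longrightarrow> cross Bc \<xi> L k m" using cross_sums[of C] by blast
 obtain Kh where Kh: "0 \<le> Kh" "\<And>C \<xi> L k m. good C \<xi> L k \<Longrightarrow> (real k + L) / sqrt (rlen \<xi> m k) \<le> Kh * rateA k L"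
  using log_over_root_length by blast
 let ?N = "real CARD('n)"
 define H where "H = 3 * (Ho + Hm + (?N * Ke)^2 * Z)"
 define P0 where "P0 = sqrt H"
 have H0: "0 \<le> H" using Ho Hm Z by (simp add: H_def)
 have P00: "0 \<le> P0" and P02: "P0^2 = H" using H0 by (auto simp: P0_def)
 show thesis
 proof (rule that[of "Bc * Kh + 2 * sqrt Kn * P0 + 2 * H", OF _ Ke(2)])
  show "0 \<le> Bc * Kh + 2 * sqrt Kn * P0 + 2 * H" using Bc(1) Kh(1) Kn(1) P00 H0 by simp
  fix \<xi> L k i l assume g: "good C \<xi> L k" and small: "real k + L \<le> cs * sqrt (rlen \<xi> m k)"
  note \<xi> = goodD(1)[OF g]
  let ?a = "rateA k L" and ?b = "rateB k" and ?n = "rlen \<xi> m k" and ?u = "real k + L"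
  let ?I = "iv \<xi> m k" and ?Q = "true_param G m (profile_at \<xi> (k - 1))" and ?T = "fst (\<theta>hat \<xi> m k)"
  define q where "q = ?a + ?b"
  note rf = rate_facts[OF g]
  have q: "0 \<le> q" "q \<le> 2" "?a \<le> q" using rf by (auto simp: q_def)
  have n1: "1 \<le> ?n" by (rule good_interval(5)[OF g])
  have T: "?T = ls_param (\<beta> m) (reg \<xi> m) (\<lambda>t. x t \<xi>) ?I" "snd (\<theta>hat \<xi> m k) = ls_cov (\<beta> m) (reg \<xi> m) (\<lambda>t. x t \<xi>) ?I"
   by (simp_all add: \<theta>hat_def)
  define d where "d t = transpose (?T - ?Q) *v reg \<xi> m t" for t
  \<comment> \<open>Residual of the estimated model minus the state noise; \<open>d t\<close> is the
    effect of the parameter error on the prediction.\<close>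
  define \<rho> where "\<rho> t = others_noise \<xi> m k t + mismatch \<xi> m k t - d t" for t
  have d2: "(norm (d t))^2 \<le> (?N * Ke)^2 * ?a^2 * (norm (reg \<xi> m t))^2" for t
  proof -
   have "norm (d t) \<le> ?N * (Ke * ?a * norm (reg \<xi> m t))"
   proof (rule norm_le_component_bound)
    fix l
    have "(transpose A *v y) $ l = column l A \<bullet> y" for A :: "real^'n^(unit + ('n + 'd))" and y
     by (simp add: vector_matrix_mult_component)
    then have "d t $ l = column l (?T - ?Q) \<bullet> reg \<xi> m t" unfolding d_def .
    moreover have "column l (?T - ?Q) = column l ?T - column l ?Q" by (simp add: column_def vec_eq_iff)
    ultimately have "\<bar>d t $ l\<bar> \<le> norm (column l ?T - column l ?Q) * norm (reg \<xi> m t)" by (simp add: Cauchy_Schwarz_ineq2)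
    also have "\<dots> \<le> Ke * ?a * norm (reg \<xi> m t)" by (rule mult_right_mono[OF Ke(3)[OF g small] norm_ge_zero])
    finally show "\<bar>d t $ l\<bar> \<le> Ke * ?a * norm (reg \<xi> m t)" .
   qed
   then have "(norm (d t))^2 \<le> (?N * (Ke * ?a * norm (reg \<xi> m t)))^2" by (intro power_mono) auto
   then show ?thesis by (simp only: power_mult_distrib mult.assoc)
  qed
  have \<rho>2: "(norm (\<rho> t))^2 \<le> 3 * ((norm (others_noise \<xi> m k t))^2 + (norm (mismatch \<xi> m k t))^2 + (?N * Ke)^2 * ?a^2 * (norm (reg \<xi> m t))^2)" for t
  proof -
   have "norm (y + z - s) \<le> norm y + norm z + norm s" for y z s :: "real^'n" by norm
   then have "(norm (\<rho> t))^2 \<le> (norm (others_noise \<xi> m k t) + norm (mismatch \<xi> m k t) + norm (d t))^2"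
    unfolding \<rho>_def by (intro power_mono) auto
   also have "\<dots> \<le> 3 * ((norm (others_noise \<xi> m k t))^2 + (norm (mismatch \<xi> m k t))^2 + (norm (d t))^2)"
   proof -
    have "(e + p + q)^2 \<le> 3 * (e^2 + p^2 + q^2)" for e p q :: real
     using sum_squares_bound[of e p] sum_squares_bound[of e q] sum_squares_bound[of p q] by (simp add: power2_eq_square algebra_simps)
    then show ?thesis .
   qed
   also have "\<dots> \<le> 3 * ((norm (others_noise \<xi> m k t))^2 + (norm (mismatch \<xi> m k t))^2 + (?N * Ke)^2 * ?a^2 * (norm (reg \<xi> m t))^2)"
    by (intro mult_left_mono add_left_mono d2) simp
   finally show ?thesis .
  qed
  have "(\<Sum>t\<in>?I. (norm (\<rho> t))^2) \<le> (\<Sum>t\<in>?I. 3 * ((norm (others_noise \<xi> m k t))^2 + (norm (mismatch \<xi> m k t))^2 + (?N * Ke)^2 * ?a^2 * (norm (reg \<xi> m t))^2))"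
   by (intro sum_mono \<rho>2)
  also have "\<dots> = 3 * ((\<Sum>t\<in>?I. (norm (others_noise \<xi> m k t))^2) + (\<Sum>t\<in>?I. (norm (mismatch \<xi> m k t))^2) + (?N * Ke)^2 * ?a^2 * (\<Sum>t\<in>?I. (norm (reg \<xi> m t))^2))"
   by (simp only: sum_distrib_left[symmetric] sum.distrib)
  also have "\<dots> \<le> 3 * (Ho * ?b^2 * ?n + Hm * ?a^2 * ?n + (?N * Ke)^2 * ?a^2 * (Z * ?n))"
   by (intro mult_left_mono add_mono Ho(2)[OF g] Hm(2)[OF g] Z(2)[OF g]) auto
  also have "\<dots> = 3 * (Ho * ?b^2 + Hm * ?a^2 + (?N * Ke)^2 * Z * ?a^2) * ?n" by (simp add: algebra_simps)
  also have "\<dots> \<le> 3 * (Ho * q^2 + Hm * q^2 + (?N * Ke)^2 * Z * q^2) * ?n"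
   using rf Ho Hm Z by (intro mult_right_mono mult_left_mono add_mono power_mono) (auto simp: q_def)
  also have "\<dots> = (P0 * q)^2 * ?n" unfolding power_mult_distrib[of P0] P02 H_def by (simp add: algebra_simps)
  finally have \<rho>sum: "(\<Sum>t\<in>?I. (norm (\<rho> t))^2) \<le> (P0 * q)^2 * ?n" .
  have e: "x (Suc t) \<xi> - transpose ?T *v reg \<xi> m t = w t \<xi> + \<rho> t" for t
  proof -
   have "transpose (?T - ?Q) = transpose ?T - transpose ?Q" by (simp add: transpose_def vec_eq_iff)
   then have dt: "d t = transpose ?T *v reg \<xi> m t - transpose ?Q *v reg \<xi> m t" unfolding d_def by (simp only: matrix_vector_mult_diff_rdistrib)
   show ?thesis unfolding residual_eq[OF \<xi>, of t m k] \<rho>_def dt by (simp only: algebra_simps)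
  qed
  have "\<bar>(ls_cov (\<beta> m) (reg \<xi> m) (\<lambda>t. x t \<xi>) ?I - noise_cov G) $ i $ l\<bar> \<le> Bc * (sqrt ?n * ?u) / ?n + 2 * sqrt Kn * (P0 * q) + (P0 * q)^2"
  proof (rule ls_cov_error[where w="\<lambda>t. w t \<xi>" and \<rho>=\<rho>])
   show "x (Suc t) \<xi> - transpose (ls_param (\<beta> m) (reg \<xi> m) (\<lambda>t. x t \<xi>) ?I) *v reg \<xi> m t = w t \<xi> + \<rho> t" for t
    using e[of t] unfolding T(1) .
   show "real (card ?I) = ?n" using good_interval(4)[OF g, of m] by simp
   show "0 < ?n" using n1 by linarith
   show "\<bar>(\<Sum>t\<in>?I. w t \<xi> $ i * w t \<xi> $ l) - ?n * noise_cov G $ i $ l\<bar> \<le> Bc * (sqrt ?n * ?u)" by (rule crossD(11)[OF Bc(2)[OF g]])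
   show "(\<Sum>t\<in>?I. (norm (w t \<xi>))^2) \<le> Kn * ?n" by (rule Kn(2)[OF g])
   show "(\<Sum>t\<in>?I. (norm (\<rho> t))^2) \<le> (P0 * q)^2 * ?n" by (rule \<rho>sum)
   show "0 \<le> P0 * q" using P00 q by simp
   show "0 \<le> Kn" by (rule Kn(1))
  qed simp
  also have "Bc * (sqrt ?n * ?u) / ?n = Bc * (?u / sqrt ?n)"
  proof -
   have "sqrt ?n * sqrt ?n = ?n" "0 < sqrt ?n" using n1 by auto
   then show ?thesis by (simp add: field_simps)
  qed
  also have "Bc * (?u / sqrt ?n) + 2 * sqrt Kn * (P0 * q) + (P0 * q)^2 \<le> Bc * (Kh * q) + 2 * sqrt Kn * (P0 * q) + H * (2 * q)"
  proof (intro add_mono mult_left_mono order_refl)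
   show "?u / sqrt ?n \<le> Kh * q" using Kh(2)[OF g, of m] mult_left_mono[OF q(3) Kh(1)] by linarith
   \<comment> \<open>Both rates are at most 1, so the quadratic contribution is linear in
     \<open>q\<close> up to the factor 2.\<close>
   have "q^2 \<le> 2 * q" using q mult_right_mono[of q 2 q] by (simp add: power2_eq_square)
   then show "(P0 * q)^2 \<le> H * (2 * q)" unfolding power_mult_distrib P02 using H0 by (rule mult_left_mono)
  qed (use Bc(1) P00 Kn(1) in auto)
  also have "\<dots> = (Bc * Kh + 2 * sqrt Kn * P0 + 2 * H) * q" by (simp add: algebra_simps)
  finally show "\<bar>(snd (\<theta>hat \<xi> m k) - noise_cov G) $ i $ l\<bar> \<le> (Bc * Kh + 2 * sqrt Kn * P0 + 2 * H) * (?a + ?b)"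
   unfolding T(2) q_def .
 qed
qed

lemma model_error:
 obtains K cs where "0 \<le> K" "0 < cs" "\<And>\<xi> L k. good C \<xi> L k \<Longrightarrow> real k + L \<le> cs * sqrt (rlen \<xi> m k) \<Longrightarrow>
   model_dist (\<theta>hat \<xi> m k) (true_param G m (profile_at \<xi> (k - 1)), noise_cov G) \<le> K * (rateA k L + rateB k)"
proof -
 obtain Ke cs where Ke: "0 \<le> Ke" "0 < cs" "\<And>\<xi> L k l. good C \<xi> L k \<Longrightarrow> real k + L \<le> cs * sqrt (rlen \<xi> m k) \<Longrightarrow>
   norm (column l (fst (\<theta>hat \<xi> m k)) - column l (true_param G m (profile_at \<xi> (k - 1)))) \<le> Ke * rateA k L"
  using param_error[of C m] by blast
 obtain Kc cs' where Kc: "0 \<le> Kc" "0 < cs'" "\<And>\<xi> L k i l. good C \<xi> L k \<Longrightarrow> real k + L \<le> cs' * sqrt (rlen \<xi> m k) \<Longrightarrow>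
   \<bar>(snd (\<theta>hat \<xi> m k) - noise_cov G) $ i $ l\<bar> \<le> Kc * (rateA k L + rateB k)" using cov_error[of C m] by blast
 let ?N = "real CARD('n)"
 show thesis
 proof (rule that[of "?N * Ke + ?N * (?N * Kc)" "min cs cs'"])
  show "0 \<le> ?N * Ke + ?N * (?N * Kc)" "0 < min cs cs'" using Ke Kc by auto
  fix \<xi> L k assume g: "good C \<xi> L k" and small: "real k + L \<le> min cs cs' * sqrt (rlen \<xi> m k)"
  note rf = rate_facts[OF g]
  let ?q = "rateA k L + rateB k" and ?Q = "true_param G m (profile_at \<xi> (k - 1))"
  have q: "0 \<le> ?q" "rateA k L \<le> ?q" using rf by auto
  have "min cs cs' * sqrt (rlen \<xi> m k) \<le> cs * sqrt (rlen \<xi> m k)" "min cs cs' * sqrt (rlen \<xi> m k) \<le> cs' * sqrt (rlen \<xi> m k)"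
   by (intro mult_right_mono; simp)+
  then have s1: "real k + L \<le> cs * sqrt (rlen \<xi> m k)" and s2: "real k + L \<le> cs' * sqrt (rlen \<xi> m k)" using small by linarith+
  have "spec_norm (fst (\<theta>hat \<xi> m k) - ?Q) \<le> (\<Sum>l\<in>UNIV. norm (column l (fst (\<theta>hat \<xi> m k) - ?Q)))" by (rule spec_norm_le_columns)
  also have "\<dots> \<le> (\<Sum>l\<in>(UNIV::'n set). Ke * rateA k L)"
  proof (rule sum_mono)
   fix l
   have "column l (fst (\<theta>hat \<xi> m k) - ?Q) = column l (fst (\<theta>hat \<xi> m k)) - column l ?Q" by (simp add: column_def vec_eq_iff)
   then show "norm (column l (fst (\<theta>hat \<xi> m k) - ?Q)) \<le> Ke * rateA k L" using Ke(3)[OF g s1, of l] by simp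
  qed
  also have "\<dots> = ?N * (Ke * rateA k L)" by simp
  also have "\<dots> \<le> ?N * (Ke * ?q)" using q Ke(1) by (intro mult_left_mono) auto
  finally have 1: "spec_norm (fst (\<theta>hat \<xi> m k) - ?Q) \<le> ?N * (Ke * ?q)" .
  have 2: "spec_norm (snd (\<theta>hat \<xi> m k) - noise_cov G) \<le> ?N * (?N * (Kc * ?q))" by (intro spec_norm_le_entries Kc(3)[OF g s2])
  have "0 \<le> ?N * (Ke * ?q)" "0 \<le> ?N * (?N * (Kc * ?q))" using q(1) Ke(1) Kc(1) by (intro mult_nonneg_nonneg; simp)+
  moreover have "(?N * Ke + ?N * (?N * Kc)) * ?q = ?N * (Ke * ?q) + ?N * (?N * (Kc * ?q))" by (simp only: distrib_right mult.assoc)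
  ultimately show "model_dist (\<theta>hat \<xi> m k) (?Q, noise_cov G) \<le> (?N * Ke + ?N * (?N * Kc)) * ?q"
   unfolding model_dist_def fst_conv snd_conv using 1 2 by simp
 qed
qed

lemma estimate_model: assumes \<xi>: "\<xi> \<in> space M" shows "\<theta>hat \<xi> m k \<in> models G m"
proof -
 have \<beta>: "0 < \<beta> m" using run by (simp add: runs_algorithm_def)
 have "supp_in (UNIV <+> (UNIV <+> ctrl G m)) (ls_param (\<beta> m) (reg \<xi> m) (\<lambda>t. x t \<xi>) (iv \<xi> m k))"
  unfolding supp_in_def
 proof (intro allI impI)
  fix i :: "unit + ('n + 'd)" assume "i \<notin> UNIV <+> (UNIV <+> ctrl G m)"
  then obtain j where i: "i = Inr (Inr j)" "j \<notin> ctrl G m"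
   by (cases i rule: sum.exhaust[case_names l r]; cases "projr i" rule: sum.exhaust) (auto simp: Plus_def)
  show "ls_param (\<beta> m) (reg \<xi> m) (\<lambda>t. x t \<xi>) (iv \<xi> m k) $ i = 0"
   by (rule ls_param_support[OF \<beta>]) (simp add: i(1) regressor_def control_support[OF \<xi> i(2)])
 qed
 then show ?thesis unfolding models_def \<theta>hat_def by (simp add: ls_cov_psd)
qed

text \<open>Everything required of an epoch follows from one cubic inequality with a sufficiently
  small constant, so the later recursion carries a single condition on \<open>k\<close> and
  \<open>L\<close>. The constant depends neither on the path nor on \<open>L\<close>.\<close>

lemma small_epoch:
 assumes cs: "0 < cs" and \<epsilon>0: "0 < \<epsilon>0"
 obtains \<epsilon> where "0 < \<epsilon>" "\<And>C \<xi> L k. \<xi> \<in> space M \<Longrightarrow> 0 \<le> L \<Longrightarrow> 1 \<le> k \<Longrightarrow> (real k + L) ^ 3 \<le> \<epsilon> * lam powr (\<eta> * real k) \<Longrightarrow>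
   regular C L \<xi> \<Longrightarrow>
   good C \<xi> L k \<and> (\<forall>m. real k + L \<le> cs * sqrt (rlen \<xi> m k)) \<and> rateA k L \<le> \<epsilon>0 \<and> rateB k \<le> \<epsilon>0"
proof -
 define a where "a = scale_len c / 2"
 have a: "0 < a" using c by (simp add: a_def valid_schedule_def)
 have X0: "0 < X0" using lam by (simp add: X0_def less_max_iff_disj)
 \<comment> \<open>The four entries yield in turn the cubic condition in \<open>good\<close>, the
   bound \<open>X0 \<le> lam ^ k\<close>, the smallness needed for the Gram matrix, and rates below
   \<open>\<epsilon>0\<close>. The second works because \<open>k + L \<ge> 1\<close> forces
   \<open>\<epsilon> * lam powr (\<eta> * k) \<ge> 1\<close>.\<close>
 define \<epsilon> where "\<epsilon> = min (min 1 (X0 powr (- \<eta>))) (min (cs * sqrt a) \<epsilon>0)"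
 have \<epsilon>: "0 < \<epsilon>" "\<epsilon> \<le> 1" "\<epsilon> \<le> X0 powr (- \<eta>)" "\<epsilon> \<le> cs * sqrt a" "\<epsilon> \<le> \<epsilon>0" using cs \<epsilon>0 a X0 by (auto simp: \<epsilon>_def)
 note db = decay_bounds(3-8)
 show thesis
 proof (rule that[OF \<epsilon>(1)])
  fix C \<xi> L k assume \<xi>: "\<xi> \<in> space M" and L: "0 \<le> L" and k: "1 \<le> k" and s: "(real k + L) ^ 3 \<le> \<epsilon> * lam powr (\<eta> * real k)"
   and rp: "regular C L \<xi>"
  let ?u = "real k + L" and ?X = "lam ^ k"
  have e: "lam powr (\<eta> * real k) = ?X powr \<eta>" using lam by (simp add: powr_realpow[symmetric] powr_powr mult.commute)
  have X1: "1 \<le> ?X" using lam by (simp add: one_le_power)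
  have u1: "1 \<le> ?u" using k L by simp
  have u3: "?u \<le> ?u ^ 3" using u1 by (rule self_le_power) simp
  have s': "?u ^ 3 \<le> \<epsilon> * ?X powr \<eta>" using s unfolding e .
  then have su: "?u \<le> \<epsilon> * ?X powr \<eta>" using u3 by linarith
  then have s1: "1 \<le> \<epsilon> * ?X powr \<eta>" using u1 by linarith
  have "X0 \<le> ?X"
  proof (rule ccontr)
   assume "\<not> X0 \<le> ?X"
   then have "?X powr \<eta> < X0 powr \<eta>" using X1 db by (intro powr_less_mono2) auto
   then have "\<epsilon> * ?X powr \<eta> < X0 powr (- \<eta>) * X0 powr \<eta>" using \<epsilon> X0 by (intro mult_le_less_imp_less) auto
   also have "\<dots> = 1" using X0 by (simp add: powr_minus)
   finally show False using s1 by linarith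
  qed
  moreover have "\<epsilon> * ?X powr \<eta> \<le> 1 * ?X powr \<eta>" using \<epsilon> by (intro mult_right_mono) auto
  then have "?u ^ 3 \<le> lam powr (\<eta> * real k)" unfolding e using s' by linarith
  ultimately have g: "good C \<xi> L k" using \<xi> L k rp by (simp add: good_def)
  have small: "?u \<le> cs * sqrt (rlen \<xi> m k)" for m
  proof -
   have "?X powr \<eta> \<le> ?X powr (1/2)" using db X1 by (intro powr_mono) auto
   then have "\<epsilon> * ?X powr \<eta> \<le> cs * sqrt a * sqrt ?X" using \<epsilon> X1 by (intro mult_mono) (auto simp: powr_half_sqrt)
   also have "\<dots> = cs * sqrt (a * ?X)" by (simp add: real_sqrt_mult)
   also have "\<dots> \<le> cs * sqrt (rlen \<xi> m k)"
    using large_epoch(3)[OF \<xi> k \<open>X0 \<le> ?X\<close>, of m] cs by (intro mult_left_mono real_sqrt_le_mono) (auto simp: a_def)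
   finally show ?thesis using su by linarith
  qed
  have rA: "rateA k L \<le> \<epsilon>0"
  proof -
   have "sqrt ?u \<le> ?u" using u1 real_sqrt_le_mono[of ?u "?u^2"] by (simp add: self_le_power power2_eq_square)
   also have "?u \<le> \<epsilon> * ?X powr \<eta>" by (rule su)
   also have "\<dots> \<le> \<epsilon>0 * ?X powr (1/2 - numax)" using \<epsilon> \<epsilon>0 db X1 by (intro mult_mono powr_mono) auto
   finally have "rateA k L \<le> \<epsilon>0 * ?X powr (1/2 - numax) * ?X powr (- (1/2 - numax))"
    unfolding rateA_def by (intro mult_right_mono) auto
   also have "\<dots> = \<epsilon>0 * (?X powr (1/2 - numax) * ?X powr (- (1/2 - numax)))" by (simp only: mult.assoc)
   also have "\<dots> = \<epsilon>0" using X1 lam by (simp only: powr_add[symmetric]) simp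
   finally show ?thesis .
  qed
  have rB: "rateB k \<le> \<epsilon>0"
  proof -
   have "rateB k \<le> ?X powr (- \<eta>)" unfolding rateB_def using db X1 by (intro powr_mono) auto
   also have "\<dots> = 1 * ?X powr (- \<eta>)" by simp
   also have "\<dots> \<le> \<epsilon> * ?X powr \<eta> * ?X powr (- \<eta>)" using s1 by (intro mult_right_mono) auto
   also have "\<dots> = \<epsilon> * (?X powr \<eta> * ?X powr (- \<eta>))" by (simp only: mult.assoc)
   also have "\<dots> = \<epsilon>" using X1 lam by (simp only: powr_add[symmetric]) simp
   finally show ?thesis using \<epsilon> by linarith
  qed
  show "good C \<xi> L k \<and> (\<forall>m. ?u \<le> cs * sqrt (rlen \<xi> m k)) \<and> rateA k L \<le> \<epsilon>0 \<and> rateB k \<le> \<epsilon>0"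
   using g small rA rB by blast
 qed
qed

end

section \<open>Contraction towards the equilibrium\<close>

lemma profile_norm_triangle:
 assumes "0 \<le> \<mu>" shows "profile_norm \<mu> (p - q) \<le> profile_norm \<mu> (p - s) + profile_norm \<mu> (s - q)"
proof -
 have "(\<Sum>m\<in>UNIV. spec_norm (fst (p - q) m)) \<le> (\<Sum>m\<in>UNIV. spec_norm (fst (p - s) m) + spec_norm (fst (s - q) m))"
 proof (rule sum_mono)
  fix m
  show "spec_norm (fst (p - q) m) \<le> spec_norm (fst (p - s) m) + spec_norm (fst (s - q) m)"
   using spec_norm_add[of "fst (p - s) m" "fst (s - q) m"] by simp
 qed
 moreover have "(\<Sum>m\<in>UNIV. norm (snd (p - q) m)) \<le> (\<Sum>m\<in>UNIV. norm (snd (p - s) m) + norm (snd (s - q) m))"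
 proof (rule sum_mono)
  fix m
  show "norm (snd (p - q) m) \<le> norm (snd (p - s) m) + norm (snd (s - q) m)"
   using norm_triangle_ineq[of "snd (p - s) m" "snd (s - q) m"] by simp
 qed
 ultimately show ?thesis using mult_left_mono[OF _ assms] unfolding profile_norm_def sum.distrib by (fastforce simp: algebra_simps)
qed

lemma profile_norm_le:
 fixes p q :: "('m::finite, 'n::finite, 'd::finite) profile"
 assumes "0 \<le> \<mu>" "\<And>m. spec_norm (fst p m - fst q m) \<le> b" "\<And>m. norm (snd p m - snd q m) \<le> b'"
 shows "profile_norm \<mu> (p - q) \<le> \<mu> * (real CARD('m) * b) + real CARD('m) * b'"
proof -
 have "(\<Sum>m\<in>UNIV. spec_norm (fst (p - q) m)) \<le> (\<Sum>m\<in>(UNIV::'m set). b)" by (intro sum_mono) (simp add: assms)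
 moreover have "(\<Sum>m\<in>UNIV. norm (snd (p - q) m)) \<le> (\<Sum>m\<in>(UNIV::'m set). b')" by (intro sum_mono) (simp add: assms)
 ultimately show ?thesis unfolding profile_norm_def using assms(1) by (intro add_mono mult_left_mono) auto
qed

lemma profile_norm_nonneg: "0 \<le> \<mu> \<Longrightarrow> 0 \<le> profile_norm \<mu> p"
 unfolding profile_norm_def by (intro add_nonneg_nonneg mult_nonneg_nonneg sum_nonneg) auto

lemma profile_norm_components:
 assumes "0 \<le> \<mu>"
 shows "\<mu> * spec_norm (fst p m - fst q m) \<le> profile_norm \<mu> (p - q)" "norm (snd p m - snd q m) \<le> profile_norm \<mu> (p - q)"
proof -
 have a: "spec_norm (fst p m - fst q m) \<le> (\<Sum>m\<in>UNIV. spec_norm (fst (p - q) m))"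
  using member_le_sum[of m UNIV "\<lambda>m. spec_norm (fst (p - q) m)"] by simp
 have b: "norm (snd p m - snd q m) \<le> (\<Sum>m\<in>UNIV. norm (snd (p - q) m))"
  using member_le_sum[of m UNIV "\<lambda>m. norm (snd (p - q) m)"] by simp
 have "0 \<le> \<mu> * (\<Sum>m\<in>UNIV. spec_norm (fst (p - q) m))" "0 \<le> (\<Sum>m\<in>UNIV. norm (snd (p - q) m))"
  using assms by (auto intro!: mult_nonneg_nonneg sum_nonneg)
 then show "\<mu> * spec_norm (fst p m - fst q m) \<le> profile_norm \<mu> (p - q)" "norm (snd p m - snd q m) \<le> profile_norm \<mu> (p - q)"
  unfolding profile_norm_def using mult_left_mono[OF a assms] b by linarith+
qed

locale equilibrium_learning = stable_learning M G c W V \<Phi> \<beta> init x0 w v sh r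
 for M :: "'a measure" and G :: "('m::finite, 'n::finite, 'd::finite) lq_game" and c W V \<Phi> \<beta> init x0 w v sh r +
 fixes BR :: "'m \<Rightarrow> ('m, 'n, 'd) profile \<Rightarrow> ('n, 'd) strategy" and pstar :: "('m, 'n, 'd) profile" and \<mu> \<zeta> :: real
 assumes WV: "perceived_noise_laws G W V" and BR: "well_posed_best_responses M w G BR"
  and eq: "stable_equilibrium G BR pstar \<mu> \<zeta>" and lip: "uniformly_lipschitz G W V \<Phi>"
begin

lemma eqD: "0 < \<mu>" "0 < \<zeta>" "\<zeta> < 1" "pstar \<in> profiles G" "collective_response BR pstar = pstar"
 "p \<in> profiles G \<Longrightarrow> profile_norm \<mu> (collective_response BR p - collective_response BR pstar) \<le> \<zeta> * profile_norm \<mu> (p - pstar)"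
 using eq by (auto simp: stable_equilibrium_def)

text \<open>A small estimation error puts the estimate into the \<delta>-neighbourhood of a true
  model, where it is feasible; it is therefore adopted, and the fallback to an older model does not
  occur in these epochs. At the true model without exploration the selection is the best response
  whatever the current state, so the dependence on the state disappears.\<close>

lemma policy_error:
 "\<exists>\<epsilon> K. 0 < \<epsilon> \<and> 0 \<le> K \<and> (\<forall>\<xi>\<in>space M. \<forall>L\<ge>0. \<forall>k\<ge>1. (real k + L) ^ 3 \<le> \<epsilon> * lam powr (\<eta> * real k) \<longrightarrow> regular C L \<xi> \<longrightarrow>
   spec_norm (fst (policy r m k \<xi>) - fst (BR m (profile_at \<xi> (k - 1)))) \<le> K * (rateA k L + rateB k) \<and>
   norm (snd (policy r m k \<xi>) - snd (BR m (profile_at \<xi> (k - 1)))) \<le> K * (rateA k L + rateB k))"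
proof -
 obtain \<delta> Lm where \<delta>: "0 < \<delta>" "0 < Lm" "\<And>p \<theta>. p \<in> profiles G \<Longrightarrow> \<theta> \<in> models G m \<Longrightarrow>
   model_dist \<theta> (true_param G m p, noise_cov G) \<le> \<delta> \<Longrightarrow> \<theta> \<in> feasible G W V m \<and> (\<forall>x. \<forall>\<alpha>\<in>{0..\<delta>}.
     spec_norm (fst (\<Phi> m \<theta> x \<alpha>) - fst (\<Phi> m (true_param G m p, noise_cov G) x 0)) \<le> Lm * max (model_dist \<theta> (true_param G m p, noise_cov G)) \<alpha> \<and>
     norm (snd (\<Phi> m \<theta> x \<alpha>) - snd (\<Phi> m (true_param G m p, noise_cov G) x 0)) \<le> Lm * max (model_dist \<theta> (true_param G m p, noise_cov G)) \<alpha>)"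
  using lip[unfolded uniformly_lipschitz_def Let_def, rule_format, of m] by blast
 obtain Km cs where Km: "0 \<le> Km" "0 < cs" "\<And>\<xi> L k. good C \<xi> L k \<Longrightarrow> real k + L \<le> cs * sqrt (rlen \<xi> m k) \<Longrightarrow>
   model_dist (\<theta>hat \<xi> m k) (true_param G m (profile_at \<xi> (k - 1)), noise_cov G) \<le> Km * (rateA k L + rateB k)"
  using model_error[of C m] by blast
 obtain Ka where Ka: "0 \<le> Ka" "\<And>C \<xi> L k m. good C \<xi> L k \<Longrightarrow> al \<xi> m (k - 1) \<le> Ka * rateB k"
  "\<And>C \<xi> L k m. good C \<xi> L k \<Longrightarrow> al \<xi> m k \<le> Ka * rateB k" using exploration_rate by blast
 define Q where "Q = Km + Ka + 1"
 have Q: "1 \<le> Q" "Km \<le> Q" "Ka \<le> Q" using Km Ka by (auto simp: Q_def)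
 \<comment> \<open>Both the model error and the exploration scale are at most \<open>Q\<close> times
   the sum of two rates; rates below \<open>\<epsilon>0\<close> keep them within the Lipschitz
   radius \<open>\<delta>\<close>.\<close>
 define \<epsilon>0 where "\<epsilon>0 = \<delta> / (2 * Q)"
 have \<epsilon>0: "0 < \<epsilon>0" "Q * (2 * \<epsilon>0) = \<delta>" using \<delta> Q by (auto simp: \<epsilon>0_def)
 obtain \<epsilon> where \<epsilon>: "0 < \<epsilon>" "\<And>C \<xi> L k. \<xi> \<in> space M \<Longrightarrow> 0 \<le> L \<Longrightarrow> 1 \<le> k \<Longrightarrow> (real k + L) ^ 3 \<le> \<epsilon> * lam powr (\<eta> * real k) \<Longrightarrow>
   regular C L \<xi> \<Longrightarrow>
   good C \<xi> L k \<and> (\<forall>m. real k + L \<le> cs * sqrt (rlen \<xi> m k)) \<and> rateA k L \<le> \<epsilon>0 \<and> rateB k \<le> \<epsilon>0"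
  using small_epoch[OF Km(2) \<epsilon>0(1)] by blast
 show ?thesis
 proof (rule exI[of _ \<epsilon>], rule exI[of _ "Lm * Q"], intro conjI ballI allI impI)
  show "0 < \<epsilon>" by (rule \<epsilon>(1))
  show "0 \<le> Lm * Q" using \<delta>(2) Q(1) by simp
 next
  fix \<xi> L and k :: nat assume \<xi>: "\<xi> \<in> space M" and L: "0 \<le> L" and k: "1 \<le> k" and s: "(real k + L) ^ 3 \<le> \<epsilon> * lam powr (\<eta> * real k)" and rp: "regular C L \<xi>"
  from \<epsilon>(2)[OF \<xi> L k s rp] have g: "good C \<xi> L k" and small: "real k + L \<le> cs * sqrt (rlen \<xi> m k)" and r1: "rateA k L \<le> \<epsilon>0" "rateB k \<le> \<epsilon>0" by blast+
  let ?q = "rateA k L + rateB k" and ?p = "profile_at \<xi> (k - 1)"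
  let ?\<theta>0 = "(true_param G m ?p, noise_cov G)"
  note rf = rate_facts[OF g]
  have q: "0 \<le> ?q" "?q \<le> 2 * \<epsilon>0" using rf r1 by auto
  have md: "model_dist (\<theta>hat \<xi> m k) ?\<theta>0 \<le> Q * ?q" using Km(3)[OF g small] mult_right_mono[OF Q(2) q(1)] by linarith
  have "Ka * rateB k \<le> Q * ?q" using rf Q Ka(1) by (intro mult_mono) auto
  then have a: "al \<xi> m k \<le> Q * ?q" using Ka(3)[OF g, of m] by linarith
  have "Q * ?q \<le> \<delta>" unfolding \<epsilon>0(2)[symmetric] using q Q by (intro mult_left_mono) auto
  then have small': "model_dist (\<theta>hat \<xi> m k) ?\<theta>0 \<le> \<delta>" "al \<xi> m k \<in> {0..\<delta>}" using md a epoch_facts(9)[OF \<xi>, of m k] by auto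
  have p: "?p \<in> profiles G" by (rule profile_at_profiles[OF \<xi>])
  note L0 = \<delta>(3)[OF p estimate_model[OF \<xi>] small'(1)]
  have "estimate r m k \<xi> = \<theta>hat \<xi> m k" using estimate_eq[OF \<xi> k, of m] L0 by simp
  then have pol: "policy r m k \<xi> = \<Phi> m (\<theta>hat \<xi> m k) (x (st \<xi> m k) \<xi>) (al \<xi> m k)" using policy_eq[OF \<xi>, of m k] by simp
  have br: "\<Phi> m ?\<theta>0 (x (st \<xi> m k) \<xi>) 0 = BR m ?p"
   by (rule selection_eq_best_response[OF M iidw G stable WV sel BR lip p])
  have mx: "Lm * max (model_dist (\<theta>hat \<xi> m k) ?\<theta>0) (al \<xi> m k) \<le> Lm * Q * ?q"
   using md a \<delta>(2) by (simp add: mult.assoc)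
  from L0 small'(2) br pol have
   "spec_norm (fst (policy r m k \<xi>) - fst (BR m ?p)) \<le> Lm * max (model_dist (\<theta>hat \<xi> m k) ?\<theta>0) (al \<xi> m k)"
   "norm (snd (policy r m k \<xi>) - snd (BR m ?p)) \<le> Lm * max (model_dist (\<theta>hat \<xi> m k) ?\<theta>0) (al \<xi> m k)" by metis+
  with mx show "spec_norm (fst (policy r m k \<xi>) - fst (BR m ?p)) \<le> Lm * Q * ?q"
   "norm (snd (policy r m k \<xi>) - snd (BR m ?p)) \<le> Lm * Q * ?q" by linarith+
 qed
qed

abbreviation "err \<xi> k \<equiv> profile_norm \<mu> (profile_at \<xi> k - pstar)"

text \<open>Inserting the collective response to the profile of epoch \<open>k - 1\<close> separates
  the policy errors from the contraction of \<Psi>. The finitely many players share the smallest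
  threshold and the sum of their constants.\<close>

lemma error_recursion:
 obtains \<epsilon> Cr where "0 < \<epsilon>" "0 \<le> Cr" "\<And>\<xi> L k. \<xi> \<in> space M \<Longrightarrow> 0 \<le> L \<Longrightarrow> 1 \<le> k \<Longrightarrow> (real k + L) ^ 3 \<le> \<epsilon> * lam powr (\<eta> * real k) \<Longrightarrow> regular C L \<xi> \<Longrightarrow>
   err \<xi> k \<le> \<zeta> * err \<xi> (k - 1) + Cr * (sqrt (real k + L) * lam powr (- (1/2 - numax) * real k) + lam powr (- numin * real k))"
proof -
 have "\<forall>m. \<exists>\<epsilon> K. 0 < \<epsilon> \<and> 0 \<le> K \<and> (\<forall>\<xi>\<in>space M. \<forall>L\<ge>0. \<forall>k\<ge>1. (real k + L) ^ 3 \<le> \<epsilon> * lam powr (\<eta> * real k) \<longrightarrow> regular C L \<xi> \<longrightarrow>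
   spec_norm (fst (policy r m k \<xi>) - fst (BR m (profile_at \<xi> (k - 1)))) \<le> K * (rateA k L + rateB k) \<and>
   norm (snd (policy r m k \<xi>) - snd (BR m (profile_at \<xi> (k - 1)))) \<le> K * (rateA k L + rateB k))" using policy_error by blast
 then obtain \<epsilon> K where \<epsilon>: "\<forall>m. 0 < \<epsilon> m \<and> 0 \<le> K m \<and> (\<forall>\<xi>\<in>space M. \<forall>L\<ge>0. \<forall>k\<ge>1. (real k + L) ^ 3 \<le> \<epsilon> m * lam powr (\<eta> * real k) \<longrightarrow> regular C L \<xi> \<longrightarrow>
   spec_norm (fst (policy r m k \<xi>) - fst (BR m (profile_at \<xi> (k - 1)))) \<le> K m * (rateA k L + rateB k) \<and>
   norm (snd (policy r m k \<xi>) - snd (BR m (profile_at \<xi> (k - 1)))) \<le> K m * (rateA k L + rateB k))" unfolding choice_iff by blast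
 define e where "e = (MIN m. \<epsilon> m)"
 define S where "S = (\<Sum>m\<in>UNIV. K m)"
 have e: "0 < e" "e \<le> \<epsilon> m" for m unfolding e_def using \<epsilon> by (auto simp: Min_gr_iff)
 have S: "K m \<le> S" "0 \<le> S" for m unfolding S_def using \<epsilon> by (auto intro!: member_le_sum sum_nonneg)
 let ?N = "real CARD('m)"
 show thesis
 proof (rule that[OF e(1), of "\<mu> * (?N * S) + ?N * S"])
  show "0 \<le> \<mu> * (?N * S) + ?N * S" using S(2) eqD(1) by simp
  fix \<xi> L and k :: nat assume \<xi>: "\<xi> \<in> space M" and L: "0 \<le> L" and k: "1 \<le> k" and s: "(real k + L) ^ 3 \<le> e * lam powr (\<eta> * real k)" and rp: "regular C L \<xi>"
  have s': "(real k + L) ^ 3 \<le> \<epsilon> m * lam powr (\<eta> * real k)" for m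
   using s mult_right_mono[OF e(2)[of m], of "lam powr (\<eta> * real k)"] by simp
  let ?q = "rateA k L + rateB k" and ?p = "profile_at \<xi> (k - 1)"
  have q0: "0 \<le> ?q" using L by (simp add: rateA_def rateB_def)
  have "profile_norm \<mu> (profile_at \<xi> k - collective_response BR ?p) \<le> \<mu> * (?N * (S * ?q)) + ?N * (S * ?q)"
  proof (rule profile_norm_le)
   fix m
   have "spec_norm (fst (policy r m k \<xi>) - fst (BR m ?p)) \<le> K m * ?q" "norm (snd (policy r m k \<xi>) - snd (BR m ?p)) \<le> K m * ?q"
    using \<epsilon> \<xi> L k s' rp by blast+
   then show "spec_norm (fst (profile_at \<xi> k) m - fst (collective_response BR ?p) m) \<le> S * ?q"
    "norm (snd (profile_at \<xi> k) m - snd (collective_response BR ?p) m) \<le> S * ?q"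
    unfolding profile_at_def[of \<xi> k] collective_response_def fst_conv snd_conv using mult_right_mono[OF S(1)[of m] q0] by linarith+
  qed (use eqD in simp)
  moreover have "profile_norm \<mu> (collective_response BR ?p - pstar) \<le> \<zeta> * err \<xi> (k - 1)"
   using eqD(6)[OF profile_at_profiles[OF \<xi>, of "k - 1"]] unfolding eqD(5) .
  moreover have "err \<xi> k \<le> profile_norm \<mu> (profile_at \<xi> k - collective_response BR ?p) + profile_norm \<mu> (collective_response BR ?p - pstar)"
   using eqD(1) by (intro profile_norm_triangle) simp
  ultimately have "err \<xi> k \<le> \<zeta> * err \<xi> (k - 1) + (\<mu> * (?N * S) + ?N * S) * ?q" by (simp add: algebra_simps)
  moreover have "(lam ^ k) powr a = lam powr (a * real k)" for a using lam by (simp add: powr_realpow[symmetric] powr_powr mult.commute)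
  ultimately show "err \<xi> k \<le> \<zeta> * err \<xi> (k - 1) + (\<mu> * (?N * S) + ?N * S) * (sqrt (real k + L) * lam powr (- (1/2 - numax) * real k) + lam powr (- numin * real k))"
   unfolding rateA_def rateB_def by simp
 qed
qed

text \<open>A priori bound on the error of any admissible profile. It covers the epochs before the
  contraction sets in and, later, the finitely many times that the rates leave open.\<close>

definition "diam = \<mu> * (real CARD('m) * (2 * (\<Sum>m\<in>UNIV. radF G m))) + real CARD('m) * (2 * (\<Sum>m\<in>UNIV. radf G m))"

lemma profiles_diam: assumes p: "p \<in> profiles G" shows "profile_norm \<mu> (p - pstar) \<le> diam" unfolding diam_def
proof (rule profile_norm_le)
 fix m
 have rd: "0 \<le> radf G j" "0 \<le> radF G j" for j using G by (auto simp: valid_game_def intro: less_imp_le)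
 have le: "radF G m \<le> (\<Sum>m\<in>UNIV. radF G m)" "radf G m \<le> (\<Sum>m\<in>UNIV. radf G m)"
  using rd by (auto intro!: member_le_sum)
 have b: "spec_norm (fst q m) \<le> radF G m \<and> norm (snd q m) \<le> radf G m" if "q \<in> profiles G" for q
  using that by (auto simp: profiles_def gain_profiles_def offset_profiles_def gains_def offsets_def)
 show "spec_norm (fst p m - fst pstar m) \<le> 2 * (\<Sum>m\<in>UNIV. radF G m)"
  using spec_norm_diff[of "fst p m" "fst pstar m"] b[OF p] b[OF eqD(4)] le by linarith
 show "norm (snd p m - snd pstar m) \<le> 2 * (\<Sum>m\<in>UNIV. radf G m)"
  using norm_triangle_ineq4[of "snd p m" "snd pstar m"] b[OF p] b[OF eqD(4)] le by linarith
qed (use eqD in simp)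

lemma played_profiles: "\<xi> \<in> space M \<Longrightarrow> played c sh r t \<xi> \<in> profiles G"
 using policy_strategy[of \<xi>] by (auto simp: played_def profiles_def gain_profiles_def offset_profiles_def strategies_def mem_Times_iff)

abbreviation "gap \<xi> t \<equiv> profile_norm \<mu> (played c sh r t \<xi> - pstar)"
abbreviation "rate_sum c0 t \<delta> \<equiv> rate1 \<zeta> lam c0 (real t) \<delta> + rate2 (decay c) (real t) \<delta> + rate3 (decay c) (real t)"
abbreviation "rate_max c0 t \<delta> \<equiv> Max {rate1 \<zeta> lam c0 (real t) \<delta>, rate2 (decay c) (real t) \<delta>, rate3 (decay c) (real t)}"

text \<open>The played profile mixes policies from different epochs. Each component is compared with
  the full profile of the epoch its owner is in; for the gains the weight \<open>\<mu>\<close>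
  cancels, and summing over players gives the factor.\<close>

lemma played_error:
 assumes \<xi>: "\<xi> \<in> space M" and b: "\<And>m. err \<xi> (ep \<xi> m t) \<le> b"
 shows "gap \<xi> t \<le> 2 * real CARD('m) * b"
proof -
 have "gap \<xi> t \<le> \<mu> * (real CARD('m) * (b / \<mu>)) + real CARD('m) * b"
 proof (rule profile_norm_le)
  fix m
  have "\<mu> * spec_norm (fst (profile_at \<xi> (ep \<xi> m t)) m - fst pstar m) \<le> b"
   using profile_norm_components(1)[of \<mu> "profile_at \<xi> (ep \<xi> m t)" m pstar] b[of m] eqD(1) by linarith
  then show "spec_norm (fst (played c sh r t \<xi>) m - fst pstar m) \<le> b / \<mu>"
   using eqD(1) by (simp add: played_def profile_at_def field_simps)
  have "norm (snd (profile_at \<xi> (ep \<xi> m t)) m - snd pstar m) \<le> b"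
   using profile_norm_components(2)[of \<mu> "profile_at \<xi> (ep \<xi> m t)" m pstar] b[of m] eqD(1) by linarith
  then show "norm (snd (played c sh r t \<xi>) m - snd pstar m) \<le> b" by (simp add: played_def profile_at_def)
 qed (use eqD in simp)
 also have "\<dots> = 2 * real CARD('m) * b" using eqD(1) by simp
 finally show ?thesis .
qed

text \<open>The restriction \<open>\<delta> \<le> 1/2\<close> provides
  \<open>ln (1 / \<delta>) \<ge> ln 2\<close>, the lower bound on \<open>L\<close> that merging
  powers of \<open>L\<close> relies on. Larger \<open>\<delta>\<close> are reduced to
  \<open>1/2\<close> afterwards.\<close>

lemma played_rate:
 obtains c0 c1 B K where "0 < c0" "0 < c1" "0 < B" "0 < K" "\<And>\<xi> \<delta> t. \<xi> \<in> space M \<Longrightarrow> 0 < \<delta> \<Longrightarrow> \<delta> \<le> 1/2 \<Longrightarrow> regular C (ln (1 / \<delta>)) \<xi> \<Longrightarrow>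
   K * ln (1 / \<delta>) powr c1 \<le> real t \<Longrightarrow> 3 \<le> t \<Longrightarrow>
   gap \<xi> t \<le> B * rate_sum c0 t \<delta>"
proof -
 obtain \<epsilon> Cr where r: "0 < \<epsilon>" "0 \<le> Cr" "\<And>\<xi> L k. \<xi> \<in> space M \<Longrightarrow> 0 \<le> L \<Longrightarrow> 1 \<le> k \<Longrightarrow> (real k + L) ^ 3 \<le> \<epsilon> * lam powr (\<eta> * real k) \<Longrightarrow> regular C L \<xi> \<Longrightarrow>
   err \<xi> k \<le> \<zeta> * err \<xi> (k - 1) + Cr * (sqrt (real k + L) * lam powr (- (1/2 - numax) * real k) + lam powr (- numin * real k))"
  using error_recursion[of C] by blast
 define D where "D = diam"
 have D0: "0 \<le> D" unfolding D_def using profiles_diam[OF eqD(4)] profile_norm_nonneg[of \<mu> "pstar - pstar"] eqD(1) by linarith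
 define cl where "cl = (lam - 1) / ((base_len c + scale_len c + max_shift c) * lam ^ 2)"
 define Cu where "Cu = 2 / scale_len c + 1"
 have s: "0 < scale_len c" "0 \<le> base_len c" "0 < max_shift c" using c by (auto simp: valid_schedule_def)
 have cl: "0 < cl" unfolding cl_def using s lam by (intro divide_pos_pos mult_pos_pos) auto
 have Cu: "0 < Cu" using s(1) by (simp add: Cu_def add_pos_pos)
 have qa: "0 < 1/2 - numax" using decay_bounds(5) by simp
 show thesis
 proof (rule contraction_rate[OF lam eqD(2,3) qa decay_bounds(3) decay_bounds(6) r(1) D0 r(2) cl Cu])
  fix c0 c1 B K :: real
  assume cc: "0 < c0" "0 < c1" "0 < B" "0 < K"
   and main: "\<And>L e t k. ln 2 \<le> L \<Longrightarrow> (\<And>k. 0 \<le> e k \<and> e k \<le> D) \<Longrightarrow>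
    (\<And>k. 1 \<le> k \<Longrightarrow> (real k + L) ^ 3 \<le> \<epsilon> * lam powr (\<eta> * real k) \<Longrightarrow>
     e k \<le> \<zeta> * e (k - 1) + Cr * (sqrt (real k + L) * lam powr (- (1/2 - numax) * real k) + lam powr (- numin * real k))) \<Longrightarrow>
    K * L powr c1 \<le> t \<Longrightarrow> 3 \<le> t \<Longrightarrow> cl * t \<le> lam powr real k \<Longrightarrow> lam powr real k \<le> Cu * t \<Longrightarrow>
    e (k::nat) \<le> B * ((ln t powr (3/2) + L powr c0) * t powr (ln \<zeta> / ln lam) + sqrt (ln t + L) * t powr (- (1/2 - numax)) + t powr (- numin))"
  show thesis
  proof (rule that[OF cc(1,2) _ cc(4), of "2 * real CARD('m) * B"])
   show "0 < 2 * real CARD('m) * B" using cc(3) by simp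
   fix \<xi> \<delta> and t :: nat assume \<xi>: "\<xi> \<in> space M" and \<delta>: "0 < \<delta>" "\<delta> \<le> 1/2" and rp: "regular C (ln (1 / \<delta>)) \<xi>"
    and t: "K * ln (1 / \<delta>) powr c1 \<le> real t" "3 \<le> t"
   let ?L = "ln (1 / \<delta>)"
   have "2 \<le> 1 / \<delta>" using \<delta> by (simp add: field_simps)
   then have L: "ln 2 \<le> ?L" by (intro ln_mono) auto
   have L0: "0 \<le> ?L" using L ln_gt_zero[of "2::real"] by linarith
   let ?R = "(ln (real t) powr (3/2) + ?L powr c0) * real t powr (ln \<zeta> / ln lam) + sqrt (ln (real t) + ?L) * real t powr (- (1/2 - numax)) + real t powr (- numin)"
   have "err \<xi> (ep \<xi> m t) \<le> B * ?R" for m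
   proof (rule main[of ?L "err \<xi>" "real t" "ep \<xi> m t", OF L _ _ t(1)])
    show "0 \<le> err \<xi> k \<and> err \<xi> k \<le> D" for k
     unfolding D_def using profiles_diam[OF profile_at_profiles[OF \<xi>]] profile_norm_nonneg[OF less_imp_le[OF eqD(1)]] by blast
    show "err \<xi> k \<le> \<zeta> * err \<xi> (k - 1) + Cr * (sqrt (real k + ?L) * lam powr (- (1/2 - numax) * real k) + lam powr (- numin * real k))"
     if "1 \<le> k" "(real k + ?L) ^ 3 \<le> \<epsilon> * lam powr (\<eta> * real k)" for k by (rule r(3)[OF \<xi> L0 that rp])
    show "3 \<le> real t" using t(2) by simp
    have pr: "lam powr real k = lam ^ k" for k using lam by (simp add: powr_realpow)
    show "cl * real t \<le> lam powr real (ep \<xi> m t)" "lam powr real (ep \<xi> m t) \<le> Cu * real t"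
     unfolding pr cl_def Cu_def using epoch_facts(11,12)[OF \<xi>, of t m] t(2) by simp_all
   qed
   from played_error[OF \<xi> this] have "gap \<xi> t \<le> 2 * real CARD('m) * (B * ?R)" .
   also have "\<dots> = 2 * real CARD('m) * B * rate_sum c0 t \<delta>"
    by (simp add: rate1_def rate2_def rate3_def numin_def numax_def mult.assoc)
   finally show "gap \<xi> t \<le> 2 * real CARD('m) * B * rate_sum c0 t \<delta>" .
  qed
 qed
qed

end

section \<open>Convergence rates\<close>

text \<open>Provides measurability of the error, and hence of the event whose probability is to be
  bounded.\<close>

lemma continuous_on_spec_norm: "continuous_on S (spec_norm :: real^'n::finite^'k::finite \<Rightarrow> real)"
proof -
 let ?K = "real CARD('n) * real CARD('k)"
 have le: "spec_norm A \<le> ?K * norm A" for A :: "real^'n^'k"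
 proof -
  have "\<bar>A $ i $ l\<bar> \<le> norm A" for i l
   using component_le_norm_cart[of "A $ i" l] Finite_Cartesian_Product.norm_nth_le[of A i] by linarith
  from spec_norm_le_entries[OF this] show ?thesis by (simp add: mult.assoc)
 qed
 have "dist (spec_norm A) (spec_norm B) \<le> ?K * dist A B" for A B :: "real^'n^'k"
 proof -
  have "spec_norm A \<le> spec_norm B + spec_norm (A - B)" using spec_norm_add[of B "A - B"] by simp
  moreover have "spec_norm B \<le> spec_norm A + spec_norm (A - B)" using spec_norm_add[of A "B - A"] spec_norm_minus[of "A - B"] by simp
  ultimately show ?thesis using le[of "A - B"] by (simp add: dist_norm)
 qed
 then have "?K-lipschitz_on S (spec_norm :: real^'n^'k \<Rightarrow> real)" by (intro lipschitz_onI) auto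
 then show ?thesis by (rule lipschitz_on_continuous_on)
qed

lemma rate_nonneg:
 assumes "1 \<le> t" "0 < \<delta>" "\<delta> < 1"
 shows "0 \<le> rate1 \<zeta> g c0 t \<delta>" "0 \<le> rate2 \<nu> t \<delta>" "0 \<le> rate3 \<nu> t"
proof -
 have "0 \<le> ln (1 / \<delta>)" "0 \<le> ln t" using assms by auto
 then show "0 \<le> rate1 \<zeta> g c0 t \<delta>" "0 \<le> rate2 \<nu> t \<delta>" "0 \<le> rate3 \<nu> t"
  unfolding rate1_def rate2_def rate3_def by (auto intro!: mult_nonneg_nonneg add_nonneg_nonneg)
qed

lemma ln_ge_one: "3 \<le> t \<Longrightarrow> 1 \<le> ln (t::real)" using exp_le by (simp add: ln_ge_iff)

text \<open>As \<open>\<delta>\<close> approaches 1, \<open>ln (1 / \<delta>)\<close> vanishes and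
  the rates become smaller than at \<open>1/2\<close>, but not by more than a factor 2: from
  \<open>t \<ge> 3\<close> on, \<open>ln t \<ge> 1\<close> dominates \<open>ln 2\<close>. So the
  bound for \<open>\<delta> = 1/2\<close> serves for all larger \<open>\<delta>\<close>.\<close>

lemma rate_half:
 assumes t: "3 \<le> t" and \<delta>: "0 < \<delta>" "\<delta> < 1" and c0: "0 < c0"
 shows "rate1 \<zeta> g c0 t (1/2) \<le> 2 * rate1 \<zeta> g c0 t \<delta>" "rate2 \<nu> t (1/2) \<le> 2 * rate2 \<nu> t \<delta>"
proof -
 have l: "1 \<le> ln t" by (rule ln_ge_one[OF t])
 have l2: "0 \<le> ln (2::real)" "ln (2::real) \<le> 1" using ln_le_minus_one[of "2::real"] by auto
 have L: "0 \<le> ln (1 / \<delta>)" using \<delta> by simp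
 have "ln 2 powr c0 \<le> 1 powr c0" using l2 c0 by (intro powr_mono2) auto
 then have "ln 2 powr c0 \<le> 1" by simp
 moreover have "1 \<le> ln t powr (3/2)" using l by (simp add: ge_one_powr_ge_zero)
 ultimately have "ln t powr (3/2) + ln 2 powr c0 \<le> 2 * (ln t powr (3/2) + ln (1 / \<delta>) powr c0)"
 proof -
  assume as: "ln 2 powr c0 \<le> 1" "1 \<le> ln t powr (3/2)"
  have "y + z \<le> 2 * (y + s)" if "z \<le> 1" "1 \<le> y" "0 \<le> s" for y z s :: real using that by simp
  from this[OF as powr_ge_zero] show ?thesis .
 qed
 then have "(ln t powr (3/2) + ln 2 powr c0) * t powr (ln \<zeta> / ln g) \<le> 2 * ((ln t powr (3/2) + ln (1 / \<delta>) powr c0) * t powr (ln \<zeta> / ln g))"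
  unfolding mult.assoc[symmetric] by (rule mult_right_mono) simp
 then show "rate1 \<zeta> g c0 t (1/2) \<le> 2 * rate1 \<zeta> g c0 t \<delta>" by (simp add: rate1_def)
 have "y + z \<le> 4 * (y + s)" if "z \<le> 1" "1 \<le> y" "0 \<le> s" for y z s :: real using that by simp
 from this[OF l2(2) l L] have "sqrt (ln t + ln 2) \<le> sqrt (4 * (ln t + ln (1 / \<delta>)))" by (rule real_sqrt_le_mono)
 also have "\<dots> = 2 * sqrt (ln t + ln (1 / \<delta>))" unfolding real_sqrt_mult by simp
 finally have pw: "sqrt (ln t + ln 2) * t powr e \<le> 2 * sqrt (ln t + ln (1 / \<delta>)) * t powr e" for e by (intro mult_right_mono) auto
 show "rate2 \<nu> t (1/2) \<le> 2 * rate2 \<nu> t \<delta>"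
 proof -
  have h: "ln (1 / (1/2)) = ln (2::real)" by simp
  show ?thesis unfolding rate2_def h mult.assoc[symmetric] by (rule pw)
 qed
qed

text \<open>For fixed \<open>\<delta>\<close> every expression in \<open>ln (1 / \<delta>)\<close>
  is eventually below \<open>ln t\<close>. What remains is at most the power \<open>3/2\<close> of
  the logarithm, from \<open>rate1\<close>, times the slowest of the three powers of
  \<open>t\<close>.\<close>

lemma eventually_rate_le:
 assumes \<delta>: "0 < \<delta>" "\<delta> < 1"
 shows "\<forall>\<^sub>F t in sequentially. Max {rate1 \<zeta> g c0 (real t) \<delta>, rate2 \<nu> (real t) \<delta>, rate3 \<nu> (real t)}
  \<le> 2 * (ln (real t) powr (3/2) * real t powr (- limit_exponent \<zeta> g \<nu>))"
proof -
 define L where "L = ln (1 / \<delta>)"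
 define Z where "Z = max 1 (max L (L powr c0))"
 have "filterlim (\<lambda>t. ln (real t)) at_top sequentially" by (rule filterlim_compose[OF ln_at_top filterlim_real_sequentially])
 then have "\<forall>\<^sub>F t in sequentially. Z \<le> ln (real t)" by (simp add: filterlim_at_top)
 then show ?thesis using eventually_ge_at_top[of "1::nat"]
 proof eventually_elim
  case (elim t)
  let ?l = "ln (real t)" and ?q = "limit_exponent \<zeta> g \<nu>"
  have t1: "1 \<le> real t" using elim(2) by simp
  have l: "1 \<le> ?l" "L \<le> ?l" "L powr c0 \<le> ?l" using elim(1) by (auto simp: Z_def)
  have L0: "0 \<le> L" unfolding L_def using \<delta> by simp
  have "?l powr 1 \<le> ?l powr (3/2)" using l by (intro powr_mono) auto
  then have l32: "?l \<le> ?l powr (3/2)" using l by simp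
  have q: "?q \<le> - (ln \<zeta> / ln g)" "?q \<le> 1/2 - (MAX m. \<nu> m)" "?q \<le> (MIN m. \<nu> m)" unfolding limit_exponent_def by linarith+
  have p: "real t powr e \<le> real t powr (- ?q)" if "e \<le> - ?q" for e using t1 that by (intro powr_mono) auto
  have "rate1 \<zeta> g c0 (real t) \<delta> \<le> (2 * ?l powr (3/2)) * real t powr (- ?q)"
   unfolding rate1_def L_def[symmetric] using q l l32 by (intro mult_mono p) auto
  moreover have "rate2 \<nu> (real t) \<delta> \<le> (2 * ?l powr (3/2)) * real t powr (- ?q)" unfolding rate2_def L_def[symmetric]
  proof (intro mult_mono p)
   have "sqrt (?l + L) \<le> 2 * ?l"
   proof (rule real_le_lsqrt)
    have "(2 * ?l) ^ 1 \<le> (2 * ?l)^2" using l by (intro power_increasing) auto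
    then show "?l + L \<le> (2 * ?l)^2" using l by simp
   qed (use l in simp)
   then show "sqrt (?l + L) \<le> 2 * ?l powr (3/2)" using l l32 by simp
  qed (use q in auto)
  moreover have "rate3 \<nu> (real t) \<le> (2 * ?l powr (3/2)) * real t powr (- ?q)"
  proof -
   have "1 * real t powr (- (MIN m. \<nu> m)) \<le> (2 * ?l powr (3/2)) * real t powr (- ?q)" using q l l32 by (intro mult_mono p) auto
   then show ?thesis by (simp add: rate3_def)
  qed
  ultimately show ?case by (simp add: mult.assoc)
 qed
qed

section \<open>The probability bound and the almost sure rate\<close>

context equilibrium_learning begin

lemma played_error_measurable: "(\<lambda>\<xi>. gap \<xi> t) \<in> borel_measurable M"
proof -
 have s: "(\<lambda>\<xi>. strategy_of (played c sh r t \<xi>) m) \<in> borel_measurable M" for m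
  using adapted measurable_from_subalg[OF hist_M] unfolding adapted_play_def by blast
 have s1: "(\<lambda>\<xi>. fst (played c sh r t \<xi>) m) \<in> borel_measurable M" and s2: "(\<lambda>\<xi>. snd (played c sh r t \<xi>) m) \<in> borel_measurable M" for m
  using measurable_compose[OF s, of fst borel] measurable_compose[OF s, of snd borel] by (auto simp: borel_prod[symmetric] strategy_of_def)
 have "(\<lambda>\<xi>. spec_norm (fst (played c sh r t \<xi>) m - fst pstar m)) \<in> borel_measurable M" for m
  by (rule borel_measurable_continuous_on[OF continuous_on_spec_norm]) (intro borel_measurable_diff s1 borel_measurable_const)
 moreover have "(\<lambda>\<xi>. norm (snd (played c sh r t \<xi>) m - snd pstar m)) \<in> borel_measurable M" for m
  by (rule borel_measurable_continuous_on[OF continuous_on_norm_id]) (intro borel_measurable_diff s2 borel_measurable_const)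
 ultimately show ?thesis unfolding profile_norm_def
  by (intro borel_measurable_add borel_measurable_times borel_measurable_const borel_measurable_sum) simp_all
qed

definition rate_event :: "(real \<Rightarrow> real) \<Rightarrow> real \<Rightarrow> real \<Rightarrow> real \<Rightarrow> 'a set" where
 "rate_event T B c0 \<delta> = {\<xi> \<in> space M. \<forall>t::nat. T \<delta> \<le> real t \<longrightarrow> gap \<xi> t
   \<le> B * rate_max c0 t \<delta>}"

lemma rate_event_measurable: "rate_event T B c0 \<delta> \<in> events"
proof -
 have "{\<xi> \<in> space M. gap \<xi> t \<le> b} \<in> events" for t b using played_error_measurable[of t] by measurable
 then show ?thesis unfolding rate_event_def by (intro sets.sets_Collect) auto
qed

lemma rate_event_prob:
 obtains T c0 c1 B K where "0 < c0" "0 < c1" "0 < B" "0 < K" "\<And>\<delta>. 0 < \<delta> \<Longrightarrow> \<delta> < 1 \<Longrightarrow> \<bar>T \<delta>\<bar> \<le> K * ln (1 / \<delta>) powr c1"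
  "\<And>\<delta>. 0 < \<delta> \<Longrightarrow> \<delta> < 1 \<Longrightarrow> 1 - \<delta> \<le> prob (rate_event T B c0 \<delta>)"
proof -
 obtain C where C: "0 < C" "\<And>\<delta>. 0 < \<delta> \<Longrightarrow> \<delta> < 1 \<Longrightarrow> \<exists>A\<in>events. 1 - \<delta> \<le> prob A \<and>
   (\<forall>\<xi>\<in>A. regular C (ln (1 / \<delta>)) \<xi>)" using regular_event by blast
 obtain c0 c1 B K where B: "0 < c0" "0 < c1" "0 < B" "0 < K" "\<And>\<xi> \<delta> t. \<xi> \<in> space M \<Longrightarrow> 0 < \<delta> \<Longrightarrow> \<delta> \<le> 1/2 \<Longrightarrow> regular C (ln (1 / \<delta>)) \<xi> \<Longrightarrow>
   K * ln (1 / \<delta>) powr c1 \<le> real t \<Longrightarrow> 3 \<le> t \<Longrightarrow>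
   gap \<xi> t \<le> B * rate_sum c0 t \<delta>" using played_rate[of C] by blast
 have l2: "0 < ln (2::real)" by simp
 \<comment> \<open>The threshold must be a multiple of a power of \<open>ln (1 / \<delta>)\<close>;
   the second summand makes it at least 3 whenever \<open>\<delta> \<le> 1/2\<close>.\<close>
 define K' where "K' = K + 3 / ln 2 powr c1"
 define T where "T \<delta> = K' * ln (1 / \<delta>) powr c1" for \<delta>
 \<comment> \<open>The time from which the bound for \<open>\<delta> = 1/2\<close> is valid. For
   larger \<open>\<delta>\<close> the threshold may lie below it, since it tends to zero as
   \<open>\<delta>\<close> approaches 1.\<close>
 define T2 where "T2 = max 3 (K * ln 2 powr c1)"
 \<comment> \<open>The second summand covers times \<open>t < T2\<close>: there the error is at most
   \<open>diam\<close>, and \<open>T2 powr numin\<close> times \<open>rate3\<close> is at least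
   1.\<close>
 define B' where "B' = 2 * B + \<bar>diam\<bar> * T2 powr numin"
 have K': "0 < K'" using B(4) by (simp add: K'_def add_pos_pos)
 have B': "0 < B'" "2 * B \<le> B'" "\<bar>diam\<bar> * T2 powr numin \<le> B'" using B(3) by (auto simp: B'_def add_pos_nonneg)
 have bound: "gap \<xi> t \<le> B' * rate_sum c0 t \<delta> \<and> 1 \<le> t"
  if \<xi>: "\<xi> \<in> space M" and \<delta>: "0 < \<delta>" "\<delta> < 1" and rp: "regular C (ln (1 / min \<delta> (1/2))) \<xi>" and t: "T \<delta> \<le> real t" for \<xi> \<delta> t
 proof (cases "\<delta> \<le> 1/2")
  case True
  let ?L = "ln (1 / \<delta>)"
  have "2 \<le> 1 / \<delta>" using True \<delta> by (simp add: field_simps)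
  then have "ln 2 \<le> ?L" by (intro ln_mono) auto
  then have p: "ln 2 powr c1 \<le> ?L powr c1" using B(2) l2 by (intro powr_mono2) auto
  have p0: "0 < ln (2::real) powr c1" using l2 by simp
  have "3 / ln 2 powr c1 * ln 2 powr c1 \<le> 3 / ln 2 powr c1 * ?L powr c1" using p by (intro mult_left_mono) auto
  then have "3 \<le> 3 / ln 2 powr c1 * ?L powr c1" using p0 by simp
  moreover have "T \<delta> = K * ?L powr c1 + 3 / ln 2 powr c1 * ?L powr c1" by (simp add: T_def K'_def distrib_right)
  moreover have "0 \<le> K * ?L powr c1" using B(4) by simp
  ultimately have t': "K * ?L powr c1 \<le> real t" "3 \<le> real t" using t by linarith+
  have m: "min \<delta> (1/2) = \<delta>" using True by simp
  let ?S = "rate_sum c0 t \<delta>"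
  have "gap \<xi> t \<le> B * ?S" using B(5)[OF \<xi> \<delta>(1) True rp[unfolded m] t'(1)] t'(2) by simp
  also have "\<dots> \<le> B' * ?S" using B'(2) B(3) rate_nonneg[of "real t" \<delta>] \<delta> t'(2) by (intro mult_right_mono add_nonneg_nonneg) auto
  finally show ?thesis using t'(2) by simp
 next
  case False
  have m: "min \<delta> (1/2) = 1/2" using False by simp
  have "0 < ln (1 / \<delta>)" using \<delta> by (simp add: field_simps)
  then have "0 < T \<delta>" using K' by (simp add: T_def)
  then have t1: "1 \<le> t" using t by (cases t) auto
  let ?r1 = "rate1 \<zeta> lam c0 (real t) \<delta>" and ?r2 = "rate2 (decay c) (real t) \<delta>" and ?r3 = "rate3 (decay c) (real t)"
  have nn: "0 \<le> ?r1" "0 \<le> ?r2" "0 \<le> ?r3" using rate_nonneg[of "real t" \<delta>] \<delta> t1 by auto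
  show ?thesis
  proof (cases "T2 \<le> real t")
   case True
   then have t3: "3 \<le> real t" "K * ln 2 powr c1 \<le> real t" by (auto simp: T2_def)
   have "gap \<xi> t \<le> B * (rate1 \<zeta> lam c0 (real t) (1/2) + rate2 (decay c) (real t) (1/2) + ?r3)"
    using B(5)[OF \<xi>, of "1/2" t] rp[unfolded m] t3 by simp
   also have "\<dots> \<le> B * (2 * ?r1 + 2 * ?r2 + 2 * ?r3)"
    using rate_half[OF t3(1) \<delta> B(1)] nn B(3) by (intro mult_left_mono add_mono) auto
   also have "\<dots> = 2 * B * (?r1 + ?r2 + ?r3)" by (simp add: algebra_simps)
   also have "\<dots> \<le> B' * (?r1 + ?r2 + ?r3)" using B'(2) nn by (intro mult_right_mono) auto
   finally show ?thesis using t1 by simp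
  next
   case False
   have "real t powr numin \<le> T2 powr numin" using False t1 decay_bounds(3) by (intro powr_mono2) auto
   then have "real t powr numin * real t powr (- numin) \<le> T2 powr numin * real t powr (- numin)" by (intro mult_right_mono) auto
   then have "1 \<le> T2 powr numin * real t powr (- numin)" using t1 by (simp add: powr_minus)
   then have "\<bar>diam\<bar> * 1 \<le> \<bar>diam\<bar> * (T2 powr numin * real t powr (- numin))" by (intro mult_left_mono) auto
   then have "gap \<xi> t \<le> \<bar>diam\<bar> * T2 powr numin * ?r3"
    using profiles_diam[OF played_profiles[OF \<xi>, of t]] by (simp add: rate3_def numin_def mult.assoc)
   also have "\<dots> \<le> B' * ?r3" using B'(3) nn by (intro mult_right_mono) auto
   also have "\<dots> \<le> B' * (?r1 + ?r2 + ?r3)" using B'(1) nn by (intro mult_left_mono) auto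
   finally show ?thesis using t1 by simp
  qed
 qed
 show thesis
 \<comment> \<open>The factor 3 replaces the sum of the three rates by their maximum.\<close>
 proof (rule that[OF B(1,2) _ K', of "3 * B'" T])
  show "0 < 3 * B'" using B' by simp
  show "\<bar>T \<delta>\<bar> \<le> K' * ln (1 / \<delta>) powr c1" for \<delta> using K' by (simp add: T_def abs_mult)
  fix \<delta> :: real assume \<delta>: "0 < \<delta>" "\<delta> < 1"
  obtain A where A: "A \<in> events" "1 - min \<delta> (1/2) \<le> prob A" "\<forall>\<xi>\<in>A. regular C (ln (1 / min \<delta> (1/2))) \<xi>"
  proof -
   have "0 < min \<delta> (1/2)" "min \<delta> (1/2) < 1" using \<delta> by auto
   from C(2)[OF this] show thesis using that by blast
  qed
  have "A \<subseteq> rate_event T (3 * B') c0 \<delta>" unfolding rate_event_def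
  proof (intro subsetI CollectI conjI allI impI)
   fix \<xi> assume w: "\<xi> \<in> A"
   then show \<xi>: "\<xi> \<in> space M" using A(1) sets.sets_into_space by blast
   fix t assume t: "T \<delta> \<le> real t"
   let ?X = "{rate1 \<zeta> lam c0 (real t) \<delta>, rate2 (decay c) (real t) \<delta>, rate3 (decay c) (real t)}"
   have rp: "regular C (ln (1 / min \<delta> (1/2))) \<xi>" using A(3) w by blast
   have "y \<le> Max ?X" if "y \<in> ?X" for y by (rule Max_ge[OF _ that]) simp
   then have "rate1 \<zeta> lam c0 (real t) \<delta> \<le> Max ?X" "rate2 (decay c) (real t) \<delta> \<le> Max ?X" "rate3 (decay c) (real t) \<le> Max ?X" by blast+
   then have "rate_sum c0 t \<delta> \<le> 3 * Max ?X" by linarith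
   then have "B' * rate_sum c0 t \<delta> \<le> B' * (3 * Max ?X)" using B'(1) by (intro mult_left_mono) auto
   then show "gap \<xi> t \<le> 3 * B' * Max ?X" using bound[OF \<xi> \<delta> rp t] by (simp only: mult_ac) linarith
  qed
  then have "prob A \<le> prob (rate_event T (3 * B') c0 \<delta>)" by (intro finite_measure_mono rate_event_measurable)
  then show "1 - \<delta> \<le> prob (rate_event T (3 * B') c0 \<delta>)" using A(2) by linarith
 qed
qed

lemma played_bigo:
 assumes \<xi>: "\<xi> \<in> rate_event T B c0 \<delta>" and B: "0 < B" and \<delta>: "0 < \<delta>" "\<delta> < 1"
 shows "gap \<xi> \<in> O(\<lambda>t. ln (real t) powr (3/2) * real t powr (- limit_exponent \<zeta> lam (decay c)))"
proof (rule bigoI)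
 have "\<forall>\<^sub>F t in sequentially. T \<delta> \<le> real t" using filterlim_real_sequentially by (simp add: filterlim_at_top)
 then show "\<forall>\<^sub>F t in sequentially. norm (gap \<xi> t) \<le> (B * 2) * norm (ln (real t) powr (3/2) * real t powr (- limit_exponent \<zeta> lam (decay c)))"
  using eventually_rate_le[OF \<delta>, of \<zeta> lam c0 "decay c"]
 proof eventually_elim
  case (elim t)
  have "0 \<le> gap \<xi> t" using eqD(1) by (intro profile_norm_nonneg) simp
  moreover have "gap \<xi> t \<le> B * rate_max c0 t \<delta>" using \<xi> elim(1) unfolding rate_event_def by blast
  moreover have "\<dots> \<le> B * (2 * (ln (real t) powr (3/2) * real t powr (- limit_exponent \<zeta> lam (decay c))))"
   using elim(2) B by (intro mult_left_mono) auto
  ultimately show ?case by (simp add: abs_mult)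
 qed
qed

text \<open>Membership in \<open>rate_event\<close> for a single \<open>\<delta>\<close> already
  gives the asymptotic rate, so the union over \<open>\<delta> = 1 / (N + 2)\<close> suffices; it
  has probability one because its members have probability at least \<open>1 - \<delta>\<close>. The
  2 keeps \<open>\<delta>\<close> below 1 at \<open>N = 0\<close>.\<close>

lemma played_bigo_AE:
 "AE \<xi> in M. gap \<xi> \<in> O(\<lambda>t. ln (real t) powr (3/2) * real t powr (- limit_exponent \<zeta> lam (decay c)))"
proof (rule rate_event_prob)
 fix T c0 c1 B K assume T: "0 < c0" "0 < c1" "0 < B" "0 < K" "\<And>\<delta>. 0 < \<delta> \<Longrightarrow> \<delta> < 1 \<Longrightarrow> \<bar>T \<delta>\<bar> \<le> K * ln (1 / \<delta>) powr c1"
  "\<And>\<delta>. 0 < \<delta> \<Longrightarrow> \<delta> < 1 \<Longrightarrow> 1 - \<delta> \<le> prob (rate_event T B c0 \<delta>)"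
 define d where "d N = 1 / real (N + 2)" for N
 have d: "0 < d N" "d N < 1" for N by (auto simp: d_def)
 define S where "S = (\<Union>N. rate_event T B c0 (d N))"
 have S: "S \<in> events" unfolding S_def using rate_event_measurable by auto
 have "1 \<le> prob S + e" if e: "0 < e" for e
 proof -
  obtain N where "1 / real (Suc N) < e" using nat_approx_posE[OF e] by blast
  moreover have "d N \<le> 1 / real (Suc N)" by (simp add: d_def frac_le)
  moreover have "prob (rate_event T B c0 (d N)) \<le> prob S" using S by (intro finite_measure_mono) (auto simp: S_def)
  ultimately show ?thesis using T(6)[OF d, of N] by linarith
 qed
 then have "1 \<le> prob S" by (rule field_le_epsilon)
 then have "prob S = 1" using prob_le_1[of S] by linarith
 then have "AE \<xi> in M. \<xi> \<in> S" using S by (simp add: prob_eq_1)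
 then show ?thesis
 proof (rule AE_mp, intro AE_I2 impI)
  fix \<xi> assume "\<xi> \<in> S"
  then obtain N where "\<xi> \<in> rate_event T B c0 (d N)" by (auto simp: S_def)
  from played_bigo[OF this T(3) d] show "gap \<xi> \<in> O(\<lambda>t. ln (real t) powr (3/2) * real t powr (- limit_exponent \<zeta> lam (decay c)))" .
 qed
qed

end

theorem theorem1:
  fixes M :: "'a measure"
    and G :: "('m::finite, 'n::finite, 'd::finite) lq_game"
    and c :: "'m schedule"
    and W :: "'m \<Rightarrow> real^'n^'n \<Rightarrow> (real^'n) measure"
    and V :: "'m \<Rightarrow> (real^'d) measure"
    and \<Phi> :: "'m \<Rightarrow> ('n, 'd) model \<Rightarrow> real^'n \<Rightarrow> real \<Rightarrow> ('n, 'd) strategy"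
    and BR :: "'m \<Rightarrow> ('m, 'n, 'd) profile \<Rightarrow> ('n, 'd) strategy"
    and pstar :: "('m, 'n, 'd) profile"
    and \<mu> \<zeta> :: real
    and \<beta> :: "'m \<Rightarrow> real"
    and init :: "'m \<Rightarrow> ('n, 'd) model"
    and x0 :: "real^'n"
    and w :: "nat \<Rightarrow> 'a \<Rightarrow> real^'n"
    and v :: "'m \<Rightarrow> nat \<Rightarrow> 'a \<Rightarrow> real^'d"
    and sh :: "'m \<Rightarrow> nat \<Rightarrow> 'a \<Rightarrow> real"
    and r :: "('a, 'm, 'n, 'd) run"
  assumes "prob_space M"
    and "valid_game G"
    and "valid_schedule c"
    and "learning_noise M G c w v sh"
    and "perceived_noise_laws G W V"
    and "optimal_selection G W V \<Phi>"
    and "well_posed_best_responses M w G BR"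
    and "stable_equilibrium G BR pstar \<mu> \<zeta>"
    and "uniformly_stable G"
    and "uniformly_lipschitz G W V \<Phi>"
    and "runs_algorithm M G c W V \<Phi> \<beta> init x0 w v sh r"
    and "adapted_play M c w v sh r"
  shows "(\<exists>c0>0. \<exists>c1>0. \<exists>C>0. \<exists>K>0. \<exists>T :: real \<Rightarrow> real.
            \<forall>\<delta>\<in>{0<..<1}.
              \<bar>T \<delta>\<bar> \<le> K * ln (1 / \<delta>) powr c1 \<and>
              measure M {\<omega> \<in> space M. \<forall>t::nat. T \<delta> \<le> real t \<longrightarrow>
                 profile_norm \<mu> (played c sh r t \<omega> - pstar)
                   \<le> C * Max {rate1 \<zeta> (growth c) c0 (real t) \<delta>,
                               rate2 (decay c) (real t) \<delta>, rate3 (decay c) (real t)}}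
                \<ge> 1 - \<delta>)
       \<and> (\<exists>b::real. AE \<omega> in M.
            (\<lambda>t::nat. profile_norm \<mu> (played c sh r t \<omega> - pstar))
              \<in> O(\<lambda>t. ln (real t) powr b * real t powr (- limit_exponent \<zeta> (growth c) (decay c))))"
proof -
 interpret equilibrium_learning M G c W V \<Phi> \<beta> init x0 w v sh r BR pstar \<mu> \<zeta>
  by (intro equilibrium_learning.intro stable_learning.intro learning_setup.intro stable_learning_axioms.intro
    equilibrium_learning_axioms.intro) (fact assms)+
 show ?thesis
 proof (rule rate_event_prob)
 fix T c0 c1 B K assume T: "0 < c0" "0 < c1" "0 < B" "0 < K" "\<And>\<delta>. 0 < \<delta> \<Longrightarrow> \<delta> < 1 \<Longrightarrow> \<bar>T \<delta>\<bar> \<le> K * ln (1 / \<delta>) powr c1"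
  "\<And>\<delta>. 0 < \<delta> \<Longrightarrow> \<delta> < 1 \<Longrightarrow> 1 - \<delta> \<le> prob (rate_event T B c0 \<delta>)"
 show ?thesis
 proof (rule conjI, goal_cases)
  case 1
  show ?case by (rule exI[of _ c0], rule conjI[OF T(1)], rule exI[of _ c1], rule conjI[OF T(2)],
     rule exI[of _ B], rule conjI[OF T(3)], rule exI[of _ K], rule conjI[OF T(4)], rule exI[of _ T])
    (use T(5,6) in \<open>simp add: rate_event_def\<close>)
 next
  case 2
  show ?case by (rule exI[of _ "3/2"]) (rule played_bigo_AE)
 qed
 qed
qed

end
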